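(* Let $B_1\subset\mathbb{R}^2$ be the open unit disk. Let $\boldsymbol{u}\in H^1\cap L^\infty(B_1,\mathbb{R}^{n+1})$ be a weak solution of $$-\mathbf{div}(A\nabla\boldsymbol{u})=\boldsymbol{\Omega}\cdot\nabla\boldsymbol{u}+\boldsymbol{f}\quad\text{in }B_1.$$ Assume that, for some $q>1$ and some $\gamma_0\in(0,1]$: (A1) $A:B_1\to\mathbb{R}^{2\times2}$ is symmetric and uniformly elliptic, i.e. there are $0<\lambda\le\Lambda<+\infty$ with $\lambda|\xi|^2\le A(x)\xi\cdot\xi\le\Lambda|\xi|^2$ for all $x\in B_1$, $\xi\in\mathbb{R}^2$, and $A\in C^{0,\gamma_0}(\overline{B_1})$; (A2) $\boldsymbol{\Omega}\in L^2(B_1,\mathbb{R}^{(n+1)\times(n+1)}\otimes\mathbb{R}^2)$; (A3) $\boldsymbol{f}\in L^q(B_1,\mathbb{R}^{n+1})$; (A4) $\mathbf{div}\,\boldsymbol{\Omega}\in L^q(B_1,\mathbb{R}^{(n+1)\times(n+1)})$. Then $\boldsymbol{u}$ is locally Hölder continuous in $B_1$: there exists $\eta\in(0,1)$ such that $\boldsymbol{u}\in C^{0,\eta}_{\mathrm{loc}}(B_1,\mathbb{R}^{n+1})$.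
   Context: $\boldsymbol\Omega=(\Omega^{\alpha\beta})_{1\le\alpha,\beta\le n+1}$ is a matrix whose entries are $\mathbb{R}^2$-valued vector fields; no antisymmetry is assumed. $(\boldsymbol\Omega\cdot\nabla\boldsymbol u)^\alpha:=\sum_{\beta=1}^{n+1}\Omega^{\alpha\beta}\cdot\nabla u^\beta$; $\mathbf{div}\,\boldsymbol\Omega$ is the matrix of distributional divergences $\operatorname{div}\Omega^{\alpha\beta}$; $\mathbf{div}(A\nabla\boldsymbol u)$ is the vector with components $\operatorname{div}(A\nabla u^\alpha)$. Continuity refers to a suitable a.e. representative. *)

theory Defs
  imports "HOL-Analysis.Analysis"
begin

definition Lp_on :: "real \<Rightarrow> 'a::euclidean_space set \<Rightarrow> ('a \<Rightarrow> 'b::euclidean_space) \<Rightarrow> bool" where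
  "Lp_on p U f \<longleftrightarrow>
     f \<in> borel_measurable (lebesgue_on U) \<and>
     integrable (lebesgue_on U) (\<lambda>x. norm (f x) powr p)"

definition Linf_on :: "'a::euclidean_space set \<Rightarrow> ('a \<Rightarrow> 'b::euclidean_space) \<Rightarrow> bool" where
  "Linf_on U f \<longleftrightarrow>
     f \<in> borel_measurable (lebesgue_on U) \<and>
     (\<exists>M. AE x in lebesgue_on U. norm (f x) \<le> M)"

definition L1_loc_on :: "'a::euclidean_space set \<Rightarrow> ('a \<Rightarrow> 'b::euclidean_space) \<Rightarrow> bool" where
  "L1_loc_on U f \<longleftrightarrow> (\<forall>K. compact K \<and> K \<subseteq> U \<longrightarrow> f absolutely_integrable_on K)"

primrec Ck :: "nat \<Rightarrow> ('a::euclidean_space \<Rightarrow> 'b::euclidean_space) \<Rightarrow> bool" where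
  "Ck 0 f \<longleftrightarrow> continuous_on UNIV f"
| "Ck (Suc k) f \<longleftrightarrow>
     (\<forall>x. f differentiable (at x)) \<and> (\<forall>v. Ck k (\<lambda>x. frechet_derivative f (at x) v))"

text \<open>Elements of $C_c^\infty(U)$ are represented by their extensions by zero to the whole space.\<close>

definition test_function :: "'a::euclidean_space set \<Rightarrow> ('a \<Rightarrow> real) \<Rightarrow> bool" where
  "test_function U \<phi> \<longleftrightarrow>
     (\<forall>k. Ck k \<phi>) \<and> compact (closure {x. \<phi> x \<noteq> 0}) \<and> closure {x. \<phi> x \<noteq> 0} \<subseteq> U"

definition grad :: "(real ^ 'd \<Rightarrow> real) \<Rightarrow> real ^ 'd \<Rightarrow> real ^ 'd" where
  "grad \<phi> x = (\<chi> i. frechet_derivative \<phi> (at x) (axis i 1))"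

text \<open>The integrability requirements make the Bochner integrals below meaningful (the integral of
  a non-integrable function is 0 by convention).\<close>

definition has_weak_gradient ::
    "(real ^ 'd \<Rightarrow> real) \<Rightarrow> (real ^ 'd \<Rightarrow> real ^ 'd) \<Rightarrow> (real ^ 'd) set \<Rightarrow> bool" where
  "has_weak_gradient w G U \<longleftrightarrow>
     L1_loc_on U w \<and> L1_loc_on U G \<and>
     (\<forall>\<phi> i. test_function U \<phi> \<longrightarrow>
        (LINT x|lebesgue_on U. w x * grad \<phi> x $ i) = - (LINT x|lebesgue_on U. G x $ i * \<phi> x))"

definition has_weak_divergence ::
    "(real ^ 'd \<Rightarrow> real ^ 'd) \<Rightarrow> (real ^ 'd \<Rightarrow> real) \<Rightarrow> (real ^ 'd) set \<Rightarrow> bool" where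
  "has_weak_divergence F g U \<longleftrightarrow>
     L1_loc_on U F \<and> L1_loc_on U g \<and>
     (\<forall>\<phi>. test_function U \<phi> \<longrightarrow>
        (LINT x|lebesgue_on U. F x \<bullet> grad \<phi> x) = - (LINT x|lebesgue_on U. g x * \<phi> x))"

text \<open>\<open>H1_on U u Du\<close>: $u \in H^1(U)$, and \<open>Du\<close> represents its weak gradient (unique a.e. if
  $U$ is open); \<open>Du x $ \<alpha>\<close> is the gradient of the component \<open>\<alpha>\<close>.\<close>

definition H1_on ::
    "(real ^ 'd) set \<Rightarrow> (real ^ 'd \<Rightarrow> real ^ 'm) \<Rightarrow> (real ^ 'd \<Rightarrow> real ^ 'd ^ 'm) \<Rightarrow> bool" where
  "H1_on U u Du \<longleftrightarrow>
     Lp_on 2 U u \<and> Lp_on 2 U Du \<and>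
     (\<forall>\<alpha>. has_weak_gradient (\<lambda>x. u x $ \<alpha>) (\<lambda>x. Du x $ \<alpha>) U)"

text \<open>$\mathbf{div}\,\boldsymbol\Omega \in L^q(U)$: every distributional divergence
  $\mathrm{div}\,\Omega^{\alpha\beta}$ is represented by a function in $L^q(U)$.\<close>

definition div_in_Lp :: "real \<Rightarrow> (real ^ 'd) set \<Rightarrow> (real ^ 'd \<Rightarrow> real ^ 'd ^ 'm ^ 'm) \<Rightarrow> bool" where
  "div_in_Lp q U \<Omega> \<longleftrightarrow>
     (\<exists>D :: real ^ 'd \<Rightarrow> real ^ 'm ^ 'm. Lp_on q U D \<and>
        (\<forall>\<alpha> \<beta>. has_weak_divergence (\<lambda>x. \<Omega> x $ \<alpha> $ \<beta>) (\<lambda>x. D x $ \<alpha> $ \<beta>) U))"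

definition Omega_dot :: "real ^ 'd ^ 'm ^ 'm \<Rightarrow> real ^ 'd ^ 'm \<Rightarrow> real ^ 'm" where
  "Omega_dot W P = (\<chi> \<alpha>. \<Sum>\<beta>\<in>UNIV. W $ \<alpha> $ \<beta> \<bullet> P $ \<beta>)"

text \<open>Weak form of $-\mathbf{div}(A\nabla\boldsymbol u) = \boldsymbol\Omega\cdot\nabla\boldsymbol u
  + \boldsymbol f$ in $U$, where \<open>Du\<close> is the weak gradient of $\boldsymbol u$.\<close>

definition weak_solution ::
    "(real ^ 'd) set \<Rightarrow> (real ^ 'd \<Rightarrow> real ^ 'd ^ 'd) \<Rightarrow> (real ^ 'd \<Rightarrow> real ^ 'd ^ 'm ^ 'm) \<Rightarrow>
     (real ^ 'd \<Rightarrow> real ^ 'm) \<Rightarrow> (real ^ 'd \<Rightarrow> real ^ 'm) \<Rightarrow> (real ^ 'd \<Rightarrow> real ^ 'd ^ 'm) \<Rightarrow> bool"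
  where
  "weak_solution U A \<Omega> f u Du \<longleftrightarrow>
     H1_on U u Du \<and>
     (\<forall>\<phi> \<alpha>. test_function U \<phi> \<longrightarrow>
        (LINT x|lebesgue_on U. (A x *v (Du x $ \<alpha>)) \<bullet> grad \<phi> x) =
        (LINT x|lebesgue_on U. (Omega_dot (\<Omega> x) (Du x) + f x) $ \<alpha> * \<phi> x))"

definition uniformly_elliptic_on :: "(real ^ 'd) set \<Rightarrow> (real ^ 'd \<Rightarrow> real ^ 'd ^ 'd) \<Rightarrow> bool" where
  "uniformly_elliptic_on U A \<longleftrightarrow>
     (\<exists>lam Lam. 0 < lam \<and> lam \<le> Lam \<and>
        (\<forall>x\<in>U. \<forall>\<xi>. lam * (norm \<xi>)\<^sup>2 \<le> (A x *v \<xi>) \<bullet> \<xi> \<and> (A x *v \<xi>) \<bullet> \<xi> \<le> Lam * (norm \<xi>)\<^sup>2))"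

definition holder_on :: "real \<Rightarrow> 'a::metric_space set \<Rightarrow> ('a \<Rightarrow> 'b::metric_space) \<Rightarrow> bool" where
  "holder_on \<gamma> S f \<longleftrightarrow>
     (\<exists>C. \<forall>x\<in>S. \<forall>y\<in>S. dist (f x) (f y) \<le> C * dist x y powr \<gamma>)"

text \<open>\<open>f \<in> C\<^sup>0\<^sup>,\<^sup>\<gamma>(closure U)\<close> for a function whose values matter only on a
  bounded open set \<open>U\<close>: it has a Hoelder continuous extension to the closure.\<close>

definition holder_upto_closure ::
    "real \<Rightarrow> 'a::metric_space set \<Rightarrow> ('a \<Rightarrow> 'b::metric_space) \<Rightarrow> bool" where
  "holder_upto_closure \<gamma> U f \<longleftrightarrow>
     (\<exists>g. (\<forall>x\<in>U. g x = f x) \<and> holder_on \<gamma> (closure U) g)"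

definition locally_holder_on ::
    "real \<Rightarrow> 'a::metric_space set \<Rightarrow> ('a \<Rightarrow> 'b::metric_space) \<Rightarrow> bool" where
  "locally_holder_on \<eta> U f \<longleftrightarrow> (\<forall>K. compact K \<and> K \<subseteq> U \<longrightarrow> holder_on \<eta> K f)"

end

(*
  Fix a point x in the disk, freeze A at x, and choose P with A(x) P^T P = 1.  Truncations psi_k of
  the logarithm of |P(y - x)| to the dyadic scales R_k = 2^-k R are bounded, with |grad psi_k| of order
  1/R_k on a ring, and integrating A(x) grad u against grad psi_k gives the difference of the
  averages of u over two consecutive rings.  So testing the equation with psi_k controls the
  increments of the ring averages.  In the critical term Omega . grad u one integrates by parts: as
  div Omega is in L^q, it equals -(u - c) Omega . grad psi_k up to a power of R_k, and on the ring the
  Poincare inequality bounds it by the product of the L^2 norms of Omega and grad u there.  Summing over k by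
  Cauchy-Schwarz and evaluating at Lebesgue points, |u - c| <= C (E(kappa R) + R^beta)^(1/2) almost
  everywhere on a ball of radius R, where E is the Dirichlet energy.

  With this bound on u - c, testing with psi^2 (u - c) gives a
  Caccioppoli inequality in which Omega . grad u is absorbed once the L^2 norm of Omega on the ball
  is small.  Filling the hole yields E(R/4) <= theta E(kappa R) + C R^beta with theta < 1, hence
  power decay of E, and the pointwise bound turns this into Hoelder continuity.
*)
theory Submission
  imports Defs
begin

section \<open>Mollification and compactly supported test functions\<close>

text \<open>The product of \<Omega> and the gradient is merely integrable, so the equation cannot be
  tested with the unbounded logarithm itself. Its dyadic pieces are bounded by one and the same
  constant and are admissible, but an O(1) bound per piece would be useless after infinitely many
  scales. What makes the increments summable is different for each term. Freezing A costs |A(y) -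
  A(x)|, a power of R_k, against a gradient of size 1/R_k on an area of order R_k^2, hence a factor
  R_k^\<beta>; f and div \<Omega> gain the same factor from the decay of L^q functions on small
  balls, with \<beta> the minimum of \<gamma>_0 and 2 - 2/q. These are geometric series. The
  critical term has no gain of this kind: it is scale invariant, and it sums only because it is a
  product of two L^2 norms over rings that overlap boundedly often. Boundedness of u enters where u
  - c multiplies div \<Omega>. No smallness of \<Omega> is used for the pointwise bound; it is
  needed only to absorb a term in the energy inequality, where absolute continuity of the integral
  provides it on small balls.\<close>

lemma lborel_integral_translate:
  fixes f :: "'a::euclidean_space \<Rightarrow> 'b::{banach, second_countable_topology}"
  shows "(\<integral>x. f (a + x) \<partial>lborel) = (\<integral>x. f x \<partial>lborel)"
proof (cases "integrable lborel f")
  case True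
  have "(\<integral>x. f x \<partial>lborel) = (\<integral>x. f x \<partial>distr lborel borel ((+) a))"
    by (simp add: lborel_distr_plus)
  also have "\<dots> = (\<integral>x. f (a + x) \<partial>lborel)"
    using True by (intro integral_distr) auto
  finally show ?thesis by simp
next
  case False
  have "\<not> integrable lborel (\<lambda>x. f (a + x))"
  proof
    assume i: "integrable lborel (\<lambda>x. f (a + x))"
    have "integrable (distr lborel borel ((+) (-a))) (\<lambda>x. f (a + x))"
      using i by (simp add: lborel_distr_plus)
    then have "integrable lborel (\<lambda>x. f (a + (- a + x)))"
      by (subst (asm) integrable_distr_eq) (use i in auto)
    with False show False by simp
  qed
  with False show ?thesis by (simp add: not_integrable_integral_eq)
qed

lemma lborel_integrable_translate:
  fixes f :: "'a::euclidean_space \<Rightarrow> 'b::{banach, second_countable_topology}"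
  assumes "integrable lborel f"
  shows "integrable lborel (\<lambda>x. f (a + x))"
proof -
  have "integrable (distr lborel borel ((+) a)) f"
    using assms by (simp add: lborel_distr_plus)
  then show ?thesis
    by (subst (asm) integrable_distr_eq) (use assms in auto)
qed

lemma lborel_distr_reflect:
  "distr lborel borel (\<lambda>x::'a::euclidean_space. a - x) = lborel"
  using lborel_affine[of "-1" a] by (simp add: density_1)

lemma lborel_integral_reflect:
  fixes f :: "'a::euclidean_space \<Rightarrow> 'b::{banach, second_countable_topology}"
  assumes "f \<in> borel_measurable borel"
  shows "(\<integral>x. f (a - x) \<partial>lborel) = (\<integral>x. f x \<partial>lborel)"
proof -
  have "(\<integral>x. f x \<partial>lborel) = (\<integral>x. f x \<partial>distr lborel borel (\<lambda>x. a - x))"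
    by (simp add: lborel_distr_reflect)
  also have "\<dots> = (\<integral>x. f (a - x) \<partial>lborel)"
    using assms by (intro integral_distr) auto
  finally show ?thesis by simp
qed

lemma lborel_integrable_reflect:
  fixes f :: "'a::euclidean_space \<Rightarrow> 'b::{banach, second_countable_topology}"
  assumes "integrable lborel f"
  shows "integrable lborel (\<lambda>x. f (a - x))"
proof -
  have "integrable (distr lborel borel (\<lambda>x. a - x)) f"
    using assms by (simp add: lborel_distr_reflect)
  then show ?thesis
    by (subst (asm) integrable_distr_eq) (use assms in auto)
qed

section \<open>C^1 functions carried together with their gradients\<close>

definition has_grad :: "('a::euclidean_space \<Rightarrow> real) \<Rightarrow> ('a \<Rightarrow> 'a) \<Rightarrow> bool" where
  "has_grad f g \<longleftrightarrow> (\<forall>x. (f has_derivative (\<lambda>h. g x \<bullet> h)) (at x)) \<and> continuous_on UNIV g"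

text \<open>The class of test functions actually used. The vector field behind the potentials has
  only C^1 components, and the Sobolev approximants are multiplied into the test functions, so every
  weak identity is later extended from smooth test functions to this class.\<close>

definition C1c :: "'a::euclidean_space set \<Rightarrow> ('a \<Rightarrow> real) \<Rightarrow> ('a \<Rightarrow> 'a) \<Rightarrow> bool" where
  "C1c U f g \<longleftrightarrow> has_grad f g \<and> (\<exists>K. compact K \<and> K \<subseteq> U \<and> (\<forall>x. x \<notin> K \<longrightarrow> f x = 0 \<and> g x = 0))"

lemma has_grad_D:
  assumes "has_grad f g"
  shows "(f has_derivative (\<lambda>h. g x \<bullet> h)) (at x within S)" "continuous_on S g" "continuous_on S f"
proof -
  show "(f has_derivative (\<lambda>h. g x \<bullet> h)) (at x within S)" for S
    using assms unfolding has_grad_def using has_derivative_at_withinI by blast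
  show "continuous_on S g" using assms unfolding has_grad_def using continuous_on_subset by blast
  show "continuous_on S f"
    using assms unfolding has_grad_def
    by (meson continuous_at_imp_continuous_on has_derivative_continuous)
qed

lemma continuous_on_imp_borel:
  assumes "continuous_on UNIV f" shows "f \<in> borel_measurable borel"
  using assms by (rule borel_measurable_continuous_onI)

lemma has_grad_borel:
  assumes "has_grad f g"
  shows "f \<in> borel_measurable borel" "g \<in> borel_measurable borel"
  using has_grad_D[OF assms] continuous_on_imp_borel by blast+

text \<open>Vanishing of the gradient comes for free: the complement of K is open and f is zero
  there, so uniqueness of the derivative gives \<open>g x = 0\<close>.\<close>

lemma C1cI:
  assumes "has_grad f g" "compact K" "K \<subseteq> U" "\<And>x. x \<notin> K \<Longrightarrow> f x = 0"
  shows "C1c U f g"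
proof -
  have "g x = 0" if "x \<notin> K" for x
  proof -
    have o: "open (- K)" using assms(2) compact_imp_closed by blast
    have "((\<lambda>x. 0) has_derivative (\<lambda>h. g x \<bullet> h)) (at x)"
      by (rule has_derivative_transform_within_open[OF _ o, of f])
         (use assms(1,4) that in \<open>auto simp: has_grad_def\<close>)
    moreover have "((\<lambda>x. 0::real) has_derivative (\<lambda>h. 0)) (at x)" by simp
    ultimately have "(\<lambda>h. g x \<bullet> h) = (\<lambda>h. 0)" using has_derivative_unique by blast
    then have "g x \<bullet> g x = 0" by metis
    then show ?thesis by simp
  qed
  then show ?thesis unfolding C1c_def using assms by blast
qed

lemma C1c_has_grad: "C1c U f g \<Longrightarrow> has_grad f g"
  unfolding C1c_def by blast

lemma compact_support_bounded:
  fixes f :: "'a::euclidean_space \<Rightarrow> 'b::euclidean_space"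
  assumes "continuous_on UNIV f" "compact K" "\<And>x. x \<notin> K \<Longrightarrow> f x = 0"
  obtains B where "B > 0" "\<And>x. norm (f x) \<le> B"
proof -
  have "compact (f ` K)" using assms by (meson compact_continuous_image continuous_on_subset subset_UNIV)
  then obtain B where B: "B > 0" "\<And>y. y \<in> f ` K \<Longrightarrow> norm y \<le> B"
    using bounded_pos compact_imp_bounded by metis
  have "norm (f x) \<le> B" for x
    using B assms(3)[of x] by (cases "x \<in> K") auto
  with that B show ?thesis by blast
qed

text \<open>Heine-Cantor on a ball with one unit of room around K. With steps shorter than 1, either
  both points lie in that ball, or both are off K and the values agree.\<close>

lemma compact_support_uniformly_continuous:
  fixes f :: "'a::euclidean_space \<Rightarrow> 'b::euclidean_space"
  assumes "continuous_on UNIV f" "compact K" "\<And>x. x \<notin> K \<Longrightarrow> f x = 0" "e > 0"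
  obtains d where "d > 0" "\<And>x y. norm (x - y) < d \<Longrightarrow> norm (f x - f y) < e"
proof -
  obtain R where R: "K \<subseteq> cball 0 R"
    using compact_imp_bounded[OF assms(2)] by (meson bounded_iff mem_cball_0 subsetI)
  have "uniformly_continuous_on (cball 0 (R + 1)) f"
    by (rule compact_uniformly_continuous) (auto intro: continuous_on_subset[OF assms(1)])
  then obtain d where d: "d > 0" "\<And>x y. x \<in> cball 0 (R+1) \<Longrightarrow> y \<in> cball 0 (R+1) \<Longrightarrow> dist y x < d \<Longrightarrow> dist (f y) (f x) < e"
    unfolding uniformly_continuous_on_def using \<open>e > 0\<close> by metis
  show ?thesis
  proof
    show "min d 1 > 0" using d by simp
    fix x y :: 'a assume xy: "norm (x - y) < min d 1"
    show "norm (f x - f y) < e"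
    proof (cases "x \<in> K \<or> y \<in> K")
      case True
      then have "norm x \<le> R + 1" "norm y \<le> R + 1"
        using R xy norm_triangle_ineq2[of x y] norm_triangle_ineq2[of y x]
        by (auto simp: subset_eq norm_minus_commute)
      then show ?thesis using d(2)[of y x] xy by (simp add: dist_norm)
    next
      case False
      then show ?thesis using assms by simp
    qed
  qed
qed

lemma compact_support_integrable:
  fixes f :: "'a::euclidean_space \<Rightarrow> 'b::euclidean_space"
  assumes "continuous_on UNIV f" "compact K" "\<And>x. x \<notin> K \<Longrightarrow> f x = 0"
  shows "integrable lborel f"
proof -
  have "integrable lborel (\<lambda>x. indicator K x *\<^sub>R f x)"
    by (intro borel_integrable_compact assms continuous_on_subset[OF assms(1)]) auto
  moreover have "(\<lambda>x. indicator K x *\<^sub>R f x) = f"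
    using assms(3) by (auto simp: indicator_def)
  ultimately show ?thesis by simp
qed

lemma C1c_bounds:
  assumes "C1c U f g"
  obtains B where "B > 0" "\<And>x. \<bar>f x\<bar> \<le> B" "\<And>x. norm (g x) \<le> B"
proof -
  obtain K where K: "compact K" "\<And>x. x \<notin> K \<Longrightarrow> f x = 0" "\<And>x. x \<notin> K \<Longrightarrow> g x = 0"
    using assms unfolding C1c_def by blast
  note hg = has_grad_D[OF C1c_has_grad[OF assms]]
  obtain B1 where B1: "B1 > 0" "\<And>x. norm (f x) \<le> B1"
    using compact_support_bounded[OF hg(3) K(1,2)] by metis
  obtain B2 where B2: "B2 > 0" "\<And>x. norm (g x) \<le> B2"
    using compact_support_bounded[OF hg(2) K(1,3)] by metis
  show ?thesis
    by (rule that[of "max B1 B2"]) (use B1 B2 in \<open>auto simp: le_max_iff_disj\<close>)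
qed

text \<open>A single radius serves all base points because g is uniformly continuous. This
  uniformity allows the remainder to be integrated against any integrable kernel.\<close>

lemma C1c_uniform_taylor:
  assumes "C1c U f g" "e > 0"
  obtains d where "d > 0" "\<And>x h. norm h < d \<Longrightarrow> \<bar>f (x + h) - f x - g x \<bullet> h\<bar> \<le> e * norm h"
proof -
  obtain K where K: "compact K" "\<And>x. x \<notin> K \<Longrightarrow> g x = 0"
    using assms unfolding C1c_def by blast
  note hg = has_grad_D[OF C1c_has_grad[OF assms(1)]]
  obtain d where d: "d > 0" "\<And>x y. norm (x - y) < d \<Longrightarrow> norm (g x - g y) < e"
    using compact_support_uniformly_continuous[OF hg(2) K assms(2)] by metis
  show ?thesis
  proof (rule that[OF d(1)])
    fix x h :: 'a assume h: "norm h < d"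
    have "norm (f (x + h) - f x - g x \<bullet> (x + h - x)) \<le> norm (x + h - x) * e"
    proof (rule differentiable_bound_linearization[where S = "ball x d" and f' = "\<lambda>x h. g x \<bullet> h"])
      fix t :: real assume "t \<in> {0..1}"
      then have "norm (t *\<^sub>R h) < d" using h
        by (smt (verit) atLeastAtMost_iff mult_left_le_one_le norm_ge_zero norm_scaleR abs_of_nonneg)
      then show "x + t *\<^sub>R (x + h - x) \<in> ball x d" by (simp add: dist_norm)
    next
      fix y assume "y \<in> ball x d"
      then have ny: "norm (g y - g x) < e" using d(2)[of y x] by (simp add: dist_norm norm_minus_commute)
      show "onorm ((\<lambda>h. g y \<bullet> h) - (\<lambda>h. g x \<bullet> h)) \<le> e"
      proof (rule onorm_le)
        fix z :: 'a
        have "\<bar>(g y - g x) \<bullet> z\<bar> \<le> norm (g y - g x) * norm z" by (rule Cauchy_Schwarz_ineq2)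
        also have "\<dots> \<le> e * norm z" using ny by (intro mult_right_mono) auto
        finally show "norm (((\<lambda>h. g y \<bullet> h) - (\<lambda>h. g x \<bullet> h)) z) \<le> e * norm z"
          by (simp add: inner_diff_left)
      qed
    qed (use hg d in auto)
    then show "\<bar>f (x + h) - f x - g x \<bullet> h\<bar> \<le> e * norm h" by (simp add: mult.commute)
  qed
qed

section \<open>Convolution and differentiation under the integral\<close>

definition conv :: "('a::euclidean_space \<Rightarrow> real) \<Rightarrow> ('a \<Rightarrow> 'b::euclidean_space) \<Rightarrow> 'a \<Rightarrow> 'b" where
  "conv w f x = (\<integral>y. w y *\<^sub>R f (x - y) \<partial>lborel)"

lemma conv_integrable:
  fixes f :: "'a::euclidean_space \<Rightarrow> 'b::euclidean_space"
  assumes "integrable lborel w" "f \<in> borel_measurable borel" "\<And>x. norm (f x) \<le> B"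
  shows "integrable lborel (\<lambda>y. w y *\<^sub>R f (x - y))"
proof (rule Bochner_Integration.integrable_bound)
  show "integrable lborel (\<lambda>y. B * w y)" using assms by simp
  have "w \<in> borel_measurable borel" using assms(1) by auto
  then show "(\<lambda>y. w y *\<^sub>R f (x - y)) \<in> borel_measurable lborel" using assms(2) by measurable
  show "AE y in lborel. norm (w y *\<^sub>R f (x - y)) \<le> norm (B * w y)"
  proof (rule AE_I2)
    fix y
    have "norm (f (x - y)) \<le> \<bar>B\<bar>" using assms(3)[of "x - y"] by linarith
    then show "norm (w y *\<^sub>R f (x - y)) \<le> norm (B * w y)"
      by (simp add: abs_mult mult.commute[of "\<bar>B\<bar>"] mult_left_mono)
  qed
qed

text \<open>In \<open>conv w f\<close> the first argument only has to be integrable and all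
  regularity comes from the second. A rough function is therefore mollified by swapping it into the
  first slot.\<close>

lemma conv_commute:
  fixes f g :: "'a::euclidean_space \<Rightarrow> real"
  assumes "f \<in> borel_measurable borel" "g \<in> borel_measurable borel"
  shows "conv f g = conv g f"
proof
  fix x
  have "conv f g x = (\<integral>y. (\<lambda>z. f (x - z) * g z) (x - y) \<partial>lborel)"
    by (simp add: conv_def)
  also have "\<dots> = (\<integral>z. f (x - z) * g z \<partial>lborel)"
    by (rule lborel_integral_reflect) (use assms in measurable)
  finally show "conv f g x = conv g f x" by (simp add: conv_def mult.commute)
qed

lemma integral_scaleR_bound:
  fixes F :: "'a \<Rightarrow> 'b::euclidean_space"
  assumes w: "integrable M w" and "integrable M (\<lambda>y. w y *\<^sub>R F y)"
    and "\<And>y. norm (F y) \<le> e"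
  shows "norm (\<integral>y. w y *\<^sub>R F y \<partial>M) \<le> e * (\<integral>y. \<bar>w y\<bar> \<partial>M)"
proof -
  have "norm (\<integral>y. w y *\<^sub>R F y \<partial>M) \<le> (\<integral>y. norm (w y *\<^sub>R F y) \<partial>M)"
    by (rule integral_norm_bound)
  also have "\<dots> \<le> (\<integral>y. e * \<bar>w y\<bar> \<partial>M)"
    using assms integrable_norm[OF assms(2)]
    by (intro integral_mono) (auto simp: mult.commute[of e] intro!: mult_left_mono)
  finally show ?thesis by simp
qed

lemma conv_continuous:
  fixes f :: "'a::euclidean_space \<Rightarrow> 'b::euclidean_space"
  assumes w: "integrable lborel w" and f: "continuous_on UNIV f" "compact K" "\<And>x. x \<notin> K \<Longrightarrow> f x = 0"
  shows "continuous_on UNIV (conv w f)"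
  unfolding continuous_on_iff
proof (intro ballI allI impI)
  fix x :: 'a and e :: real assume e: "e > 0"
  define I where "I = (\<integral>y. \<bar>w y\<bar> \<partial>lborel)"
  have I: "I \<ge> 0" unfolding I_def by simp
  obtain B where B: "\<And>x. norm (f x) \<le> B" using compact_support_bounded[OF f] by metis
  obtain d where d: "d > 0" "\<And>x y. norm (x - y) < d \<Longrightarrow> norm (f x - f y) < e / (I + 1)"
    using compact_support_uniformly_continuous[OF f, of "e / (I + 1)"] e I by (metis add_nonneg_pos divide_pos_pos zero_less_one)
  have fb: "f \<in> borel_measurable borel" by (rule continuous_on_imp_borel) fact
  note ci = conv_integrable[OF w fb B]
  show "\<exists>d>0. \<forall>x'\<in>UNIV. dist x' x < d \<longrightarrow> dist (conv w f x') (conv w f x) < e"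
  proof (intro exI[of _ d] conjI ballI impI)
    fix x' assume x': "dist x' x < d"
    have "conv w f x' - conv w f x = (\<integral>y. w y *\<^sub>R (f (x' - y) - f (x - y)) \<partial>lborel)"
      unfolding conv_def by (subst Bochner_Integration.integral_diff[symmetric]) (use ci in \<open>auto simp: algebra_simps\<close>)
    also have "norm \<dots> \<le> e / (I + 1) * I"
      unfolding I_def
    proof (rule integral_scaleR_bound[OF w])
      show "integrable lborel (\<lambda>y. w y *\<^sub>R (f (x' - y) - f (x - y)))"
        using Bochner_Integration.integrable_diff[OF ci[of x'] ci[of x]] by (simp add: algebra_simps)
      fix y show "norm (f (x' - y) - f (x - y)) \<le> e / ((\<integral>y. \<bar>w y\<bar> \<partial>lborel) + 1)"
        using d(2)[of "x' - y" "x - y"] x' unfolding I_def[symmetric] by (simp add: dist_norm)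
    qed
    also have "\<dots> < e" using e I by (simp add: field_simps)
    finally show "dist (conv w f x') (conv w f x) < e" by (simp add: dist_norm)
  qed (use d in auto)
qed

text \<open>The Taylor remainder of f is uniformly at most \<open>e / (I + 1) * norm h\<close>;
  integrating it against the kernel of total mass \<open>I\<close> keeps it below
  \<open>e * norm h\<close>.\<close>

lemma conv_has_grad:
  assumes w: "integrable lborel w" and f: "C1c U f g"
  shows "has_grad (conv w f) (conv w g)"
  unfolding has_grad_def
proof (intro conjI allI)
  obtain K where K: "compact K" "\<And>x. x \<notin> K \<Longrightarrow> f x = 0" "\<And>x. x \<notin> K \<Longrightarrow> g x = 0"
    using f unfolding C1c_def by blast
  note hg = has_grad_D[OF C1c_has_grad[OF f]]
  show "continuous_on UNIV (conv w g)" by (rule conv_continuous[OF w hg(2) K(1,3)])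
  obtain B where B: "B > 0" "\<And>x. norm (f x) \<le> B" "\<And>x. norm (g x) \<le> B" using C1c_bounds[OF f] by (metis real_norm_def)
  have bf: "f \<in> borel_measurable borel" "g \<in> borel_measurable borel"
    using has_grad_borel[OF C1c_has_grad[OF f]] by auto
  note cf = conv_integrable[OF w bf(1) B(2)] and cg = conv_integrable[OF w bf(2) B(3)]
  define I where "I = (\<integral>y. \<bar>w y\<bar> \<partial>lborel)"
  have I: "I \<ge> 0" unfolding I_def by simp
  fix x
  show "(conv w f has_derivative (\<lambda>h. conv w g x \<bullet> h)) (at x)"
    unfolding has_derivative_at_alt
  proof (intro conjI allI impI)
    show "bounded_linear ((\<bullet>) (conv w g x))" by (rule bounded_linear_inner_right)
    fix e :: real assume e: "e > 0"
    obtain d where d: "d > 0" "\<And>x h. norm h < d \<Longrightarrow> \<bar>f (x + h) - f x - g x \<bullet> h\<bar> \<le> e / (I + 1) * norm h"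
      using C1c_uniform_taylor[OF f, of "e / (I + 1)"] e I by (metis add_nonneg_pos divide_pos_pos zero_less_one)
    show "\<exists>d>0. \<forall>y. norm (y - x) < d \<longrightarrow> norm (conv w f y - conv w f x - conv w g x \<bullet> (y - x)) \<le> e * norm (y - x)"
    proof (intro exI[of _ d] conjI allI impI)
      fix y assume y: "norm (y - x) < d"
      define h where "h = y - x"
      have ig: "integrable lborel (\<lambda>z. w z * (g (x - z) \<bullet> h))"
        using integrable_inner_left[OF cg[of x], of h] by (simp)
      have "conv w f y - conv w f x - conv w g x \<bullet> h =
        (\<integral>z. w z *\<^sub>R f (y - z) \<partial>lborel) - (\<integral>z. w z *\<^sub>R f (x - z) \<partial>lborel) - (\<integral>z. w z * (g (x - z) \<bullet> h) \<partial>lborel)"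
        unfolding conv_def by (subst integral_inner_left[symmetric]) (use cg in auto)
      also have "\<dots> = (\<integral>z. w z *\<^sub>R (f (y - z) - f (x - z) - g (x - z) \<bullet> h) \<partial>lborel)"
        using cf[of y] cf[of x] ig by (simp add: algebra_simps)
      also have "norm \<dots> \<le> e / (I + 1) * norm h * I"
        unfolding I_def
      proof (rule integral_scaleR_bound[OF w])
        show "integrable lborel (\<lambda>z. w z *\<^sub>R (f (y - z) - f (x - z) - g (x - z) \<bullet> h))"
          using Bochner_Integration.integrable_diff[OF Bochner_Integration.integrable_diff[OF cf[of y] cf[of x]] ig]
          by (simp add: algebra_simps)
        fix z show "norm (f (y - z) - f (x - z) - g (x - z) \<bullet> h) \<le> e / ((\<integral>y. \<bar>w y\<bar> \<partial>lborel) + 1) * norm h"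
          using d(2)[of h "x - z"] y unfolding I_def[symmetric] h_def by (simp add: algebra_simps)
      qed
      also have "\<dots> = e * norm h * (I / (I + 1))" by simp
      also have "\<dots> \<le> e * norm h" using e I by (intro mult_left_le) auto
      finally show "norm (conv w f y - conv w f x - conv w g x \<bullet> (y - x)) \<le> e * norm (y - x)"
        by (simp add: h_def)
    qed (use d in auto)
  qed
qed

section \<open>Smoothness classes and the standard mollifier\<close>

lemma Ck_Suc_has_derivative:
  assumes "\<And>x. (f has_derivative f' x) (at x)"
  shows "Ck (Suc k) f \<longleftrightarrow> (\<forall>v. Ck k (\<lambda>x. f' x v))"
proof -
  have "frechet_derivative f (at x) = f' x" for x
    using frechet_derivative_at[OF assms] by simp
  moreover have "f differentiable (at x)" for x
    using assms unfolding differentiable_def by blast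
  ultimately show ?thesis by simp
qed

lemma Ck_SucD: "Ck (Suc k) f \<Longrightarrow> Ck k f"
proof (induction k arbitrary: f)
  case 0
  then show ?case
    by (simp add: continuous_at_imp_continuous_on differentiable_imp_continuous_within)
next
  case (Suc k)
  show ?case
    unfolding Ck.simps(2)[of k f] using Suc.IH Suc.prems Ck.simps(2) by blast
qed

lemma Ck_Suc_has_derivativeD:
  assumes "Ck (Suc k) f"
  shows "(f has_derivative frechet_derivative f (at x)) (at x)"
  using assms frechet_derivative_works by auto

lemma Ck_const: "Ck k (\<lambda>x. c)"
  by (induction k arbitrary: c) simp_all

lemma Ck_inner: "Ck k (\<lambda>x. x \<bullet> v)"
proof (cases k)
  case (Suc j)
  have "((\<lambda>x. x \<bullet> v) has_derivative (\<lambda>h. h \<bullet> v)) (at x)" for x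
    by (auto intro!: derivative_eq_intros)
  from Ck_Suc_has_derivative[where f = "\<lambda>x. x \<bullet> v" and f' = "\<lambda>x h. h \<bullet> v", OF this]
  show ?thesis by (simp add: Suc Ck_const)
qed (auto intro!: continuous_intros)

lemma Ck_add:
  "Ck k f \<Longrightarrow> Ck k g \<Longrightarrow> Ck k (\<lambda>x. f x + g x)"
proof (induction k arbitrary: f g)
  case (Suc k)
  note d = Ck_Suc_has_derivativeD[OF Suc.prems(1)] Ck_Suc_has_derivativeD[OF Suc.prems(2)]
  show ?case
    unfolding Ck_Suc_has_derivative[OF has_derivative_add[OF d]]
    using Suc.prems by (intro allI Suc.IH) auto
qed (auto intro!: continuous_intros)

lemma Ck_mult:
  fixes f g :: "'a::euclidean_space \<Rightarrow> real"
  shows "Ck k f \<Longrightarrow> Ck k g \<Longrightarrow> Ck k (\<lambda>x. f x * g x)"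
proof (induction k arbitrary: f g)
  case (Suc k)
  note d = Ck_Suc_has_derivativeD[OF Suc.prems(1)] Ck_Suc_has_derivativeD[OF Suc.prems(2)]
  show ?case
    unfolding Ck_Suc_has_derivative[OF has_derivative_mult[OF d]]
    using Suc.prems by (intro allI Ck_add Suc.IH) (auto intro: Ck_SucD)
qed (auto intro!: continuous_intros)

text \<open>The function exp(-1/t) extended by zero, with powers of 1/t attached. The powers make
  the family closed under differentiation up to linear combinations, so that one induction covers
  all orders.\<close>

definition flat_exp :: "nat \<Rightarrow> real \<Rightarrow> real" where
  "flat_exp n t = (if t > 0 then exp (- inverse t) * inverse t ^ n else 0)"

lemma flat_exp_tendsto_0: "(flat_exp n \<longlongrightarrow> 0) (at 0)"
proof -
  have "((\<lambda>t. inverse t ^ n / exp (inverse t)) \<longlongrightarrow> (0::real)) (at_right 0)"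
    by (rule filterlim_compose[OF tendsto_power_div_exp_0 filterlim_inverse_at_top_right])
  then have r: "(flat_exp n \<longlongrightarrow> 0) (at_right 0)"
    by (rule Lim_transform_eventually)
       (auto simp: eventually_at_filter flat_exp_def exp_minus divide_inverse mult.commute)
  have l: "(flat_exp n \<longlongrightarrow> 0) (at_left 0)"
    by (rule Lim_transform_eventually[OF tendsto_const]) (auto simp: eventually_at_filter flat_exp_def)
  show ?thesis using l r by (simp add: filterlim_split_at)
qed

lemma flat_exp_has_derivative:
  "(flat_exp n has_real_derivative (flat_exp (n+2) t - n * flat_exp (n+1) t)) (at t)"
proof -
  consider "t > 0" | "t < 0" | "t = 0" by linarith
  then show ?thesis
  proof cases
    case 1
    have "((\<lambda>t. exp (- inverse t) * inverse t ^ n) has_real_derivative (flat_exp (n+2) t - n * flat_exp (n+1) t)) (at t)"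
      using 1
      by (auto intro!: derivative_eq_intros simp: flat_exp_def power2_eq_square algebra_simps)
         (metis One_nat_def power_eq_if)
    then show ?thesis
      by (rule has_field_derivative_transform_within_open[of _ _ _ "{0<..}"]) (use 1 in \<open>auto simp: flat_exp_def\<close>)
  next
    case 2
    have "((\<lambda>t. 0::real) has_real_derivative (flat_exp (n+2) t - n * flat_exp (n+1) t)) (at t)"
      using 2 by (auto simp: flat_exp_def)
    then show ?thesis
      by (rule has_field_derivative_transform_within_open[of _ _ _ "{..<0}"]) (use 2 in \<open>auto simp: flat_exp_def\<close>)
  next
    case 3
    \<comment> \<open>At the origin the difference quotient of \<open>flat_exp n\<close> is
      \<open>flat_exp (Suc n)\<close>, which tends to 0.\<close>
    have "((\<lambda>h. (flat_exp n (0 + h) - flat_exp n 0) / h) \<longlongrightarrow> 0) (at 0)"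
      by (rule Lim_transform_eventually[OF flat_exp_tendsto_0[of "Suc n"]])
         (auto simp: eventually_at_filter flat_exp_def divide_inverse)
    then show ?thesis
      unfolding DERIV_def using 3 by (simp add: flat_exp_def)
  qed
qed

text \<open>The squared norm is used instead of the norm, so the inner function is a polynomial.
  Each derivative is a linear factor times members of the same family, and the induction runs over
  all n simultaneously.\<close>

lemma Ck_flat_exp_radial:
  "Ck k (\<lambda>x::'a::euclidean_space. flat_exp n (c - x \<bullet> x))"
proof (induction k arbitrary: n)
  case 0
  have "continuous_on UNIV (flat_exp n)"
    by (meson DERIV_isCont continuous_at_imp_continuous_on flat_exp_has_derivative)
  then have "continuous_on UNIV (\<lambda>x::'a. flat_exp n (c - x \<bullet> x))"
    by (rule continuous_on_compose2) (auto intro!: continuous_intros)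
  then show ?case by simp
next
  case (Suc k)
  define f' where "f' = (\<lambda>x h::'a. (flat_exp (n+2) (c - x \<bullet> x) + (- real n) * flat_exp (n+1) (c - x \<bullet> x)) * ((-2) * (x \<bullet> h)))"
  have "((\<lambda>x. flat_exp n (c - x \<bullet> x)) has_derivative f' x) (at x)" for x
  proof -
    have hd: "((\<lambda>x. c - x \<bullet> x) has_derivative (\<lambda>h. (-2) * (x \<bullet> h))) (at x)"
      by (auto intro!: derivative_eq_intros simp: inner_commute)
    show ?thesis
      using has_derivative_compose[OF hd flat_exp_has_derivative[unfolded has_field_derivative_def, of n]]
      unfolding f'_def by simp
  qed
  from Ck_Suc_has_derivative[OF this] show ?case
    unfolding f'_def by (simp only:) (intro allI Ck_mult Ck_add Suc.IH Ck_const Ck_inner)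
qed

definition bump :: "real \<Rightarrow> 'a::euclidean_space \<Rightarrow> real" where
  "bump r x = flat_exp 0 (r\<^sup>2 - x \<bullet> x)"

definition mollifier :: "real \<Rightarrow> 'a::euclidean_space \<Rightarrow> real" where
  "mollifier r x = (1 / (\<integral>y. bump r (y::'a) \<partial>lborel)) * bump r x"

lemma bump_pos_iff: "r > 0 \<Longrightarrow> bump r x > 0 \<longleftrightarrow> norm x < r"
  unfolding bump_def flat_exp_def
  by (auto simp: dot_square_norm intro: power2_less_imp_less power_strict_mono)

lemma bump_nonneg: "bump r x \<ge> 0"
  by (simp add: bump_def flat_exp_def)

lemma bump_zero: "r > 0 \<Longrightarrow> norm x \<ge> r \<Longrightarrow> bump r x = 0"
  using bump_pos_iff[of r x] bump_nonneg[of r x] by linarith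

lemma bump_integrable:
  assumes "r > 0" shows "integrable lborel (bump r :: 'a::euclidean_space \<Rightarrow> real)"
proof (rule compact_support_integrable)
  have "Ck 0 (bump r :: 'a \<Rightarrow> real)" unfolding bump_def[abs_def] by (rule Ck_flat_exp_radial)
  then show "continuous_on UNIV (bump r :: 'a \<Rightarrow> real)" by simp
  show "compact (cball (0::'a) r)" by simp
  show "\<And>x. x \<notin> cball (0::'a) r \<Longrightarrow> bump r x = 0" using assms by (intro bump_zero) auto
qed

lemma bump_integral_pos:
  assumes "r > 0" shows "(\<integral>y. bump r (y::'a::euclidean_space) \<partial>lborel) > 0"
proof -
  have "(\<integral>y. bump r (y::'a) \<partial>lborel) \<noteq> 0"
  proof
    assume "(\<integral>y. bump r (y::'a) \<partial>lborel) = 0"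
    then have "AE y in lborel. bump r (y::'a) = 0"
      using integral_nonneg_eq_0_iff_AE[OF bump_integrable[OF assms]] bump_nonneg by auto
    then have "AE y in lborel. y \<notin> ball (0::'a) r"
      by (rule AE_mp) (use bump_pos_iff[OF assms] in \<open>auto intro!: AE_I2 simp: less_le\<close>)
    then have "ball (0::'a) r \<in> null_sets lborel"
      by (subst (asm) AE_iff_null_sets[symmetric]) auto
    then show False
      using content_ball_pos[OF assms, of "0::'a"] by (simp add: null_sets_def measure_def)
  qed
  moreover have "(\<integral>y. bump r (y::'a) \<partial>lborel) \<ge> 0" by (simp add: bump_nonneg)
  ultimately show ?thesis by linarith
qed

lemma mollifier_props:
  fixes x :: "'a::euclidean_space"
  assumes "r > 0"
  shows "mollifier r x \<ge> 0" "norm x \<ge> r \<Longrightarrow> mollifier r x = 0"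
    "integrable lborel (mollifier r :: 'a::euclidean_space \<Rightarrow> real)"
    "(\<integral>y. mollifier r (y::'a) \<partial>lborel) = 1"
    "Ck k (mollifier r :: 'a \<Rightarrow> real)"
proof -
  show "mollifier r x \<ge> 0" unfolding mollifier_def
    using bump_nonneg[of r x] bump_integral_pos[OF assms, where 'a='a] by simp
  show "norm x \<ge> r \<Longrightarrow> mollifier r x = 0" unfolding mollifier_def using bump_zero[OF assms, of x] by simp
  show "integrable lborel (mollifier r :: 'a::euclidean_space \<Rightarrow> real)"
    unfolding mollifier_def[abs_def] using bump_integrable[OF assms, where 'a='a] by simp
  show "(\<integral>y. mollifier r (y::'a) \<partial>lborel) = 1"
    unfolding mollifier_def using bump_integral_pos[OF assms, where 'a='a] by simp
  show "Ck k (mollifier r :: 'a \<Rightarrow> real)"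
    unfolding mollifier_def[abs_def] bump_def[abs_def] by (intro Ck_mult Ck_const Ck_flat_exp_radial)
qed

lemma Ck_has_grad:
  fixes f :: "'a::euclidean_space \<Rightarrow> real"
  assumes "Ck (Suc 0) f"
  shows "has_grad f (\<lambda>x. \<Sum>b\<in>Basis. frechet_derivative f (at x) b *\<^sub>R b)"
  unfolding has_grad_def
proof (intro conjI allI)
  fix x
  have d: "(f has_derivative frechet_derivative f (at x)) (at x)"
    using Ck_Suc_has_derivativeD[OF assms] .
  then interpret bounded_linear "frechet_derivative f (at x)" by (rule has_derivative_bounded_linear)
  have "frechet_derivative f (at x) h = (\<Sum>b\<in>Basis. frechet_derivative f (at x) b *\<^sub>R b) \<bullet> h" for h
  proof -
    have "frechet_derivative f (at x) h = frechet_derivative f (at x) (\<Sum>b\<in>Basis. (h \<bullet> b) *\<^sub>R b)"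
      by (simp only: euclidean_representation)
    also have "\<dots> = (\<Sum>b\<in>Basis. (h \<bullet> b) * frechet_derivative f (at x) b)"
      by (simp add: sum scaleR)
    also have "\<dots> = (\<Sum>b\<in>Basis. frechet_derivative f (at x) b *\<^sub>R b) \<bullet> h"
      by (simp only: inner_sum_left inner_scaleR_left) (simp add: inner_commute mult.commute)
    finally show ?thesis .
  qed
  then show "(f has_derivative (\<bullet>) (\<Sum>b\<in>Basis. frechet_derivative f (at x) b *\<^sub>R b)) (at x)"
    using d by (metis (no_types, lifting) ext)
next
  show "continuous_on UNIV (\<lambda>x. \<Sum>b\<in>Basis. frechet_derivative f (at x) b *\<^sub>R b)"
    using assms by (auto intro!: continuous_intros)
qed

lemma has_grad_frechet:
  "has_grad f g \<Longrightarrow> frechet_derivative f (at x) v = g x \<bullet> v"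
  unfolding has_grad_def using frechet_derivative_at by metis

lemma has_grad_grad:
  fixes f :: "real^'d \<Rightarrow> real"
  assumes "has_grad f g" shows "grad f = g"
  by (rule ext) (simp add: grad_def has_grad_frechet[OF assms] inner_axis vec_eq_iff)

text \<open>A directional derivative of \<open>conv w f\<close> is again a convolution with w, now
  of a directional derivative of f, which is smooth with the same support; hence f is generalized in
  the induction.\<close>

lemma Ck_conv:
  fixes f :: "'a::euclidean_space \<Rightarrow> real"
  assumes w: "integrable lborel w" and K: "compact K"
  shows "(\<And>j. Ck j f) \<Longrightarrow> (\<And>x. x \<notin> K \<Longrightarrow> f x = 0) \<Longrightarrow> Ck k (conv w f)"
proof (induction k arbitrary: f)
  case 0
  have "continuous_on UNIV f" using 0(1)[of 0] by simp
  from conv_continuous[OF w this K 0(2)] show ?case by simp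
next
  case (Suc k)
  obtain g where g: "has_grad f g" using Ck_has_grad Suc.prems(1) by blast
  have gK: "C1c UNIV f g" by (rule C1cI[OF g K]) (use Suc.prems in auto)
  then have g0: "x \<notin> K \<Longrightarrow> g x = 0" for x using C1cI[OF g K order_refl Suc.prems(2)]
    Suc.prems(2)
  proof -
    assume x: "x \<notin> K"
    have o: "open (- K)" using K compact_imp_closed by blast
    have "((\<lambda>x. 0) has_derivative (\<lambda>h. g x \<bullet> h)) (at x)"
      by (rule has_derivative_transform_within_open[OF _ o, of f])
         (use g Suc.prems(2) x in \<open>auto simp: has_grad_def\<close>)
    moreover have "((\<lambda>x. 0::real) has_derivative (\<lambda>h. 0)) (at x)" by simp
    ultimately have "(\<lambda>h. g x \<bullet> h) = (\<lambda>h. 0)" using has_derivative_unique by blast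
    then have "g x \<bullet> g x = 0" by metis
    then show ?thesis by simp
  qed
  have cg: "has_grad (conv w f) (conv w g)" by (rule conv_has_grad[OF w gK])
  have "Ck k (\<lambda>x. conv w g x \<bullet> v)" for v
  proof -
    have Cg: "Ck j (\<lambda>x. g x \<bullet> v)" for j
      using Suc.prems(1)[of "Suc j"] has_grad_frechet[OF g] by simp
    obtain B where B: "\<And>x. norm (g x) \<le> B" using C1c_bounds[OF gK] by metis
    have "conv w g x \<bullet> v = conv w (\<lambda>x. g x \<bullet> v) x" for x
    proof -
      have "integrable lborel (\<lambda>y. w y *\<^sub>R g (x - y))"
        by (rule conv_integrable[OF w has_grad_borel(2)[OF g] B])
      then show ?thesis unfolding conv_def by (subst integral_inner_left[symmetric]) auto
    qed
    moreover have "Ck k (conv w (\<lambda>x. g x \<bullet> v))" by (rule Suc.IH) (use Cg g0 in auto)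
    ultimately show ?thesis by simp
  qed
  then show ?case using Ck_Suc_has_derivative[of "conv w f" "\<lambda>x h. conv w g x \<bullet> h"] cg
    unfolding has_grad_def by blast
qed

section \<open>Mollified test functions and extension of weak identities\<close>

lemma mollify_close:
  fixes f :: "'a::euclidean_space \<Rightarrow> 'b::euclidean_space"
  assumes r: "r > 0" and f: "f \<in> borel_measurable borel" "\<And>x. norm (f x) \<le> B"
    and close: "\<And>y. norm y < r \<Longrightarrow> norm (f (x - y) - f x) \<le> e"
  shows "norm (conv (mollifier r) f x - f x) \<le> e"
proof -
  note m = mollifier_props[OF r, where 'a='a]
  note ci = conv_integrable[OF m(3) f, of x]
  have "conv (mollifier r) f x - f x = (\<integral>y. mollifier r y *\<^sub>R f (x - y) \<partial>lborel) - (\<integral>y. mollifier r (y::'a) *\<^sub>R f x \<partial>lborel)"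
    unfolding conv_def using m(3,4) by simp
  also have "\<dots> = (\<integral>y. mollifier r y *\<^sub>R (f (x - y) - f x) \<partial>lborel)"
    using ci m(3) by (simp add: algebra_simps)
  also have "norm \<dots> \<le> (\<integral>y. norm (mollifier r y *\<^sub>R (f (x - y) - f x)) \<partial>lborel)"
    by (rule integral_norm_bound)
  also have "\<dots> \<le> (\<integral>y. e * mollifier r (y::'a) \<partial>lborel)"
  proof (rule integral_mono)
    show "integrable lborel (\<lambda>y. norm (mollifier r y *\<^sub>R (f (x - y) - f x)))"
      using Bochner_Integration.integrable_diff[OF ci integrable_scaleR_left[OF m(3), of "f x"]]
      by (intro integrable_norm) (auto simp: algebra_simps)
    show "integrable lborel (\<lambda>y::'a. e * mollifier r y)" using m(3) by auto
    fix y :: 'a show "norm (mollifier r y *\<^sub>R (f (x - y) - f x)) \<le> e * mollifier r y"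
      using close[of y] m(1)[of y] m(2)[of y]
      by (cases "norm y < r") (auto simp: mult.commute[of e] intro!: mult_left_mono)
  qed
  also have "\<dots> = e" using m(4) by simp
  finally show ?thesis .
qed

lemma mollify_test_function:
  fixes f :: "real^'d \<Rightarrow> real"
  assumes f: "C1c U f g" and "open U"
  obtains d where "d > 0"
    "\<And>r. 0 < r \<Longrightarrow> r < d \<Longrightarrow> test_function U (conv (mollifier r) f)"
proof -
  obtain K where K: "compact K" "K \<subseteq> U" "\<And>x. x \<notin> K \<Longrightarrow> f x = 0" "\<And>x. x \<notin> K \<Longrightarrow> g x = 0"
    using f unfolding C1c_def by blast
  obtain d where d: "d > 0" "(\<Union>x\<in>K. cball x d) \<subseteq> U"
    using compact_subset_open_imp_cball_epsilon_subset[OF K(1) \<open>open U\<close> K(2)] by metis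
  show ?thesis
  proof (rule that[OF d(1)])
    fix r :: real assume r: "0 < r" "r < d"
    note m = mollifier_props[OF r(1), where 'a="real^'d"]
    have bf: "f \<in> borel_measurable borel" using has_grad_borel[OF C1c_has_grad[OF f]] by simp
    have fi: "integrable lborel f"
      by (rule compact_support_integrable[OF has_grad_D(3)[OF C1c_has_grad[OF f]] K(1,3)])
    have bm: "mollifier r \<in> borel_measurable (borel :: (real^'d) measure)" using m(3) by auto
    \<comment> \<open>f is only C^1, so smoothness of the convolution has to be read off from the
      mollifier in the second slot.\<close>
    have eq: "conv (mollifier r) f = conv f (mollifier r)" by (rule conv_commute[OF bm bf])
    have "Ck k (conv f (mollifier r))" for k
      by (rule Ck_conv[OF fi, of "cball 0 r"]) (use m in auto)
    \<comment> \<open>The support lies in the sum of K with a closed ball of radius r. This sum is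
      compact, and it stays inside U because r is below the distance of K to the complement.\<close>
    moreover have sub: "{x. conv (mollifier r) f x \<noteq> 0} \<subseteq> (\<Union>x\<in>K. \<Union>y\<in>cball 0 r. {x + y})"
    proof
      fix x assume "x \<in> {x. conv (mollifier r) f x \<noteq> 0}"
      moreover have "conv (mollifier r) f x = 0" if "\<forall>y. mollifier r y *\<^sub>R f (x - y) = 0"
        unfolding conv_def that[rule_format] by simp
      ultimately have "\<not> (\<forall>y. mollifier r y *\<^sub>R f (x - y) = 0)" by blast
      then obtain y where "mollifier r y \<noteq> 0" "f (x - y) \<noteq> 0" by auto
      then have "norm y \<le> r" "x - y \<in> K" using m(2)[of y] K(3)[of "x - y"] by (meson linear)+
      then show "x \<in> (\<Union>x\<in>K. \<Union>y\<in>cball 0 r. {x + y})" by (intro UN_I[of "x - y"] UN_I[of y]) auto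
    qed
    have cS: "compact (\<Union>x\<in>K. \<Union>y\<in>cball 0 r. {x + y})"
      by (rule compact_sums'[OF K(1)]) simp
    then have cl: "closure {x. conv (mollifier r) f x \<noteq> 0} \<subseteq> (\<Union>x\<in>K. \<Union>y\<in>cball 0 r. {x + y})"
      using closure_minimal[OF sub compact_imp_closed] by blast
    moreover have "(\<Union>x\<in>K. \<Union>y\<in>cball 0 r. {x + y}) \<subseteq> U"
      using d(2) r by (fastforce simp: dist_norm)
    ultimately show "test_function U (conv (mollifier r) f)"
      unfolding test_function_def eq
      using compact_Int_closed[OF cS closed_closure, of "{x. conv f (mollifier r) x \<noteq> 0}"]
      by (simp add: inf.absorb2 subset_trans)
  qed
qed

text \<open>Mollifying f changes f and its gradient uniformly little, and P and p are integrable, so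
  both sides pass to the limit. Weak gradients, weak divergences and the equation itself all have
  this shape, and all three are extended to C^1 test functions by this one statement.\<close>

lemma weak_identity_C1c:
  fixes P :: "real^'d \<Rightarrow> real^'d" and p :: "real^'d \<Rightarrow> real"
  assumes U: "open U" and P: "integrable lborel P" and p: "integrable lborel p"
    and weak: "\<And>\<phi>. test_function U \<phi> \<Longrightarrow> (\<integral>x. P x \<bullet> grad \<phi> x \<partial>lborel) = (\<integral>x. p x * \<phi> x \<partial>lborel)"
    and f: "C1c U f g"
  shows "(\<integral>x. P x \<bullet> g x \<partial>lborel) = (\<integral>x. p x * f x \<partial>lborel)"
proof -
  obtain K where K: "compact K" "\<And>x. x \<notin> K \<Longrightarrow> f x = 0" "\<And>x. x \<notin> K \<Longrightarrow> g x = 0"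
    using f unfolding C1c_def by blast
  note hg = C1c_has_grad[OF f]
  note bfg = has_grad_borel[OF hg]
  obtain B where B: "B > 0" "\<And>x. norm (f x) \<le> B" "\<And>x. norm (g x) \<le> B" using C1c_bounds[OF f] by (metis real_norm_def)
  obtain d0 where d0: "d0 > 0" "\<And>r. 0 < r \<Longrightarrow> r < d0 \<Longrightarrow> test_function U (conv (mollifier r) f)"
    using mollify_test_function[OF f U] by metis
  have intPv: "integrable lborel (\<lambda>x. P x \<bullet> v x)" if "v \<in> borel_measurable borel" "\<And>x. norm (v x) \<le> C" for v C
  proof (rule Bochner_Integration.integrable_bound)
    show "integrable lborel (\<lambda>x. C * norm (P x))" using P by simp
    have "P \<in> borel_measurable borel" using P by auto
    then show "(\<lambda>x. P x \<bullet> v x) \<in> borel_measurable lborel" using that(1) by simp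
    have "\<bar>P x \<bullet> v x\<bar> \<le> \<bar>C * norm (P x)\<bar>" for x
    proof -
      have "\<bar>P x \<bullet> v x\<bar> \<le> norm (P x) * norm (v x)" by (rule Cauchy_Schwarz_ineq2)
      also have "\<dots> \<le> norm (P x) * C" using that(2) by (intro mult_left_mono) auto
      finally show ?thesis by (simp add: mult.commute)
    qed
    then show "AE x in lborel. norm (P x \<bullet> v x) \<le> norm (C * norm (P x))" by simp
  qed
  have intpv: "integrable lborel (\<lambda>x. p x * v x)" if "v \<in> borel_measurable borel" "\<And>x. \<bar>v x\<bar> \<le> C" for v C
  proof (rule Bochner_Integration.integrable_bound)
    show "integrable lborel (\<lambda>x. C * \<bar>p x\<bar>)" using p by simp
    have "p \<in> borel_measurable borel" using p by auto
    then show "(\<lambda>x. p x * v x) \<in> borel_measurable lborel" using that(1) by simp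
    have "\<bar>p x * v x\<bar> \<le> \<bar>C * \<bar>p x\<bar>\<bar>" for x
      using mult_left_mono[OF that(2)[of x], of "\<bar>p x\<bar>"] by (simp add: abs_mult mult.commute[of C] mult.commute[of "\<bar>C\<bar>"])
         (smt (verit) abs_ge_self mult_left_mono abs_ge_zero)
    then show "AE x in lborel. norm (p x * v x) \<le> norm (C * \<bar>p x\<bar>)" by simp
  qed
  define I where "I = (\<integral>x. norm (P x) \<partial>lborel) + (\<integral>x. \<bar>p x\<bar> \<partial>lborel)"
  have I0: "I \<ge> 0" unfolding I_def by simp
  have est: "\<bar>(\<integral>x. P x \<bullet> g x \<partial>lborel) - (\<integral>x. p x * f x \<partial>lborel)\<bar> \<le> e * I" if e: "e > 0" for e
  proof -
    obtain d1 where d1: "d1 > 0" "\<And>x y. norm (x - y) < d1 \<Longrightarrow> norm (f x - f y) < e"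
      using compact_support_uniformly_continuous[OF has_grad_D(3)[OF hg] K(1,2) e] by metis
    obtain d2 where d2: "d2 > 0" "\<And>x y. norm (x - y) < d2 \<Longrightarrow> norm (g x - g y) < e"
      using compact_support_uniformly_continuous[OF has_grad_D(2)[OF hg] K(1,3) e] by metis
    define r where "r = min d0 (min d1 d2) / 2"
    have r: "r > 0" "r < d0" "r < d1" "r < d2" using d0 d1 d2 unfolding r_def by auto
    define F where "F = conv (mollifier r) f"
    define G where "G = conv (mollifier r) g"
    have m: "integrable lborel (mollifier r :: real^'d \<Rightarrow> real)" using mollifier_props[OF r(1)] by blast
    have hF: "has_grad F G" unfolding F_def G_def by (rule conv_has_grad[OF m f])
    have FG: "norm (F x - f x) \<le> e" "norm (G x - g x) \<le> e" for x
      unfolding F_def G_def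
      by (rule mollify_close[OF r(1) bfg(1) B(2)], use d1(2)[of "x - y" x for y] r in \<open>simp add: less_imp_le\<close>)
         (rule mollify_close[OF r(1) bfg(2) B(3)], use d2(2)[of "x - y" x for y] r in \<open>simp add: less_imp_le\<close>)
    note bFG = has_grad_borel[OF hF]
    have weakF: "(\<integral>x. P x \<bullet> G x \<partial>lborel) = (\<integral>x. p x * F x \<partial>lborel)"
      using weak[of F] d0(2)[of r] r unfolding has_grad_grad[OF hF] F_def[symmetric] by simp
    have i1: "integrable lborel (\<lambda>x. P x \<bullet> g x)" by (rule intPv[OF bfg(2) B(3)])
    have i2: "integrable lborel (\<lambda>x. p x * f x)" by (rule intpv[OF bfg(1) B(2)[unfolded real_norm_def]])
    have i3: "integrable lborel (\<lambda>x. P x \<bullet> (G x - g x))"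
      by (rule intPv[OF _ FG(2)]) (use bFG bfg in simp)
    have i4: "integrable lborel (\<lambda>x. p x * (F x - f x))"
      by (rule intpv[OF _ FG(1)[unfolded real_norm_def]]) (use bFG bfg in simp)
    have "(\<integral>x. P x \<bullet> G x \<partial>lborel) = (\<integral>x. P x \<bullet> g x + P x \<bullet> (G x - g x) \<partial>lborel)"
      by (simp add: inner_diff_right)
    also have "\<dots> = (\<integral>x. P x \<bullet> g x \<partial>lborel) + (\<integral>x. P x \<bullet> (G x - g x) \<partial>lborel)"
      using i1 i3 by simp
    finally have e1: "(\<integral>x. P x \<bullet> G x \<partial>lborel) = (\<integral>x. P x \<bullet> g x \<partial>lborel) + (\<integral>x. P x \<bullet> (G x - g x) \<partial>lborel)" .
    have "(\<integral>x. p x * F x \<partial>lborel) = (\<integral>x. p x * f x + p x * (F x - f x) \<partial>lborel)"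
      by (simp add: algebra_simps)
    also have "\<dots> = (\<integral>x. p x * f x \<partial>lborel) + (\<integral>x. p x * (F x - f x) \<partial>lborel)"
      using i2 i4 by simp
    finally have e2: "(\<integral>x. p x * F x \<partial>lborel) = (\<integral>x. p x * f x \<partial>lborel) + (\<integral>x. p x * (F x - f x) \<partial>lborel)" .
    have "\<bar>\<integral>x. P x \<bullet> (G x - g x) \<partial>lborel\<bar> \<le> (\<integral>x. e * norm (P x) \<partial>lborel)"
    proof (rule order_trans[OF integral_abs_bound], rule integral_mono)
      fix x
      have "\<bar>P x \<bullet> (G x - g x)\<bar> \<le> norm (P x) * norm (G x - g x)" by (rule Cauchy_Schwarz_ineq2)
      also have "\<dots> \<le> norm (P x) * e" using FG by (intro mult_left_mono) auto
      finally show "\<bar>P x \<bullet> (G x - g x)\<bar> \<le> e * norm (P x)" by (simp add: mult.commute)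
    qed (use i3 P in auto)
    moreover have "\<bar>\<integral>x. p x * (F x - f x) \<partial>lborel\<bar> \<le> (\<integral>x. e * \<bar>p x\<bar> \<partial>lborel)"
      using integrable_abs[OF i4] p FG(1)
      by (intro order_trans[OF integral_abs_bound] integral_mono)
         (auto simp: abs_mult mult.commute[of e] intro!: mult_left_mono)
    ultimately show ?thesis using e1 e2 weakF unfolding I_def by (simp add: algebra_simps)
  qed
  have "\<bar>(\<integral>x. P x \<bullet> g x \<partial>lborel) - (\<integral>x. p x * f x \<partial>lborel)\<bar> \<le> 0"
  proof (rule field_le_epsilon)
    fix e :: real assume "e > 0"
    then have "\<bar>(\<integral>x. P x \<bullet> g x \<partial>lborel) - (\<integral>x. p x * f x \<partial>lborel)\<bar> \<le> e / (I + 1) * I"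
      using est[of "e / (I + 1)"] I0 by simp
    also have "\<dots> \<le> e" using I0 \<open>e > 0\<close> by (simp add: field_simps)
    finally show "\<bar>(\<integral>x. P x \<bullet> g x \<partial>lborel) - (\<integral>x. p x * f x \<partial>lborel)\<bar> \<le> 0 + e" by simp
  qed
  then show ?thesis by simp
qed

section \<open>Translation continuity, Lebesgue points and Sobolev approximation\<close>

definition L1_shift :: "('a::euclidean_space \<Rightarrow> 'b::euclidean_space) \<Rightarrow> 'a \<Rightarrow> real" where
  "L1_shift f z = (\<integral>x. norm (f (z + x) - f x) \<partial>lborel)"

lemma L1_shift_integrable:
  fixes f :: "'a::euclidean_space \<Rightarrow> 'b::euclidean_space"
  assumes "integrable lborel f"
  shows "integrable lborel (\<lambda>x. f (z + x) - f x)"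
  using assms lborel_integrable_translate[OF assms] by (intro Bochner_Integration.integrable_diff)

lemma L1_shift_triangle:
  fixes f g :: "'a::euclidean_space \<Rightarrow> 'b::euclidean_space"
  assumes f: "integrable lborel f" and g: "integrable lborel g"
  shows "L1_shift f z \<le> L1_shift g z + 2 * (\<integral>x. norm (f x - g x) \<partial>lborel)"
proof -
  have d: "integrable lborel (\<lambda>x. norm (f x - g x))" using f g by auto
  note dz = lborel_integrable_translate[OF d, of z]
  have i: "integrable lborel (\<lambda>x. norm (g (z + x) - g x))" using L1_shift_integrable[OF g] by auto
  have "L1_shift f z \<le> (\<integral>x. norm (g (z + x) - g x) + (norm (f (z + x) - g (z + x)) + norm (f x - g x)) \<partial>lborel)"
    unfolding L1_shift_def
  proof (rule integral_mono)
    fix x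
    have "f (z + x) - f x = (g (z + x) - g x) + ((f (z + x) - g (z + x)) + (g x - f x))" by simp
    also have "norm \<dots> \<le> norm (g (z + x) - g x) + (norm (f (z + x) - g (z + x)) + norm (g x - f x))"
      by (intro order_trans[OF norm_triangle_ineq] add_left_mono norm_triangle_ineq)
    finally show "norm (f (z + x) - f x) \<le> norm (g (z + x) - g x) + (norm (f (z + x) - g (z + x)) + norm (f x - g x))"
      by (simp only: norm_minus_commute[of "f x"])
  qed (use L1_shift_integrable[OF f] i d dz in auto)
  also have "\<dots> = L1_shift g z + ((\<integral>x. norm (f (z + x) - g (z + x)) \<partial>lborel) + (\<integral>x. norm (f x - g x) \<partial>lborel))"
    unfolding L1_shift_def using i d dz by (subst Bochner_Integration.integral_add, simp, simp)+ simp
  also have "(\<integral>x. norm (f (z + x) - g (z + x)) \<partial>lborel) = (\<integral>x. norm (f x - g x) \<partial>lborel)"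
    using lborel_integral_translate[of "\<lambda>x. norm (f x - g x)" z] by simp
  finally show ?thesis by simp
qed

text \<open>Indicators of open sets are lower semicontinuous, and their integrals do not change under
  translation; so the negative part of the increment, which is dominated, controls all of it.\<close>

lemma L1_shift_open:
  fixes Z :: "nat \<Rightarrow> 'a::euclidean_space"
  assumes U: "open U" "emeasure lborel U < \<infinity>" and Z: "Z \<longlonglongrightarrow> 0"
  shows "(\<lambda>n. L1_shift (indicator U :: 'a \<Rightarrow> real) (Z n)) \<longlonglongrightarrow> 0"
proof -
  let ?u = "indicator U :: 'a \<Rightarrow> real"
  have u: "integrable lborel ?u" using U by (simp add: integrable_indicator_iff)
  define p where "p n x = max 0 (?u x - ?u (Z n + x))" for n x
  have uz: "integrable lborel (\<lambda>x. ?u (Z n + x))" for n by (rule lborel_integrable_translate[OF u])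
  have pI: "integrable lborel (p n)" for n
    unfolding p_def using u uz[of n] by (intro integrable_max) auto
  have "(\<lambda>n. \<integral>x. p n x \<partial>lborel) \<longlonglongrightarrow> (\<integral>x. 0 \<partial>(lborel::'a measure))"
  proof (rule integral_dominated_convergence[where w = ?u])
    show "AE x in lborel. (\<lambda>n. p n x) \<longlonglongrightarrow> 0"
    proof (rule AE_I2)
      fix x
      show "(\<lambda>n. p n x) \<longlonglongrightarrow> 0"
      proof (cases "x \<in> U")
        case True
        have "(\<lambda>n. Z n + x) \<longlonglongrightarrow> 0 + x" using Z by (intro tendsto_intros)
        then have "(\<lambda>n. Z n + x) \<longlonglongrightarrow> x" by simp
        from topological_tendstoD[OF this U(1) True]
        have "eventually (\<lambda>n. Z n + x \<in> U) sequentially" .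
        then have "eventually (\<lambda>n. p n x = 0) sequentially"
          by eventually_elim (simp add: p_def True)
        then show ?thesis by (simp add: tendsto_eventually)
      qed (simp add: p_def max_absorb1)
    qed
    show "AE x in lborel. norm (p n x) \<le> ?u x" for n
      by (rule AE_I2) (simp add: p_def indicator_def)
    show "p n \<in> borel_measurable lborel" for n using pI[of n] by auto
  qed (use u in auto)
  moreover have "L1_shift ?u (Z n) = 2 * (\<integral>x. p n x \<partial>lborel)" for n
  proof -
    have "L1_shift ?u (Z n) = (\<integral>x. 2 * p n x + (?u (Z n + x) - ?u x) \<partial>lborel)"
      unfolding L1_shift_def by (rule Bochner_Integration.integral_cong) (auto simp: p_def max_def indicator_def)
    also have "\<dots> = 2 * (\<integral>x. p n x \<partial>lborel) + ((\<integral>x. ?u (Z n + x) \<partial>lborel) - (\<integral>x. ?u x \<partial>lborel))"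
      using pI u uz by simp
    finally show ?thesis by (simp add: lborel_integral_translate)
  qed
  ultimately show ?thesis by (simp add: tendsto_mult_right_zero)
qed

text \<open>By outer regularity A is close in measure to an open superset, where the shift is
  already controlled; replacing one set by the other costs twice the measure of the difference,
  uniformly in the shift.\<close>

lemma L1_shift_indicator:
  fixes Z :: "nat \<Rightarrow> 'a::euclidean_space"
  assumes A: "A \<in> sets borel" "emeasure lborel A < \<infinity>" and Z: "Z \<longlonglongrightarrow> 0"
  shows "(\<lambda>n. L1_shift (indicator A :: 'a \<Rightarrow> real) (Z n)) \<longlonglongrightarrow> 0"
proof (rule LIMSEQ_I)
  fix e :: real assume e: "e > 0"
  obtain U where U: "open U" "A \<subseteq> U" "emeasure lborel (U - A) < ennreal (e / 4)"
    using outer_regular_lborel[OF A(1), of "e / 4"] e by auto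
  have "emeasure lborel U = emeasure lborel A + emeasure lborel (U - A)"
    using U A by (subst plus_emeasure) (auto simp: Un_absorb1)
  also have "\<dots> < \<infinity>" using less_trans[OF U(3) ennreal_less_top] A(2) by (simp add: ennreal_add_less_top)
  finally have Uf: "emeasure lborel U < \<infinity>" .
  have iU: "integrable lborel (indicator U :: 'a \<Rightarrow> real)" and iA: "integrable lborel (indicator A :: 'a \<Rightarrow> real)"
    using Uf U A by (auto simp: integrable_indicator_iff)
  have "(\<integral>x. norm (indicator A x - indicator U x :: real) \<partial>lborel) = (\<integral>x. indicator (U - A) x \<partial>lborel)"
    by (rule Bochner_Integration.integral_cong) (use U in \<open>auto simp: indicator_def\<close>)
  also have "\<dots> = measure lborel (U - A)" by simp
  also have "\<dots> < e / 4"
    using U(3) e less_trans[OF U(3) ennreal_less_top]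
    by (subst (asm) emeasure_eq_ennreal_measure) (auto simp: ennreal_less_iff)
  finally have d: "(\<integral>x. norm (indicator A x - indicator U x :: real) \<partial>lborel) < e / 4" .
  obtain N where N: "\<And>n. n \<ge> N \<Longrightarrow> norm (L1_shift (indicator U :: 'a \<Rightarrow> real) (Z n)) < e / 2"
    using LIMSEQ_D[OF L1_shift_open[OF U(1) Uf Z], of "e/2"] e by auto
  have "norm (L1_shift (indicator A :: 'a \<Rightarrow> real) (Z n)) < e" if "n \<ge> N" for n
  proof -
    have "0 \<le> L1_shift (indicator A :: 'a \<Rightarrow> real) (Z n)" unfolding L1_shift_def by simp
    with L1_shift_triangle[OF iA iU, of "Z n"] N[OF that] d show ?thesis by simp
  qed
  then show "\<exists>N. \<forall>n\<ge>N. norm (L1_shift (indicator A :: 'a \<Rightarrow> real) (Z n) - 0) < e" by auto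
qed

lemma L1_shift_tendsto:
  fixes f :: "'a::euclidean_space \<Rightarrow> 'b::euclidean_space"
  assumes "integrable lborel f" and Z: "Z \<longlonglongrightarrow> 0"
  shows "(\<lambda>n. L1_shift f (Z n)) \<longlonglongrightarrow> 0"
  using assms(1)
proof (induction rule: integrable_induct)
  case (base A c)
  have "L1_shift (\<lambda>x. indicator A x *\<^sub>R c) z = L1_shift (indicator A :: 'a \<Rightarrow> real) z * norm c" for z
    unfolding L1_shift_def by (simp add: scaleR_diff_left[symmetric])
  then show ?case using L1_shift_indicator[of A, OF _ _ Z] base by (simp add: tendsto_mult_left_zero)
next
  case (add f g)
  show ?case
  proof (rule tendsto_sandwich[of "\<lambda>_. 0"])
    show "\<forall>\<^sub>F n in sequentially. L1_shift (\<lambda>x. f x + g x) (Z n) \<le> L1_shift f (Z n) + L1_shift g (Z n)"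
    proof (intro always_eventually allI)
      fix n
      have i: "integrable lborel (\<lambda>x. norm (f (Z n + x) - f x))" "integrable lborel (\<lambda>x. norm (g (Z n + x) - g x))"
        using integrable_norm[OF L1_shift_integrable[OF add(1)]] integrable_norm[OF L1_shift_integrable[OF add(2)]] by simp_all
      have "L1_shift (\<lambda>x. f x + g x) (Z n) \<le> (\<integral>x. norm (f (Z n + x) - f x) + norm (g (Z n + x) - g x) \<partial>lborel)"
        unfolding L1_shift_def
      proof (rule integral_mono)
        fix x
        show "norm (f (Z n + x) + g (Z n + x) - (f x + g x)) \<le> norm (f (Z n + x) - f x) + norm (g (Z n + x) - g x)"
          using norm_triangle_ineq[of "f (Z n + x) - f x" "g (Z n + x) - g x"] by (simp add: algebra_simps)
      qed (use i L1_shift_integrable[OF Bochner_Integration.integrable_add[OF add(1,2)]] in auto)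
      then show "L1_shift (\<lambda>x. f x + g x) (Z n) \<le> L1_shift f (Z n) + L1_shift g (Z n)"
        unfolding L1_shift_def using i by simp
    qed
    show "(\<lambda>n. L1_shift f (Z n) + L1_shift g (Z n)) \<longlonglongrightarrow> 0" using tendsto_add[OF add(3,4)] by simp
  qed (simp_all add: L1_shift_def)
next
  case (lim f s)
  have "(\<lambda>i. \<integral>x. norm (f x - s i x) \<partial>lborel) \<longlonglongrightarrow> (\<integral>x. 0 \<partial>(lborel::'a measure))"
  proof (rule integral_dominated_convergence[where w = "\<lambda>x. 3 * norm (f x)"])
    show "AE x in lborel. (\<lambda>i. norm (f x - s i x)) \<longlonglongrightarrow> 0"
    proof (rule AE_I2)
      fix x :: 'a
      have "(\<lambda>i. f x - s i x) \<longlonglongrightarrow> f x - f x" by (intro tendsto_intros lim(2)) simp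
      then show "(\<lambda>i. norm (f x - s i x)) \<longlonglongrightarrow> 0" by (simp add: tendsto_norm_zero)
    qed
    show "AE x in lborel. norm (norm (f x - s i x)) \<le> 3 * norm (f x)" for i
    proof (rule AE_I2)
      fix x :: 'a
      show "norm (norm (f x - s i x)) \<le> 3 * norm (f x)"
        using lim(3)[of x i] norm_triangle_ineq4[of "f x" "s i x"] by simp
    qed
    show "(\<lambda>x. norm (f x - s i x)) \<in> borel_measurable lborel" for i using lim(1)[of i] lim(4) by auto
  qed (use lim in auto)
  then have l: "(\<lambda>i. \<integral>x. norm (f x - s i x) \<partial>lborel) \<longlonglongrightarrow> 0" by simp
  show ?case
  proof (rule LIMSEQ_I)
    fix e :: real assume e: "e > 0"
    obtain i where i: "norm (\<integral>x. norm (f x - s i x) \<partial>lborel) < e / 4"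
      using LIMSEQ_D[OF l, of "e/4"] e by auto
    obtain N where N: "\<And>n. n \<ge> N \<Longrightarrow> norm (L1_shift (s i) (Z n)) < e / 2"
      using LIMSEQ_D[OF lim(5), of "e/2" i] e by auto
    have "norm (L1_shift f (Z n)) < e" if "n \<ge> N" for n
    proof -
      have "0 \<le> L1_shift f (Z n)" unfolding L1_shift_def by simp
      with L1_shift_triangle[OF lim(4) lim(1)[of i], of "Z n"] N[OF that] i show ?thesis by simp
    qed
    then show "\<exists>N. \<forall>n\<ge>N. norm (L1_shift f (Z n) - 0) < e" by auto
  qed
qed

lemma L1_shift_small:
  fixes f :: "'a::euclidean_space \<Rightarrow> 'b::euclidean_space"
  assumes f: "integrable lborel f" and e: "e > 0"
  obtains d where "d > 0" "\<And>z. norm z < d \<Longrightarrow> L1_shift f z < e"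
proof -
  have "\<exists>d>0. \<forall>z. norm z < d \<longrightarrow> L1_shift f z < e"
  proof (rule ccontr)
    assume *: "\<not> ?thesis"
    have "\<exists>z. norm z < 1 / (real n + 1) \<and> L1_shift f z \<ge> e" for n
      using *[simplified, rule_format, of "1 / (real n + 1)"] by (auto simp: not_less)
    then obtain Z where Z: "\<And>n. norm (Z n) < 1 / (real n + 1)" "\<And>n. L1_shift f (Z n) \<ge> e" by metis
    have "(\<lambda>n. norm (Z n)) \<longlonglongrightarrow> 0"
      by (rule tendsto_sandwich[of "\<lambda>_. 0" _ _ "\<lambda>n. 1 / (real n + 1)"])
         (use Z(1) LIMSEQ_inverse_real_of_nat in \<open>auto intro!: always_eventually less_imp_le simp: inverse_eq_divide add.commute\<close>)
    then have "Z \<longlonglongrightarrow> 0" by (rule tendsto_norm_zero_cancel)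
    from LIMSEQ_D[OF L1_shift_tendsto[OF f this] e] obtain N where "norm (L1_shift f (Z N)) < e" by auto
    with Z(2)[of N] show False by simp
  qed
  with that show ?thesis by blast
qed

text \<open>For nonnegative numbers (a - b)^2 is at most |a^2 - b^2|, so the L^2 shift of g is
  bounded by the L^1 shift of its square. Signs and vector values are treated afterwards by positive
  and negative parts and by components.\<close>

lemma L2_shift_small_nonneg:
  fixes g :: "'a::euclidean_space \<Rightarrow> real"
  assumes g: "integrable lborel (\<lambda>x. (g x)\<^sup>2)" "g \<in> borel_measurable borel" "\<And>x. g x \<ge> 0" and e: "e > 0"
  obtains d where "d > 0" "\<And>z. norm z < d \<Longrightarrow> (\<integral>\<^sup>+x. ennreal ((g (z + x) - g x)\<^sup>2) \<partial>lborel) \<le> ennreal e"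
proof -
  obtain d where d: "d > 0" "\<And>z. norm z < d \<Longrightarrow> L1_shift (\<lambda>x. (g x)\<^sup>2) z < e"
    using L1_shift_small[OF g(1) e] by metis
  show ?thesis
  proof (rule that[OF d(1)])
    fix z :: 'a assume z: "norm z < d"
    have "(\<integral>\<^sup>+x. ennreal ((g (z + x) - g x)\<^sup>2) \<partial>lborel) \<le> (\<integral>\<^sup>+x. ennreal (norm ((g (z + x))\<^sup>2 - (g x)\<^sup>2)) \<partial>lborel)"
    proof (intro nn_integral_mono ennreal_leI)
      fix x
      have "(a - b)\<^sup>2 \<le> \<bar>a\<^sup>2 - b\<^sup>2\<bar>" if "a \<ge> 0" "b \<ge> 0" for a b :: real
      proof -
        have "(a - b)\<^sup>2 = \<bar>a - b\<bar> * \<bar>a - b\<bar>" by (simp add: power2_eq_square)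
        also have "\<dots> \<le> \<bar>a - b\<bar> * \<bar>a + b\<bar>" using that by (intro mult_left_mono) auto
        also have "\<dots> = \<bar>a\<^sup>2 - b\<^sup>2\<bar>" by (simp add: power2_eq_square abs_mult[symmetric] algebra_simps)
        finally show ?thesis .
      qed
      then show "(g (z + x) - g x)\<^sup>2 \<le> norm ((g (z + x))\<^sup>2 - (g x)\<^sup>2)" using g(3) by simp
    qed
    also have "\<dots> = ennreal (L1_shift (\<lambda>x. (g x)\<^sup>2) z)"
      unfolding L1_shift_def using integrable_norm[OF L1_shift_integrable[OF g(1), of z]] by (intro nn_integral_eq_integral) auto
    also have "\<dots> \<le> ennreal e" using d(2)[OF z] by (intro ennreal_leI) simp
    finally show "(\<integral>\<^sup>+x. ennreal ((g (z + x) - g x)\<^sup>2) \<partial>lborel) \<le> ennreal e" .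
  qed
qed

lemma L2_shift_small_real:
  fixes g :: "'a::euclidean_space \<Rightarrow> real"
  assumes g: "integrable lborel (\<lambda>x. (g x)\<^sup>2)" "g \<in> borel_measurable borel" and e: "e > 0"
  obtains d where "d > 0" "\<And>z. norm z < d \<Longrightarrow> (\<integral>\<^sup>+x. ennreal ((g (z + x) - g x)\<^sup>2) \<partial>lborel) \<le> ennreal e"
proof -
  define p where "p x = max (g x) 0" for x
  define m where "m x = max (- g x) 0" for x
  have pm: "p \<in> borel_measurable borel" "m \<in> borel_measurable borel" unfolding p_def m_def using g(2) by measurable
  have i: "integrable lborel (\<lambda>x. (p x)\<^sup>2)" "integrable lborel (\<lambda>x. (m x)\<^sup>2)"
    by (rule Bochner_Integration.integrable_bound[OF g(1)], use pm in simp, simp add: p_def m_def max_def)+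
  obtain d1 where d1: "d1 > 0" "\<And>z. norm z < d1 \<Longrightarrow> (\<integral>\<^sup>+x. ennreal ((p (z + x) - p x)\<^sup>2) \<partial>lborel) \<le> ennreal (e/4)"
    by (rule L2_shift_small_nonneg[OF i(1) pm(1), of "e/4"]) (use e in \<open>auto simp: p_def\<close>)
  obtain d2 where d2: "d2 > 0" "\<And>z. norm z < d2 \<Longrightarrow> (\<integral>\<^sup>+x. ennreal ((m (z + x) - m x)\<^sup>2) \<partial>lborel) \<le> ennreal (e/4)"
    by (rule L2_shift_small_nonneg[OF i(2) pm(2), of "e/4"]) (use e in \<open>auto simp: m_def\<close>)
  show ?thesis
  proof (rule that[of "min d1 d2"])
    fix z :: 'a assume z: "norm z < min d1 d2"
    have "(\<integral>\<^sup>+x. ennreal ((g (z + x) - g x)\<^sup>2) \<partial>lborel) \<le> (\<integral>\<^sup>+x. 2 * ennreal ((p (z + x) - p x)\<^sup>2) + 2 * ennreal ((m (z + x) - m x)\<^sup>2) \<partial>lborel)"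
    proof (rule nn_integral_mono)
      fix x
      have gd: "g y = p y - m y" for y by (auto simp: p_def m_def max_def)
      have "(a - b - (c - d))\<^sup>2 \<le> 2 * (a - c)\<^sup>2 + 2 * (b - d)\<^sup>2" for a b c d :: real
        using sum_squares_bound[of "a - c" "-(b - d)"] by (simp add: power2_eq_square algebra_simps)
      then have "ennreal ((g (z + x) - g x)\<^sup>2) \<le> ennreal (2 * (p (z + x) - p x)\<^sup>2 + 2 * (m (z + x) - m x)\<^sup>2)"
        unfolding gd by (intro ennreal_leI)
      then show "ennreal ((g (z + x) - g x)\<^sup>2) \<le> 2 * ennreal ((p (z + x) - p x)\<^sup>2) + 2 * ennreal ((m (z + x) - m x)\<^sup>2)"
        by (simp add: ennreal_plus ennreal_mult')
    qed
    also have "\<dots> = 2 * (\<integral>\<^sup>+x. ennreal ((p (z + x) - p x)\<^sup>2) \<partial>lborel) + 2 * (\<integral>\<^sup>+x. ennreal ((m (z + x) - m x)\<^sup>2) \<partial>lborel)"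
      using pm by (subst nn_integral_add) (auto simp: nn_integral_cmult)
    also have "\<dots> \<le> 2 * ennreal (e/4) + 2 * ennreal (e/4)"
      using d1(2)[of z] d2(2)[of z] z by (intro add_mono mult_left_mono) auto
    also have "\<dots> = ennreal (2 * (e/4) + 2 * (e/4))" using e by (simp only: ennreal_plus ennreal_mult' mult_nonneg_nonneg) simp
    finally show "(\<integral>\<^sup>+x. ennreal ((g (z + x) - g x)\<^sup>2) \<partial>lborel) \<le> ennreal e" by simp
  qed (use d1 d2 in auto)
qed

lemma L2_shift_small:
  fixes g :: "'a::euclidean_space \<Rightarrow> 'b::euclidean_space"
  assumes g: "integrable lborel (\<lambda>x. (norm (g x))\<^sup>2)" "g \<in> borel_measurable borel" and e: "e > 0"
  obtains d where "d > 0" "\<And>z. norm z < d \<Longrightarrow> (\<integral>\<^sup>+x. ennreal ((norm (g (z + x) - g x))\<^sup>2) \<partial>lborel) \<le> ennreal e"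
proof -
  have "\<exists>d>0. \<forall>z. norm z < d \<longrightarrow> (\<integral>\<^sup>+x. ennreal ((g (z + x) \<bullet> b - g x \<bullet> b)\<^sup>2) \<partial>lborel) \<le> ennreal (e / DIM('b))" if b: "b \<in> Basis" for b
  proof -
    have "integrable lborel (\<lambda>x. (g x \<bullet> b)\<^sup>2)"
      by (rule Bochner_Integration.integrable_bound[OF g(1)])
         (use g(2) Basis_le_norm[OF b] in \<open>auto intro!: AE_I2 simp: abs_le_square_iff[symmetric]\<close>)
    moreover have "(\<lambda>x. g x \<bullet> b) \<in> borel_measurable borel" using g(2) by simp
    moreover have "e / DIM('b) > 0" using e by simp
    ultimately show ?thesis by (rule L2_shift_small_real) blast
  qed
  then have "\<forall>b\<in>Basis. \<exists>d. d > 0 \<and> (\<forall>z. norm z < d \<longrightarrow> (\<integral>\<^sup>+x. ennreal ((g (z + x) \<bullet> b - g x \<bullet> b)\<^sup>2) \<partial>lborel) \<le> ennreal (e / DIM('b)))"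
    by blast
  from bchoice[OF this] obtain d where
    d': "\<forall>b\<in>Basis. d b > 0 \<and> (\<forall>z. norm z < d b \<longrightarrow> (\<integral>\<^sup>+x. ennreal ((g (z + x) \<bullet> b - g x \<bullet> b)\<^sup>2) \<partial>lborel) \<le> ennreal (e / DIM('b)))"
    by (rule exE)
  then have d: "d b > 0" "norm z < d b \<Longrightarrow> (\<integral>\<^sup>+x. ennreal ((g (z + x) \<bullet> b - g x \<bullet> b)\<^sup>2) \<partial>lborel) \<le> ennreal (e / DIM('b))"
    if "b \<in> Basis" for b z using that by (simp_all)
  show ?thesis
  proof (rule that[of "Min (d ` Basis)"])
    show "Min (d ` Basis) > 0" using d(1) by simp
    fix z :: 'a assume "norm z < Min (d ` Basis)"
    then have z: "norm z < d b" if "b \<in> Basis" for b using that by simp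
    have sq: "(norm v)\<^sup>2 = (\<Sum>b\<in>Basis. (v \<bullet> b)\<^sup>2)" for v :: 'b
      unfolding power2_norm_eq_inner by (subst euclidean_inner) (simp add: power2_eq_square)
    have "(\<integral>\<^sup>+x. ennreal ((norm (g (z + x) - g x))\<^sup>2) \<partial>lborel) = (\<integral>\<^sup>+x. (\<Sum>b\<in>Basis. ennreal ((g (z + x) \<bullet> b - g x \<bullet> b)\<^sup>2)) \<partial>lborel)"
      by (rule nn_integral_cong) (simp add: sum_ennreal sq inner_diff_left)
    also have "\<dots> = (\<Sum>b\<in>Basis. (\<integral>\<^sup>+x. ennreal ((g (z + x) \<bullet> b - g x \<bullet> b)\<^sup>2) \<partial>lborel))"
      using g(2) by (subst nn_integral_sum) auto
    also have "\<dots> \<le> (\<Sum>b\<in>(Basis::'b set). ennreal (e / DIM('b)))"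
      using d(2) z by (intro sum_mono) auto
    also have "\<dots> = ennreal e" using e by (subst sum_ennreal) auto
    finally show "(\<integral>\<^sup>+x. ennreal ((norm (g (z + x) - g x))\<^sup>2) \<partial>lborel) \<le> ennreal e" .
  qed
qed

text \<open>Jensen's inequality for a probability density, from Cauchy-Schwarz with w written as the
  product of its square roots. If the integrand on the left is not integrable, its integral is 0 by
  convention and the bound is trivial.\<close>

lemma integral_norm_square_le:
  fixes F :: "'a::euclidean_space \<Rightarrow> 'b::euclidean_space"
  assumes w: "integrable lborel w" "\<And>y. w y \<ge> 0" "(\<integral>y. w y \<partial>lborel) = 1"
    and F: "F \<in> borel_measurable borel"
  shows "ennreal ((norm (\<integral>y. w y *\<^sub>R F y \<partial>lborel))\<^sup>2) \<le> (\<integral>\<^sup>+y. ennreal (w y * (norm (F y))\<^sup>2) \<partial>lborel)"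
proof (cases "integrable lborel (\<lambda>y. w y *\<^sub>R F y)")
  case True
  have wb: "w \<in> borel_measurable borel" using w by auto
  have "ennreal (norm (\<integral>y. w y *\<^sub>R F y \<partial>lborel)) \<le> (\<integral>\<^sup>+y. ennreal (norm (w y *\<^sub>R F y)) \<partial>lborel)"
    by (rule integral_norm_bound_ennreal[OF True])
  also have "\<dots> = (\<integral>\<^sup>+y. ennreal (sqrt (w y)) * ennreal (sqrt (w y) * norm (F y)) \<partial>lborel)"
    using w(2) by (intro nn_integral_cong) (simp add: ennreal_mult[symmetric] mult.assoc[symmetric])
  finally have "(ennreal (norm (\<integral>y. w y *\<^sub>R F y \<partial>lborel)))\<^sup>2 \<le> (\<integral>\<^sup>+y. ennreal (sqrt (w y)) * ennreal (sqrt (w y) * norm (F y)) \<partial>lborel)\<^sup>2"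
    by (rule power_mono) simp
  also have "\<dots> \<le> (\<integral>\<^sup>+y. ennreal (sqrt (w y)) ^ 2 \<partial>lborel) * (\<integral>\<^sup>+y. ennreal (sqrt (w y) * norm (F y)) ^ 2 \<partial>lborel)"
    by (rule Cauchy_Schwarz_nn_integral) (use wb F in auto)
  also have "(\<integral>\<^sup>+y. ennreal (sqrt (w y)) ^ 2 \<partial>lborel) = (\<integral>\<^sup>+y. ennreal (w y) \<partial>lborel)"
    using w(2) by (intro nn_integral_cong) (simp add: ennreal_power)
  also have "\<dots> = 1" using w by (subst nn_integral_eq_integral) auto
  also have "(\<integral>\<^sup>+y. ennreal (sqrt (w y) * norm (F y)) ^ 2 \<partial>lborel) = (\<integral>\<^sup>+y. ennreal (w y * (norm (F y))\<^sup>2) \<partial>lborel)"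
    using w(2) by (intro nn_integral_cong) (simp add: ennreal_power power_mult_distrib)
  finally show ?thesis by (simp add: ennreal_power)
qed (simp add: not_integrable_integral_eq)

text \<open>By Jensen the squared error at x is at most a weighted average of squared translation
  errors; Fubini turns the total error into an average of L^2 shifts by vectors shorter than
  r.\<close>

lemma mollify_L2:
  fixes g :: "'a::euclidean_space \<Rightarrow> 'b::euclidean_space"
  assumes g: "integrable lborel (\<lambda>x. (norm (g x))\<^sup>2)" "integrable lborel g" and e: "e > 0"
  obtains d where "d > 0" "\<And>r. 0 < r \<Longrightarrow> r < d \<Longrightarrow>
     (\<integral>\<^sup>+x. ennreal ((norm (conv (mollifier r) g x - g x))\<^sup>2) \<partial>lborel) \<le> ennreal e"
proof -
  have gb: "g \<in> borel_measurable borel" using g(2) by auto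
  obtain d where d: "d > 0" "\<And>z. norm z < d \<Longrightarrow> (\<integral>\<^sup>+x. ennreal ((norm (g (z + x) - g x))\<^sup>2) \<partial>lborel) \<le> ennreal e"
    using L2_shift_small[OF g(1) gb e] by metis
  show ?thesis
  proof (rule that[OF d(1)])
    fix r :: real assume r: "0 < r" "r < d"
    note m = mollifier_props[OF r(1), where 'a='a]
    have mb: "mollifier r \<in> borel_measurable (borel :: 'a measure)" using m(3) by auto
    have ci: "integrable lborel (\<lambda>y. mollifier r y *\<^sub>R g (x - y))" for x
    proof -
      have "continuous_on UNIV (mollifier r :: 'a \<Rightarrow> real)" using m(5)[of 0] by simp
      then obtain B where B: "\<And>x::'a. norm (mollifier r x) \<le> B"
        by (rule compact_support_bounded[of "mollifier r :: 'a \<Rightarrow> real" "cball 0 r"]) (use m(2) in auto)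
      show ?thesis
      proof (rule Bochner_Integration.integrable_bound)
        show "integrable lborel (\<lambda>y. B * norm (g (x - y)))" using lborel_integrable_reflect[OF g(2)] by auto
        show "(\<lambda>y. mollifier r y *\<^sub>R g (x - y)) \<in> borel_measurable lborel" using mb gb by simp
        show "AE y in lborel. norm (mollifier r y *\<^sub>R g (x - y)) \<le> norm (B * norm (g (x - y)))"
        proof (rule AE_I2)
          fix y
          have "norm (mollifier r y *\<^sub>R g (x - y)) = \<bar>mollifier r y\<bar> * norm (g (x - y))" by simp
          also have "\<dots> \<le> \<bar>B\<bar> * norm (g (x - y))" using B[of y] by (intro mult_right_mono) auto
          finally show "norm (mollifier r y *\<^sub>R g (x - y)) \<le> norm (B * norm (g (x - y)))" by (simp add: abs_mult)
        qed
      qed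
    qed
    have "(\<integral>\<^sup>+x. ennreal ((norm (conv (mollifier r) g x - g x))\<^sup>2) \<partial>lborel)
      \<le> (\<integral>\<^sup>+x. (\<integral>\<^sup>+y. ennreal (mollifier r y * (norm (g (x - y) - g x))\<^sup>2) \<partial>lborel) \<partial>lborel)"
    proof (rule nn_integral_mono)
      fix x
      have "conv (mollifier r) g x - g x = (\<integral>y. mollifier r y *\<^sub>R g (x - y) \<partial>lborel) - (\<integral>y. mollifier r (y::'a) *\<^sub>R g x \<partial>lborel)"
        unfolding conv_def using m(3,4) by simp
      also have "\<dots> = (\<integral>y. mollifier r y *\<^sub>R (g (x - y) - g x) \<partial>lborel)"
        using ci[of x] m(3) by (simp add: algebra_simps)
      finally show "ennreal ((norm (conv (mollifier r) g x - g x))\<^sup>2) \<le> (\<integral>\<^sup>+y. ennreal (mollifier r y * (norm (g (x - y) - g x))\<^sup>2) \<partial>lborel)"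
        using integral_norm_square_le[OF m(3) m(1) m(4), of "\<lambda>y. g (x - y) - g x"] gb by simp
    qed
    also have "\<dots> = (\<integral>\<^sup>+y. (\<integral>\<^sup>+x. ennreal (mollifier r y * (norm (g (x - y) - g x))\<^sup>2) \<partial>lborel) \<partial>lborel)"
      by (rule lborel_pair.Fubini') (use mb gb in measurable)
    also have "\<dots> \<le> (\<integral>\<^sup>+y. ennreal (mollifier r (y::'a)) * ennreal e \<partial>lborel)"
    proof (rule nn_integral_mono)
      fix y :: 'a
      have "(\<integral>\<^sup>+x. ennreal (mollifier r y * (norm (g (x - y) - g x))\<^sup>2) \<partial>lborel) = ennreal (mollifier r y) * (\<integral>\<^sup>+x. ennreal ((norm (g (- y + x) - g x))\<^sup>2) \<partial>lborel)"
        using m(1)[of y] gb by (subst nn_integral_cmult[symmetric]) (auto simp: ennreal_mult)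
      also have "\<dots> \<le> ennreal (mollifier r y) * ennreal e"
        using d(2)[of "- y"] m(2)[of y] r by (cases "norm y < r") (auto intro!: mult_left_mono)
      finally show "(\<integral>\<^sup>+x. ennreal (mollifier r y * (norm (g (x - y) - g x))\<^sup>2) \<partial>lborel) \<le> ennreal (mollifier r y) * ennreal e" .
    qed
    also have "\<dots> = ennreal e"
      using m(1,3,4) mb by (subst nn_integral_multc) (auto simp: nn_integral_eq_integral)
    finally show "(\<integral>\<^sup>+x. ennreal ((norm (conv (mollifier r) g x - g x))\<^sup>2) \<partial>lborel) \<le> ennreal e" .
  qed
qed

section \<open>Lebesgue points along a subsequence and interior H^1 approximation\<close>

lemma nn_integral_le_realD:
  fixes f :: "'a \<Rightarrow> real"
  assumes "f \<in> borel_measurable M" "\<And>x. 0 \<le> f x" "(\<integral>\<^sup>+x. ennreal (f x) \<partial>M) \<le> ennreal e" "0 \<le> e"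
  shows "integrable M f" "(\<integral>x. f x \<partial>M) \<le> e"
proof -
  have "(\<integral>\<^sup>+x. ennreal (f x) \<partial>M) < \<infinity>" using assms(3) by (metis ennreal_less_top infinity_ennreal_def order.strict_trans1)
  then show i: "integrable M f" using assms(1,2) by (intro integrableI_nonneg) auto
  have "ennreal (\<integral>x. f x \<partial>M) \<le> ennreal e"
    using assms(3) nn_integral_eq_integral[OF i] assms(2) by simp
  then show "(\<integral>x. f x \<partial>M) \<le> e" using assms(4) by simp
qed

text \<open>By Fubini the L^1 norm of the mean oscillation at radius \<open>s n\<close> is an
  average of \<open>L1_shift u\<close> over that ball, hence tends to 0. Convergence in L^1 gives
  almost everywhere convergence along a subsequence of radii, which is enough for identifying limits
  of ring averages.\<close>

lemma lebesgue_points_subseq: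
  fixes u :: "'a::euclidean_space \<Rightarrow> real"
  assumes u: "integrable lborel u" and s: "\<And>n. s n > 0" "s \<longlonglongrightarrow> 0"
  obtains r :: "nat \<Rightarrow> nat" where "strict_mono r"
    "AE x in lborel. (\<lambda>n. (\<integral>y. indicator (ball 0 (s (r n))) y * \<bar>u (y + x) - u x\<bar> \<partial>lborel) / s (r n) ^ DIM('a)) \<longlonglongrightarrow> 0"
proof -
  have ub[measurable]: "u \<in> borel_measurable borel" using u by auto
  define F where "F n = (\<lambda>(y::'a, x::'a). indicator (ball 0 (s n)) y * \<bar>u (y + x) - u x\<bar>)" for n
  define T where "T n x = (\<integral>y. F n (y, x) \<partial>lborel) / s n ^ DIM('a)" for n x
  have Fm[measurable]: "F n \<in> borel_measurable (lborel \<Otimes>\<^sub>M lborel)" for n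
  proof -
    have "(\<lambda>p. indicator (ball 0 (s n)) (fst p) * \<bar>u (fst p + snd p) - u (snd p)\<bar>) \<in> borel_measurable (borel \<Otimes>\<^sub>M borel)"
      by (intro borel_measurable_times borel_measurable_abs borel_measurable_diff
          measurable_compose[OF measurable_fst borel_measurable_indicator] measurable_compose[OF _ ub]) auto
    moreover have "borel_measurable (lborel \<Otimes>\<^sub>M lborel) = (borel_measurable (borel \<Otimes>\<^sub>M borel) :: ('a \<times> 'a \<Rightarrow> real) set)"
      by (rule measurable_cong_sets) (auto intro!: sets_pair_measure_cong)
    ultimately show ?thesis by (simp add: F_def case_prod_beta')
  qed
  have Lm: "L1_shift u \<in> borel_measurable borel" unfolding L1_shift_def by measurable
  have sh: "integrable lborel (\<lambda>x. \<bar>u (y + x) - u x\<bar>)" for y using L1_shift_integrable[OF u, of y] by (rule integrable_abs)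
  have inner: "(\<integral>x. F n (y, x) \<partial>lborel) = indicator (ball 0 (s n)) y * L1_shift u y" for n y
    unfolding F_def L1_shift_def by simp
  have Lb: "L1_shift u y \<le> 2 * (\<integral>x. \<bar>u x\<bar> \<partial>lborel)" for y
    using L1_shift_triangle[OF u, of "\<lambda>_. 0" y] by (simp add: L1_shift_def)
  have ind: "integrable lborel (\<lambda>y. indicator (ball 0 (s n)) y * c)" for c :: real and n
    by (rule integrable_mult_left) (auto simp: integrable_indicator_iff emeasure_lborel_ball_finite[unfolded infinity_ennreal_def])
  have L0: "L1_shift u y \<ge> 0" for y by (simp add: L1_shift_def)
  have FI: "integrable (lborel \<Otimes>\<^sub>M lborel) (F n)" for n
  proof (rule lborel_pair.Fubini_integrable)
    have "norm (F n (y, x)) = F n (y, x)" for y x by (simp add: F_def)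
    then have "(\<lambda>y. \<integral>x. norm (F n (y, x)) \<partial>lborel) = (\<lambda>y. indicator (ball 0 (s n)) y * L1_shift u y)"
      by (simp add: inner)
    moreover have "integrable lborel (\<lambda>y. indicator (ball 0 (s n)) y * L1_shift u y)"
      by (rule Bochner_Integration.integrable_bound[OF ind[of n "2 * (\<integral>x. \<bar>u x\<bar> \<partial>lborel)"]])
         (use Lm Lb L0 in \<open>auto simp: indicator_def intro: order_trans[OF _ abs_ge_self]\<close>)
    ultimately show "integrable lborel (\<lambda>y. \<integral>x. norm (F n (y, x)) \<partial>lborel)" by simp
    show "AE y in lborel. integrable lborel (\<lambda>x. F n (y, x))"
      unfolding F_def using sh by (intro AE_I2) simp
  qed simp
  have TI: "integrable lborel (T n)" for n
    unfolding T_def using lborel_pair.integrable_snd[of "\<lambda>y x. F n (y, x)"] FI[of n] by (simp add: case_prod_beta')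
  have Tint: "(\<integral>x. T n x \<partial>lborel) = (\<integral>y. indicator (ball 0 (s n)) y * L1_shift u y \<partial>lborel) / s n ^ DIM('a)" for n
    unfolding T_def using lborel_pair.Fubini_integral[of "\<lambda>y x. F n (y, x)"] FI[of n] by (simp add: inner case_prod_beta')
  define C where "C = measure lborel (ball (0::'a) 1)"
  have C: "C > 0" unfolding C_def by (rule content_ball_pos) simp
  have T0: "T n x \<ge> 0" for n x unfolding T_def F_def using s(1)[of n] by simp
  have "(\<lambda>n. \<integral>x. norm (T n x) \<partial>lborel) \<longlonglongrightarrow> 0"
  proof (rule LIMSEQ_I)
    fix e :: real assume e: "e > 0"
    obtain d where d: "d > 0" "\<And>z. norm z < d \<Longrightarrow> L1_shift u z < e / (2 * C)"
      using L1_shift_small[OF u, of "e / (2 * C)"] e C by auto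
    obtain N where N: "\<And>n. n \<ge> N \<Longrightarrow> norm (s n - 0) < d" using LIMSEQ_D[OF s(2) d(1)] by auto
    have "norm (\<integral>x. norm (T n x) \<partial>lborel) < e" if n: "n \<ge> N" for n
    proof -
      have "(\<integral>y. indicator (ball 0 (s n)) y * L1_shift u y \<partial>lborel) \<le> (\<integral>y. indicator (ball (0::'a) (s n)) y * (e / (2 * C)) \<partial>lborel)"
      proof (rule integral_mono)
        show "integrable lborel (\<lambda>y. indicator (ball 0 (s n)) y * L1_shift u y)"
          by (rule Bochner_Integration.integrable_bound[OF ind[of n "2 * (\<integral>x. \<bar>u x\<bar> \<partial>lborel)"]])
             (use Lm Lb L0 in \<open>auto simp: indicator_def intro: order_trans[OF _ abs_ge_self]\<close>)
        show "integrable lborel (\<lambda>y. indicator (ball (0::'a) (s n)) y * (e / (2 * C)))" by (rule ind)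
        fix y show "indicator (ball 0 (s n)) y * L1_shift u y \<le> indicator (ball (0::'a) (s n)) y * (e / (2 * C))"
          using d(2)[of y] N[OF n] s(1)[of n] by (auto simp: indicator_def less_imp_le)
      qed
      also have "\<dots> = measure lborel (ball (0::'a) (s n)) * (e / (2 * C))" by simp
      also have "\<dots> = s n ^ DIM('a) * (e / 2)"
        using content_ball_conv_unit_ball[of "s n" "0::'a"] s(1)[of n] C by (simp add: C_def)
      finally have "(\<integral>x. T n x \<partial>lborel) \<le> e / 2" unfolding Tint using s(1)[of n] by (simp add: field_simps)
      then show ?thesis using T0 e by (simp add: Bochner_Integration.integral_nonneg)
    qed
    then show "\<exists>N. \<forall>n\<ge>N. norm ((\<integral>x. norm (T n x) \<partial>lborel) - 0) < e" by auto
  qed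
  from tendsto_L1_AE_subseq[OF TI this] obtain r :: "nat \<Rightarrow> nat" where "strict_mono r" "AE x in lborel. (\<lambda>n. T (r n) x) \<longlonglongrightarrow> 0" by blast
  with that show ?thesis unfolding T_def F_def by simp
qed

lemma has_grad_reflect:
  assumes "has_grad f g" shows "has_grad (\<lambda>y. f (x - y)) (\<lambda>y. - g (x - y))"
  unfolding has_grad_def
proof (intro conjI allI)
  fix y
  have "((\<lambda>y. x - y) has_derivative (\<lambda>h. - h)) (at y)" by (auto intro!: derivative_eq_intros)
  from has_derivative_compose[OF this, of f "\<lambda>h. g (x - y) \<bullet> h"] has_grad_D(1)[OF assms, of "x - y" UNIV]
  have "((\<lambda>y. f (x - y)) has_derivative (\<lambda>h. - (g (x - y) \<bullet> h))) (at y)"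
    by (simp only: inner_minus_right)
  moreover have "(\<lambda>h. - (g (x - y) \<bullet> h)) = (\<bullet>) (- g (x - y))" by (rule ext) simp
  ultimately show "((\<lambda>y. f (x - y)) has_derivative (\<bullet>) (- g (x - y))) (at y)" by simp
  show "continuous_on UNIV (\<lambda>y. - g (x - y))"
    by (rule continuous_on_minus, rule continuous_on_compose2[OF has_grad_D(2)[OF assms, of UNIV]])
       (auto intro!: continuous_intros)
qed

lemma integrable_bounded_scaleR:
  fixes G :: "'a::euclidean_space \<Rightarrow> 'b::euclidean_space"
  assumes "integrable lborel G" "k \<in> borel_measurable borel" "\<And>x. \<bar>k x\<bar> \<le> B"
  shows "integrable lborel (\<lambda>x. k x *\<^sub>R G x)"
proof (rule Bochner_Integration.integrable_bound)
  show "integrable lborel (\<lambda>x. B * norm (G x))" using assms(1) by auto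
  show "(\<lambda>x. k x *\<^sub>R G x) \<in> borel_measurable lborel" using assms by auto
  show "AE x in lborel. norm (k x *\<^sub>R G x) \<le> norm (B * norm (G x))"
    using assms(3) by (intro AE_I2) (simp add: abs_mult mult_right_mono order_trans[OF _ abs_ge_self])
qed

text \<open>The approximants are mollifications of u. Averaging preserves the bound M, and away from
  the boundary the gradient of the mollification is the mollification of G. One sequence of radii is
  chosen to be good for u and G at the same time.\<close>

lemma H1_approximation:
  fixes u :: "'a::euclidean_space \<Rightarrow> real" and G :: "'a \<Rightarrow> 'a"
  assumes u: "u \<in> borel_measurable borel" "\<And>x. \<bar>u x\<bar> \<le> M" "\<And>x. x \<notin> ball 0 1 \<Longrightarrow> u x = 0"
    and G: "integrable lborel G" "integrable lborel (\<lambda>x. (norm (G x))\<^sup>2)"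
    and weak: "\<And>\<phi> g b. C1c (ball 0 1) \<phi> g \<Longrightarrow> (\<integral>x. u x * (g x \<bullet> b) \<partial>lborel) = - (\<integral>x. (G x \<bullet> b) * \<phi> x \<partial>lborel)"
  obtains v gv where "\<And>n::nat. has_grad (v n) (gv n)" "\<And>n x. \<bar>v n x\<bar> \<le> M"
    "AE x in lborel. (\<lambda>n. v n x) \<longlonglongrightarrow> u x"
    "\<And>\<rho>. \<rho> < 1 \<Longrightarrow> (\<lambda>n. \<integral>x\<in>ball 0 \<rho>. (norm (gv n x - G x))\<^sup>2 \<partial>lborel) \<longlonglongrightarrow> 0"
proof -
  have ind: "integrable lborel (\<lambda>x::'a. indicator (ball 0 1) x * c)" for c :: real
    by (rule integrable_mult_left) (auto simp: integrable_indicator_iff emeasure_lborel_ball_finite[unfolded infinity_ennreal_def])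
  have ui: "integrable lborel u"
    by (rule Bochner_Integration.integrable_bound[OF ind[of M]])
       (use u in \<open>auto simp: indicator_def intro!: AE_I2 order_trans[OF _ abs_ge_self]\<close>)
  have u2: "integrable lborel (\<lambda>x. (norm (u x))\<^sup>2)"
    by (rule Bochner_Integration.integrable_bound[OF ind[of "M\<^sup>2"]])
       (use u in \<open>auto simp: indicator_def intro!: AE_I2 simp: abs_le_square_iff[symmetric] order_trans[OF _ abs_ge_self]\<close>)
  have Gb: "G \<in> borel_measurable borel" using G by auto
  have "\<exists>r>0. r < 1 / (real n + 1) \<and> (\<integral>\<^sup>+x. ennreal ((norm (conv (mollifier r) u x - u x))\<^sup>2) \<partial>lborel) \<le> ennreal (1 / (real n + 1))
    \<and> (\<integral>\<^sup>+x. ennreal ((norm (conv (mollifier r) G x - G x))\<^sup>2) \<partial>lborel) \<le> ennreal (1 / (real n + 1))" for n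
  proof -
    have e: "1 / (real n + 1) > 0" by simp
    obtain d1 where d1: "d1 > 0" "\<And>r. 0 < r \<Longrightarrow> r < d1 \<Longrightarrow> (\<integral>\<^sup>+x. ennreal ((norm (conv (mollifier r) u x - u x))\<^sup>2) \<partial>lborel) \<le> ennreal (1 / (real n + 1))"
      by (rule mollify_L2[OF u2 ui e]) blast
    obtain d2 where d2: "d2 > 0" "\<And>r. 0 < r \<Longrightarrow> r < d2 \<Longrightarrow> (\<integral>\<^sup>+x. ennreal ((norm (conv (mollifier r) G x - G x))\<^sup>2) \<partial>lborel) \<le> ennreal (1 / (real n + 1))"
      by (rule mollify_L2[OF G(2,1) e]) blast
    define k where "k = min (1 / (real n + 1)) (min d1 d2)"
    define r where "r = k / 2"
    have "k > 0" "k \<le> 1 / (real n + 1)" "k \<le> d1" "k \<le> d2" unfolding k_def using d1(1) d2(1) e by simp_all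
    then
    have "r > 0" "r < 1 / (real n + 1)" "r < d1" "r < d2" unfolding r_def by linarith+
    then show ?thesis using d1(2) d2(2) by blast
  qed
  then have "\<exists>R. \<forall>n. R n > 0 \<and> R n < 1 / (real n + 1) \<and> (\<integral>\<^sup>+x. ennreal ((norm (conv (mollifier (R n)) u x - u x))\<^sup>2) \<partial>lborel) \<le> ennreal (1 / (real n + 1))
    \<and> (\<integral>\<^sup>+x. ennreal ((norm (conv (mollifier (R n)) G x - G x))\<^sup>2) \<partial>lborel) \<le> ennreal (1 / (real n + 1))"
    by (intro choice allI)
  then obtain R where R: "\<And>n. R n > 0" "\<And>n. R n < 1 / (real n + 1)"
    "\<And>n. (\<integral>\<^sup>+x. ennreal ((norm (conv (mollifier (R n)) u x - u x))\<^sup>2) \<partial>lborel) \<le> ennreal (1 / (real n + 1))"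
    "\<And>n. (\<integral>\<^sup>+x. ennreal ((norm (conv (mollifier (R n)) G x - G x))\<^sup>2) \<partial>lborel) \<le> ennreal (1 / (real n + 1))" by blast
  define w where "w n = conv (mollifier (R n)) u" for n
  have lim0: "(\<lambda>n. 1 / (real n + 1)) \<longlonglongrightarrow> 0"
    using LIMSEQ_inverse_real_of_nat by (simp add: inverse_eq_divide add.commute)
  note m = mollifier_props[OF R(1), where 'a='a]
  have mb: "mollifier (R n) \<in> borel_measurable (borel :: 'a measure)" for n using m(3)[of n] by auto
  have wu: "w n = conv u (mollifier (R n))" for n unfolding w_def by (rule conv_commute[OF mb u(1)])
  define \<mu> where "\<mu> n = (\<lambda>x::'a. \<Sum>b\<in>Basis. frechet_derivative (mollifier (R n)) (at x) b *\<^sub>R b)" for n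
  have \<mu>: "has_grad (mollifier (R n)) (\<mu> n)" for n unfolding \<mu>_def by (rule Ck_has_grad[OF m(5)])
  have \<mu>c: "C1c UNIV (mollifier (R n)) (\<mu> n)" for n by (rule C1cI[OF \<mu>, of "cball 0 (R n)"]) (use m(2) in auto)
  define gw where "gw n = conv u (\<mu> n)" for n
  have hw: "has_grad (w n) (gw n)" for n unfolding wu gw_def by (rule conv_has_grad[OF ui \<mu>c])
  have wM: "\<bar>w n x\<bar> \<le> M" for n x
  proof -
    have ci: "integrable lborel (\<lambda>y. mollifier (R n) y *\<^sub>R u (x - y))"
      by (rule conv_integrable[OF m(3) u(1)]) (use u(2) in simp)
    have "norm (w n x) \<le> M * (\<integral>y. \<bar>mollifier (R n) (y::'a)\<bar> \<partial>lborel)"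
      unfolding w_def conv_def by (rule integral_scaleR_bound[OF m(3) ci]) (use u(2) in simp)
    then show ?thesis using m(1,4)[of n] by simp
  qed
  \<comment> \<open>The weak gradient is tested with the mollifier reflected and centred at x. It is
    an admissible test function only if its support stays in the disk, which is why the gradients
    converge only on balls of radius \<rho> < 1.\<close>
  have gwG: "gw n x = conv (mollifier (R n)) G x" if x: "norm x < 1 - R n" for n x
  proof (rule euclidean_eqI)
    fix b :: 'a
    obtain B where B: "\<And>y. \<bar>mollifier (R n) (y::'a)\<bar> \<le> B" "\<And>y. norm (\<mu> n y) \<le> B" using C1c_bounds[OF \<mu>c[of n]] by metis
    have sub: "cball x (R n) \<subseteq> ball 0 1"
    proof
      fix y assume "y \<in> cball x (R n)"
      then have "norm (y - x) \<le> R n" by (simp add: dist_norm norm_minus_commute)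
      then show "y \<in> ball 0 1" using x norm_triangle_ineq2[of y x] by simp
    qed
    have C: "C1c (ball 0 1) (\<lambda>y. mollifier (R n) (x - y)) (\<lambda>y. - \<mu> n (x - y))"
      by (rule C1cI[OF has_grad_reflect[OF \<mu>] compact_cball sub]) (use m(2) in \<open>auto simp: dist_norm\<close>)
    have "gw n x \<bullet> b = (\<integral>y. (u y *\<^sub>R \<mu> n (x - y)) \<bullet> b \<partial>lborel)"
      unfolding gw_def conv_def
      by (subst integral_inner_left) (use conv_integrable[OF ui has_grad_borel(2)[OF \<mu>] B(2)] in auto)
    also have "\<dots> = - (\<integral>y. u y * ((- \<mu> n (x - y)) \<bullet> b) \<partial>lborel)" by simp
    also have "\<dots> = (\<integral>y. (G y \<bullet> b) * mollifier (R n) (x - y) \<partial>lborel)" using weak[OF C, of b] by simp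
    also have "\<dots> = (\<integral>y. (mollifier (R n) (x - y) *\<^sub>R G y) \<bullet> b \<partial>lborel)" by (simp add: mult.commute)
    also have "\<dots> = (\<integral>y. mollifier (R n) (x - y) *\<^sub>R G y \<partial>lborel) \<bullet> b"
      by (rule integral_inner_left) (use integrable_bounded_scaleR[OF G(1) _ B(1), of "\<lambda>y. x - y"] mb in auto)
    also have "(\<integral>y. mollifier (R n) (x - y) *\<^sub>R G y \<partial>lborel) = conv (mollifier (R n)) G x"
      using lborel_integral_reflect[of "\<lambda>y. mollifier (R n) (x - y) *\<^sub>R G y" x] mb Gb by (simp add: conv_def)
    finally show "gw n x \<bullet> b = conv (mollifier (R n)) G x \<bullet> b" .
  qed
  have wb: "w n \<in> borel_measurable borel" "gw n \<in> borel_measurable borel" for n using has_grad_borel[OF hw] by auto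
  have d2: "integrable lborel (\<lambda>x. (w n x - u x)\<^sup>2)" "(\<integral>x. (w n x - u x)\<^sup>2 \<partial>lborel) \<le> 1 / (real n + 1)" for n
    by (rule nn_integral_le_realD, use wb u(1) R(3)[of n] in \<open>auto simp: w_def\<close>)+
  have "(\<lambda>n. \<integral>x. norm ((w n x - u x)\<^sup>2) \<partial>lborel) \<longlonglongrightarrow> 0"
    by (rule tendsto_sandwich[OF _ _ tendsto_const lim0]) (use d2(2) in auto)
  from tendsto_L1_AE_subseq[OF d2(1) this] obtain r :: "nat \<Rightarrow> nat" where r: "strict_mono r" "AE x in lborel. (\<lambda>n. (w (r n) x - u x)\<^sup>2) \<longlonglongrightarrow> 0" by blast
  show ?thesis
  proof (rule that[of "\<lambda>n. w (r n)" "\<lambda>n. gw (r n)"])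
    show "AE x in lborel. (\<lambda>n. w (r n) x) \<longlonglongrightarrow> u x"
      using r(2)
    proof (rule AE_mp, intro AE_I2 impI)
      fix x assume "(\<lambda>n. (w (r n) x - u x)\<^sup>2) \<longlonglongrightarrow> 0"
      then have "(\<lambda>n. \<bar>w (r n) x - u x\<bar>) \<longlonglongrightarrow> 0" using tendsto_real_sqrt by fastforce
      then show "(\<lambda>n. w (r n) x) \<longlonglongrightarrow> u x" using LIM_zero_cancel tendsto_rabs_zero_iff by blast
    qed
    fix \<rho> :: real assume \<rho>: "\<rho> < 1"
    have "(\<lambda>n. \<integral>x\<in>ball 0 \<rho>. (norm (gw n x - G x))\<^sup>2 \<partial>lborel) \<longlonglongrightarrow> 0"
    proof (rule tendsto_sandwich[OF _ _ tendsto_const lim0])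
      have "eventually (\<lambda>n. 1 / (real n + 1) < 1 - \<rho>) sequentially"
        using order_tendstoD(2)[OF lim0, of "1 - \<rho>"] \<rho> by simp
      then show "\<forall>\<^sub>F n in sequentially. (\<integral>x\<in>ball 0 \<rho>. (norm (gw n x - G x))\<^sup>2 \<partial>lborel) \<le> 1 / (real n + 1)"
      proof eventually_elim
        fix n assume n: "1 / (real n + 1) < 1 - \<rho>"
        have "(\<integral>\<^sup>+x. ennreal (indicator (ball 0 \<rho>) x * (norm (gw n x - G x))\<^sup>2) \<partial>lborel) \<le> (\<integral>\<^sup>+x. ennreal ((norm (conv (mollifier (R n)) G x - G x))\<^sup>2) \<partial>lborel)"
          by (rule nn_integral_mono) (use gwG[of _ n] R(2)[of n] n in \<open>auto simp: indicator_def\<close>)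
        also have "\<dots> \<le> ennreal (1 / (real n + 1))" by (rule R(4))
        finally show "(\<integral>x\<in>ball 0 \<rho>. (norm (gw n x - G x))\<^sup>2 \<partial>lborel) \<le> 1 / (real n + 1)"
          unfolding set_lebesgue_integral_def real_scaleR_def
          by (intro nn_integral_le_realD(2) borel_measurable_times borel_measurable_power borel_measurable_norm borel_measurable_diff)
             (use wb Gb in \<open>auto intro!: borel_measurable_indicator\<close>)
      qed
    qed (auto simp: set_lebesgue_integral_def)
    from LIMSEQ_subseq_LIMSEQ[OF this r(1)]
    show "(\<lambda>n. \<integral>x\<in>ball 0 \<rho>. (norm (gw (r n) x - G x))\<^sup>2 \<partial>lborel) \<longlonglongrightarrow> 0" by (simp add: o_def)
  qed (use hw wM in auto)
qed

section \<open>Poincare inequalities\<close>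

lemma lborel_pair_measurable:
  "borel_measurable (lborel \<Otimes>\<^sub>M lborel) = (borel_measurable (borel \<Otimes>\<^sub>M borel) :: ('a::euclidean_space \<times> 'b::euclidean_space \<Rightarrow> 'c::topological_space) set)"
  by (rule measurable_cong_sets) (auto intro!: sets_pair_measure_cong)

lemma set_integrable_compact:
  fixes h :: "'a::euclidean_space \<Rightarrow> 'b::euclidean_space"
  assumes "compact S" "continuous_on UNIV h"
  shows "set_integrable lborel S h"
  unfolding set_integrable_def
  by (intro borel_integrable_compact assms continuous_on_subset[OF assms(2)]) auto

lemma set_integral_mono_nonneg_set:
  fixes h :: "'a \<Rightarrow> real"
  assumes "set_integrable M T h" "S \<subseteq> T" "S \<in> sets M" "\<And>x. 0 \<le> h x"
  shows "(\<integral>x\<in>S. h x \<partial>M) \<le> (\<integral>x\<in>T. h x \<partial>M)"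
  unfolding set_lebesgue_integral_def
proof (rule integral_mono)
  show "integrable M (\<lambda>x. indicator S x *\<^sub>R h x)"
    using set_integrable_subset[OF assms(1,3,2)] unfolding set_integrable_def .
qed (use assms in \<open>auto simp: set_integrable_def indicator_def\<close>)

lemma set_integral_Un_le:
  fixes h :: "'a \<Rightarrow> real"
  assumes "set_integrable M S h" "set_integrable M T h" "S \<in> sets M" "T \<in> sets M" "\<And>x. 0 \<le> h x"
  shows "(\<integral>x\<in>S \<union> T. h x \<partial>M) \<le> (\<integral>x\<in>S. h x \<partial>M) + (\<integral>x\<in>T. h x \<partial>M)"
proof -
  have "(\<integral>x\<in>S \<union> T. h x \<partial>M) \<le> (\<integral>x. indicator S x *\<^sub>R h x + indicator T x *\<^sub>R h x \<partial>M)"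
    unfolding set_lebesgue_integral_def
  proof (rule integral_mono)
    show "integrable M (\<lambda>x. indicator (S \<union> T) x *\<^sub>R h x)"
      using set_integrable_Un[OF assms(1-4)] unfolding set_integrable_def .
  qed (use assms in \<open>auto simp: set_integrable_def indicator_def\<close>)
  then show ?thesis using assms(1,2) unfolding set_lebesgue_integral_def set_integrable_def by simp
qed

lemma nn_integral_eq_set_integral:
  fixes h :: "'a::euclidean_space \<Rightarrow> real"
  assumes "set_integrable lborel S h" "\<And>x. 0 \<le> h x"
  shows "(\<integral>\<^sup>+x. ennreal (indicator S x * h x) \<partial>lborel) = ennreal (\<integral>x\<in>S. h x \<partial>lborel)"
  using assms unfolding set_integrable_def set_lebesgue_integral_def
  by (subst nn_integral_eq_integral) auto

text \<open>Only the half of the segment nearer to y is used. There the parameter t is at least 1/2,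
  so the point x + t(y - x) depends on y through a dilation that does not degenerate; over the whole
  segment the change of variables would blow up at t = 0.\<close>

lemma segment_square_bound:
  fixes v :: "'a::euclidean_space \<Rightarrow> real"
  assumes v: "has_grad v g"
  shows "ennreal ((v y - v (x + (1/2) *\<^sub>R (y - x)))\<^sup>2)
    \<le> ennreal ((norm (y - x))\<^sup>2) * (\<integral>\<^sup>+t. ennreal (indicator {1/2..1} t * (norm (g (x + t *\<^sub>R (y - x))))\<^sup>2) \<partial>lborel)"
proof -
  define \<phi> where "\<phi> t = g (x + t *\<^sub>R (y - x)) \<bullet> (y - x)" for t :: real
  have cg: "continuous_on UNIV (\<lambda>t. g (x + t *\<^sub>R (y - x)))"
    by (rule continuous_on_compose2[OF has_grad_D(2)[OF v, of UNIV]]) (auto intro!: continuous_intros)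
  then have c\<phi>: "continuous_on S \<phi>" for S unfolding \<phi>_def by (intro continuous_intros continuous_on_subset[OF cg]) auto
  have D: "((\<lambda>t. v (x + t *\<^sub>R (y - x))) has_vector_derivative \<phi> t) (at t within S)" for t S
  proof -
    have "((\<lambda>t. x + t *\<^sub>R (y - x)) has_derivative (\<lambda>h. h *\<^sub>R (y - x))) (at t within S)"
      by (auto intro!: derivative_eq_intros)
    from has_derivative_compose[OF this has_grad_D(1)[OF v, of _ UNIV]]
    show ?thesis unfolding has_vector_derivative_def \<phi>_def by simp
  qed
  have "(\<integral>t. indicator {1/2..1} t *\<^sub>R \<phi> t \<partial>lborel) = v (x + 1 *\<^sub>R (y - x)) - v (x + (1/2) *\<^sub>R (y - x))"
    by (rule integral_FTC_atLeastAtMost) (use D c\<phi> in auto)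
  then have eq: "v y - v (x + (1/2) *\<^sub>R (y - x)) = (1/2) * (\<integral>t. (2 * indicator {1/2..1} t) *\<^sub>R \<phi> t \<partial>lborel)"
    by (simp add: mult.assoc)
  \<comment> \<open>The factor 2 makes this a probability density, as Jensen's inequality
    requires.\<close>
  have wi: "integrable lborel (\<lambda>t::real. 2 * indicator {1/2..1} t :: real)" by (intro integrable_mult_right integrable_real_indicator emeasure_bounded_finite) auto
  have "ennreal ((norm (\<integral>t. (2 * indicator {1/2..1} t) *\<^sub>R \<phi> t \<partial>lborel))\<^sup>2) \<le> (\<integral>\<^sup>+t. ennreal (2 * indicator {1/2..1} t * (norm (\<phi> t))\<^sup>2) \<partial>lborel)"
    by (rule integral_norm_square_le[OF wi]) (use continuous_on_imp_borel[OF c\<phi>] in auto)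
  also have "\<dots> \<le> (\<integral>\<^sup>+t. ennreal (2 * (norm (y - x))\<^sup>2) * ennreal (indicator {1/2..1} t * (norm (g (x + t *\<^sub>R (y - x))))\<^sup>2) \<partial>lborel)"
  proof (rule nn_integral_mono)
    fix t :: real
    have "norm (\<phi> t) \<le> norm (g (x + t *\<^sub>R (y - x))) * norm (y - x)"
      unfolding \<phi>_def by (simp add: Cauchy_Schwarz_ineq2)
    then have "(norm (\<phi> t))\<^sup>2 \<le> (norm (g (x + t *\<^sub>R (y - x))) * norm (y - x))\<^sup>2"
      by (intro power_mono) auto
    then show "ennreal (2 * indicator {1/2..1} t * (norm (\<phi> t))\<^sup>2) \<le> ennreal (2 * (norm (y - x))\<^sup>2) * ennreal (indicator {1/2..1} t * (norm (g (x + t *\<^sub>R (y - x))))\<^sup>2)"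
      by (subst ennreal_mult[symmetric]) (auto intro!: ennreal_leI simp: indicator_def power_mult_distrib mult_ac)
  qed
  also have "\<dots> = ennreal (2 * (norm (y - x))\<^sup>2) * (\<integral>\<^sup>+t. ennreal (indicator {1/2..1} t * (norm (g (x + t *\<^sub>R (y - x))))\<^sup>2) \<partial>lborel)"
    by (rule nn_integral_cmult) (use continuous_on_imp_borel[OF cg] in measurable)
  finally have "ennreal ((2 * (v y - v (x + (1/2) *\<^sub>R (y - x))))\<^sup>2) \<le> ennreal (2 * (norm (y - x))\<^sup>2) * (\<integral>\<^sup>+t. ennreal (indicator {1/2..1} t * (norm (g (x + t *\<^sub>R (y - x))))\<^sup>2) \<partial>lborel)"
    unfolding eq by simp
  moreover have "(2 * (v y - v (x + (1/2) *\<^sub>R (y - x))))\<^sup>2 = 4 * (v y - v (x + (1/2) *\<^sub>R (y - x)))\<^sup>2"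
    by (simp only: power_mult_distrib) simp
  ultimately have "ennreal 4 * ennreal ((v y - v (x + (1/2) *\<^sub>R (y - x)))\<^sup>2) \<le> ennreal 2 * (ennreal ((norm (y - x))\<^sup>2) * (\<integral>\<^sup>+t. ennreal (indicator {1/2..1} t * (norm (g (x + t *\<^sub>R (y - x))))\<^sup>2) \<partial>lborel))"
    by (simp only: ennreal_mult' zero_le_numeral mult.assoc)
  also have "\<dots> \<le> ennreal 4 * (ennreal ((norm (y - x))\<^sup>2) * (\<integral>\<^sup>+t. ennreal (indicator {1/2..1} t * (norm (g (x + t *\<^sub>R (y - x))))\<^sup>2) \<partial>lborel))"
    by (intro mult_right_mono ennreal_leI) auto
  finally show ?thesis by (subst (asm) ennreal_mult_le_mult_iff) auto
qed

lemma nn_integral_affine_le: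
  fixes f :: "'a::euclidean_space \<Rightarrow> ennreal"
  assumes f: "f \<in> borel_measurable borel" and t: "1/2 \<le> t"
  shows "(\<integral>\<^sup>+y. f (a + t *\<^sub>R y) \<partial>lborel) \<le> 2 ^ DIM('a) * (\<integral>\<^sup>+y. f y \<partial>lborel)"
proof -
  have "(\<integral>\<^sup>+y. f y \<partial>lborel) = (\<integral>\<^sup>+y. f y \<partial>density (distr lborel borel (\<lambda>x. a + t *\<^sub>R x)) (\<lambda>_. ennreal (\<bar>t\<bar>^DIM('a))))"
    using lborel_affine[of t a] t by simp
  also have "\<dots> = (\<integral>\<^sup>+y. ennreal (\<bar>t\<bar>^DIM('a)) * f y \<partial>distr lborel borel (\<lambda>x. a + t *\<^sub>R x))"
    by (rule nn_integral_density) (use f in auto)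
  also have "\<dots> = (\<integral>\<^sup>+y. ennreal (\<bar>t\<bar>^DIM('a)) * f (a + t *\<^sub>R y) \<partial>lborel)"
    by (rule nn_integral_distr) (use f in auto)
  also have "\<dots> = ennreal (\<bar>t\<bar>^DIM('a)) * (\<integral>\<^sup>+y. f (a + t *\<^sub>R y) \<partial>lborel)"
    by (rule nn_integral_cmult) (use f in auto)
  finally have eq: "(\<integral>\<^sup>+y. f y \<partial>lborel) = ennreal (\<bar>t\<bar>^DIM('a)) * (\<integral>\<^sup>+y. f (a + t *\<^sub>R y) \<partial>lborel)" .
  have "(1::real) \<le> 2 ^ DIM('a) * \<bar>t\<bar> ^ DIM('a)"
    unfolding power_mult_distrib[symmetric] using t by (intro one_le_power) auto
  then have "ennreal 1 \<le> ennreal (2 ^ DIM('a)) * ennreal (\<bar>t\<bar> ^ DIM('a))"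
    by (subst ennreal_mult[symmetric]) (auto intro!: ennreal_leI)
  then have "1 * (\<integral>\<^sup>+y. f (a + t *\<^sub>R y) \<partial>lborel) \<le> (ennreal (2 ^ DIM('a)) * ennreal (\<bar>t\<bar> ^ DIM('a))) * (\<integral>\<^sup>+y. f (a + t *\<^sub>R y) \<partial>lborel)"
    by (intro mult_right_mono) auto
  then show ?thesis unfolding eq by (simp add: mult.assoc ennreal_power[symmetric])
qed

text \<open>Convexity keeps the segments in S. After exchanging the order of integration the
  y-integral is innermost, and substituting (1 - t)x + ty costs at most 2 to the dimension, as t is
  at least 1/2.\<close>

lemma poincare_double_half:
  fixes v :: "'a::euclidean_space \<Rightarrow> real"
  assumes v: "has_grad v g" and S: "compact S" "convex S" and d: "\<And>x y. x \<in> S \<Longrightarrow> y \<in> S \<Longrightarrow> norm (y - x) \<le> d"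
  shows "(\<integral>\<^sup>+x. \<integral>\<^sup>+y. ennreal (indicator S x * indicator S y * (v y - v (x + (1/2) *\<^sub>R (y - x)))\<^sup>2) \<partial>lborel \<partial>lborel)
    \<le> ennreal (2 ^ DIM('a) * d\<^sup>2 * measure lborel S * (\<integral>x\<in>S. (norm (g x))\<^sup>2 \<partial>lborel))"
proof -
  have gm[measurable]: "g \<in> borel_measurable borel" using has_grad_borel[OF v] by simp
  have Sm[measurable]: "S \<in> sets borel" using S by (simp add: compact_imp_closed borel_closed)
  have Sf: "emeasure lborel S < \<infinity>" using S(1) by (intro emeasure_bounded_finite compact_imp_bounded)
  define H where "H z = ennreal (indicator S z * (norm (g z))\<^sup>2)" for z
  have Hm[measurable]: "H \<in> borel_measurable borel" unfolding H_def by measurable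
  define I where "I = (\<integral>\<^sup>+z. H z \<partial>lborel)"
  have gc: "continuous_on UNIV (\<lambda>x. (norm (g x))\<^sup>2)" using has_grad_D(2)[OF v] by (intro continuous_intros)
  have I: "I = ennreal (\<integral>x\<in>S. (norm (g x))\<^sup>2 \<partial>lborel)"
    unfolding I_def H_def by (rule nn_integral_eq_set_integral[OF set_integrable_compact[OF S(1) gc]]) simp
  have "(\<integral>\<^sup>+x. \<integral>\<^sup>+y. ennreal (indicator S x * indicator S y * (v y - v (x + (1/2) *\<^sub>R (y - x)))\<^sup>2) \<partial>lborel \<partial>lborel)
    \<le> (\<integral>\<^sup>+x. \<integral>\<^sup>+y. \<integral>\<^sup>+t. ennreal (d\<^sup>2) * (indicator S x * (indicator {1/2..1::real} t * H ((1 - t) *\<^sub>R x + t *\<^sub>R y))) \<partial>lborel \<partial>lborel \<partial>lborel)"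
  proof (intro nn_integral_mono)
    fix x y :: 'a
    show "ennreal (indicator S x * indicator S y * (v y - v (x + (1/2) *\<^sub>R (y - x)))\<^sup>2)
      \<le> (\<integral>\<^sup>+t. ennreal (d\<^sup>2) * (indicator S x * (indicator {1/2..1::real} t * H ((1 - t) *\<^sub>R x + t *\<^sub>R y))) \<partial>lborel)"
    proof (cases "x \<in> S \<and> y \<in> S")
      case True
      have "ennreal ((v y - v (x + (1/2) *\<^sub>R (y - x)))\<^sup>2) \<le> ennreal ((norm (y - x))\<^sup>2) * (\<integral>\<^sup>+t. ennreal (indicator {1/2..1} t * (norm (g (x + t *\<^sub>R (y - x))))\<^sup>2) \<partial>lborel)"
        by (rule segment_square_bound[OF v])
      also have "\<dots> \<le> ennreal (d\<^sup>2) * (\<integral>\<^sup>+t. indicator {1/2..1::real} t * H ((1 - t) *\<^sub>R x + t *\<^sub>R y) \<partial>lborel)"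
      proof (intro mult_mono nn_integral_mono ennreal_leI power_mono d)
        fix t :: real
        have "(1 - t) *\<^sub>R x + t *\<^sub>R y \<in> S" if "t \<in> {1/2..1}"
          using convexD[OF S(2), of x y "1 - t" t] True that by simp
        moreover have "x + t *\<^sub>R (y - x) = (1 - t) *\<^sub>R x + t *\<^sub>R y" by (simp add: algebra_simps)
        ultimately show "ennreal (indicator {1/2..1} t * (norm (g (x + t *\<^sub>R (y - x))))\<^sup>2) \<le> indicator {1/2..1::real} t * H ((1 - t) *\<^sub>R x + t *\<^sub>R y)"
          by (auto simp: H_def indicator_def)
      qed (use True in auto)
      also have "\<dots> = (\<integral>\<^sup>+t. ennreal (d\<^sup>2) * (indicator {1/2..1::real} t * H ((1 - t) *\<^sub>R x + t *\<^sub>R y)) \<partial>lborel)"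
        by (rule nn_integral_cmult[symmetric]) measurable
      finally show ?thesis using True by simp
    qed (auto simp: indicator_def)
  qed
  also have "\<dots> = (\<integral>\<^sup>+x. \<integral>\<^sup>+t. \<integral>\<^sup>+y. ennreal (d\<^sup>2) * (indicator S x * (indicator {1/2..1::real} t * H ((1 - t) *\<^sub>R x + t *\<^sub>R y))) \<partial>lborel \<partial>lborel \<partial>lborel)"
  proof (rule nn_integral_cong, rule lborel_pair.Fubini')
    fix x :: 'a
    have "(\<lambda>p. ennreal (d\<^sup>2) * (indicator S x * (indicator {1/2..1::real} (fst p) * H ((1 - fst p) *\<^sub>R x + fst p *\<^sub>R snd p))))
        \<in> borel_measurable (borel \<Otimes>\<^sub>M borel)"
      by (intro borel_measurable_times_ennreal borel_measurable_const measurable_compose[OF _ Hm]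
          measurable_compose[OF measurable_fst borel_measurable_indicator]) auto
    then show "(\<lambda>(t, y). ennreal (d\<^sup>2) * (indicator S x * (indicator {1/2..1::real} t * H ((1 - t) *\<^sub>R x + t *\<^sub>R y))))
        \<in> borel_measurable (lborel \<Otimes>\<^sub>M lborel)"
      by (simp add: case_prod_beta' lborel_pair_measurable)
  qed
  also have "\<dots> \<le> (\<integral>\<^sup>+x. \<integral>\<^sup>+t. ennreal (d\<^sup>2) * (indicator S x * (indicator {1/2..1::real} t * (2 ^ DIM('a) * I))) \<partial>lborel \<partial>lborel)"
  proof (intro nn_integral_mono)
    fix x :: 'a and t :: real
    have Ha: "(\<lambda>y. H ((1 - t) *\<^sub>R x + t *\<^sub>R y)) \<in> borel_measurable borel"
      by (rule measurable_compose[OF _ Hm]) auto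
    have "(\<integral>\<^sup>+y. ennreal (d\<^sup>2) * (indicator S x * (indicator {1/2..1::real} t * H ((1 - t) *\<^sub>R x + t *\<^sub>R y))) \<partial>lborel)
      = ennreal (d\<^sup>2) * (indicator S x * (indicator {1/2..1::real} t * (\<integral>\<^sup>+y. H ((1 - t) *\<^sub>R x + t *\<^sub>R y) \<partial>lborel)))"
      by (cases "x \<in> S"; cases "t \<in> {1/2..1}") (simp_all add: nn_integral_cmult Ha)
    also have "\<dots> \<le> ennreal (d\<^sup>2) * (indicator S x * (indicator {1/2..1::real} t * (2 ^ DIM('a) * I)))"
    proof (cases "t \<in> {1/2..1}")
      case True
      then show ?thesis unfolding I_def by (intro mult_left_mono nn_integral_affine_le Hm) auto
    qed simp
    finally show "(\<integral>\<^sup>+y. ennreal (d\<^sup>2) * (indicator S x * (indicator {1/2..1::real} t * H ((1 - t) *\<^sub>R x + t *\<^sub>R y))) \<partial>lborel)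
       \<le> ennreal (d\<^sup>2) * (indicator S x * (indicator {1/2..1::real} t * (2 ^ DIM('a) * I)))" .
  qed
  also have "\<dots> = (\<integral>\<^sup>+x. indicator S x * (ennreal (d\<^sup>2) * (2 ^ DIM('a) * I) * (\<integral>\<^sup>+t. indicator {1/2..1::real} t \<partial>lborel)) \<partial>lborel)"
  proof (rule nn_integral_cong)
    fix x :: 'a
    have "(\<integral>\<^sup>+t. ennreal (d\<^sup>2) * (indicator {1/2..1::real} t * (2 ^ DIM('a) * I)) \<partial>lborel) = ennreal (d\<^sup>2) * (2 ^ DIM('a) * I) * (\<integral>\<^sup>+t. indicator {1/2..1::real} t \<partial>lborel)"
      by (subst nn_integral_cmult, simp, subst nn_integral_multc) (simp_all add: mult_ac del: nn_integral_indicator)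
    then show "(\<integral>\<^sup>+t. ennreal (d\<^sup>2) * (indicator S x * (indicator {1/2..1::real} t * (2 ^ DIM('a) * I))) \<partial>lborel)
       = indicator S x * (ennreal (d\<^sup>2) * (2 ^ DIM('a) * I) * (\<integral>\<^sup>+t. indicator {1/2..1::real} t \<partial>lborel))"
      by (cases "x \<in> S") simp_all
  qed
  also have "\<dots> = emeasure lborel S * (ennreal (d\<^sup>2) * (2 ^ DIM('a) * I) * (\<integral>\<^sup>+t. indicator {1/2..1::real} t \<partial>lborel))"
    by (subst nn_integral_multc) simp_all
  also have "\<dots> \<le> emeasure lborel S * (ennreal (d\<^sup>2) * (2 ^ DIM('a) * I) * 1)"
  proof (intro mult_left_mono)
    have "(\<integral>\<^sup>+t. indicator {1/2..1::real} t \<partial>lborel) = ennreal (1 - 1/2)"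
      by (simp only: nn_integral_indicator sets_lborel atLeastAtMost_borel) (rule emeasure_lborel_Icc, simp)
    also have "\<dots> \<le> ennreal 1" by (rule ennreal_leI) simp
    finally show "(\<integral>\<^sup>+t. indicator {1/2..1::real} t \<partial>lborel) \<le> 1" by (simp only: ennreal_1)
  qed simp_all
  also have "\<dots> = ennreal (2 ^ DIM('a) * d\<^sup>2 * measure lborel S * (\<integral>x\<in>S. (norm (g x))\<^sup>2 \<partial>lborel))"
    using Sf unfolding I by (subst emeasure_eq_ennreal_measure)
      (auto simp: ennreal_mult mult_ac ennreal_power[symmetric] set_lebesgue_integral_def Bochner_Integration.integral_nonneg)
  finally show ?thesis .
qed

text \<open>The constant subtracted from v is a value of v at a point of S, not its mean. It thus
  inherits any pointwise bound on v, and no average over S has to be formed.\<close>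

definition poincare :: "'a::euclidean_space set \<Rightarrow> real \<Rightarrow> bool" where
  "poincare S C \<longleftrightarrow> (\<forall>v g. has_grad v g \<longrightarrow>
     (\<exists>y\<in>S. (\<integral>x\<in>S. (v x - v y)\<^sup>2 \<partial>lborel) \<le> C * (\<integral>x\<in>S. (norm (g x))\<^sup>2 \<partial>lborel)))"

text \<open>The difference v(x) - v(y) is split at the midpoint of the segment, and the two halves
  are mirror images of each other. This bounds the double integral over S x S; some y must then do
  at least as well as the average, which supplies the constant.\<close>

lemma poincare_convex:
  fixes S :: "'a::euclidean_space set"
  assumes S: "compact S" "convex S" "measure lborel S > 0" and d: "\<And>x y. x \<in> S \<Longrightarrow> y \<in> S \<Longrightarrow> norm (y - x) \<le> d"
  shows "poincare S (4 * 2 ^ DIM('a) * d\<^sup>2)"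
  unfolding poincare_def
proof (intro allI impI)
  fix v :: "'a \<Rightarrow> real" and g assume v: "has_grad v g"
  have vm[measurable]: "v \<in> borel_measurable borel" using has_grad_borel[OF v] by simp
  have Sm[measurable]: "S \<in> sets borel" using S by (simp add: compact_imp_closed borel_closed)
  have Sf: "emeasure lborel S < \<infinity>" using S(1) by (intro emeasure_bounded_finite compact_imp_bounded)
  define E where "E = (\<integral>x\<in>S. (norm (g x))\<^sup>2 \<partial>lborel)"
  have E: "E \<ge> 0" unfolding E_def set_lebesgue_integral_def by (simp add: Bochner_Integration.integral_nonneg)
  define K where "K = 2 ^ DIM('a) * d\<^sup>2 * measure lborel S * E"
  define q where "q x y = indicator S x * indicator S y * (v y - v (x + (1/2) *\<^sub>R (y - x)))\<^sup>2" for x y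
  have half: "(\<integral>\<^sup>+x. \<integral>\<^sup>+y. ennreal (q x y) \<partial>lborel \<partial>lborel) \<le> ennreal K"
    unfolding q_def K_def E_def by (rule poincare_double_half[OF v S(1,2) d])
  have qm[measurable]: "(\<lambda>p. q (fst p) (snd p)) \<in> borel_measurable (borel \<Otimes>\<^sub>M borel)" unfolding q_def by measurable
  have qs: "(\<lambda>x. q x y) \<in> borel_measurable borel" "(\<lambda>x. q y x) \<in> borel_measurable borel" for y
    unfolding q_def by measurable
  have qi: "(\<lambda>y. \<integral>\<^sup>+x. ennreal (q x y) \<partial>lborel) \<in> borel_measurable borel" "(\<lambda>y. \<integral>\<^sup>+x. ennreal (q y x) \<partial>lborel) \<in> borel_measurable borel"
    unfolding q_def by measurable
  define J where "J y = (\<integral>\<^sup>+x. ennreal (indicator S x * (v x - v y)\<^sup>2) \<partial>lborel)" for y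
  have Jm: "J \<in> borel_measurable lborel" unfolding J_def by measurable
  have "(\<integral>\<^sup>+y. indicator S y * J y \<partial>lborel) = (\<integral>\<^sup>+y. \<integral>\<^sup>+x. ennreal (indicator S x * indicator S y * (v x - v y)\<^sup>2) \<partial>lborel \<partial>lborel)"
  proof (rule nn_integral_cong)
    fix y show "indicator S y * J y = (\<integral>\<^sup>+x. ennreal (indicator S x * indicator S y * (v x - v y)\<^sup>2) \<partial>lborel)"
      unfolding J_def by (cases "y \<in> S") simp_all
  qed
  also have "\<dots> \<le> (\<integral>\<^sup>+y. \<integral>\<^sup>+x. 2 * ennreal (q x y) + 2 * ennreal (q y x) \<partial>lborel \<partial>lborel)"
  proof (intro nn_integral_mono)
    fix x y :: 'a
    \<comment> \<open>Symmetry of the midpoint: the second half of the path is the first one with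
      the roles of x and y exchanged.\<close>
    have m: "y + (1/2) *\<^sub>R (x - y) = x + (1/2) *\<^sub>R (y - x)" by (rule euclidean_eqI) (simp add: inner_add_left inner_diff_left field_simps)
    have "(a - b)\<^sup>2 \<le> 2 * (b - c)\<^sup>2 + 2 * (a - c)\<^sup>2" for a b c :: real
      using sum_squares_bound[of "a - c" "c - b"] by (simp add: power2_eq_square algebra_simps)
    then have "indicator S x * indicator S y * (v x - v y)\<^sup>2 \<le> 2 * q x y + 2 * q y x"
      unfolding q_def m by (auto simp: indicator_def)
    then have "ennreal (indicator S x * indicator S y * (v x - v y)\<^sup>2) \<le> ennreal (2 * q x y + 2 * q y x)" by (rule ennreal_leI)
    also have "\<dots> = 2 * ennreal (q x y) + 2 * ennreal (q y x)"
      by (simp add: ennreal_plus ennreal_mult' q_def)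
    finally show "ennreal (indicator S x * indicator S y * (v x - v y)\<^sup>2) \<le> 2 * ennreal (q x y) + 2 * ennreal (q y x)" .
  qed
  also have "\<dots> = 2 * (\<integral>\<^sup>+y. \<integral>\<^sup>+x. ennreal (q x y) \<partial>lborel \<partial>lborel) + 2 * (\<integral>\<^sup>+y. \<integral>\<^sup>+x. ennreal (q y x) \<partial>lborel \<partial>lborel)"
    using qs qi by (simp add: nn_integral_add nn_integral_cmult)
  also have "(\<integral>\<^sup>+y. \<integral>\<^sup>+x. ennreal (q x y) \<partial>lborel \<partial>lborel) = (\<integral>\<^sup>+x. \<integral>\<^sup>+y. ennreal (q x y) \<partial>lborel \<partial>lborel)"
    by (rule lborel_pair.Fubini') measurable
  also have "2 * \<dots> + 2 * (\<integral>\<^sup>+y. \<integral>\<^sup>+x. ennreal (q y x) \<partial>lborel \<partial>lborel) \<le> 2 * ennreal K + 2 * ennreal K"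
    using half by (intro add_mono mult_left_mono) auto
  also have "\<dots> = ennreal (4 * K)"
    using E by (simp add: K_def ennreal_mult' flip: distrib_right)
  also have "\<dots> = (\<integral>\<^sup>+y. indicator S y * ennreal (4 * 2 ^ DIM('a) * d\<^sup>2 * E) \<partial>lborel)"
    using Sf E by (subst nn_integral_multc) (auto simp: emeasure_eq_ennreal_measure K_def ennreal_mult'[symmetric] mult_ac)
  finally have le: "(\<integral>\<^sup>+y. indicator S y * J y \<partial>lborel) \<le> (\<integral>\<^sup>+y. indicator S y * ennreal (4 * 2 ^ DIM('a) * d\<^sup>2 * E) \<partial>lborel)" .
  \<comment> \<open>If every y in S exceeded the average, integrating over S, which has positive
    measure, would contradict \<open>le\<close>.\<close>
  have "\<exists>y\<in>S. J y \<le> ennreal (4 * 2 ^ DIM('a) * d\<^sup>2 * E)"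
  proof (rule ccontr)
    assume "\<not> ?thesis"
    then have gt: "J y > ennreal (4 * 2 ^ DIM('a) * d\<^sup>2 * E)" if "y \<in> S" for y using that by (auto simp: not_le)
    have "(\<integral>\<^sup>+y. indicator S y * ennreal (4 * 2 ^ DIM('a) * d\<^sup>2 * E) \<partial>lborel) < (\<integral>\<^sup>+y. indicator S y * J y \<partial>lborel)"
    proof (rule nn_integral_less)
      show "(\<integral>\<^sup>+y. indicator S y * ennreal (4 * 2 ^ DIM('a) * d\<^sup>2 * E) \<partial>lborel) \<noteq> \<infinity>"
        using Sf by (subst nn_integral_multc) (auto simp: ennreal_mult_eq_top_iff)
      show "AE y in lborel. indicator S y * ennreal (4 * 2 ^ DIM('a) * d\<^sup>2 * E) \<le> indicator S y * J y"
        using gt by (intro AE_I2) (auto simp: indicator_def less_imp_le)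
      show "\<not> (AE y in lborel. indicator S y * J y \<le> indicator S y * ennreal (4 * 2 ^ DIM('a) * d\<^sup>2 * E))"
      proof
        assume "AE y in lborel. indicator S y * J y \<le> indicator S y * ennreal (4 * 2 ^ DIM('a) * d\<^sup>2 * E)"
        then have "AE y in lborel. y \<notin> S"
        proof (rule AE_mp, intro AE_I2 impI notI)
          fix y assume "indicator S y * J y \<le> indicator S y * ennreal (4 * 2 ^ DIM('a) * d\<^sup>2 * E)" "y \<in> S"
          with gt[of y] show False by (simp add: leD)
        qed
        then have "S \<in> null_sets lborel" by (subst (asm) AE_iff_null_sets[symmetric]) auto
        with S(3) show False by (simp add: null_sets_def measure_def)
      qed
    qed (use Jm in measurable)
    with le show False by simp
  qed
  then obtain y where y: "y \<in> S" "J y \<le> ennreal (4 * 2 ^ DIM('a) * d\<^sup>2 * E)" by blast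
  have vc: "continuous_on UNIV (\<lambda>x. (v x - v y)\<^sup>2)" using has_grad_D(3)[OF v] by (intro continuous_intros)
  have "J y = ennreal (\<integral>x\<in>S. (v x - v y)\<^sup>2 \<partial>lborel)"
    unfolding J_def by (rule nn_integral_eq_set_integral[OF set_integrable_compact[OF S(1) vc]]) simp
  with y E show "\<exists>y\<in>S. (\<integral>x\<in>S. (v x - v y)\<^sup>2 \<partial>lborel) \<le> 4 * 2 ^ DIM('a) * d\<^sup>2 * (\<integral>x\<in>S. (norm (g x))\<^sup>2 \<partial>lborel)"
    unfolding E_def[symmetric] by (intro bexI[of _ y]) auto
qed

text \<open>The constants \<open>v y\<close> for S and \<open>v z\<close> for T are compared on the
  overlap, where v is close to both; the overlap must therefore have measure bounded below. The
  resulting constant depends on measures only through \<nu> / \<mu>, which is invariant under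
  scaling.\<close>

lemma poincare_Un:
  fixes S T :: "'a::euclidean_space set"
  assumes S: "compact S" "poincare S A" and T: "compact T" "poincare T B"
    and m: "measure lborel (S \<inter> T) \<ge> \<mu>" "\<mu> > 0" "measure lborel T \<le> \<nu>" and AB: "A \<ge> 0" "B \<ge> 0"
  shows "poincare (S \<union> T) (A + 2 * B + 4 * (\<nu> / \<mu>) * (A + B))"
  unfolding poincare_def
proof (intro allI impI)
  fix v :: "'a \<Rightarrow> real" and g assume v: "has_grad v g"
  have Sm: "S \<in> sets lborel" "T \<in> sets lborel" using S T by (auto simp: compact_imp_closed borel_closed)
  have vc: "continuous_on UNIV (\<lambda>x. (v x - c)\<^sup>2)" for c using has_grad_D(3)[OF v] by (intro continuous_intros)
  have gc: "continuous_on UNIV (\<lambda>x. (norm (g x))\<^sup>2)" using has_grad_D(2)[OF v] by (intro continuous_intros)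
  note iv = set_integrable_compact[OF _ vc] and ig = set_integrable_compact[OF _ gc]
  define E where "E = (\<integral>x\<in>S \<union> T. (norm (g x))\<^sup>2 \<partial>lborel)"
  have E: "E \<ge> 0" unfolding E_def set_lebesgue_integral_def by (simp add: Bochner_Integration.integral_nonneg)
  have ES: "(\<integral>x\<in>S. (norm (g x))\<^sup>2 \<partial>lborel) \<le> E" "(\<integral>x\<in>T. (norm (g x))\<^sup>2 \<partial>lborel) \<le> E"
    unfolding E_def using S T Sm by (auto intro!: set_integral_mono_nonneg_set ig compact_Un)
  obtain y where y: "y \<in> S" "(\<integral>x\<in>S. (v x - v y)\<^sup>2 \<partial>lborel) \<le> A * (\<integral>x\<in>S. (norm (g x))\<^sup>2 \<partial>lborel)"
    using S(2) v unfolding poincare_def by blast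
  obtain z where z: "z \<in> T" "(\<integral>x\<in>T. (v x - v z)\<^sup>2 \<partial>lborel) \<le> B * (\<integral>x\<in>T. (norm (g x))\<^sup>2 \<partial>lborel)"
    using T(2) v unfolding poincare_def by blast
  have yE: "(\<integral>x\<in>S. (v x - v y)\<^sup>2 \<partial>lborel) \<le> A * E" using y(2) mult_left_mono[OF ES(1) AB(1)] by linarith
  have zE: "(\<integral>x\<in>T. (v x - v z)\<^sup>2 \<partial>lborel) \<le> B * E" using z(2) mult_left_mono[OF ES(2) AB(2)] by linarith
  have cI: "compact (S \<inter> T)" using S T by (simp add: compact_Int)
  have fin: "emeasure lborel (S \<inter> T) < \<infinity>" "emeasure lborel T < \<infinity>" using cI T(1) by (auto intro!: emeasure_bounded_finite compact_imp_bounded simp del: infinity_ennreal_def)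
  define a where "a = (v y - v z)\<^sup>2"
  have sI: "S \<inter> T \<in> sets lborel" using Sm by blast
  have ic: "set_integrable lborel W (\<lambda>x. c::real)" if "compact W" for W :: "'a set" and c
    by (rule set_integrable_compact[OF that]) simp
  have sc: "(\<integral>x\<in>W. c \<partial>lborel) = measure lborel W * c" for W :: "'a set" and c :: real
    unfolding set_lebesgue_integral_def by simp
  have "measure lborel (S \<inter> T) * a = (\<integral>x\<in>S \<inter> T. a \<partial>lborel)" by (simp add: sc)
  also have "\<dots> \<le> (\<integral>x\<in>S \<inter> T. 2 * (v x - v y)\<^sup>2 + 2 * (v x - v z)\<^sup>2 \<partial>lborel)"
  proof (rule set_integral_mono)
    show "set_integrable lborel (S \<inter> T) (\<lambda>x. 2 * (v x - v y)\<^sup>2 + 2 * (v x - v z)\<^sup>2)"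
      by (intro set_integral_add set_integrable_mult_right iv cI)
    fix x
    show "a \<le> 2 * (v x - v y)\<^sup>2 + 2 * (v x - v z)\<^sup>2"
      unfolding a_def using sum_squares_bound[of "v x - v y" "v z - v x"] by (simp add: power2_eq_square algebra_simps)
  qed (use ic cI in auto)
  also have "\<dots> = 2 * (\<integral>x\<in>S \<inter> T. (v x - v y)\<^sup>2 \<partial>lborel) + 2 * (\<integral>x\<in>S \<inter> T. (v x - v z)\<^sup>2 \<partial>lborel)"
    by (subst set_integral_add) (auto intro!: set_integrable_mult_right iv cI)
  also have "\<dots> \<le> 2 * (A * E) + 2 * (B * E)"
  proof -
    have "(\<integral>x\<in>S \<inter> T. (v x - v y)\<^sup>2 \<partial>lborel) \<le> (\<integral>x\<in>S. (v x - v y)\<^sup>2 \<partial>lborel)"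
      by (rule set_integral_mono_nonneg_set[OF iv[OF S(1)] _ sI]) auto
    moreover have "(\<integral>x\<in>S \<inter> T. (v x - v z)\<^sup>2 \<partial>lborel) \<le> (\<integral>x\<in>T. (v x - v z)\<^sup>2 \<partial>lborel)"
      by (rule set_integral_mono_nonneg_set[OF iv[OF T(1)] _ sI]) auto
    ultimately show ?thesis using yE zE by linarith
  qed
  finally have "measure lborel (S \<inter> T) * a \<le> 2 * (A * E) + 2 * (B * E)" .
  moreover have "\<mu> * a \<le> measure lborel (S \<inter> T) * a" using m(1) by (intro mult_right_mono) (auto simp: a_def)
  ultimately have "\<mu> * a \<le> 2 * (A + B) * E" by (simp add: algebra_simps)
  then have a: "a \<le> 2 * (A + B) * E / \<mu>" using m(2) by (simp add: pos_le_divide_eq mult.commute)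
  have "(\<integral>x\<in>T. (v x - v y)\<^sup>2 \<partial>lborel) \<le> (\<integral>x\<in>T. 2 * (v x - v z)\<^sup>2 + 2 * a \<partial>lborel)"
  proof (rule set_integral_mono)
    show "set_integrable lborel T (\<lambda>x. 2 * (v x - v z)\<^sup>2 + 2 * a)"
      by (intro set_integral_add set_integrable_mult_right iv T ic)
    fix x
    show "(v x - v y)\<^sup>2 \<le> 2 * (v x - v z)\<^sup>2 + 2 * a"
      unfolding a_def using sum_squares_bound[of "v x - v z" "v z - v y"] by (simp add: power2_eq_square algebra_simps)
  qed (use iv T in auto)
  also have "\<dots> = 2 * (\<integral>x\<in>T. (v x - v z)\<^sup>2 \<partial>lborel) + measure lborel T * (2 * a)"
    by (subst set_integral_add) (auto intro!: set_integrable_mult_right iv T ic simp: sc)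
  also have "\<dots> \<le> 2 * (B * E) + \<nu> * (2 * (2 * (A + B) * E / \<mu>))"
  proof -
    have "0 \<le> \<nu>" using m(3) measure_nonneg[of lborel T] by linarith
    then have "measure lborel T * (2 * a) \<le> \<nu> * (2 * (2 * (A + B) * E / \<mu>))"
      using m(3) a by (intro mult_mono) (auto simp: a_def)
    with zE show ?thesis by linarith
  qed
  finally have TE: "(\<integral>x\<in>T. (v x - v y)\<^sup>2 \<partial>lborel) \<le> 2 * (B * E) + \<nu> * (2 * (2 * (A + B) * E / \<mu>))" .
  have "(\<integral>x\<in>S \<union> T. (v x - v y)\<^sup>2 \<partial>lborel) \<le> (\<integral>x\<in>S. (v x - v y)\<^sup>2 \<partial>lborel) + (\<integral>x\<in>T. (v x - v y)\<^sup>2 \<partial>lborel)"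
    by (rule set_integral_Un_le[OF iv[OF S(1)] iv[OF T(1)] Sm]) auto
  also have "\<dots> \<le> A * E + (2 * (B * E) + \<nu> * (2 * (2 * (A + B) * E / \<mu>)))" using yE TE by linarith
  also have "\<dots> = (A + 2 * B + 4 * (\<nu> / \<mu>) * (A + B)) * E" by (simp add: algebra_simps add_divide_distrib)
  finally show "\<exists>y\<in>S \<union> T. (\<integral>x\<in>S \<union> T. (v x - v y)\<^sup>2 \<partial>lborel) \<le> (A + 2 * B + 4 * (\<nu> / \<mu>) * (A + B)) * (\<integral>x\<in>S \<union> T. (norm (g x))\<^sup>2 \<partial>lborel)"
    using y(1) unfolding E_def by blast
qed

section \<open>Balls and rings in the plane\<close>

lemma measure_ball_plane: "r \<ge> 0 \<Longrightarrow> measure lborel (ball (x::real^2) r) = pi * r\<^sup>2"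
  using circle_area[of r x] by (simp add: mult.commute)

lemma measure_cball_plane: "r \<ge> 0 \<Longrightarrow> measure lborel (cball (x::real^2) r) = pi * r\<^sup>2"
  by (simp add: content_cball unit_ball_vol_2 mult.commute)

lemma poincare_cball:
  assumes "r > 0"
  shows "poincare (cball (x::real^2) r) (64 * r\<^sup>2)"
proof -
  have "norm (z - y) \<le> 2 * r" if "y \<in> cball x r" "z \<in> cball x r" for y z
    using that norm_triangle_ineq4[of "z - x" "y - x"] by (simp add: dist_norm norm_minus_commute)
  from poincare_convex[OF compact_cball convex_cball _ this] show ?thesis
    using assms by (simp add: power_mult_distrib)
qed

text \<open>A square annulus in the coordinates P(y - x): their maximum norm lies between s/8 and s.
  It contains the round ring s/4 < |P(y - x)| < s, since a planar vector of length above s/4 has a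
  coordinate of size at least s/8; unlike the round ring it splits into convex pieces.\<close>

definition ring_set :: "real^2^2 \<Rightarrow> real^2 \<Rightarrow> real \<Rightarrow> (real^2) set" where
  "ring_set P x s = {y. (s / 8 \<le> \<bar>(P *v (y - x)) $ 1\<bar> \<or> s / 8 \<le> \<bar>(P *v (y - x)) $ 2\<bar>)
      \<and> \<bar>(P *v (y - x)) $ 1\<bar> \<le> s \<and> \<bar>(P *v (y - x)) $ 2\<bar> \<le> s}"

text \<open>A ring is the union of four parallelograms, each meeting the next in a corner.\<close>

lemma poincare_ring:
  assumes a: "a > 0" and b: "b > 0"
  obtains C where "C > 0"
    "\<And>P x s. (\<And>z. a * norm z \<le> norm (P *v z)) \<Longrightarrow> (\<And>z. norm (P *v z) \<le> b * norm z) \<Longrightarrow> s > 0 \<Longrightarrow>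
       poincare (ring_set P x s) (C * s\<^sup>2)"
proof -
  \<comment> \<open>\<open>c\<close> is the convex constant 4 * 2^2 * d^2 for diameter bound 4s/a,
    with the scale s removed. \<open>K\<close> is the ratio of the area of a ball of radius 2s/a,
    which contains each piece, to that of a ball of radius 3s/(8b), which fits into each corner.
    \<open>nxt\<close> is the effect of attaching one more piece by
    \<open>poincare_Un\<close>.\<close>
  define c where "c = 256 / a\<^sup>2"
  define K where "K = (16 * b / (3 * a))\<^sup>2"
  define nxt where "nxt A = A + 2 * c + 4 * K * (A + c)" for A
  have c0: "c > 0" "K > 0" using a b by (auto simp: c_def K_def)
  have nx: "nxt A > 0" if "A > 0" for A using that c0 unfolding nxt_def by (intro add_pos_pos mult_pos_pos) auto
  show ?thesis
  proof (rule that)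
    show "nxt (nxt (nxt c)) > 0" using c0 nx by blast
    fix P :: "real^2^2" and x :: "real^2" and s :: real
    assume Pa: "\<And>z. a * norm z \<le> norm (P *v z)" and Pb: "\<And>z. norm (P *v z) \<le> b * norm z" and s: "s > 0"
    define W where "W l h = {y. P *v (y - x) \<in> cbox l h}" for l h :: "real^2"
    have lin: "linear (matrix_vector_mult P)" by simp
    have injP: "inj (matrix_vector_mult P)"
    proof (rule injI)
      fix y z assume "P *v y = P *v z"
      then have "P *v (y - z) = 0" by (simp add: matrix_vector_mult_diff_distrib)
      then show "y = z" using Pa[of "y - z"] a by (simp add: mult_le_0_iff)
    qed
    have surjP: "surj (matrix_vector_mult P)" using linear_injective_imp_surjective[OF lin injP] by simp
    have nb: "norm w \<le> 2 * s" if "w \<in> cbox l h" "l \<in> cbox (\<chi> i. -s) (\<chi> i. s)" "h \<in> cbox (\<chi> i. -s) (\<chi> i. s)" for w l h :: "real^2"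
    proof -
      have "\<bar>w $ i\<bar> \<le> s" for i using that by (auto simp: mem_box_cart abs_le_iff) (smt (verit) that mem_box_cart vec_lambda_beta)+
      from this[of 1] this[of 2] have "\<bar>w $ 1\<bar> + \<bar>w $ 2\<bar> \<le> 2 * s" by linarith
      then show ?thesis using norm_le_l1_cart[of w] by (simp add: sum_2)
    qed
    have sub: "W l h \<subseteq> cball x (2 * s / a)" if "l \<in> cbox (\<chi> i. -s) (\<chi> i. s)" "h \<in> cbox (\<chi> i. -s) (\<chi> i. s)" for l h
    proof
      fix y assume "y \<in> W l h"
      then have "norm (P *v (y - x)) \<le> 2 * s" using nb[OF _ that] by (simp add: W_def)
      with Pa[of "y - x"] have "a * norm (y - x) \<le> 2 * s" by linarith
      then show "y \<in> cball x (2 * s / a)" using a by (simp add: dist_norm norm_minus_commute field_simps)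
    qed
    have cW: "compact (W l h)" if "l \<in> cbox (\<chi> i. -s) (\<chi> i. s)" "h \<in> cbox (\<chi> i. -s) (\<chi> i. s)" for l h
    proof -
      have "continuous_on UNIV (\<lambda>y. P *v (y - x))"
        by (intro bounded_linear.continuous_on[OF matrix_vector_mul_bounded_linear] continuous_intros)
      then have "closed (W l h)" unfolding W_def
        using closed_vimage[OF closed_cbox, of "\<lambda>y. P *v (y - x)" l h] by (simp add: vimage_def)
      then show ?thesis using sub[OF that] by (meson bounded_cball bounded_subset compact_eq_bounded_closed)
    qed
    have vW: "convex (W l h)" for l h
    proof -
      have "W l h = (+) x ` (matrix_vector_mult P -` cbox l h)" unfolding W_def by (force simp: image_iff intro!: bexI[of _ "_ - x"])
      then show ?thesis using convex_linear_vimage[OF lin convex_box(1)] by (simp add: convex_translation)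
    qed
    \<comment> \<open>Since P stretches lengths by at most b, a ball of this radius is mapped into a
      square of half side 3s/8 around w.\<close>
    have corner: "measure lborel (ball x0 (3 * s / (8 * b))) \<le> measure lborel S"
      if "compact S" "P *v (x0 - x) = w" "\<And>y. (\<And>i. \<bar>(P *v (y - x)) $ i - w $ i\<bar> \<le> 3 * s / 8) \<Longrightarrow> y \<in> S" for S x0 w
    proof (rule measure_mono_fmeasurable)
      show "ball x0 (3 * s / (8 * b)) \<subseteq> S"
      proof
        fix y assume "y \<in> ball x0 (3 * s / (8 * b))"
        then have "norm (y - x0) * b \<le> 3 * s / 8" using b by (simp add: dist_norm norm_minus_commute field_simps)
        then have "norm (P *v (y - x0)) \<le> 3 * s / 8" using Pb[of "y - x0"] by (simp add: mult.commute)
        moreover have "P *v (y - x0) = P *v (y - x) - w"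
          using that(2) by (simp add: matrix_vector_mult_diff_distrib algebra_simps)
        ultimately have "\<bar>(P *v (y - x)) $ i - w $ i\<bar> \<le> 3 * s / 8" for i
          using component_le_norm_cart[of "P *v (y - x) - w" i] by simp
        then show "y \<in> S" by (rule that(3))
      qed
      show "S \<in> fmeasurable lborel"
        using that(1) by (rule fmeasurable_compact)
    qed simp
    define \<mu> where "\<mu> = pi * (3 * s / (8 * b))\<^sup>2"
    define \<nu> where "\<nu> = pi * (2 * s / a)\<^sup>2"
    have \<mu>0: "\<mu> > 0" unfolding \<mu>_def using s b by simp
    have ratio: "\<nu> / \<mu> = K" unfolding \<nu>_def \<mu>_def K_def using s a b by (simp add: field_simps power2_eq_square)
    define \<rho> where "\<rho> = 3 * s / 8"
    have \<rho>: "8 * \<rho> = 3 * s" by (simp add: \<rho>_def)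
    have cm: "\<mu> \<le> measure lborel S"
      if "compact S" and S: "\<And>y. \<bar>(P *v (y - x)) $ 1 - p\<bar> \<le> \<rho> \<Longrightarrow> \<bar>(P *v (y - x)) $ 2 - q\<bar> \<le> \<rho> \<Longrightarrow> y \<in> S" for S p q
    proof -
      obtain z where "P *v z = vector [p, q]" using surjP by (metis surjD)
      then have w: "P *v ((x + z) - x) = vector [p, q]" by simp
      have "y \<in> S" if "\<And>i. \<bar>(P *v (y - x)) $ i - (vector [p, q] :: real^2) $ i\<bar> \<le> 3 * s / 8" for y
        using S[of y] that[of 1] that[of 2] unfolding \<rho>_def by (simp only: vector_2)
      from corner[OF that(1) w this] show ?thesis
        unfolding \<mu>_def using s b by (simp add: measure_ball_plane)
    qed
    have W\<nu>: "measure lborel (W l h) \<le> \<nu>" if "l \<in> cbox (\<chi> i. -s) (\<chi> i. s)" "h \<in> cbox (\<chi> i. -s) (\<chi> i. s)" for l h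
    proof -
      have "measure lborel (W l h) \<le> measure lborel (cball x (2 * s / a))"
        by (rule measure_mono_fmeasurable[OF sub[OF that]])
           (use cW[OF that] in \<open>auto simp: compact_imp_closed borel_closed intro!: fmeasurable_compact\<close>)
      then show ?thesis unfolding \<nu>_def using s a by (simp add: measure_cball_plane)
    qed
    have pW: "poincare (W l h) (c * s\<^sup>2)"
      if lh: "l \<in> cbox (\<chi> i. -s) (\<chi> i. s)" "h \<in> cbox (\<chi> i. -s) (\<chi> i. s)" and m: "measure lborel (W l h) \<ge> \<mu>" for l h
    proof -
      have "norm (z - y) \<le> 4 * s / a" if "y \<in> W l h" "z \<in> W l h" for y z
      proof -
        have "norm (y - x) \<le> 2 * s / a" "norm (z - x) \<le> 2 * s / a"
          using sub[OF lh] that by (auto simp: dist_norm norm_minus_commute subset_eq)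
        then show "norm (z - y) \<le> 4 * s / a" using norm_triangle_ineq4[of "z - x" "y - x"] by simp
      qed
      from poincare_convex[OF cW[OF lh] vW _ this] show ?thesis
        using a m \<mu>0 by (simp add: c_def power_divide power_mult_distrib)
    qed
    let ?v = "\<lambda>p q. vector [p, q] :: real^2"
    define W1 where "W1 = W (?v (s/8) (-s)) (?v s s)"
    define W2 where "W2 = W (?v (-s) (s/8)) (?v s s)"
    define W3 where "W3 = W (?v (-s) (-s)) (?v (-s/8) s)"
    define W4 where "W4 = W (?v (-s) (-s)) (?v s (-s/8))"
    note Ws = W1_def W2_def W3_def W4_def
    have vb: "?v p q \<in> cbox (\<chi> i. -s) (\<chi> i. s)" if "\<bar>p\<bar> \<le> s" "\<bar>q\<bar> \<le> s" for p q
      using that by (auto simp: mem_box_cart forall_2)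
    have cWs: "compact W1" "compact W2" "compact W3" "compact W4"
      unfolding Ws by (rule cW; rule vb; use s in simp)+
    have \<nu>Ws: "measure lborel W2 \<le> \<nu>" "measure lborel W3 \<le> \<nu>" "measure lborel W4 \<le> \<nu>"
      unfolding Ws by (rule W\<nu>; rule vb; use s in simp)+
    have mem: "y \<in> W1 \<longleftrightarrow> s/8 \<le> (P *v (y - x)) $ 1 \<and> (P *v (y - x)) $ 1 \<le> s \<and> \<bar>(P *v (y - x)) $ 2\<bar> \<le> s"
      "y \<in> W2 \<longleftrightarrow> s/8 \<le> (P *v (y - x)) $ 2 \<and> (P *v (y - x)) $ 2 \<le> s \<and> \<bar>(P *v (y - x)) $ 1\<bar> \<le> s"
      "y \<in> W3 \<longleftrightarrow> -s \<le> (P *v (y - x)) $ 1 \<and> (P *v (y - x)) $ 1 \<le> -s/8 \<and> \<bar>(P *v (y - x)) $ 2\<bar> \<le> s"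
      "y \<in> W4 \<longleftrightarrow> -s \<le> (P *v (y - x)) $ 2 \<and> (P *v (y - x)) $ 2 \<le> -s/8 \<and> \<bar>(P *v (y - x)) $ 1\<bar> \<le> s" for y
      unfolding Ws W_def by (auto simp: mem_box_cart forall_2 abs_le_iff)
    \<comment> \<open>The corner squares are centred at coordinates of size s/2 and have half side
      3s/8; each coordinate then ranges in absolute value from s/8 to 7s/8, inside both adjacent
      pieces.\<close>
    have m12: "\<mu> \<le> measure lborel (W1 \<inter> W2)"
      by (rule cm[of _ "(s/2)" "(s/2)"]) (use cWs s \<rho> in \<open>auto simp: mem abs_le_iff compact_Int compact_Un\<close>)
    have m23: "\<mu> \<le> measure lborel ((W1 \<union> W2) \<inter> W3)"
      by (rule cm[of _ "(-s/2)" "(s/2)"]) (use cWs s \<rho> in \<open>auto simp: mem abs_le_iff compact_Int compact_Un\<close>)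
    have m34: "\<mu> \<le> measure lborel ((W1 \<union> W2 \<union> W3) \<inter> W4)"
      by (rule cm[of _ "(s/2)" "(-s/2)"]) (use cWs s \<rho> in \<open>auto simp: mem abs_le_iff compact_Int compact_Un\<close>)
    have m1: "\<mu> \<le> measure lborel W1"
      by (rule cm[of _ "(s/2)" "(s/2)"]) (use cWs s \<rho> in \<open>auto simp: mem abs_le_iff compact_Int compact_Un\<close>)
    have m2: "\<mu> \<le> measure lborel W2"
      by (rule cm[of _ "(s/2)" "(s/2)"]) (use cWs s \<rho> in \<open>auto simp: mem abs_le_iff compact_Int compact_Un\<close>)
    have m3: "\<mu> \<le> measure lborel W3"
      by (rule cm[of _ "(-s/2)" "(s/2)"]) (use cWs s \<rho> in \<open>auto simp: mem abs_le_iff compact_Int compact_Un\<close>)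
    have m4: "\<mu> \<le> measure lborel W4"
      by (rule cm[of _ "(s/2)" "(-s/2)"]) (use cWs s \<rho> in \<open>auto simp: mem abs_le_iff compact_Int compact_Un\<close>)
    have p1: "poincare W1 (c * s\<^sup>2)" using m1 unfolding W1_def by (intro pW vb) (use s in simp_all)
    have p2: "poincare W2 (c * s\<^sup>2)" using m2 unfolding W2_def by (intro pW vb) (use s in simp_all)
    have p3: "poincare W3 (c * s\<^sup>2)" using m3 unfolding W3_def by (intro pW vb) (use s in simp_all)
    have p4: "poincare W4 (c * s\<^sup>2)" using m4 unfolding W4_def by (intro pW vb) (use s in simp_all)
    have nxs: "nxt A * s\<^sup>2 = A * s\<^sup>2 + 2 * (c * s\<^sup>2) + 4 * (\<nu> / \<mu>) * (A * s\<^sup>2 + c * s\<^sup>2)" for A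
      unfolding ratio nxt_def by (simp add: algebra_simps)
    have pos: "0 \<le> A * s\<^sup>2" if "A > 0" for A using that by simp
    have q2: "poincare (W1 \<union> W2) (nxt c * s\<^sup>2)" unfolding nxs
      by (rule poincare_Un[OF cWs(1) p1 cWs(2) p2 m12 \<mu>0 \<nu>Ws(1) pos[OF c0(1)] pos[OF c0(1)]])
    have q3: "poincare (W1 \<union> W2 \<union> W3) (nxt (nxt c) * s\<^sup>2)" unfolding nxs[of "nxt c"]
      by (rule poincare_Un[OF compact_Un[OF cWs(1,2)] q2 cWs(3) p3 m23 \<mu>0 \<nu>Ws(2) pos[OF nx[OF c0(1)]] pos[OF c0(1)]])
    have q4: "poincare (W1 \<union> W2 \<union> W3 \<union> W4) (nxt (nxt (nxt c)) * s\<^sup>2)" unfolding nxs[of "nxt (nxt c)"]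
      by (rule poincare_Un[OF compact_Un[OF compact_Un[OF cWs(1,2)] cWs(3)] q3 cWs(4) p4 m34 \<mu>0 \<nu>Ws(3) pos[OF nx[OF nx[OF c0(1)]]] pos[OF c0(1)]])
    moreover have "W1 \<union> W2 \<union> W3 \<union> W4 = ring_set P x s"
      unfolding ring_set_def by (auto simp: mem abs_le_iff le_max_iff_disj abs_if split: if_splits)
    ultimately show "poincare (ring_set P x s) (nxt (nxt (nxt c)) * s\<^sup>2)" by simp
  qed
qed

section \<open>Truncated logarithmic potentials\<close>

text \<open>The potentials will be \<open>prof_f (\<bar>P (y - x)\<bar>\<^sup>2 / R\<^sup>2)\<close>, a smoothly truncated dyadic piece of a
  logarithm: \<open>- prof_f' = prof_h\<close> is supported in \<open>[1/16, 1]\<close>, and \<open>(t prof_h)' = (4 w (4 t) - w t) / 2\<close>,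
  which telescopes under \<open>t \<mapsto> 4 t\<close>.\<close>

definition prof_w :: "real \<Rightarrow> real" where
  "prof_w t = max 0 ((t - 1/4) * (1 - t))"

definition prof_k :: "real \<Rightarrow> real" where
  "prof_k t = integral {-1..t} prof_w"

text \<open>The solution of the equation for t h obtained by integration: t h is half of
  \<open>prof_k (4 * t) - prof_k t\<close>. For t at least 1 both values of \<open>prof_k\<close>
  are the full mass of \<open>prof_w\<close> and cancel, which gives the compact support.\<close>

definition prof_h :: "real \<Rightarrow> real" where
  "prof_h t = (prof_k (4 * t) - prof_k t) / (2 * t)"

definition prof_h' :: "real \<Rightarrow> real" where
  "prof_h' t = (4 * prof_w (4 * t) - prof_w t) / (2 * t) - (prof_k (4 * t) - prof_k t) / (2 * t\<^sup>2)"

text \<open>The antiderivative of -h normalized to vanish from t = 1 on. The base point -1/8 lies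
  strictly to the left of 0, where h vanishes, so that the derivative at t = 0 is two-sided.\<close>

definition prof_f :: "real \<Rightarrow> real" where
  "prof_f t = integral {-1/8..1} prof_h - integral {-1/8..t} prof_h"

lemma prof_w_simps:
  "0 \<le> prof_w t" "prof_w t \<le> 1" "t \<le> 1/4 \<Longrightarrow> prof_w t = 0" "1 \<le> t \<Longrightarrow> prof_w t = 0"
  "continuous_on S prof_w" "1/2 \<le> t \<Longrightarrow> t \<le> 3/4 \<Longrightarrow> 1/16 \<le> prof_w t"
proof -
  show "0 \<le> prof_w t" by (simp add: prof_w_def)
  have "(t - 1/4) * (1 - t) = 9/64 - (t - 5/8)\<^sup>2" by (simp add: power2_eq_square field_simps)
  then have "(t - 1/4) * (1 - t) \<le> 1" using zero_le_power2[of "t - 5/8"] by linarith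
  then show "prof_w t \<le> 1" by (simp add: prof_w_def)
  show "prof_w t = 0" if "t \<le> 1/4" using that by (simp add: prof_w_def mult_nonpos_nonneg)
  show "prof_w t = 0" if "1 \<le> t" using that by (simp add: prof_w_def mult_nonneg_nonpos)
  show "continuous_on S prof_w" unfolding prof_w_def by (intro continuous_intros)
  show "1/16 \<le> prof_w t" if "1/2 \<le> t" "t \<le> 3/4"
  proof -
    have "(1/4) * (1/4) \<le> (t - 1/4) * (1 - t)" using that by (intro mult_mono) auto
    then show ?thesis by (simp add: prof_w_def)
  qed
qed

lemma prof_k_deriv: "t > -1 \<Longrightarrow> (prof_k has_real_derivative prof_w t) (at t)"
proof -
  assume t: "t > -1"
  have "((\<lambda>x. integral {-1..x} prof_w) has_real_derivative prof_w t) (at t within {-1..t+1})"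
    by (rule integral_has_real_derivative) (use t prof_w_simps in auto)
  moreover have "at t within {-1..t+1} = at t"
    by (rule at_within_interior) (use t in simp)
  ultimately show ?thesis unfolding prof_k_def[abs_def] by simp
qed

lemma prof_k_small: "t \<le> 1/4 \<Longrightarrow> prof_k t = 0"
proof -
  assume "t \<le> 1/4"
  then have "integral {-1..t} prof_w = integral {-1..t} (\<lambda>_. 0)"
    by (intro Henstock_Kurzweil_Integration.integral_cong) (simp add: prof_w_simps)
  then show ?thesis by (simp add: prof_k_def)
qed

lemma prof_k_large: "1 \<le> t \<Longrightarrow> prof_k t = prof_k 1"
proof -
  assume t: "1 \<le> t"
  have "prof_w integrable_on {-1..t}" by (intro integrable_continuous_real prof_w_simps)
  then have "integral {-1..1} prof_w + integral {1..t} prof_w = integral {-1..t} prof_w"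
    using t by (intro Henstock_Kurzweil_Integration.integral_combine) auto
  moreover have "integral {1..t} prof_w = integral {1..t} (\<lambda>_. 0)"
    by (intro Henstock_Kurzweil_Integration.integral_cong) (simp add: prof_w_simps)
  ultimately show ?thesis by (simp add: prof_k_def)
qed

lemma prof_k_mono: "s \<le> t \<Longrightarrow> prof_k s \<le> prof_k t"
  unfolding prof_k_def
  by (intro integral_subset_le integrable_continuous_real prof_w_simps) (auto simp: prof_w_simps)

lemma prof_h_outside: "t \<le> 1/16 \<Longrightarrow> prof_h t = 0" "1 \<le> t \<Longrightarrow> prof_h t = 0"
proof -
  show "prof_h t = 0" if "t \<le> 1/16" using that by (simp add: prof_h_def prof_k_small)
  show "prof_h t = 0" if "1 \<le> t" using that prof_k_large[of t] prof_k_large[of "4 * t"] by (simp add: prof_h_def)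
qed

lemma prof_h'_small: "t \<le> 1/16 \<Longrightarrow> prof_h' t = 0"
  by (simp add: prof_h'_def prof_k_small prof_w_simps)

lemma prof_h_bounds: "0 \<le> prof_h t" "prof_h t \<le> 8 * prof_k 1"
proof -
  have k0: "0 \<le> prof_k s" for s using prof_k_mono[of "-1" s] prof_k_small[of s] prof_k_small[of "-1"]
    by (cases "s \<le> 1/4") (auto intro: prof_k_mono)
  have k1: "prof_k s \<le> prof_k 1" for s using prof_k_mono[of s 1] prof_k_large[of s] by (cases "s \<le> 1") auto
  have "0 \<le> prof_h t \<and> prof_h t \<le> 8 * prof_k 1"
  proof (cases "t \<le> 1/16")
    case True
    then show ?thesis using k0[of 1] by (simp add: prof_h_outside)
  next
    case False
    have "prof_k (4 * t) - prof_k t \<le> 8 * prof_k 1 * (2 * t)"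
    proof -
      have "prof_k (4 * t) - prof_k t \<le> prof_k 1 * 1" using k1[of "4*t"] k0[of t] by simp
      also have "\<dots> \<le> prof_k 1 * (16 * t)" using k0[of 1] False by (intro mult_left_mono) auto
      finally show ?thesis by simp
    qed
    moreover have "prof_k t \<le> prof_k (4 * t)" using False by (intro prof_k_mono) auto
    ultimately show ?thesis using False unfolding prof_h_def by (simp add: divide_le_eq)
  qed
  then show "0 \<le> prof_h t" "prof_h t \<le> 8 * prof_k 1" by auto
qed

lemma prof_h_deriv: "t > -1/4 \<Longrightarrow> (prof_h has_real_derivative prof_h' t) (at t)"
proof -
  assume t: "t > -1/4"
  show ?thesis
  proof (cases "t < 1/16")
    case True
    have "((\<lambda>t. 0::real) has_real_derivative 0) (at t)" by simp
    then have "(prof_h has_real_derivative 0) (at t)"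
      by (rule has_field_derivative_transform_within_open[of _ _ _ "{..<1/16}"])
         (use True in \<open>auto simp: prof_h_outside\<close>)
    then show ?thesis using True by (simp add: prof_h'_small)
  next
    case False
    have k4: "((\<lambda>t. prof_k (4 * t)) has_real_derivative prof_w (4 * t) * 4) (at t)"
    proof (rule DERIV_chain2[where f = prof_k])
      show "((\<lambda>t. 4 * t) has_real_derivative 4) (at t)" by (auto intro!: derivative_eq_intros)
    qed (use False in \<open>auto intro!: prof_k_deriv\<close>)
    have "((\<lambda>t. (prof_k (4 * t) - prof_k t) / (2 * t)) has_real_derivative
       ((prof_w (4 * t) * 4 - prof_w t) * (2 * t) - (prof_k (4 * t) - prof_k t) * 2) / (2 * t * (2 * t))) (at t)"
    proof (rule DERIV_divide[OF DERIV_diff[OF k4 prof_k_deriv]])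
      show "((\<lambda>t. 2 * t) has_real_derivative 2) (at t)" by (auto intro!: derivative_eq_intros)
    qed (use False in auto)
    moreover have "((prof_w (4 * t) * 4 - prof_w t) * (2 * t) - (prof_k (4 * t) - prof_k t) * 2) / (2 * t * (2 * t)) = prof_h' t"
      using False unfolding prof_h'_def by (simp add: field_simps power2_eq_square)
    ultimately show ?thesis unfolding prof_h_def[abs_def] by simp
  qed
qed

text \<open>In two dimensions the divergence of \<open>prof_h t\<close> times the position vector is
  twice the left-hand side, because t is quadratic. The right-hand side is a difference of the same
  weight at two consecutive scales.\<close>

lemma prof_relation: "t \<ge> 0 \<Longrightarrow> prof_h t + t * prof_h' t = (4 * prof_w (4 * t) - prof_w t) / 2"
proof (cases "t = 0")
  case True
  then show ?thesis by (simp add: prof_h_outside prof_w_simps)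
next
  case False
  then show ?thesis unfolding prof_h_def prof_h'_def by (simp add: field_simps power2_eq_square)
qed

lemma prof_h_continuous: "continuous_on {0..} prof_h" "continuous_on {0..} prof_h'"
proof -
  show "continuous_on {0..} prof_h"
  proof (intro continuous_at_imp_continuous_on ballI)
    fix t :: real assume "t \<in> {0..}"
    then show "isCont prof_h t" using DERIV_isCont[OF prof_h_deriv[of t]] by simp
  qed
  have kc: "continuous_on {0<..} prof_k"
  proof (intro continuous_at_imp_continuous_on ballI)
    fix t :: real assume "t \<in> {0<..}"
    then show "isCont prof_k t" using DERIV_isCont[OF prof_k_deriv[of t]] by simp
  qed
  have 1: "continuous_on {0<..} prof_h'"
    unfolding prof_h'_def
    by (intro continuous_intros continuous_on_compose2[OF kc] continuous_on_compose2[OF prof_w_simps(5)[of UNIV]] kc prof_w_simps) auto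
  have "continuous_on {..<1/16} (\<lambda>t::real. 0::real)" by simp
  then have 2: "continuous_on {..<1/16} prof_h'"
    by (rule continuous_on_eq) (simp add: prof_h'_small)
  have "continuous_on ({0<..} \<union> {..<1/16}) prof_h'"
    by (rule continuous_on_open_Un[OF _ _ 1 2]) auto
  then show "continuous_on {0..} prof_h'" by (rule continuous_on_subset) auto
qed

lemma prof_h_integrable: "-1/8 \<le> s \<Longrightarrow> prof_h integrable_on {s..t}"
proof -
  assume s: "-1/8 \<le> s"
  have "continuous_on {s..t} prof_h"
  proof (intro continuous_at_imp_continuous_on ballI)
    fix x assume "x \<in> {s..t}"
    then show "isCont prof_h x" using DERIV_isCont[OF prof_h_deriv[of x]] s by simp
  qed
  then show ?thesis by (rule integrable_continuous_real)
qed

lemma prof_f_deriv: "t \<ge> 0 \<Longrightarrow> (prof_f has_real_derivative - prof_h t) (at t)"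
proof -
  assume t: "t \<ge> 0"
  have "continuous_on {-1/8..t+1} prof_h"
  proof (intro continuous_at_imp_continuous_on ballI)
    fix x assume "x \<in> {-1/8..t+1}"
    then show "isCont prof_h x" using DERIV_isCont[OF prof_h_deriv[of x]] by simp
  qed
  then have "((\<lambda>x. integral {-1/8..x} prof_h) has_real_derivative prof_h t) (at t within {-1/8..t+1})"
    by (rule integral_has_real_derivative) (use t in auto)
  moreover have "at t within {-1/8..t+1} = at t"
    by (rule at_within_interior) (use t in simp)
  ultimately have "((\<lambda>x. integral {-1/8..x} prof_h) has_real_derivative prof_h t) (at t)" by simp
  then have "((\<lambda>x. integral {-1/8..1} prof_h - integral {-1/8..x} prof_h) has_real_derivative 0 - prof_h t) (at t)"
    by (intro DERIV_diff DERIV_const)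
  then show ?thesis unfolding prof_f_def[abs_def] by simp
qed

lemma prof_f_large: "1 \<le> t \<Longrightarrow> prof_f t = 0"
proof -
  assume t: "1 \<le> t"
  have "integral {-1/8..1} prof_h + integral {1..t} prof_h = integral {-1/8..t} prof_h"
    using t by (intro Henstock_Kurzweil_Integration.integral_combine prof_h_integrable) auto
  moreover have "integral {1..t} prof_h = integral {1..t} (\<lambda>_. 0)"
    by (intro Henstock_Kurzweil_Integration.integral_cong) (simp add: prof_h_outside)
  ultimately show ?thesis by (simp add: prof_f_def)
qed

lemma prof_f_bounds:
  assumes "t \<ge> 0" shows "0 \<le> prof_f t" "prof_f t \<le> 16 * prof_k 1"
proof -
  have "0 \<le> prof_f t \<and> prof_f t \<le> 16 * prof_k 1"
  proof (cases "1 \<le> t")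
    case True
    then show ?thesis using prof_h_bounds[of 0] by (simp add: prof_f_large)
  next
    case False
    have "integral {-1/8..t} prof_h + integral {t..1} prof_h = integral {-1/8..1} prof_h"
      using False assms by (intro Henstock_Kurzweil_Integration.integral_combine prof_h_integrable) auto
    then have eq: "prof_f t = integral {t..1} prof_h" by (simp add: prof_f_def)
    have "0 \<le> integral {t..1} prof_h"
      using assms by (intro Henstock_Kurzweil_Integration.integral_nonneg prof_h_integrable) (auto simp: prof_h_bounds)
    moreover have "integral {t..1} prof_h \<le> integral {t..1} (\<lambda>_. 8 * prof_k 1)"
      using assms by (intro integral_le prof_h_integrable) (auto simp: prof_h_bounds)
    moreover have "\<dots> \<le> 16 * prof_k 1"
    proof -
      have "0 \<le> prof_k 1" using prof_h_bounds[of 0] by linarith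
      then have "(1 - t) * (8 * prof_k 1) \<le> 1 * (16 * prof_k 1)" using assms False by (intro mult_mono) auto
      then show ?thesis using False by (simp add: algebra_simps)
    qed
    ultimately show ?thesis unfolding eq by linarith
  qed
  then show "0 \<le> prof_f t" "prof_f t \<le> 16 * prof_k 1" by auto
qed

definition prof_B :: real where "prof_B = 16 * prof_k 1 + 1"

lemma prof_B: "prof_B > 0" "\<bar>prof_h t\<bar> \<le> prof_B" "t \<ge> 0 \<Longrightarrow> \<bar>prof_f t\<bar> \<le> prof_B"
  using prof_h_bounds[of t] prof_h_bounds[of 0] prof_f_bounds[of t] unfolding prof_B_def by auto

lemma spd_matrix_bound:
  fixes A :: "real^'n^'n"
  assumes sym: "transpose A = A" and ell: "\<And>\<xi>. 0 \<le> (A *v \<xi>) \<bullet> \<xi>" "\<And>\<xi>. (A *v \<xi>) \<bullet> \<xi> \<le> L * (norm \<xi>)\<^sup>2"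
  shows "norm (A *v \<xi>) \<le> L * norm \<xi>"
proof -
  have symI: "(A *v x) \<bullet> y = (A *v y) \<bullet> x" for x y
    using dot_lmul_matrix[of y A x] sym by (metis inner_commute transpose_matrix_vector)
  \<comment> \<open>Polarization: the bilinear form is a quarter of the difference of the quadratic
    form at x + y and x - y, and the subtracted value is nonnegative.\<close>
  have pol: "(A *v x) \<bullet> y \<le> L" if "norm x = 1" "norm y = 1" for x y
  proof -
    have "4 * ((A *v x) \<bullet> y) = (A *v (x + y)) \<bullet> (x + y) - (A *v (x - y)) \<bullet> (x - y)"
      using symI[of x y] by (simp add: matrix_vector_right_distrib matrix_vector_mult_diff_distrib inner_add_left inner_add_right inner_diff_left inner_diff_right)
    also have "\<dots> \<le> L * (norm (x + y))\<^sup>2" using ell(1)[of "x - y"] ell(2)[of "x + y"] by linarith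
    also have "\<dots> \<le> L * 2\<^sup>2"
    proof (intro mult_left_mono power_mono)
      show "norm (x + y) \<le> 2" using norm_triangle_ineq[of x y] that by simp
      show "0 \<le> L" using ell(1)[of x] ell(2)[of x] that by simp
    qed simp
    finally show ?thesis by simp
  qed
  show ?thesis
  proof (cases "A *v \<xi> = 0")
    case True
    show ?thesis
    proof (cases "\<xi> = 0")
      case False
      then have "0 \<le> L * (norm \<xi>)\<^sup>2" using ell(1)[of \<xi>] ell(2)[of \<xi>] by linarith
      then have "0 \<le> L" using False by (simp add: zero_le_mult_iff)
      then show ?thesis using True by simp
    qed simp
  next
    case False
    then have \<xi>: "\<xi> \<noteq> 0" by auto
    define x where "x = (1 / norm \<xi>) *\<^sub>R \<xi>"
    define y where "y = (1 / norm (A *v \<xi>)) *\<^sub>R (A *v \<xi>)"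
    have "norm x = 1" "norm y = 1" unfolding x_def y_def using \<xi> False by simp_all
    from pol[OF this] have "(1 / norm \<xi>) * (1 / norm (A *v \<xi>)) * (norm (A *v \<xi>))\<^sup>2 \<le> L"
      unfolding x_def y_def by (simp add: matrix_vector_mult_scaleR power2_norm_eq_inner mult.commute[of "norm \<xi>"])
    then show ?thesis using \<xi> False by (simp add: field_simps power2_eq_square)
  qed
qed

text \<open>P is an explicit triangular Cholesky factor of the inverse of A. Its bounds come from
  ellipticity at \<xi> = P^T P z, the solution of A \<xi> = z, for which |Pz|^2 equals \<xi> .
  z.\<close>

lemma spd_factor:
  fixes A :: "real^2^2"
  assumes sym: "transpose A = A" and lam: "0 < l" and ell: "\<And>\<xi>. l * (norm \<xi>)\<^sup>2 \<le> (A *v \<xi>) \<bullet> \<xi>"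
    "\<And>\<xi>. (A *v \<xi>) \<bullet> \<xi> \<le> L * (norm \<xi>)\<^sup>2"
  obtains P :: "real^2^2" where "A ** (transpose P ** P) = mat 1"
    "\<And>z. sqrt l / L * norm z \<le> norm (P *v z)" "\<And>z. norm (P *v z) \<le> 1 / sqrt l * norm z"
proof -
  define \<alpha> where "\<alpha> = A $ 1 $ 1"
  define \<beta> where "\<beta> = A $ 1 $ 2"
  define \<gamma> where "\<gamma> = A $ 2 $ 2"
  have A21: "A $ 2 $ 1 = \<beta>"
  proof -
    have "A $ 2 $ 1 = transpose A $ 1 $ 2" by (simp add: transpose_def)
    then show ?thesis unfolding sym \<beta>_def .
  qed
  note As = \<alpha>_def[symmetric] \<beta>_def[symmetric] \<gamma>_def[symmetric] A21
  define D where "D = \<alpha> * \<gamma> - \<beta>\<^sup>2"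
  have Av: "A *v \<xi> = vector [\<alpha> * \<xi> $ 1 + \<beta> * \<xi> $ 2, \<beta> * \<xi> $ 1 + \<gamma> * \<xi> $ 2]" for \<xi>
    by (simp add: vec_eq_iff forall_2 matrix_vector_mult_def sum_2 As)
  have Q: "(A *v \<xi>) \<bullet> \<xi> = \<alpha> * (\<xi> $ 1)\<^sup>2 + 2 * \<beta> * \<xi> $ 1 * \<xi> $ 2 + \<gamma> * (\<xi> $ 2)\<^sup>2" for \<xi>
    unfolding Av by (simp add: inner_vec_def sum_2 algebra_simps power2_eq_square)
  have nrm: "(norm \<xi>)\<^sup>2 = (\<xi> $ 1)\<^sup>2 + (\<xi> $ 2)\<^sup>2" for \<xi> :: "real^2"
    unfolding power2_norm_eq_inner by (simp add: inner_vec_def sum_2 power2_eq_square)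
  have a0: "\<alpha> > 0" using ell(1)[of "vector [1, 0]"] lam unfolding Q nrm by simp
  have "0 < l * (\<beta>\<^sup>2 + \<alpha>\<^sup>2)" using lam a0 by (intro mult_pos_pos add_nonneg_pos) auto
  \<comment> \<open>The quadratic form at the vector (\<beta>, -\<alpha>) equals \<alpha> times the
    determinant, so ellipticity makes the determinant positive.\<close>
  also have "\<dots> \<le> \<alpha> * D" using ell(1)[of "vector [\<beta>, - \<alpha>]"] unfolding Q nrm D_def
    by (simp add: algebra_simps power2_eq_square)
  finally have D0: "D > 0" using a0 by (simp add: zero_less_mult_iff)
  define p where "p = sqrt \<alpha>"
  define d where "d = sqrt D"
  have pd: "p > 0" "d > 0" "\<alpha> = p * p" "D = d * d" using a0 D0 by (simp_all add: p_def d_def)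
  have rel: "p * p * \<gamma> = d * d + \<beta> * \<beta>" using D_def pd by (simp add: power2_eq_square)
  define P :: "real^2^2" where "P = vector [vector [1 / p, 0], vector [- \<beta> / (p * d), p / d]]"
  have P: "A ** (transpose P ** P) = mat 1"
  proof -
    have "1 / p * (1 / p) + \<beta> / (p * d) * (\<beta> / (p * d)) = (d * d + \<beta> * \<beta>) / (p * p * (d * d))"
      using pd(1,2) by (simp add: add_divide_distrib)
    also have "\<dots> = \<gamma> / (d * d)" unfolding rel[symmetric] using pd(1) by simp
    finally have PP: "(transpose P ** P) $ 1 $ 1 = \<gamma> / D" "(transpose P ** P) $ 1 $ 2 = - \<beta> / D"
      "(transpose P ** P) $ 2 $ 1 = - \<beta> / D" "(transpose P ** P) $ 2 $ 2 = \<alpha> / D"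
      unfolding pd(3,4) using pd(1,2) by (simp_all add: P_def matrix_matrix_mult_def transpose_def sum_2)
    show ?thesis
      unfolding vec_eq_iff forall_2 matrix_matrix_mult_def[of A] sum_2 vec_lambda_beta PP As
      using D0 by (simp add: mat_def field_simps) (simp add: D_def power2_eq_square algebra_simps)
  qed
  have key: "l * (norm \<xi>)\<^sup>2 \<le> (norm (P *v z))\<^sup>2" "norm z \<le> L * norm \<xi>" "(norm (P *v z))\<^sup>2 \<le> norm \<xi> * norm z"
    if \<xi>: "\<xi> = transpose P *v (P *v z)" for \<xi> z
  proof -
    have Az: "A *v \<xi> = z"
      unfolding \<xi> using P by (metis matrix_vector_mul_assoc matrix_vector_mul_lid)
    have Pz: "(norm (P *v z))\<^sup>2 = \<xi> \<bullet> z"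
      unfolding \<xi> power2_norm_eq_inner by (metis dot_lmul_matrix transpose_matrix_vector)
    show "l * (norm \<xi>)\<^sup>2 \<le> (norm (P *v z))\<^sup>2" using ell(1)[of \<xi>] unfolding Az Pz by (simp add: inner_commute)
    have "norm (A *v \<xi>) \<le> L * norm \<xi>"
    proof (rule spd_matrix_bound[OF sym])
      show "0 \<le> (A *v \<xi>) \<bullet> \<xi>" for \<xi> using order_trans[OF _ ell(1)[of \<xi>]] lam by simp
    qed (rule ell(2))
    then show "norm z \<le> L * norm \<xi>" using Az by simp
    show "(norm (P *v z))\<^sup>2 \<le> norm \<xi> * norm z" unfolding Pz by (rule norm_cauchy_schwarz)
  qed
  have L0: "L > 0"
    using ell(1)[of "vector [1,0]"] ell(2)[of "vector [1,0]"] lam unfolding nrm by simp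
  show ?thesis
  proof (rule that[OF P])
    fix z :: "real^2"
    define \<xi> where "\<xi> = transpose P *v (P *v z)"
    note k = key[OF \<xi>_def]
    have "sqrt (l * (norm \<xi>)\<^sup>2) \<le> norm (P *v z)" using k(1) by (rule real_le_lsqrt[OF norm_ge_zero])
    then have k1: "sqrt l * norm \<xi> \<le> norm (P *v z)" by (simp add: real_sqrt_mult)
    have "sqrt l * norm z \<le> sqrt l * (L * norm \<xi>)" using k(2) lam by (intro mult_left_mono) auto
    also have "\<dots> \<le> L * norm (P *v z)" using k1 L0 by (simp add: mult.left_commute)
    finally show "sqrt l / L * norm z \<le> norm (P *v z)" using L0 by (simp add: field_simps)
    have "sqrt l * (norm (P *v z))\<^sup>2 \<le> sqrt l * norm \<xi> * norm z" using mult_left_mono[OF k(3), of "sqrt l"] lam by (simp add: mult.assoc)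
    also have "\<dots> \<le> norm (P *v z) * norm z" using k1 by (intro mult_right_mono) auto
    finally have "norm (P *v z) * (sqrt l * norm (P *v z)) \<le> norm (P *v z) * norm z" by (simp add: power2_eq_square mult.left_commute)
    then have "sqrt l * norm (P *v z) \<le> norm z" by (cases "norm (P *v z) = 0") auto
    then show "norm (P *v z) \<le> 1 / sqrt l * norm z" using lam by (simp add: field_simps)
  qed
qed

text \<open>The Cauchy-Schwarz inequality in the form used for bilinear terms: an integrand k
  dominated pointwise by c |f| |g| on S. Working with nonnegative integrals yields integrability of
  k together with the bound.\<close>

lemma L2_product_bound:
  fixes f g k :: "'a \<Rightarrow> real"
  assumes [measurable]: "f \<in> borel_measurable M" "g \<in> borel_measurable M" "k \<in> borel_measurable M" "S \<in> sets M"
    and f: "set_integrable M S (\<lambda>x. (f x)\<^sup>2)" and g: "set_integrable M S (\<lambda>x. (g x)\<^sup>2)"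
    and k: "\<And>x. \<bar>k x\<bar> \<le> c * (indicator S x * (\<bar>f x\<bar> * \<bar>g x\<bar>))" and c: "c \<ge> 0"
  shows "integrable M k" "(\<integral>x. \<bar>k x\<bar> \<partial>M) \<le> c * (sqrt (\<integral>x\<in>S. (f x)\<^sup>2 \<partial>M) * sqrt (\<integral>x\<in>S. (g x)\<^sup>2 \<partial>M))"
    "\<bar>\<integral>x. k x \<partial>M\<bar> \<le> c * (sqrt (\<integral>x\<in>S. (f x)\<^sup>2 \<partial>M) * sqrt (\<integral>x\<in>S. (g x)\<^sup>2 \<partial>M))"
proof -
  define p where "p = (\<integral>x\<in>S. (f x)\<^sup>2 \<partial>M)"
  define q where "q = (\<integral>x\<in>S. (g x)\<^sup>2 \<partial>M)"
  have pq: "p \<ge> 0" "q \<ge> 0" unfolding p_def q_def set_lebesgue_integral_def by simp_all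
  have P: "(\<integral>\<^sup>+x. (ennreal (indicator S x * \<bar>f x\<bar>))\<^sup>2 \<partial>M) = ennreal p"
    unfolding p_def set_lebesgue_integral_def
    by (subst nn_integral_eq_integral[symmetric])
       (use f in \<open>auto simp: set_integrable_def ennreal_power power_mult_distrib indicator_def intro!: nn_integral_cong\<close>)
  have Q: "(\<integral>\<^sup>+x. (ennreal (indicator S x * \<bar>g x\<bar>))\<^sup>2 \<partial>M) = ennreal q"
    unfolding q_def set_lebesgue_integral_def
    by (subst nn_integral_eq_integral[symmetric])
       (use g in \<open>auto simp: set_integrable_def ennreal_power power_mult_distrib indicator_def intro!: nn_integral_cong\<close>)
  define J where "J = (\<integral>\<^sup>+x. ennreal (indicator S x * \<bar>f x\<bar>) * ennreal (indicator S x * \<bar>g x\<bar>) \<partial>M)"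
  have "J\<^sup>2 \<le> ennreal p * ennreal q"
    unfolding J_def P[symmetric] Q[symmetric] by (rule Cauchy_Schwarz_nn_integral) measurable
  also have "\<dots> = (ennreal (sqrt p * sqrt q))\<^sup>2"
    using pq by (simp add: ennreal_power power_mult_distrib ennreal_mult)
  finally have "J\<^sup>2 \<le> (ennreal (sqrt p * sqrt q))\<^sup>2" .
  have J: "J \<le> ennreal (sqrt p * sqrt q)"
  proof (cases J rule: ennreal_cases)
    case (real j)
    then show ?thesis using pq \<open>J\<^sup>2 \<le> (ennreal (sqrt p * sqrt q))\<^sup>2\<close>
      by (auto simp: ennreal_power intro!: ennreal_leI power2_le_imp_le)
  next
    case top
    then show ?thesis using \<open>J\<^sup>2 \<le> (ennreal (sqrt p * sqrt q))\<^sup>2\<close> pq by (simp add: ennreal_power power2_eq_square ennreal_mult_eq_top_iff top_unique)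
  qed
  have "(\<integral>\<^sup>+x. ennreal \<bar>k x\<bar> \<partial>M) \<le> (\<integral>\<^sup>+x. ennreal c * (ennreal (indicator S x * \<bar>f x\<bar>) * ennreal (indicator S x * \<bar>g x\<bar>)) \<partial>M)"
  proof (rule nn_integral_mono)
    fix x
    have "\<bar>k x\<bar> \<le> c * ((indicator S x * \<bar>f x\<bar>) * (indicator S x * \<bar>g x\<bar>))" using k[of x] by (cases "x \<in> S") auto
    then have "ennreal \<bar>k x\<bar> \<le> ennreal (c * ((indicator S x * \<bar>f x\<bar>) * (indicator S x * \<bar>g x\<bar>)))" by (rule ennreal_leI)
    then show "ennreal \<bar>k x\<bar> \<le> ennreal c * (ennreal (indicator S x * \<bar>f x\<bar>) * ennreal (indicator S x * \<bar>g x\<bar>))"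
      using c by (simp only: ennreal_mult mult_nonneg_nonneg indicator_pos_le abs_ge_zero)
  qed
  also have "\<dots> = ennreal c * J" unfolding J_def by (rule nn_integral_cmult) measurable
  also have "\<dots> \<le> ennreal c * ennreal (sqrt p * sqrt q)" using J by (intro mult_left_mono) auto
  also have "\<dots> = ennreal (c * (sqrt p * sqrt q))" using c pq by (simp add: ennreal_mult)
  finally have *: "(\<integral>\<^sup>+x. ennreal \<bar>k x\<bar> \<partial>M) \<le> ennreal (c * (sqrt p * sqrt q))" .
  have i: "integrable M (\<lambda>x. \<bar>k x\<bar>)" "(\<integral>x. \<bar>k x\<bar> \<partial>M) \<le> c * (sqrt p * sqrt q)"
    using nn_integral_le_realD[of "\<lambda>x. \<bar>k x\<bar>" M "c * (sqrt p * sqrt q)"] * c pq by simp_all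
  show "integrable M k" by (rule integrable_abs_cancel[OF i(1)]) measurable
  show "(\<integral>x. \<bar>k x\<bar> \<partial>M) \<le> c * (sqrt p * sqrt q)" by (rule i(2))
  then show "\<bar>\<integral>x. k x \<partial>M\<bar> \<le> c * (sqrt p * sqrt q)" using integral_abs_bound[of M k] by linarith
qed

section \<open>Potentials, their gradients and ring averages\<close>

definition log_pot :: "real^2^2 \<Rightarrow> real^2 \<Rightarrow> real \<Rightarrow> real^2 \<Rightarrow> real" where
  "log_pot P x R y = prof_f ((norm (P *v (y - x)))\<^sup>2 / R\<^sup>2)"

definition log_pot_grad :: "real^2^2 \<Rightarrow> real^2 \<Rightarrow> real \<Rightarrow> real^2 \<Rightarrow> real^2" where
  "log_pot_grad P x R y = (- (2 * prof_h ((norm (P *v (y - x)))\<^sup>2 / R\<^sup>2) / R\<^sup>2)) *\<^sub>R (transpose P *v (P *v (y - x)))"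

lemma adjoint_inner: "(transpose P *v w) \<bullet> h = w \<bullet> (P *v h)" for P :: "real^'n^'m"
  by (metis dot_lmul_matrix transpose_matrix_vector)

lemma quad_has_derivative:
  fixes P :: "real^2^2"
  shows "((\<lambda>y. (norm (P *v (y - x)))\<^sup>2 / R\<^sup>2) has_derivative (\<lambda>h. ((2 / R\<^sup>2) *\<^sub>R (transpose P *v (P *v (y - x)))) \<bullet> h)) (at y)"
proof -
  have "((\<lambda>y. P *v (y - x)) has_derivative (\<lambda>h. P *v h)) (at y)"
    by (rule bounded_linear.has_derivative[OF matrix_vector_mul_bounded_linear]) (auto intro!: derivative_eq_intros)
  from has_derivative_inner[OF this this]
  have "((\<lambda>y. (P *v (y - x)) \<bullet> (P *v (y - x)) / R\<^sup>2) has_derivative (\<lambda>h. ((P *v (y - x)) \<bullet> (P *v h) + (P *v h) \<bullet> (P *v (y - x))) / R\<^sup>2)) (at y)"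
    by (rule bounded_linear.has_derivative[OF bounded_linear_divide])
  moreover have "((P *v (y - x)) \<bullet> (P *v h) + (P *v h) \<bullet> (P *v (y - x))) / R\<^sup>2 = ((2 / R\<^sup>2) *\<^sub>R (transpose P *v (P *v (y - x)))) \<bullet> h" for h
    using adjoint_inner[of P "P *v (y - x)" h] by (simp add: inner_commute)
  ultimately show ?thesis by (simp add: power2_norm_eq_inner)
qed

lemma continuous_quad: "continuous_on S (\<lambda>y::real^2. (norm (P *v (y - x)))\<^sup>2 / R\<^sup>2)" for P :: "real^2^2"
  by (cases "R = 0") (auto intro!: continuous_intros bounded_linear.continuous_on[OF matrix_vector_mul_bounded_linear])

lemma continuous_PP: "continuous_on S (\<lambda>y::real^2. transpose P *v (P *v (y - x)))" for P :: "real^2^2"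
  by (intro bounded_linear.continuous_on[OF matrix_vector_mul_bounded_linear] continuous_intros)

lemma outside_quad:
  fixes P :: "real^2^2"
  assumes "a > 0" "R > 0" "\<And>z. a * norm z \<le> norm (P *v z)" "y \<notin> cball x (R / a)"
  shows "1 \<le> (norm (P *v (y - x)))\<^sup>2 / R\<^sup>2"
proof -
  have "R \<le> a * norm (y - x)" using assms by (simp add: dist_norm norm_minus_commute field_simps)
  also have "\<dots> \<le> norm (P *v (y - x))" by (rule assms)
  finally have "R\<^sup>2 \<le> (norm (P *v (y - x)))\<^sup>2" using assms by (intro power_mono) auto
  then show ?thesis using assms by simp
qed

lemma log_pot_C1c:
  fixes P :: "real^2^2"
  assumes "a > 0" "R > 0" "\<And>z. a * norm z \<le> norm (P *v z)" "cball x (R / a) \<subseteq> S"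
  shows "C1c S (log_pot P x R) (log_pot_grad P x R)"
proof (rule C1cI[OF _ compact_cball assms(4)])
  show "has_grad (log_pot P x R) (log_pot_grad P x R)"
    unfolding has_grad_def
  proof (intro conjI allI)
    fix y
    have "(prof_f has_derivative (\<lambda>h. (- prof_h ((norm (P *v (y - x)))\<^sup>2 / R\<^sup>2)) * h)) (at ((norm (P *v (y - x)))\<^sup>2 / R\<^sup>2))"
      by (rule prof_f_deriv[unfolded has_field_derivative_def]) simp
    from has_derivative_compose[OF quad_has_derivative this]
    show "(log_pot P x R has_derivative (\<bullet>) (log_pot_grad P x R y)) (at y)"
      unfolding log_pot_def[abs_def] by (rule has_derivative_eq_rhs) (simp add: fun_eq_iff log_pot_grad_def)
    show "continuous_on UNIV (log_pot_grad P x R)"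
      unfolding log_pot_grad_def divide_inverse
      by (intro continuous_intros continuous_PP continuous_on_compose2[OF prof_h_continuous(1) continuous_quad[unfolded divide_inverse]]) auto
  qed
  show "log_pot P x R y = 0" if "y \<notin> cball x (R / a)" for y
    unfolding log_pot_def by (rule prof_f_large[OF outside_quad[OF assms(1-3) that]])
qed

lemma log_pot_bound: "\<bar>log_pot P x R y\<bar> \<le> prof_B"
  unfolding log_pot_def by (rule prof_B) simp

lemma transpose_bound:
  fixes P :: "real^'n^'m"
  assumes "\<And>z. norm (P *v z) \<le> b * norm z"
  shows "norm (transpose P *v w) \<le> b * norm w"
proof (cases "transpose P *v w = 0")
  case True
  have "0 \<le> b * norm w"
  proof -
    have "0 \<le> b * norm (axis undefined 1 :: real^'n)" using order_trans[OF norm_ge_zero assms] .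
    then have "0 \<le> b" by (simp add: norm_axis_1)
    then show ?thesis by simp
  qed
  with True show ?thesis by simp
next
  case False
  have "norm (transpose P *v w) * norm (transpose P *v w) = w \<bullet> (P *v (transpose P *v w))"
    by (simp add: adjoint_inner[symmetric] power2_norm_eq_inner[symmetric] power2_eq_square)
  also have "\<dots> \<le> norm w * norm (P *v (transpose P *v w))" by (rule norm_cauchy_schwarz)
  also have "\<dots> \<le> norm w * (b * norm (transpose P *v w))" using assms by (intro mult_left_mono) auto
  finally show ?thesis using False by (simp add: mult.assoc[symmetric] mult.commute)
qed

text \<open>The derivative of the quadratic argument is of order |P(y - x)| / R^2, and h vanishes
  unless |P(y - x)| lies between R/4 and R; hence the size 1/R and the support in a ring.\<close>

lemma log_pot_grad_bound:
  fixes P :: "real^2^2"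
  assumes "R > 0" "b \<ge> 0" "\<And>z. norm (P *v z) \<le> b * norm z"
  shows "norm (log_pot_grad P x R y) \<le> 2 * prof_B * b / R"
    "log_pot_grad P x R y \<noteq> 0 \<Longrightarrow> R / 4 < norm (P *v (y - x))" "log_pot_grad P x R y \<noteq> 0 \<Longrightarrow> norm (P *v (y - x)) < R"
proof -
  define t where "t = (norm (P *v (y - x)))\<^sup>2 / R\<^sup>2"
  have nz: "1/16 < t \<and> t < 1" if "log_pot_grad P x R y \<noteq> 0"
    using that prof_h_outside[of t] unfolding log_pot_grad_def t_def[symmetric] by (auto simp: not_le[symmetric])
  show 1: "norm (P *v (y - x)) < R" if "log_pot_grad P x R y \<noteq> 0"
    using nz[OF that] assms(1) unfolding t_def by (intro power2_less_imp_less[of _ R]) auto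
  show "R / 4 < norm (P *v (y - x))" if "log_pot_grad P x R y \<noteq> 0"
    using nz[OF that] assms(1) unfolding t_def by (intro power2_less_imp_less[of "R/4"]) (auto simp: power_divide)
  show "norm (log_pot_grad P x R y) \<le> 2 * prof_B * b / R"
  proof (cases "log_pot_grad P x R y = 0")
    case True
    then show ?thesis using assms prof_B(1) by simp
  next
    case False
    have "norm (log_pot_grad P x R y) = 2 * \<bar>prof_h t\<bar> / R\<^sup>2 * norm (transpose P *v (P *v (y - x)))"
      unfolding log_pot_grad_def t_def[symmetric] by (simp add: abs_mult)
    also have "\<dots> \<le> 2 * prof_B / R\<^sup>2 * (b * R)"
    proof (rule mult_mono)
      show "2 * \<bar>prof_h t\<bar> / R\<^sup>2 \<le> 2 * prof_B / R\<^sup>2" using prof_B(2)[of t] by (intro divide_right_mono) auto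
      have "norm (transpose P *v (P *v (y - x))) \<le> b * norm (P *v (y - x))" by (rule transpose_bound[OF assms(3)])
      also have "\<dots> \<le> b * R" using 1[OF False] assms(2) by (intro mult_left_mono) auto
      finally show "norm (transpose P *v (P *v (y - x))) \<le> b * R" .
    qed (use prof_B(1) in auto)
    also have "\<dots> = 2 * prof_B * b / R" using assms(1) by (simp add: power2_eq_square)
    finally show ?thesis .
  qed
qed

text \<open>The factor 2 / R^2 is what the divergence identity produces; it makes the weight scale
  invariant. The total mass is \<open>ring_mass P\<close> rather than 1, the same for every centre
  and every radius.\<close>

definition ring_mean :: "real^2^2 \<Rightarrow> real^2 \<Rightarrow> real \<Rightarrow> (real^2 \<Rightarrow> real) \<Rightarrow> real" where
  "ring_mean P x R u = 2 / R\<^sup>2 * (\<integral>y. u y * prof_w ((norm (P *v (y - x)))\<^sup>2 / R\<^sup>2) \<partial>lborel)"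

lemma prof_w_weight:
  fixes P :: "real^2^2"
  assumes "a > 0" "R > 0" "\<And>z. a * norm z \<le> norm (P *v z)"
  shows "continuous_on UNIV (\<lambda>y. prof_w ((norm (P *v (y - x)))\<^sup>2 / R\<^sup>2))"
    "\<And>y. y \<notin> cball x (R / a) \<Longrightarrow> prof_w ((norm (P *v (y - x)))\<^sup>2 / R\<^sup>2) = 0"
proof -
  show "continuous_on UNIV (\<lambda>y. prof_w ((norm (P *v (y - x)))\<^sup>2 / R\<^sup>2))"
    by (rule continuous_on_compose2[OF prof_w_simps(5)[of UNIV] continuous_quad]) auto
  show "\<And>y. y \<notin> cball x (R / a) \<Longrightarrow> prof_w ((norm (P *v (y - x)))\<^sup>2 / R\<^sup>2) = 0"
    by (rule prof_w_simps(4)[OF outside_quad[OF assms]])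
qed

lemma prof_w_weight_integrable:
  fixes P :: "real^2^2"
  assumes "a > 0" "R > 0" "\<And>z. a * norm z \<le> norm (P *v z)" "u \<in> borel_measurable borel" "\<And>y. \<bar>u y\<bar> \<le> M"
  shows "integrable lborel (\<lambda>y. u y * prof_w ((norm (P *v (y - x)))\<^sup>2 / R\<^sup>2))"
proof -
  have "integrable lborel (\<lambda>y. prof_w ((norm (P *v (y - x)))\<^sup>2 / R\<^sup>2))"
    by (rule compact_support_integrable[OF prof_w_weight(1)[OF assms(1-3)] compact_cball prof_w_weight(2)[OF assms(1-3)]])
  from integrable_bounded_scaleR[OF this assms(4,5)] show ?thesis by simp
qed

text \<open>With \<open>A P\<^sup>T P = 1\<close>, the field \<open>A \<nabla>\<psi>\<close> is radial and its divergence lives on two rings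
  only; this is the cancellation behind \<open>div (A \<nabla> log |P z|) = 0\<close>.\<close>

lemma log_pot_identity:
  fixes P :: "real^2^2"
  assumes a: "a > 0" and R: "R > 0" and Pa: "\<And>z. a * norm z \<le> norm (P *v z)" and S: "cball x (R / a) \<subseteq> S"
    and AP: "A ** (transpose P ** P) = mat 1" and sym: "transpose A = A"
    and u: "u \<in> borel_measurable borel" "\<And>x. \<bar>u x\<bar> \<le> M" and G: "integrable lborel G"
    and weak: "\<And>\<phi> g b. C1c S \<phi> g \<Longrightarrow> (\<integral>x. u x * (g x \<bullet> b) \<partial>lborel) = - (\<integral>x. (G x \<bullet> b) * \<phi> x \<partial>lborel)"
  shows "(\<integral>y. (A *v G y) \<bullet> log_pot_grad P x R y \<partial>lborel) = ring_mean P x (R / 2) u - ring_mean P x R u"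
proof -
  define t where "t y = (norm (P *v (y - x)))\<^sup>2 / R\<^sup>2" for y
  define B where "B y = transpose P *v (P *v (y - x))" for y
  \<comment> \<open>The components of the radial field \<open>prof_h (t y)\<close> times y - x.
    Testing the weak gradient of u with each of them and summing over the basis amounts to
    integrating u against the divergence of this field.\<close>
  define \<phi> where "\<phi> b y = prof_h (t y) * ((y - x) \<bullet> b)" for b y
  define g where "g b y = (prof_h' (t y) * ((y - x) \<bullet> b)) *\<^sub>R ((2 / R\<^sup>2) *\<^sub>R B y) + prof_h (t y) *\<^sub>R b" for b y
  have t0: "t y \<ge> 0" for y unfolding t_def by simp
  have tc: "continuous_on UNIV t" unfolding t_def using continuous_quad by blast
  have hc: "continuous_on UNIV (\<lambda>y. prof_h (t y))" "continuous_on UNIV (\<lambda>y. prof_h' (t y))"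
    by (rule continuous_on_compose2[OF prof_h_continuous(1) tc], use t0 in auto)
       (rule continuous_on_compose2[OF prof_h_continuous(2) tc], use t0 in auto)
  have C: "C1c S (\<phi> b) (g b)" for b
  proof (rule C1cI[OF _ compact_cball S])
    show "has_grad (\<phi> b) (g b)"
      unfolding has_grad_def
    proof (intro conjI allI)
      fix y
      have "(prof_h has_derivative (\<lambda>h. prof_h' (t y) * h)) (at (t y))"
        by (rule prof_h_deriv[unfolded has_field_derivative_def]) (use t0[of y] in simp)
      then have d1: "((\<lambda>y. prof_h (t y)) has_derivative (\<lambda>h. prof_h' (t y) * (((2 / R\<^sup>2) *\<^sub>R B y) \<bullet> h))) (at y)"
        unfolding t_def B_def using has_derivative_compose[OF quad_has_derivative] by blast
      have d2: "((\<lambda>y. (y - x) \<bullet> b) has_derivative (\<lambda>h. h \<bullet> b)) (at y)" by (auto intro!: derivative_eq_intros)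
      have "(\<phi> b has_derivative (\<lambda>h. prof_h (t y) * (h \<bullet> b) + prof_h' (t y) * (((2 / R\<^sup>2) *\<^sub>R B y) \<bullet> h) * ((y - x) \<bullet> b))) (at y)"
        unfolding \<phi>_def[abs_def] by (rule has_derivative_mult[OF d1 d2])
      moreover have "(\<lambda>h. prof_h (t y) * (h \<bullet> b) + prof_h' (t y) * (((2 / R\<^sup>2) *\<^sub>R B y) \<bullet> h) * ((y - x) \<bullet> b)) = (\<bullet>) (g b y)"
        by (rule ext) (simp add: g_def inner_add_left inner_commute[of b] mult_ac)
      ultimately show "(\<phi> b has_derivative (\<bullet>) (g b y)) (at y)" by simp
      show "continuous_on UNIV (g b)"
        unfolding g_def B_def by (intro continuous_intros hc continuous_PP)
    qed
    show "\<phi> b y = 0" if "y \<notin> cball x (R / a)" for y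
      using prof_h_outside(2)[OF outside_quad[OF a R Pa that]] unfolding \<phi>_def t_def by simp
  qed
  have Gb: "G \<in> borel_measurable borel" using G by auto
  have int\<phi>: "integrable lborel (\<lambda>y. (G y \<bullet> b) * \<phi> b y)" for b
  proof -
    obtain B0 where B0: "\<And>y. \<bar>\<phi> b y\<bar> \<le> B0" using C1c_bounds[OF C] by metis
    have "integrable lborel (\<lambda>y. \<phi> b y *\<^sub>R (G y \<bullet> b))"
      by (rule integrable_bounded_scaleR[OF integrable_inner_left[OF G] has_grad_borel(1)[OF C1c_has_grad[OF C]] B0])
    then show ?thesis by (simp add: mult.commute)
  qed
  have intg: "integrable lborel (\<lambda>y. u y * (g b y \<bullet> b))" for b
  proof -
    obtain K where K: "compact K" "\<And>y. y \<notin> K \<Longrightarrow> g b y = 0" using C[of b] unfolding C1c_def by blast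
    have "integrable lborel (g b)"
      by (rule compact_support_integrable[OF has_grad_D(2)[OF C1c_has_grad[OF C]] K])
    from integrable_bounded_scaleR[OF integrable_inner_left[OF this] u] show ?thesis by simp
  qed
  \<comment> \<open>The divergence of the radial field, evaluated by \<open>prof_relation\<close>:
    two ring weights with opposite signs. The value 2 of the sum over the basis is the
    dimension.\<close>
  have tr: "(\<Sum>b\<in>Basis. g b y \<bullet> b) = 4 * prof_w (4 * t y) - prof_w (t y)" for y
  proof -
    have Bz: "B y \<bullet> (y - x) = R\<^sup>2 * t y" unfolding B_def t_def using R adjoint_inner[of P "P *v (y - x)" "y - x"] by (simp add: power2_norm_eq_inner)
    have "(\<Sum>b\<in>Basis. g b y \<bullet> b) = prof_h' (t y) * (2 / R\<^sup>2) * (\<Sum>b\<in>Basis. ((y - x) \<bullet> b) * (B y \<bullet> b)) + prof_h (t y) * (\<Sum>b\<in>(Basis::(real^2) set). b \<bullet> b)"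
      by (simp add: g_def inner_add_left sum.distrib sum_distrib_left sum_divide_distrib mult_ac)
    also have "(\<Sum>b\<in>Basis. ((y - x) \<bullet> b) * (B y \<bullet> b)) = R\<^sup>2 * t y"
      using Bz euclidean_inner[of "B y" "y - x"] by (simp only: mult.commute[of "(y - x) \<bullet> _"])
    also have "(\<Sum>b\<in>(Basis::(real^2) set). b \<bullet> b) = 2" by simp
    finally show ?thesis using prof_relation[OF t0[of y]] R by (simp add: field_simps)
  qed
  have "(\<integral>y. u y * (4 * prof_w (4 * t y) - prof_w (t y)) \<partial>lborel) = (\<Sum>b\<in>Basis. \<integral>y. u y * (g b y \<bullet> b) \<partial>lborel)"
    using intg by (simp add: tr[symmetric] sum_distrib_left)
  also have "\<dots> = (\<Sum>b\<in>Basis. - (\<integral>y. (G y \<bullet> b) * \<phi> b y \<partial>lborel))" by (simp add: weak[OF C])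
  also have "\<dots> = - (\<integral>y. (\<Sum>b\<in>Basis. (G y \<bullet> b) * \<phi> b y) \<partial>lborel)" using int\<phi> by (simp add: sum_negf)
  also have "(\<lambda>y. \<Sum>b\<in>Basis. (G y \<bullet> b) * \<phi> b y) = (\<lambda>y. prof_h (t y) * (G y \<bullet> (y - x)))"
  proof
    fix y
    have "G y \<bullet> (y - x) = (\<Sum>b\<in>Basis. (G y \<bullet> b) * ((y - x) \<bullet> b))" by (rule euclidean_inner)
    then show "(\<Sum>b\<in>Basis. (G y \<bullet> b) * \<phi> b y) = prof_h (t y) * (G y \<bullet> (y - x))"
      by (simp only: \<phi>_def sum_distrib_left mult.left_commute)
  qed
  finally have e1: "(\<integral>y. u y * (4 * prof_w (4 * t y) - prof_w (t y)) \<partial>lborel) = - (\<integral>y. prof_h (t y) * (G y \<bullet> (y - x)) \<partial>lborel)" .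
  \<comment> \<open>By symmetry A moves onto the potential's gradient, and A P^T P = 1 turns that
    gradient into a multiple of y - x.\<close>
  have Ag: "(A *v G y) \<bullet> log_pot_grad P x R y = - (2 / R\<^sup>2) * (prof_h (t y) * (G y \<bullet> (y - x)))" for y
  proof -
    have "A *v B y = y - x" unfolding B_def using AP by (metis matrix_vector_mul_assoc matrix_vector_mul_lid)
    moreover have "(A *v G y) \<bullet> B y = G y \<bullet> (A *v B y)" using adjoint_inner[of A "G y" "B y"] by (simp add: sym)
    ultimately show ?thesis unfolding log_pot_grad_def t_def[symmetric] B_def[symmetric] by simp
  qed
  \<comment> \<open>Multiplying the quadratic variable by 4 halves the radius, so the two weights
    belong to the radii R/2 and R.\<close>
  have t4: "4 * t y = (norm (P *v (y - x)))\<^sup>2 / (R / 2)\<^sup>2" for y unfolding t_def using R by (simp add: power2_eq_square)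
  have R2: "R / 2 > 0" using R by simp
  have i1: "integrable lborel (\<lambda>y. u y * prof_w (4 * t y))" unfolding t4 by (rule prof_w_weight_integrable[OF a R2 Pa u])
  have i2: "integrable lborel (\<lambda>y. u y * prof_w (t y))" unfolding t_def by (rule prof_w_weight_integrable[OF a R Pa u])
  have "(\<integral>y. (A *v G y) \<bullet> log_pot_grad P x R y \<partial>lborel) = 2 / R\<^sup>2 * (\<integral>y. u y * (4 * prof_w (4 * t y) - prof_w (t y)) \<partial>lborel)"
    unfolding Ag e1 by simp
  also have "\<dots> = 2 / R\<^sup>2 * (4 * (\<integral>y. u y * prof_w (4 * t y) \<partial>lborel) - (\<integral>y. u y * prof_w (t y) \<partial>lborel))"
  proof -
    have "(\<lambda>y. u y * (4 * prof_w (4 * t y) - prof_w (t y))) = (\<lambda>y. 4 * (u y * prof_w (4 * t y)) - u y * prof_w (t y))"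
      by (simp add: fun_eq_iff algebra_simps)
    then show ?thesis using i1 i2 by simp
  qed
  also have "\<dots> = ring_mean P x (R / 2) u - ring_mean P x R u"
    unfolding ring_mean_def t4 t_def using R by (simp add: field_simps power2_eq_square)
  finally show ?thesis .
qed

section \<open>Mass of the ring weight\<close>

lemma lborel_integral_affine:
  fixes f :: "'a::euclidean_space \<Rightarrow> real"
  assumes "f \<in> borel_measurable borel" "c > 0"
  shows "(\<integral>x. f x \<partial>lborel) = c ^ DIM('a) * (\<integral>x. f (t + c *\<^sub>R x) \<partial>lborel)"
proof -
  have "(\<integral>x. f x \<partial>lborel) = (\<integral>x. f x \<partial>density (distr lborel borel (\<lambda>x. t + c *\<^sub>R x)) (\<lambda>_. ennreal (\<bar>c\<bar>^DIM('a))))"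
    using lborel_affine[of c t] assms by simp
  also have "\<dots> = (\<integral>x. \<bar>c\<bar>^DIM('a) *\<^sub>R f x \<partial>distr lborel borel (\<lambda>x. t + c *\<^sub>R x))"
    by (rule integral_density) (use assms in auto)
  also have "\<dots> = (\<integral>x. \<bar>c\<bar>^DIM('a) *\<^sub>R f (t + c *\<^sub>R x) \<partial>lborel)"
    by (rule integral_distr) (use assms in auto)
  finally show ?thesis using assms by simp
qed

definition ring_mass :: "real^2^2 \<Rightarrow> real" where
  "ring_mass P = 2 * (\<integral>z. prof_w ((norm (P *v z))\<^sup>2) \<partial>lborel)"

lemma ring_mean_const:
  fixes P :: "real^2^2"
  assumes "R > 0"
  shows "ring_mean P x R (\<lambda>y. c) = ring_mass P * c"
proof -
  have "continuous_on UNIV (\<lambda>y. prof_w ((norm (P *v (y - x)))\<^sup>2 / R\<^sup>2))"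
    by (rule continuous_on_compose2[OF prof_w_simps(5)[of UNIV] continuous_quad]) auto
  from lborel_integral_affine[OF continuous_on_imp_borel[OF this] assms, of x]
  have "(\<integral>y. prof_w ((norm (P *v (y - x)))\<^sup>2 / R\<^sup>2) \<partial>lborel) = R\<^sup>2 * (\<integral>z. prof_w ((norm (P *v z))\<^sup>2) \<partial>lborel)"
    using assms by (simp add: matrix_vector_mult_scaleR power_mult_distrib)
  then show ?thesis unfolding ring_mean_def ring_mass_def using assms by simp
qed

text \<open>A lower bound depending only on the upper bound of P, so that dividing by the mass later
  is uniform in the centre. The weight is at least 1/16 for |Pz|^2 between 1/2 and 3/4, and this set
  contains a ball.\<close>

lemma ring_mass_lower:
  fixes P :: "real^2^2"
  assumes a: "a > 0" and b: "b > 0" and Pa: "\<And>z. a * norm z \<le> norm (P *v z)" and Pb: "\<And>z. norm (P *v z) \<le> b * norm z"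
  shows "ring_mass P \<ge> (1/8) * (pi * (7 / (100 * b))\<^sup>2)"
proof -
  define e where "e = (axis 1 1 :: real^2)"
  have e: "norm e = 1" by (simp add: e_def norm_axis_1)
  have Pe: "norm (P *v e) > 0" using Pa[of e] a unfolding e by linarith
  \<comment> \<open>Within 7/100 of 79/100 the length |Pz| runs from 0.72 to 0.86, whose squares
    0.5184 and 0.7396 lie between 1/2 and 3/4.\<close>
  define z0 where "z0 = (79 / 100 / norm (P *v e)) *\<^sub>R e"
  have Pz0: "norm (P *v z0) = 79 / 100" unfolding z0_def using Pe by (simp add: matrix_vector_mult_scaleR)
  define S where "S = ball z0 (7 / (100 * b))"
  have c: "continuous_on UNIV (\<lambda>z. prof_w ((norm (P *v z))\<^sup>2))"
    using prof_w_weight(1)[OF a zero_less_one Pa, of 0] by simp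
  have w: "integrable lborel (\<lambda>z. prof_w ((norm (P *v z))\<^sup>2))"
    by (rule compact_support_integrable[OF c compact_cball[of 0 "1 / a"]])
       (use prof_w_weight(2)[OF a zero_less_one Pa, of _ 0] in auto)
  have "(1/16) * measure lborel S = (\<integral>z. indicator S z * (1/16) \<partial>lborel)" unfolding S_def by simp
  also have "\<dots> \<le> (\<integral>z. prof_w ((norm (P *v z))\<^sup>2) \<partial>lborel)"
  proof (rule integral_mono[OF _ w])
    show "integrable lborel (\<lambda>z. indicator S z * (1/16::real))"
      unfolding S_def by (rule integrable_mult_left) (auto simp: integrable_indicator_iff emeasure_lborel_ball_finite[unfolded infinity_ennreal_def])
    fix z
    show "indicator S z * (1/16) \<le> prof_w ((norm (P *v z))\<^sup>2)"
    proof (cases "z \<in> S")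
      case True
      then have "norm (z - z0) < 7 / (100 * b)" by (simp add: S_def dist_norm norm_minus_commute)
      then have "b * norm (z - z0) \<le> 7 / 100" using b by (simp add: field_simps)
      then have d: "norm (P *v z - P *v z0) \<le> 7 / 100" using Pb[of "z - z0"] by (simp add: matrix_vector_mult_diff_distrib)
      then have "72 / 100 \<le> norm (P *v z)" "norm (P *v z) \<le> 86 / 100"
        using Pz0 norm_triangle_ineq2[of "P *v z" "P *v z0"] norm_triangle_ineq3[of "P *v z" "P *v z0"] by auto
      then have "(72/100)\<^sup>2 \<le> (norm (P *v z))\<^sup>2" "(norm (P *v z))\<^sup>2 \<le> (86/100)\<^sup>2" by (intro power_mono; simp)+
      then have "1/16 \<le> prof_w ((norm (P *v z))\<^sup>2)" by (intro prof_w_simps(6)) (auto simp: power2_eq_square)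
      then show ?thesis using True by simp
    qed (use prof_w_simps(1) in simp)
  qed
  finally have "(1/16) * measure lborel S \<le> (\<integral>z. prof_w ((norm (P *v z))\<^sup>2) \<partial>lborel)" .
  then show ?thesis unfolding ring_mass_def S_def using b by (simp add: measure_ball_plane)
qed

section \<open>Pointwise oscillation bound\<close>

lemma integrable_imp_set_integrable:
  fixes f :: "'a \<Rightarrow> 'b::{banach, second_countable_topology}"
  assumes "integrable M f" "S \<in> sets M" shows "set_integrable M S f"
  unfolding set_integrable_def using assms by (intro integrable_mult_indicator)

lemma integrable_inner_bounded:
  fixes P v :: "'a::euclidean_space \<Rightarrow> 'b::euclidean_space"
  assumes P: "integrable lborel P" and v: "v \<in> borel_measurable borel" "\<And>x. norm (v x) \<le> C"
  shows "integrable lborel (\<lambda>x. P x \<bullet> v x)"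
proof (rule Bochner_Integration.integrable_bound)
  show "integrable lborel (\<lambda>x. C * norm (P x))" using P by simp
  have "P \<in> borel_measurable borel" using P by auto
  then show "(\<lambda>x. P x \<bullet> v x) \<in> borel_measurable lborel" using v(1) by simp
  have "\<bar>P x \<bullet> v x\<bar> \<le> \<bar>C * norm (P x)\<bar>" for x
  proof -
    have "\<bar>P x \<bullet> v x\<bar> \<le> norm (P x) * norm (v x)" by (rule Cauchy_Schwarz_ineq2)
    also have "\<dots> \<le> norm (P x) * C" using v(2) by (intro mult_left_mono) auto
    finally show ?thesis by (simp add: mult.commute)
  qed
  then show "AE x in lborel. norm (P x \<bullet> v x) \<le> norm (C * norm (P x))" by simp
qed

lemma has_grad_diff_const: "has_grad v g \<Longrightarrow> has_grad (\<lambda>x. v x - c) g"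
  unfolding has_grad_def by (auto intro!: derivative_eq_intros)

lemma C1c_mult:
  assumes v: "has_grad v gv" and f: "C1c S f g"
  shows "C1c S (\<lambda>x. v x * f x) (\<lambda>x. f x *\<^sub>R gv x + v x *\<^sub>R g x)"
proof -
  obtain K where K: "compact K" "K \<subseteq> S" "\<And>x. x \<notin> K \<Longrightarrow> f x = 0" using f unfolding C1c_def by blast
  show ?thesis
  proof (rule C1cI[OF _ K(1,2)])
    show "has_grad (\<lambda>x. v x * f x) (\<lambda>x. f x *\<^sub>R gv x + v x *\<^sub>R g x)"
      unfolding has_grad_def
    proof (intro conjI allI)
      fix x
      have "((\<lambda>x. v x * f x) has_derivative (\<lambda>h. v x * (g x \<bullet> h) + (gv x \<bullet> h) * f x)) (at x)"
        by (rule has_derivative_mult[OF has_grad_D(1)[OF v] has_grad_D(1)[OF C1c_has_grad[OF f]]])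
      then show "((\<lambda>x. v x * f x) has_derivative (\<bullet>) (f x *\<^sub>R gv x + v x *\<^sub>R g x)) (at x)"
        by (rule has_derivative_eq_rhs) (simp add: fun_eq_iff inner_add_left mult.commute add.commute)
      show "continuous_on UNIV (\<lambda>x. f x *\<^sub>R gv x + v x *\<^sub>R g x)"
        using has_grad_D[OF v] has_grad_D[OF C1c_has_grad[OF f]] by (intro continuous_intros) auto
    qed
  qed (use K(3) in simp)
qed

lemma norm_add_less_one:
  fixes x :: "real^2"
  assumes "cball x s \<subseteq> ball 0 1" "s \<ge> 0"
  shows "norm x + s < 1"
proof -
  define e where "e = (if x = 0 then axis 1 1 else sgn x)"
  have e: "norm e = 1" by (simp add: e_def norm_axis_1 norm_sgn)
  have "norm x *\<^sub>R e = x" by (simp add: e_def sgn_div_norm)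
  then have "x + s *\<^sub>R e = (norm x + s) *\<^sub>R e" by (simp add: scaleR_add_left)
  then have "norm (x + s *\<^sub>R e) = norm x + s" using e assms(2) by simp
  moreover have "x + s *\<^sub>R e \<in> ball 0 1" using assms e by (intro subsetD[OF assms(1)]) (simp add: dist_norm)
  ultimately show ?thesis by simp
qed

text \<open>Approximating gradients converge only on balls of radius \<rho> < 1; a closed ball
  contained in the open disk always leaves the room for such a \<rho>.\<close>

lemma cball_subset_smaller_ball:
  fixes x :: "real^2"
  assumes "cball x s \<subseteq> ball 0 1" "s \<ge> 0"
  obtains \<rho> where "\<rho> < 1" "cball x s \<subseteq> ball 0 \<rho>"
proof
  define \<rho> where "\<rho> = (1 + norm x + s) / 2"
  show "\<rho> < 1" using norm_add_less_one[OF assms] by (simp add: \<rho>_def)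
  show "cball x s \<subseteq> ball 0 \<rho>"
  proof
    fix y assume "y \<in> cball x s"
    then have "norm y \<le> norm x + s" using norm_triangle_ineq2[of y x] by (simp add: dist_norm norm_minus_commute)
    then show "y \<in> ball 0 \<rho>" using norm_add_less_one[OF assms] by (simp add: \<rho>_def)
  qed
qed

lemma closed_ring_set: "closed (ring_set P x s)"
  unfolding ring_set_def
  by (intro closed_Collect_conj closed_Collect_disj closed_Collect_le continuous_intros
      bounded_linear.continuous_on[OF matrix_vector_mul_bounded_linear])

lemma ring_set_subset:
  assumes "a > 0" "\<And>z. a * norm z \<le> norm (P *v z)"
  shows "ring_set P x s \<subseteq> cball x (2 * s / a)"
proof
  fix y assume "y \<in> ring_set P x s"
  then have "\<bar>(P *v (y - x)) $ 1\<bar> \<le> s" "\<bar>(P *v (y - x)) $ 2\<bar> \<le> s" by (auto simp: ring_set_def)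
  then have "norm (P *v (y - x)) \<le> 2 * s" using norm_le_l1_cart[of "P *v (y - x)"] by (simp add: sum_2)
  then have "a * norm (y - x) \<le> 2 * s" using assms(2)[of "y - x"] by linarith
  then show "y \<in> cball x (2 * s / a)" using assms(1) by (simp add: dist_norm norm_minus_commute field_simps)
qed

lemma ring_setI:
  assumes "s / 4 < norm (P *v (y - x))" "norm (P *v (y - x)) < s"
  shows "y \<in> ring_set P x s"
  using assms norm_le_l1_cart[of "P *v (y - x)"] component_le_norm_cart[of "P *v (y - x)" 1] component_le_norm_cart[of "P *v (y - x)" 2]
  unfolding ring_set_def by (auto simp: sum_2)

text \<open>With m the maximum norm of P(y - x), membership forces the radius of the k-th ring to
  lie between m and 8m, and such an interval contains at most four dyadic radii.\<close>

lemma ring_overlap: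
  assumes s: "s > 0"
  shows "(\<Sum>k<N. indicator (ring_set P x (s * (1/2) ^ k)) y) \<le> (4::real)"
proof -
  define m where "m = max \<bar>(P *v (y - x)) $ 1\<bar> \<bar>(P *v (y - x)) $ 2\<bar>"
  define Ks where "Ks = {k. k < N \<and> y \<in> ring_set P x (s * (1/2) ^ k)}"
  have mem: "s * (1/2) ^ k \<le> 8 * m \<and> m \<le> s * (1/2) ^ k" if "k \<in> Ks" for k
    using that unfolding Ks_def ring_set_def m_def by auto
  have fin: "finite Ks" unfolding Ks_def by simp
  have "(\<Sum>k<N. indicator (ring_set P x (s * (1/2) ^ k)) y) = (\<Sum>k<N. if k \<in> Ks then (1::real) else 0)"
    by (rule sum.cong) (auto simp: Ks_def indicator_def)
  also have "\<dots> = (\<Sum>k\<in>{..<N} \<inter> Ks. 1)" by (rule sum.inter_restrict[symmetric]) simp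
  also have "{..<N} \<inter> Ks = Ks" by (auto simp: Ks_def)
  also have "(\<Sum>k\<in>Ks. (1::real)) = real (card Ks)" by simp
  also have "card Ks \<le> 4"
  proof (cases "Ks = {}")
    case False
    define k0 where "k0 = Min Ks"
    have k0: "k0 \<in> Ks" "\<And>k. k \<in> Ks \<Longrightarrow> k0 \<le> k" unfolding k0_def using fin False by auto
    have "Ks \<subseteq> {k0..k0 + 3}"
    proof
      fix k assume k: "k \<in> Ks"
      have "k \<le> k0 + 3"
      proof (rule ccontr)
        assume "\<not> k \<le> k0 + 3"
        then have "(1/2) ^ k \<le> (1/2::real) ^ (k0 + 4)" by (intro power_decreasing) auto
        then have "s * (1/2) ^ k \<le> s * (1/2) ^ (k0 + 4)" using s by (intro mult_left_mono) auto
        also have "\<dots> = s * (1/2) ^ k0 / 16" by (simp add: power_add eval_nat_numeral)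
        finally have "m \<le> s * (1/2) ^ k0 / 16" using mem[OF k] by linarith
        moreover have "s * (1/2) ^ k0 \<le> 8 * m" using mem[OF k0(1)] by blast
        moreover have "s * (1/2) ^ k0 > 0" using s by simp
        ultimately show False by linarith
      qed
      then show "k \<in> {k0..k0 + 3}" using k0(2)[OF k] by simp
    qed
    then have "card Ks \<le> card {k0..k0 + 3}" by (intro card_mono) auto
    then show ?thesis by simp
  qed simp
  finally show ?thesis by simp
qed

lemma sum_sqrt_mult_le:
  assumes "\<And>k. k \<in> I \<Longrightarrow> 0 \<le> p k" "\<And>k. k \<in> I \<Longrightarrow> 0 \<le> q k"
  shows "(\<Sum>k\<in>I. sqrt (p k) * sqrt (q k)) \<le> sqrt (\<Sum>k\<in>I. p k) * sqrt (\<Sum>k\<in>I. q k)"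
proof -
  have "(\<Sum>k\<in>I. sqrt (p k) * sqrt (q k)) = (\<Sum>k\<in>I. \<bar>sqrt (p k)\<bar> * \<bar>sqrt (q k)\<bar>)" using assms by simp
  also have "\<dots> \<le> L2_set (\<lambda>k. sqrt (p k)) I * L2_set (\<lambda>k. sqrt (q k)) I" by (rule L2_set_mult_ineq)
  also have "\<dots> = sqrt (\<Sum>k\<in>I. p k) * sqrt (\<Sum>k\<in>I. q k)" unfolding L2_set_def using assms by (simp cong: sum.cong)
  finally show ?thesis .
qed

lemma norm_diff_square_le: "(norm (x - y))\<^sup>2 \<le> 2 * (norm x)\<^sup>2 + 2 * (norm y)\<^sup>2" for x y :: "'a::real_normed_vector"
proof -
  have "(norm (x - y))\<^sup>2 \<le> (norm x + norm y)\<^sup>2" by (intro power_mono norm_triangle_ineq4) simp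
  also have "\<dots> \<le> 2 * (norm x)\<^sup>2 + 2 * (norm y)\<^sup>2"
    using sum_squares_bound[of "norm x" "norm y"] by (simp add: power2_eq_square algebra_simps)
  finally show ?thesis .
qed

text \<open>Pointwise t is at most 1 + t^q, and f lives on a set of finite measure.\<close>

lemma Lp_imp_integrable:
  fixes f :: "'a::euclidean_space \<Rightarrow> 'b::euclidean_space"
  assumes f: "f \<in> borel_measurable borel" "\<And>x. x \<notin> ball 0 1 \<Longrightarrow> f x = 0"
    and i: "integrable lborel (\<lambda>x. norm (f x) powr q)" and q: "1 \<le> q"
  shows "integrable lborel f"
proof (rule Bochner_Integration.integrable_bound)
  have "integrable lborel (indicator (ball 0 1) :: 'a \<Rightarrow> real)"
    by (simp add: integrable_indicator_iff emeasure_lborel_ball_finite[unfolded infinity_ennreal_def])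
  then show "integrable lborel (\<lambda>x. indicator (ball 0 1) x + norm (f x) powr q)" using i by (rule Bochner_Integration.integrable_add)
  show "AE x in lborel. norm (f x) \<le> norm (indicator (ball 0 1) x + norm (f x) powr q)"
  proof (rule AE_I2)
    fix x
    have "t \<le> 1 + t powr q" if "0 \<le> t" for t :: real
    proof (cases "t \<le> 1")
      case False
      then have "t powr 1 \<le> t powr q" using q by (intro powr_mono) auto
      then show ?thesis using False by simp
    qed (simp add: add_increasing2)
    then show "norm (f x) \<le> norm (indicator (ball 0 1) x + norm (f x) powr q)"
      using f(2)[of x] by (cases "x \<in> ball 0 1") auto
  qed
qed (use f(1) in simp)

text \<open>Borel data on the whole plane, all vanishing outside the unit disk: \<open>U \<alpha>\<close> and \<open>G \<alpha>\<close> are the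
  components of the solution and their gradients, \<open>X\<close> stands for \<open>\<Omega>\<close>, \<open>D\<close> for its divergence and \<open>F\<close>
  for the right-hand side.  Only the Morrey decay of \<open>D\<close> and \<open>F\<close> is needed.\<close>

locale elliptic_system =
  fixes A :: "real^2 \<Rightarrow> real^2^2" and X :: "'m::finite \<Rightarrow> 'm \<Rightarrow> real^2 \<Rightarrow> real^2"
    and D :: "'m \<Rightarrow> 'm \<Rightarrow> real^2 \<Rightarrow> real" and F U :: "'m \<Rightarrow> real^2 \<Rightarrow> real"
    and G :: "'m \<Rightarrow> real^2 \<Rightarrow> real^2" and M l L H K \<beta> :: real
  assumes U_meas: "U \<alpha> \<in> borel_measurable borel" and U_bound: "\<bar>U \<alpha> x\<bar> \<le> M" and U_zero: "x \<notin> ball 0 1 \<Longrightarrow> U \<alpha> x = 0"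
    and G_meas: "G \<alpha> \<in> borel_measurable borel" and G_L2: "integrable lborel (\<lambda>x. (norm (G \<alpha> x))\<^sup>2)" and G_zero: "x \<notin> ball 0 1 \<Longrightarrow> G \<alpha> x = 0"
    and X_meas: "X \<alpha> \<gamma> \<in> borel_measurable borel" and X_L2: "integrable lborel (\<lambda>x. (norm (X \<alpha> \<gamma> x))\<^sup>2)" and X_zero: "x \<notin> ball 0 1 \<Longrightarrow> X \<alpha> \<gamma> x = 0"
    and D_int: "integrable lborel (D \<alpha> \<gamma>)" and F_int: "integrable lborel (F \<alpha>)"
    and D_ball: "0 < r \<Longrightarrow> r \<le> 1 \<Longrightarrow> (\<integral>y\<in>cball x r. \<bar>D \<alpha> \<gamma> y\<bar> \<partial>lborel) \<le> K * r powr \<beta>"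
    and F_ball: "0 < r \<Longrightarrow> r \<le> 1 \<Longrightarrow> (\<integral>y\<in>cball x r. \<bar>F \<alpha> y\<bar> \<partial>lborel) \<le> K * r powr \<beta>"
    and A_meas: "A \<in> borel_measurable borel"
    and A_sym: "x \<in> ball 0 1 \<Longrightarrow> transpose (A x) = A x"
    and A_lower: "x \<in> ball 0 1 \<Longrightarrow> l * (norm \<xi>)\<^sup>2 \<le> (A x *v \<xi>) \<bullet> \<xi>"
    and A_upper: "x \<in> ball 0 1 \<Longrightarrow> (A x *v \<xi>) \<bullet> \<xi> \<le> L * (norm \<xi>)\<^sup>2"
    and A_holder: "x \<in> ball 0 1 \<Longrightarrow> y \<in> ball 0 1 \<Longrightarrow> norm ((A x - A y) *v \<xi>) \<le> H * dist x y powr \<beta> * norm \<xi>"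
    and l_pos: "0 < l" and \<beta>_pos: "0 < \<beta>" and \<beta>_le: "\<beta> \<le> 1" and H_nonneg: "0 \<le> H" and K_nonneg: "0 \<le> K"
    and weak_U: "C1c (ball 0 1) \<phi> g \<Longrightarrow> (\<integral>x. U \<alpha> x * (g x \<bullet> b) \<partial>lborel) = - (\<integral>x. (G \<alpha> x \<bullet> b) * \<phi> x \<partial>lborel)"
    and weak_X: "C1c (ball 0 1) \<phi> g \<Longrightarrow> (\<integral>x. X \<alpha> \<gamma> x \<bullet> g x \<partial>lborel) = - (\<integral>x. D \<alpha> \<gamma> x * \<phi> x \<partial>lborel)"
    and weak_eq: "C1c (ball 0 1) \<phi> g \<Longrightarrow> (\<integral>x. (A x *v G \<alpha> x) \<bullet> g x \<partial>lborel)
       = (\<integral>x. ((\<Sum>\<gamma>\<in>UNIV. X \<alpha> \<gamma> x \<bullet> G \<gamma> x) + F \<alpha> x) * \<phi> x \<partial>lborel)"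
begin

section \<open>Uniform constants and local energies\<close>

definition "lo = sqrt l / L"
definition "hi = 1 / sqrt l"

lemma M_nonneg: "0 \<le> M" using order_trans[OF abs_ge_zero U_bound] .

lemma L_pos: "0 < L"
proof -
  have "l * (norm (axis 1 1 :: real^2))\<^sup>2 \<le> L * (norm (axis 1 1 :: real^2))\<^sup>2"
    using order_trans[OF A_lower[of 0 "axis 1 1"] A_upper[of 0 "axis 1 1"]] by simp
  then show ?thesis using l_pos by (simp add: norm_axis_1)
qed

lemma lo_pos: "0 < lo" and hi_pos: "0 < hi" using l_pos L_pos by (auto simp: lo_def hi_def)

text \<open>The factor for A frozen at x, chosen separately at each point. Across different points
  only the common bounds \<open>lo\<close> and \<open>hi\<close> are compared.\<close>

definition "Pm x = (SOME P :: real^2^2. A x ** (transpose P ** P) = mat 1 \<and> (\<forall>z. lo * norm z \<le> norm (P *v z)) \<and> (\<forall>z. norm (P *v z) \<le> hi * norm z))"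

lemma Pm:
  assumes "x \<in> ball 0 1"
  shows "A x ** (transpose (Pm x) ** Pm x) = mat 1" "lo * norm z \<le> norm (Pm x *v z)" "norm (Pm x *v z) \<le> hi * norm z"
proof -
  have "\<exists>P :: real^2^2. A x ** (transpose P ** P) = mat 1 \<and> (\<forall>z. lo * norm z \<le> norm (P *v z)) \<and> (\<forall>z. norm (P *v z) \<le> hi * norm z)"
    unfolding lo_def hi_def by (rule spd_factor[OF A_sym[OF assms] l_pos A_lower[OF assms] A_upper[OF assms]]) blast
  from someI_ex[OF this, folded Pm_def]
  show "A x ** (transpose (Pm x) ** Pm x) = mat 1" "lo * norm z \<le> norm (Pm x *v z)" "norm (Pm x *v z) \<le> hi * norm z" by blast+
qed

lemma A_bound: "x \<in> ball 0 1 \<Longrightarrow> norm (A x *v \<xi>) \<le> L * norm \<xi>"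
  by (rule spd_matrix_bound[OF A_sym])
     (use A_upper order_trans[OF _ A_lower] l_pos in auto)

lemma G_int: "integrable lborel (G \<alpha>)"
  by (rule Lp_imp_integrable[OF G_meas G_zero, where q = 2]) (use G_L2 in \<open>simp_all add: powr_numeral\<close>)
lemma X_int: "integrable lborel (X \<alpha> \<gamma>)"
  by (rule Lp_imp_integrable[OF X_meas X_zero, where q = 2]) (use X_L2 in \<open>simp_all add: powr_numeral\<close>)

definition En :: "(real^2) set \<Rightarrow> real" where "En S = (\<Sum>\<alpha>\<in>UNIV. \<integral>x\<in>S. (norm (G \<alpha> x))\<^sup>2 \<partial>lborel)"
definition Xn :: "(real^2) set \<Rightarrow> real" where "Xn S = (\<Sum>\<alpha>\<in>UNIV. \<Sum>\<gamma>\<in>UNIV. \<integral>x\<in>S. (norm (X \<alpha> \<gamma> x))\<^sup>2 \<partial>lborel)"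

lemma set_int_nonneg: "(\<And>x. 0 \<le> h x) \<Longrightarrow> 0 \<le> (\<integral>x\<in>S. h x \<partial>N)" for h :: "'z \<Rightarrow> real"
  unfolding set_lebesgue_integral_def by (simp add: Bochner_Integration.integral_nonneg)

lemma En_nonneg: "0 \<le> En S" and Xn_nonneg: "0 \<le> Xn S"
  unfolding En_def Xn_def by (auto intro!: sum_nonneg set_int_nonneg)

lemma G_set: "S \<in> sets borel \<Longrightarrow> set_integrable lborel S (\<lambda>x. (norm (G \<alpha> x))\<^sup>2)"
  by (rule integrable_imp_set_integrable[OF G_L2]) simp
lemma X_set: "S \<in> sets borel \<Longrightarrow> set_integrable lborel S (\<lambda>x. (norm (X \<alpha> \<gamma> x))\<^sup>2)"
  by (rule integrable_imp_set_integrable[OF X_L2]) simp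

lemma G_le_En: "(\<integral>x\<in>S. (norm (G \<alpha> x))\<^sup>2 \<partial>lborel) \<le> En S"
  unfolding En_def by (rule member_le_sum) (auto intro!: set_int_nonneg)

lemma X_le_Xn: "(\<integral>x\<in>S. (norm (X \<alpha> \<gamma> x))\<^sup>2 \<partial>lborel) \<le> Xn S"
proof -
  have "(\<integral>x\<in>S. (norm (X \<alpha> \<gamma> x))\<^sup>2 \<partial>lborel) \<le> (\<Sum>\<gamma>\<in>UNIV. \<integral>x\<in>S. (norm (X \<alpha> \<gamma> x))\<^sup>2 \<partial>lborel)"
    by (rule member_le_sum) (auto intro!: set_int_nonneg)
  also have "\<dots> \<le> Xn S" unfolding Xn_def by (rule member_le_sum) (auto intro!: sum_nonneg set_int_nonneg)
  finally show ?thesis .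
qed

lemma G_mono: "S \<subseteq> T \<Longrightarrow> S \<in> sets borel \<Longrightarrow> T \<in> sets borel \<Longrightarrow> (\<integral>x\<in>S. (norm (G \<alpha> x))\<^sup>2 \<partial>lborel) \<le> (\<integral>x\<in>T. (norm (G \<alpha> x))\<^sup>2 \<partial>lborel)"
  by (rule set_integral_mono_nonneg_set[OF G_set]) auto
lemma En_mono: "S \<subseteq> T \<Longrightarrow> S \<in> sets borel \<Longrightarrow> T \<in> sets borel \<Longrightarrow> En S \<le> En T"
  unfolding En_def by (intro sum_mono G_mono)
lemma Xn_mono: "S \<subseteq> T \<Longrightarrow> S \<in> sets borel \<Longrightarrow> T \<in> sets borel \<Longrightarrow> Xn S \<le> Xn T"
  unfolding Xn_def by (intro sum_mono set_integral_mono_nonneg_set[OF X_set]) auto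

lemma approximation:
  obtains v gv where "\<And>n::nat. has_grad (v n) (gv n)" "\<And>n x. \<bar>v n x\<bar> \<le> M"
    "AE x in lborel. (\<lambda>n. v n x) \<longlonglongrightarrow> U \<alpha> x"
    "\<And>\<rho>. \<rho> < 1 \<Longrightarrow> (\<lambda>n. \<integral>x\<in>ball 0 \<rho>. (norm (gv n x - G \<alpha> x))\<^sup>2 \<partial>lborel) \<longlonglongrightarrow> 0"
  by (rule H1_approximation[OF U_meas[of \<alpha>] U_bound[of \<alpha>] U_zero[of _ \<alpha>] G_int[of \<alpha>] G_L2[of \<alpha>]])
     (assumption, rule weak_U, assumption, rule that)

lemma grad_diff_set_integrable:
  assumes "has_grad v gv"
  shows "set_integrable lborel (ball 0 \<rho>) (\<lambda>x. (norm (gv x - G \<alpha> x))\<^sup>2)"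
proof -
  have c: "continuous_on UNIV (\<lambda>x. (norm (gv x))\<^sup>2)" using has_grad_D(2)[OF assms] by (intro continuous_intros)
  have "set_integrable lborel (ball 0 \<rho>) (\<lambda>x. (norm (gv x))\<^sup>2)"
    by (rule set_integrable_subset[OF set_integrable_compact[OF compact_cball[of 0 \<rho>] c]]) auto
  then have "set_integrable lborel (ball 0 \<rho>) (\<lambda>x. 2 * (norm (gv x))\<^sup>2 + 2 * (norm (G \<alpha> x))\<^sup>2)"
    using G_set[of "ball 0 \<rho>" \<alpha>] by (intro set_integral_add set_integrable_mult_right) auto
  then show ?thesis
    unfolding set_integrable_def
  proof (rule Bochner_Integration.integrable_bound)
    show "(\<lambda>x. indicator (ball 0 \<rho>) x *\<^sub>R (norm (gv x - G \<alpha> x))\<^sup>2) \<in> borel_measurable lborel"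
      using has_grad_borel(2)[OF assms] G_meas[of \<alpha>] by (intro borel_measurable_scaleR borel_measurable_indicator borel_measurable_power borel_measurable_norm borel_measurable_diff) auto
    show "AE x in lborel. norm (indicator (ball 0 \<rho>) x *\<^sub>R (norm (gv x - G \<alpha> x))\<^sup>2) \<le> norm (indicator (ball 0 \<rho>) x *\<^sub>R (2 * (norm (gv x))\<^sup>2 + 2 * (norm (G \<alpha> x))\<^sup>2))"
      using norm_diff_square_le by (intro AE_I2) (auto simp: indicator_def)
  qed
qed

text \<open>The passage from approximants to the solution in terms linear in the gradient: k cuts
  off to a ball where the gradients converge in L^2, and V is in L^2, so Cauchy-Schwarz
  applies.\<close>

lemma pairing_tendsto_zero:
  fixes V :: "real^2 \<Rightarrow> real^2"
  assumes V: "V \<in> borel_measurable borel" "integrable lborel (\<lambda>x. (norm (V x))\<^sup>2)"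
    and v: "\<And>n. has_grad (v n) (gv n)"
    and lim: "(\<lambda>n. \<integral>x\<in>ball 0 \<rho>. (norm (gv n x - G \<alpha> x))\<^sup>2 \<partial>lborel) \<longlonglongrightarrow> 0"
    and k: "k \<in> borel_measurable borel" "\<And>x. \<bar>k x\<bar> \<le> B" "\<And>x. x \<notin> ball 0 \<rho> \<Longrightarrow> k x = 0"
  shows "(\<lambda>n. \<integral>x. V x \<bullet> (k x *\<^sub>R gv n x) \<partial>lborel) \<longlonglongrightarrow> (\<integral>x. V x \<bullet> (k x *\<^sub>R G \<alpha> x) \<partial>lborel)"
    "integrable lborel (\<lambda>x. V x \<bullet> (k x *\<^sub>R G \<alpha> x))"
proof -
  have B: "B \<ge> 0" using order_trans[OF abs_ge_zero k(2)] .
  have gm: "gv n \<in> borel_measurable borel" for n using has_grad_borel[OF v] by blast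
  have bound: "\<bar>V x \<bullet> (k x *\<^sub>R w)\<bar> \<le> B * (indicator (ball 0 \<rho>) x * (\<bar>norm (V x)\<bar> * \<bar>norm w\<bar>))" for x w
  proof (cases "x \<in> ball 0 \<rho>")
    case True
    have "\<bar>V x \<bullet> (k x *\<^sub>R w)\<bar> = \<bar>k x\<bar> * \<bar>V x \<bullet> w\<bar>" by (simp add: abs_mult)
    also have "\<dots> \<le> B * (norm (V x) * norm w)" using k(2)[of x] B by (intro mult_mono Cauchy_Schwarz_ineq2) auto
    finally show ?thesis using True by simp
  qed (use k(3) in simp)
  have iV: "set_integrable lborel (ball 0 \<rho>) (\<lambda>x. (norm (V x))\<^sup>2)" by (rule integrable_imp_set_integrable[OF V(2)]) simp
  have m: "(\<lambda>x. norm (V x)) \<in> borel_measurable lborel" using V by simp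
  have b0: "ball (0::real^2) \<rho> \<in> sets lborel" by simp
  have dm: "(\<lambda>x. norm (gv n x - G \<alpha> x)) \<in> borel_measurable lborel" for n using gm G_meas by simp
  have dk: "(\<lambda>x. V x \<bullet> (k x *\<^sub>R (gv n x - G \<alpha> x))) \<in> borel_measurable lborel" for n using gm[of n] G_meas[of \<alpha>] V k(1) by simp
  note d = L2_product_bound[OF m dm dk b0 iV grad_diff_set_integrable[OF v] bound B]
  have Gk: "(\<lambda>x. V x \<bullet> (k x *\<^sub>R G \<alpha> x)) \<in> borel_measurable lborel" using G_meas[of \<alpha>] V k(1) by simp
  have nG: "(\<lambda>x. norm (G \<alpha> x)) \<in> borel_measurable lborel" using G_meas[of \<alpha>] by simp
  have sG: "set_integrable lborel (ball 0 \<rho>) (\<lambda>x. (norm (G \<alpha> x))\<^sup>2)" by (rule G_set) simp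
  show iG: "integrable lborel (\<lambda>x. V x \<bullet> (k x *\<^sub>R G \<alpha> x))" by (rule L2_product_bound(1)[OF m nG Gk b0 iV sG bound B])
  have eq: "(\<integral>x. V x \<bullet> (k x *\<^sub>R gv n x) \<partial>lborel) = (\<integral>x. V x \<bullet> (k x *\<^sub>R (gv n x - G \<alpha> x)) \<partial>lborel) + (\<integral>x. V x \<bullet> (k x *\<^sub>R G \<alpha> x) \<partial>lborel)" for n
    unfolding Bochner_Integration.integral_add[OF d(1)[of n] iG, symmetric]
    by (rule Bochner_Integration.integral_cong) (auto simp only: inner_add_right[symmetric] scaleR_add_right[symmetric] diff_add_cancel)
  have "(\<lambda>n. \<integral>x. V x \<bullet> (k x *\<^sub>R (gv n x - G \<alpha> x)) \<partial>lborel) \<longlonglongrightarrow> 0"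
  proof (rule tendsto_rabs_zero_cancel, rule tendsto_sandwich[OF _ _ tendsto_const])
    have "(\<lambda>n. B * (sqrt (\<integral>x\<in>ball 0 \<rho>. (norm (V x))\<^sup>2 \<partial>lborel) * sqrt (\<integral>x\<in>ball 0 \<rho>. (norm (gv n x - G \<alpha> x))\<^sup>2 \<partial>lborel))) \<longlonglongrightarrow> B * (sqrt (\<integral>x\<in>ball 0 \<rho>. (norm (V x))\<^sup>2 \<partial>lborel) * sqrt 0)"
      by (intro tendsto_intros lim)
    then show "(\<lambda>n. B * (sqrt (\<integral>x\<in>ball 0 \<rho>. (norm (V x))\<^sup>2 \<partial>lborel) * sqrt (\<integral>x\<in>ball 0 \<rho>. (norm (gv n x - G \<alpha> x))\<^sup>2 \<partial>lborel))) \<longlonglongrightarrow> 0" by simp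
  qed (use d(3) in auto)
  then show "(\<lambda>n. \<integral>x. V x \<bullet> (k x *\<^sub>R gv n x) \<partial>lborel) \<longlonglongrightarrow> (\<integral>x. V x \<bullet> (k x *\<^sub>R G \<alpha> x) \<partial>lborel)"
    unfolding eq using tendsto_add[OF _ tendsto_const] by fastforce
qed

lemma grad_energy_le:
  assumes v: "has_grad v gv" and S: "S \<subseteq> ball 0 \<rho>" "S \<in> sets borel" "bounded S"
  shows "(\<integral>x\<in>S. (norm (gv x))\<^sup>2 \<partial>lborel) \<le> 2 * (\<integral>x\<in>S. (norm (G \<alpha> x))\<^sup>2 \<partial>lborel) + 2 * (\<integral>x\<in>ball 0 \<rho>. (norm (gv x - G \<alpha> x))\<^sup>2 \<partial>lborel)"
proof -
  have iD: "set_integrable lborel S (\<lambda>x. (norm (gv x - G \<alpha> x))\<^sup>2)"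
    by (rule set_integrable_subset[OF grad_diff_set_integrable[OF v, of \<rho>]]) (use S in auto)
  have iG: "set_integrable lborel S (\<lambda>x. (norm (G \<alpha> x))\<^sup>2)" using S by (intro G_set)
  have c: "continuous_on UNIV (\<lambda>x. (norm (gv x))\<^sup>2)" using has_grad_D(2)[OF v] by (intro continuous_intros)
  have ig: "set_integrable lborel S (\<lambda>x. (norm (gv x))\<^sup>2)"
    by (rule set_integrable_subset[OF set_integrable_compact[OF compact_cball[of 0 \<rho>] c]]) (use S in \<open>auto simp: subset_eq less_imp_le\<close>)
  have "(\<integral>x\<in>S. (norm (gv x))\<^sup>2 \<partial>lborel) \<le> (\<integral>x\<in>S. 2 * (norm (G \<alpha> x))\<^sup>2 + 2 * (norm (gv x - G \<alpha> x))\<^sup>2 \<partial>lborel)"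
  proof (rule set_integral_mono[OF ig])
    show "set_integrable lborel S (\<lambda>x. 2 * (norm (G \<alpha> x))\<^sup>2 + 2 * (norm (gv x - G \<alpha> x))\<^sup>2)"
      using iG iD by (intro set_integral_add set_integrable_mult_right)
    show "(norm (gv x))\<^sup>2 \<le> 2 * (norm (G \<alpha> x))\<^sup>2 + 2 * (norm (gv x - G \<alpha> x))\<^sup>2" for x
      using norm_diff_square_le[of "G \<alpha> x" "G \<alpha> x - gv x"] by (simp add: norm_minus_commute)
  qed
  also have "\<dots> = 2 * (\<integral>x\<in>S. (norm (G \<alpha> x))\<^sup>2 \<partial>lborel) + 2 * (\<integral>x\<in>S. (norm (gv x - G \<alpha> x))\<^sup>2 \<partial>lborel)"
    using iG iD by (subst set_integral_add) (auto intro!: set_integrable_mult_right)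
  also have "(\<integral>x\<in>S. (norm (gv x - G \<alpha> x))\<^sup>2 \<partial>lborel) \<le> (\<integral>x\<in>ball 0 \<rho>. (norm (gv x - G \<alpha> x))\<^sup>2 \<partial>lborel)"
    by (rule set_integral_mono_nonneg_set[OF grad_diff_set_integrable[OF v]]) (use S in auto)
  finally show ?thesis by simp
qed

text \<open>Since \<open>div X\<close> is controlled, \<open>X \<bullet> \<nabla>u \<psi>\<close> may be replaced by \<open>- (u - c) X \<bullet> \<nabla>\<psi>\<close>, which
  lives on a ring; there the Poincare inequality bounds \<open>u - c\<close> by \<open>\<nabla>u\<close>.\<close>

lemma ring_estimate:
  obtains C where "C > 0"
    "\<And>x R (P :: real^2^2) \<alpha> \<gamma>. R > 0 \<Longrightarrow> (\<And>z. lo * norm z \<le> norm (P *v z)) \<Longrightarrow> (\<And>z. norm (P *v z) \<le> hi * norm z)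
      \<Longrightarrow> cball x (2 * R / lo) \<subseteq> ball 0 1
      \<Longrightarrow> \<bar>\<integral>y. X \<alpha> \<gamma> y \<bullet> (log_pot P x R y *\<^sub>R G \<gamma> y) \<partial>lborel\<bar>
          \<le> C * (sqrt (\<integral>y\<in>ring_set P x R. (norm (X \<alpha> \<gamma> y))\<^sup>2 \<partial>lborel) * sqrt (\<integral>y\<in>ring_set P x R. (norm (G \<gamma> y))\<^sup>2 \<partial>lborel)
            + (\<integral>y\<in>cball x (2 * R / lo). \<bar>D \<alpha> \<gamma> y\<bar> \<partial>lborel))"
proof -
  obtain Cp where Cp: "Cp > 0" "\<And>P x s. (\<And>z. lo * norm z \<le> norm (P *v z)) \<Longrightarrow> (\<And>z. norm (P *v z) \<le> hi * norm z) \<Longrightarrow> s > 0 \<Longrightarrow>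
       poincare (ring_set P x s) (Cp * s\<^sup>2)"
    using poincare_ring[OF lo_pos hi_pos] by metis
  \<comment> \<open>The first summand is the gradient bound of the potential times the Poincare
    constant, with a 2 under the root from replacing approximate gradients by G. The second is the
    bound 2M on v - c times the bound on the potential, in front of the divergence.\<close>
  define C where "C = 2 * prof_B * hi * sqrt (2 * Cp) + 2 * M * prof_B + 1"
  have C0: "C > 0" unfolding C_def using prof_B(1) hi_pos Cp(1) M_nonneg by (intro add_nonneg_pos add_nonneg_nonneg) auto
  show ?thesis
  proof (rule that[OF C0])
    fix x :: "real^2" and R :: real and P :: "real^2^2" and \<alpha> \<gamma> :: 'm
    assume R: "R > 0" and Pa: "\<And>z. lo * norm z \<le> norm (P *v z)" and Pb: "\<And>z. norm (P *v z) \<le> hi * norm z"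
      and sub: "cball x (2 * R / lo) \<subseteq> ball 0 1"
    define \<psi> where "\<psi> = log_pot P x R"
    define g\<psi> where "g\<psi> = log_pot_grad P x R"
    define S where "S = ring_set P x R"
    have s0: "2 * R / lo \<ge> 0" using R lo_pos by simp
    obtain \<rho> where \<rho>: "\<rho> < 1" "cball x (2 * R / lo) \<subseteq> ball 0 \<rho>" using cball_subset_smaller_ball[OF sub s0] by blast
    have c2: "cball x (R / lo) \<subseteq> cball x (2 * R / lo)" using R lo_pos by (intro subset_cball) (simp add: divide_right_mono)
    have \<psi>C: "C1c (ball 0 1) \<psi> g\<psi>" unfolding \<psi>_def g\<psi>_def
      by (rule log_pot_C1c[OF lo_pos R Pa]) (use c2 sub in blast)
    have Ssub: "S \<subseteq> cball x (2 * R / lo)" unfolding S_def by (rule ring_set_subset[OF lo_pos Pa])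
    have Sc: "compact S" unfolding S_def using closed_ring_set Ssub[unfolded S_def] compact_eq_bounded_closed bounded_subset bounded_cball by blast
    have Sb: "S \<in> sets borel" using Sc by (simp add: compact_imp_closed borel_closed)
    have \<psi>B: "\<bar>\<psi> y\<bar> \<le> prof_B" for y unfolding \<psi>_def by (rule log_pot_bound)
    have \<psi>0: "\<psi> y = 0" if "y \<notin> cball x (2 * R / lo)" for y
      unfolding \<psi>_def log_pot_def by (rule prof_f_large[OF outside_quad[OF lo_pos R Pa]]) (use c2 that in blast)
    note gb = log_pot_grad_bound[OF R less_imp_le[OF hi_pos] Pb, of x, folded g\<psi>_def]
    have g0: "g\<psi> y = 0" if "y \<notin> S" for y using ring_setI[OF gb(2,3)] that unfolding S_def by blast
    note bm\<psi> = has_grad_borel[OF C1c_has_grad[OF \<psi>C]]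
    obtain v gv where v: "\<And>n::nat. has_grad (v n) (gv n)" "\<And>n x. \<bar>v n x\<bar> \<le> M"
      and lim: "\<And>\<rho>. \<rho> < 1 \<Longrightarrow> (\<lambda>n. \<integral>x\<in>ball 0 \<rho>. (norm (gv n x - G \<gamma> x))\<^sup>2 \<partial>lborel) \<longlonglongrightarrow> 0"
      by (rule approximation[of \<gamma>]) blast
    define e where "e n = (\<integral>x\<in>ball 0 \<rho>. (norm (gv n x - G \<gamma> x))\<^sup>2 \<partial>lborel)" for n
    have e: "e \<longlonglongrightarrow> 0" unfolding e_def using lim[OF \<rho>(1)] by simp
    define sX where "sX = sqrt (\<integral>y\<in>S. (norm (X \<alpha> \<gamma> y))\<^sup>2 \<partial>lborel)"
    define EG where "EG = (\<integral>y\<in>S. (norm (G \<gamma> y))\<^sup>2 \<partial>lborel)"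
    define ID where "ID = (\<integral>y\<in>cball x (2 * R / lo). \<bar>D \<alpha> \<gamma> y\<bar> \<partial>lborel)"
    have EG0: "EG \<ge> 0" and sX0: "sX \<ge> 0" and ID0: "ID \<ge> 0"
      unfolding EG_def sX_def ID_def by (auto intro!: set_int_nonneg)
    have Db: "D \<alpha> \<gamma> \<in> borel_measurable borel" using D_int[of \<alpha> \<gamma>] by auto
    have est: "\<bar>\<integral>y. X \<alpha> \<gamma> y \<bullet> (\<psi> y *\<^sub>R gv n y) \<partial>lborel\<bar> \<le> 2 * prof_B * hi * sqrt Cp * sX * sqrt (2 * EG + 2 * e n) + 2 * M * prof_B * ID" for n
    proof -
      \<comment> \<open>The constant \<open>v n z\<close> varies with n. This is harmless, since it
        appears only in the integrated-by-parts form and the left-hand side that passes to the limit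
        is free of it.\<close>
      obtain z where z: "(\<integral>y\<in>S. (v n y - v n z)\<^sup>2 \<partial>lborel) \<le> Cp * R\<^sup>2 * (\<integral>y\<in>S. (norm (gv n y))\<^sup>2 \<partial>lborel)"
        using Cp(2)[OF Pa Pb R, of x] v(1)[of n] unfolding poincare_def S_def by blast
      define w where "w y = v n y - v n z" for y
      have w: "has_grad w (gv n)" unfolding w_def by (rule has_grad_diff_const[OF v(1)])
      have wM: "\<bar>w y\<bar> \<le> 2 * M" for y unfolding w_def using v(2)[of n y] v(2)[of n z] by linarith
      note bw = has_grad_borel[OF w]
      have wc: "continuous_on UNIV (\<lambda>y. (w y)\<^sup>2)" using has_grad_D(3)[OF w] by (intro continuous_intros)
      note CC = C1c_mult[OF w \<psi>C]
      have i1: "integrable lborel (\<lambda>y. X \<alpha> \<gamma> y \<bullet> (\<psi> y *\<^sub>R gv n y))"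
      proof -
        obtain K where K: "compact K" "\<And>y. y \<notin> K \<Longrightarrow> \<psi> y = 0" using \<psi>C unfolding C1c_def by blast
        have c: "continuous_on UNIV (\<lambda>y. \<psi> y *\<^sub>R gv n y)"
          using has_grad_D[OF w] has_grad_D[OF C1c_has_grad[OF \<psi>C]] by (intro continuous_intros) auto
        have k0: "\<psi> y *\<^sub>R gv n y = 0" if "y \<notin> K" for y using K(2)[OF that] by simp
        obtain b0 where b0: "\<And>y. norm (\<psi> y *\<^sub>R gv n y) \<le> b0" using compact_support_bounded[OF c K(1) k0] by blast
        show ?thesis by (rule integrable_inner_bounded[OF X_int continuous_on_imp_borel[OF c] b0])
      qed
      have kk: "\<bar>X \<alpha> \<gamma> y \<bullet> (w y *\<^sub>R g\<psi> y)\<bar> \<le> (2 * prof_B * hi / R) * (indicator S y * (\<bar>norm (X \<alpha> \<gamma> y)\<bar> * \<bar>w y\<bar>))" for y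
      proof (cases "y \<in> S")
        case True
        have "\<bar>X \<alpha> \<gamma> y \<bullet> (w y *\<^sub>R g\<psi> y)\<bar> = \<bar>w y\<bar> * \<bar>X \<alpha> \<gamma> y \<bullet> g\<psi> y\<bar>" by (simp add: abs_mult)
        also have "\<dots> \<le> \<bar>w y\<bar> * (norm (X \<alpha> \<gamma> y) * norm (g\<psi> y))" by (intro mult_left_mono Cauchy_Schwarz_ineq2) auto
        also have "\<dots> \<le> \<bar>w y\<bar> * (norm (X \<alpha> \<gamma> y) * (2 * prof_B * hi / R))" by (intro mult_left_mono gb(1)) auto
        finally show ?thesis using True by (simp add: mult_ac)
      qed (use g0 in simp)
      have cpos: "0 \<le> 2 * prof_B * hi / R" using prof_B(1) hi_pos R by simp
      note r2 = L2_product_bound[where M = lborel and S = S and f = "\<lambda>y. norm (X \<alpha> \<gamma> y)" and g = w and k = "\<lambda>y. X \<alpha> \<gamma> y \<bullet> (w y *\<^sub>R g\<psi> y)",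
          OF _ _ _ _ X_set[OF Sb] set_integrable_compact[OF Sc wc] kk cpos]
      have ms: "(\<lambda>y. norm (X \<alpha> \<gamma> y)) \<in> borel_measurable lborel" "w \<in> borel_measurable lborel"
        "(\<lambda>y. X \<alpha> \<gamma> y \<bullet> (w y *\<^sub>R g\<psi> y)) \<in> borel_measurable lborel" "S \<in> sets lborel"
        using X_meas bw bm\<psi> Sb by auto
      note r3 = r2[OF ms]
      have i3: "integrable lborel (\<lambda>y. D \<alpha> \<gamma> y * (w y * \<psi> y))"
      proof -
        have "integrable lborel (\<lambda>y. (w y * \<psi> y) *\<^sub>R D \<alpha> \<gamma> y)"
        proof (rule integrable_bounded_scaleR[OF D_int])
          show "\<bar>w y * \<psi> y\<bar> \<le> 2 * M * prof_B" for y unfolding abs_mult using wM \<psi>B M_nonneg by (intro mult_mono) auto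
        qed (use bw bm\<psi> in simp)
        then show ?thesis by (simp add: mult.commute)
      qed
      \<comment> \<open>The weak divergence of X is tested with w \<psi>. This is the integration by
        parts, and it is carried out for the C^1 approximant because U itself is no admissible
        factor.\<close>
      have "(\<integral>y. X \<alpha> \<gamma> y \<bullet> (\<psi> y *\<^sub>R gv n y + w y *\<^sub>R g\<psi> y) \<partial>lborel) = - (\<integral>y. D \<alpha> \<gamma> y * (w y * \<psi> y) \<partial>lborel)"
        by (rule weak_X[OF CC])
      then have eq: "(\<integral>y. X \<alpha> \<gamma> y \<bullet> (\<psi> y *\<^sub>R gv n y) \<partial>lborel) = - (\<integral>y. X \<alpha> \<gamma> y \<bullet> (w y *\<^sub>R g\<psi> y) \<partial>lborel) - (\<integral>y. D \<alpha> \<gamma> y * (w y * \<psi> y) \<partial>lborel)"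
        using i1 r3(1) by (simp add: inner_add_right)
      have D1: "\<bar>\<integral>y. D \<alpha> \<gamma> y * (w y * \<psi> y) \<partial>lborel\<bar> \<le> (\<integral>y. 2 * M * prof_B * (indicator (cball x (2 * R / lo)) y *\<^sub>R \<bar>D \<alpha> \<gamma> y\<bar>) \<partial>lborel)"
      proof (rule order_trans[OF integral_abs_bound], rule integral_mono)
        show "integrable lborel (\<lambda>y. \<bar>D \<alpha> \<gamma> y * (w y * \<psi> y)\<bar>)" using i3 by (rule integrable_abs)
        show "integrable lborel (\<lambda>y. 2 * M * prof_B * (indicator (cball x (2 * R / lo)) y *\<^sub>R \<bar>D \<alpha> \<gamma> y\<bar>))"
          using integrable_imp_set_integrable[OF integrable_abs[OF D_int], of "cball x (2 * R / lo)"] unfolding set_integrable_def by (intro integrable_mult_right) auto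
        fix y
        show "\<bar>D \<alpha> \<gamma> y * (w y * \<psi> y)\<bar> \<le> 2 * M * prof_B * (indicator (cball x (2 * R / lo)) y *\<^sub>R \<bar>D \<alpha> \<gamma> y\<bar>)"
        proof (cases "y \<in> cball x (2 * R / lo)")
          case True
          have "\<bar>w y\<bar> * \<bar>\<psi> y\<bar> \<le> 2 * M * prof_B" using wM \<psi>B M_nonneg by (intro mult_mono) auto
          then have "\<bar>D \<alpha> \<gamma> y\<bar> * (\<bar>w y\<bar> * \<bar>\<psi> y\<bar>) \<le> \<bar>D \<alpha> \<gamma> y\<bar> * (2 * M * prof_B)" by (rule mult_left_mono) simp
          then show ?thesis using True by (simp add: abs_mult mult_ac)
        qed (use \<psi>0 in simp)
      qed
      then have D2: "\<bar>\<integral>y. D \<alpha> \<gamma> y * (w y * \<psi> y) \<partial>lborel\<bar> \<le> 2 * M * prof_B * ID" unfolding ID_def set_lebesgue_integral_def by simp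
      have "sqrt (\<integral>y\<in>S. (w y)\<^sup>2 \<partial>lborel) \<le> sqrt (Cp * R\<^sup>2 * (2 * EG + 2 * e n))"
      proof (rule real_sqrt_le_mono)
        have "(\<integral>y\<in>S. (norm (gv n y))\<^sup>2 \<partial>lborel) \<le> 2 * EG + 2 * e n"
          unfolding EG_def e_def by (rule grad_energy_le[OF v(1) _ Sb compact_imp_bounded[OF Sc]]) (use Ssub \<rho> in blast)
        then have "Cp * R\<^sup>2 * (\<integral>y\<in>S. (norm (gv n y))\<^sup>2 \<partial>lborel) \<le> Cp * R\<^sup>2 * (2 * EG + 2 * e n)"
          using Cp(1) by (intro mult_left_mono) auto
        then show "(\<integral>y\<in>S. (w y)\<^sup>2 \<partial>lborel) \<le> Cp * R\<^sup>2 * (2 * EG + 2 * e n)" using z unfolding w_def by linarith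
      qed
      \<comment> \<open>The factor R from the Poincare inequality cancels the 1/R of the potential's
        gradient, so this term is scale invariant.\<close>
      also have "\<dots> = R * (sqrt Cp * sqrt (2 * EG + 2 * e n))" using R by (simp add: real_sqrt_mult)
      finally have "(2 * prof_B * hi / R) * (sX * sqrt (\<integral>y\<in>S. (w y)\<^sup>2 \<partial>lborel)) \<le> (2 * prof_B * hi / R) * (sX * (R * (sqrt Cp * sqrt (2 * EG + 2 * e n))))"
        using sX0 cpos by (intro mult_left_mono) auto
      also have "\<dots> = 2 * prof_B * hi * sqrt Cp * sX * sqrt (2 * EG + 2 * e n)" using R by simp
      finally show ?thesis using r3(3) D2 unfolding eq sX_def by linarith
    qed
    have "(\<lambda>n. \<integral>y. X \<alpha> \<gamma> y \<bullet> (\<psi> y *\<^sub>R gv n y) \<partial>lborel) \<longlonglongrightarrow> (\<integral>y. X \<alpha> \<gamma> y \<bullet> (\<psi> y *\<^sub>R G \<gamma> y) \<partial>lborel)"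
      by (rule pairing_tendsto_zero(1)[OF X_meas X_L2 v(1) lim[OF \<rho>(1)] bm\<psi>(1) \<psi>B]) (use \<psi>0 \<rho>(2) in blast)
    then have l1: "(\<lambda>n. \<bar>\<integral>y. X \<alpha> \<gamma> y \<bullet> (\<psi> y *\<^sub>R gv n y) \<partial>lborel\<bar>) \<longlonglongrightarrow> \<bar>\<integral>y. X \<alpha> \<gamma> y \<bullet> (\<psi> y *\<^sub>R G \<gamma> y) \<partial>lborel\<bar>"
      by (rule tendsto_rabs)
    have l2: "(\<lambda>n. 2 * prof_B * hi * sqrt Cp * sX * sqrt (2 * EG + 2 * e n) + 2 * M * prof_B * ID) \<longlonglongrightarrow> 2 * prof_B * hi * sqrt Cp * sX * sqrt (2 * EG + 2 * 0) + 2 * M * prof_B * ID"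
      by (intro tendsto_intros e)
    have "\<bar>\<integral>y. X \<alpha> \<gamma> y \<bullet> (\<psi> y *\<^sub>R G \<gamma> y) \<partial>lborel\<bar> \<le> 2 * prof_B * hi * sqrt Cp * sX * sqrt (2 * EG + 2 * 0) + 2 * M * prof_B * ID"
      by (rule LIMSEQ_le[OF l1 l2]) (use est in blast)
    also have "\<dots> = (2 * prof_B * hi * sqrt (2 * Cp)) * (sX * sqrt EG) + 2 * M * prof_B * ID"
      by (simp add: real_sqrt_mult)
    also have "\<dots> \<le> C * (sX * sqrt EG) + C * ID"
    proof (intro add_mono mult_right_mono)
      show "2 * prof_B * hi * sqrt (2 * Cp) \<le> C" unfolding C_def using prof_B(1) M_nonneg by simp
      have "0 \<le> 2 * prof_B * hi * sqrt (2 * Cp)" using prof_B(1) hi_pos Cp(1) by simp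
      then show "2 * M * prof_B \<le> C" unfolding C_def by simp
    qed (use sX0 EG0 ID0 in auto)
    finally show "\<bar>\<integral>y. X \<alpha> \<gamma> y \<bullet> (log_pot P x R y *\<^sub>R G \<gamma> y) \<partial>lborel\<bar>
          \<le> C * (sqrt (\<integral>y\<in>ring_set P x R. (norm (X \<alpha> \<gamma> y))\<^sup>2 \<partial>lborel) * sqrt (\<integral>y\<in>ring_set P x R. (norm (G \<gamma> y))\<^sup>2 \<partial>lborel)
            + (\<integral>y\<in>cball x (2 * R / lo). \<bar>D \<alpha> \<gamma> y\<bar> \<partial>lborel))"
      unfolding \<psi>_def[symmetric] sX_def EG_def ID_def S_def by (simp add: algebra_simps)
  qed
qed

end

section \<open>Increments of ring averages across scales\<close>

lemma borel_measurable_matrix_vector_mult: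
  fixes A :: "'a \<Rightarrow> real^'n^'m"
  assumes "A \<in> borel_measurable N" "v \<in> borel_measurable N"
  shows "(\<lambda>x. A x *v v x) \<in> borel_measurable N"
  by (rule borel_measurable_continuous_Pair[OF assms])
     (auto simp: matrix_vector_mult_def intro!: continuous_intros continuous_on_vec_lambda)

context elliptic_system
begin

lemma AG_meas: "(\<lambda>y. A y *v G \<alpha> y) \<in> borel_measurable borel"
  by (rule borel_measurable_matrix_vector_mult[OF A_meas G_meas])

lemma AG_bound: "norm (A y *v G \<alpha> y) \<le> L * norm (G \<alpha> y)"
  using A_bound[of y "G \<alpha> y"] G_zero[of y \<alpha>] by (cases "y \<in> ball 0 1") auto

lemma AG_int: "integrable lborel (\<lambda>y. A y *v G \<alpha> y)"
proof (rule Bochner_Integration.integrable_bound)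
  show "integrable lborel (\<lambda>y. L * norm (G \<alpha> y))" using G_int by simp
  show "AE y in lborel. norm (A y *v G \<alpha> y) \<le> norm (L * norm (G \<alpha> y))"
    using AG_bound L_pos by (intro AE_I2) (simp add: abs_mult)
qed (use AG_meas in simp)

lemma XG_int: "integrable lborel (\<lambda>y. X \<alpha> \<gamma> y \<bullet> G \<delta> y)"
proof (rule L2_product_bound(1)[where S = UNIV and c = 1 and f = "\<lambda>y. norm (X \<alpha> \<gamma> y)" and g = "\<lambda>y. norm (G \<delta> y)"])
  show "set_integrable lborel UNIV (\<lambda>x. (norm (X \<alpha> \<gamma> x))\<^sup>2)" "set_integrable lborel UNIV (\<lambda>x. (norm (G \<delta> x))\<^sup>2)"
    by (rule X_set G_set; simp)+
  show "\<bar>X \<alpha> \<gamma> x \<bullet> G \<delta> x\<bar> \<le> 1 * (indicator UNIV x * (\<bar>norm (X \<alpha> \<gamma> x)\<bar> * \<bar>norm (G \<delta> x)\<bar>))" for x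
    by (simp add: Cauchy_Schwarz_ineq2)
qed (use X_meas G_meas in simp_all)

lemma radius_le_one: "cball x r \<subseteq> ball 0 1 \<Longrightarrow> r \<ge> 0 \<Longrightarrow> r \<le> 1" for x :: "real^2"
  using norm_add_less_one[of x r] norm_ge_zero[of x] by linarith

lemma center_in: "cball x r \<subseteq> ball 0 1 \<Longrightarrow> r \<ge> 0 \<Longrightarrow> x \<in> ball 0 1" for x :: "real^2"
  by (auto simp: subset_eq)

lemma bounded_ball_integral:
  fixes h k :: "real^2 \<Rightarrow> real"
  assumes h: "integrable lborel h" and k: "\<And>y. \<bar>k y\<bar> \<le> B" "\<And>y. y \<notin> S \<Longrightarrow> k y = 0" "k \<in> borel_measurable borel" "S \<in> sets borel"
  shows "integrable lborel (\<lambda>y. h y * k y)" "\<bar>\<integral>y. h y * k y \<partial>lborel\<bar> \<le> B * (\<integral>y\<in>S. \<bar>h y\<bar> \<partial>lborel)"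
proof -
  show i: "integrable lborel (\<lambda>y. h y * k y)"
    using integrable_bounded_scaleR[OF h k(3,1)] by (simp add: mult.commute)
  have "\<bar>\<integral>y. h y * k y \<partial>lborel\<bar> \<le> (\<integral>y. B * (indicator S y *\<^sub>R \<bar>h y\<bar>) \<partial>lborel)"
  proof (rule order_trans[OF integral_abs_bound], rule integral_mono)
    show "integrable lborel (\<lambda>y. B * (indicator S y *\<^sub>R \<bar>h y\<bar>))"
      using integrable_imp_set_integrable[OF integrable_abs[OF h], of S] k(4) unfolding set_integrable_def by (intro integrable_mult_right) auto
    show "\<bar>h y * k y\<bar> \<le> B * (indicator S y *\<^sub>R \<bar>h y\<bar>)" for y
      using mult_left_mono[OF k(1)[of y], of "\<bar>h y\<bar>"] k(2)[of y] by (cases "y \<in> S") (auto simp: abs_mult mult.commute)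
  qed (use i in auto)
  then show "\<bar>\<integral>y. h y * k y \<partial>lborel\<bar> \<le> B * (\<integral>y\<in>S. \<bar>h y\<bar> \<partial>lborel)" unfolding set_lebesgue_integral_def by simp
qed

text \<open>The increment is the integral of the flux frozen at x against the potential's gradient.
  Replacing A(x) by A(y) costs R^\<beta> times an energy norm; the true flux is then given by the
  equation, whose critical part is covered by \<open>ring_estimate\<close> and whose remaining parts
  decay like R^\<beta>.\<close>

lemma scale_estimate:
  obtains C where "C > 0"
    "\<And>x R \<alpha>. R > 0 \<Longrightarrow> cball x (2 * R / lo) \<subseteq> ball 0 1
      \<Longrightarrow> \<bar>ring_mean (Pm x) x (R / 2) (U \<alpha>) - ring_mean (Pm x) x R (U \<alpha>)\<bar>
          \<le> C * (R powr \<beta> * sqrt (En (cball x (2 * R / lo))) + R powr \<beta>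
            + (\<Sum>\<gamma>\<in>UNIV. sqrt (\<integral>y\<in>ring_set (Pm x) x R. (norm (X \<alpha> \<gamma> y))\<^sup>2 \<partial>lborel) * sqrt (\<integral>y\<in>ring_set (Pm x) x R. (norm (G \<gamma> y))\<^sup>2 \<partial>lborel)))"
proof -
  obtain Cr where Cr: "Cr > 0"
    "\<And>x R (P :: real^2^2) \<alpha> \<gamma>. R > 0 \<Longrightarrow> (\<And>z. lo * norm z \<le> norm (P *v z)) \<Longrightarrow> (\<And>z. norm (P *v z) \<le> hi * norm z)
      \<Longrightarrow> cball x (2 * R / lo) \<subseteq> ball 0 1
      \<Longrightarrow> \<bar>\<integral>y. X \<alpha> \<gamma> y \<bullet> (log_pot P x R y *\<^sub>R G \<gamma> y) \<partial>lborel\<bar>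
          \<le> Cr * (sqrt (\<integral>y\<in>ring_set P x R. (norm (X \<alpha> \<gamma> y))\<^sup>2 \<partial>lborel) * sqrt (\<integral>y\<in>ring_set P x R. (norm (G \<gamma> y))\<^sup>2 \<partial>lborel)
            + (\<integral>y\<in>cball x (2 * R / lo). \<bar>D \<alpha> \<gamma> y\<bar> \<partial>lborel))"
    by (rule ring_estimate) blast
  \<comment> \<open>\<open>c1\<close> multiplies the Hoelder bound of A on the support, the gradient
    bound 2 \<open>prof_B\<close> \<open>hi\<close> / R and the square root of the area of the
    support, of order R. \<open>c2\<close> collects the decay of D and F on the ball of radius 2R /
    \<open>lo\<close>.\<close>
  define c1 where "c1 = H * (1 / lo) powr \<beta> * (2 * prof_B * hi) * (sqrt pi / lo)"
  define c2 where "c2 = Cr * (real CARD('m) * (K * (2 / lo) powr \<beta>)) + prof_B * (K * (2 / lo) powr \<beta>)"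
  define C where "C = c1 + c2 + Cr"
  have c0: "c1 \<ge> 0" "c2 \<ge> 0" unfolding c1_def c2_def
    using H_nonneg prof_B(1) hi_pos lo_pos Cr(1) K_nonneg by (auto intro!: mult_nonneg_nonneg add_nonneg_nonneg)
  show ?thesis
  proof (rule that[of C])
    show "C > 0" unfolding C_def using c0 Cr(1) by linarith
    fix x :: "real^2" and R :: real and \<alpha> :: 'm
    assume R: "R > 0" and sub: "cball x (2 * R / lo) \<subseteq> ball 0 1"
    have r2: "0 < 2 * R / lo" using R lo_pos by simp
    have xb: "x \<in> ball 0 1" by (rule center_in[OF sub]) (use r2 in simp)
    have r1: "2 * R / lo \<le> 1" by (rule radius_le_one[OF sub]) (use r2 in simp)
    define P where "P = Pm x"
    have Pa: "lo * norm z \<le> norm (P *v z)" and Pb: "norm (P *v z) \<le> hi * norm z" and AP: "A x ** (transpose P ** P) = mat 1" for z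
      unfolding P_def using Pm[OF xb] by auto
    define \<psi> where "\<psi> = log_pot P x R"
    define g\<psi> where "g\<psi> = log_pot_grad P x R"
    define S where "S = cball x (R / lo)"
    define T where "T = cball x (2 * R / lo)"
    have ST: "S \<subseteq> T" unfolding S_def T_def using R lo_pos by (intro subset_cball) (simp add: divide_right_mono)
    have Sball: "cball x (R / lo) \<subseteq> ball 0 1" using ST sub unfolding S_def T_def by blast
    have C: "C1c (ball 0 1) \<psi> g\<psi>" unfolding \<psi>_def g\<psi>_def by (rule log_pot_C1c[OF lo_pos R Pa Sball])
    note bm = has_grad_borel[OF C1c_has_grad[OF C]]
    note gb = log_pot_grad_bound[OF R less_imp_le[OF hi_pos] Pb, of x, folded g\<psi>_def]
    have \<psi>0: "\<psi> y = 0" if "y \<notin> S" for y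
      unfolding \<psi>_def log_pot_def by (rule prof_f_large[OF outside_quad[OF lo_pos R Pa]]) (use that in \<open>simp add: S_def\<close>)
    have g0: "g\<psi> y = 0" if "y \<notin> S" for y
    proof (rule ccontr)
      assume "g\<psi> y \<noteq> 0"
      then have "lo * norm (y - x) < R" using gb(3)[of y] Pa[of "y - x"] by linarith
      with that lo_pos show False by (simp add: S_def dist_norm norm_minus_commute field_simps)
    qed
    have \<psi>B: "\<bar>\<psi> y\<bar> \<le> prof_B" for y unfolding \<psi>_def by (rule log_pot_bound)
    have Sb: "S \<in> sets borel" "T \<in> sets borel" unfolding S_def T_def by auto
    have id: "(\<integral>y. (A x *v G \<alpha> y) \<bullet> g\<psi> y \<partial>lborel) = ring_mean P x (R / 2) (U \<alpha>) - ring_mean P x R (U \<alpha>)"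
      unfolding g\<psi>_def by (rule log_pot_identity[OF lo_pos R Pa Sball AP A_sym[OF xb] U_meas U_bound G_int weak_U])
    have iA: "integrable lborel (\<lambda>y. (A x *v G \<alpha> y) \<bullet> g\<psi> y)"
      by (rule integrable_inner_bounded[OF _ bm(2) gb(1)]) (rule integrable_bounded_linear[OF matrix_vector_mul_bounded_linear G_int])
    have iAy: "integrable lborel (\<lambda>y. (A y *v G \<alpha> y) \<bullet> g\<psi> y)" by (rule integrable_inner_bounded[OF AG_int bm(2) gb(1)])
    define c where "c = H * (R / lo) powr \<beta> * (2 * prof_B * hi / R)"
    have c: "c \<ge> 0" unfolding c_def using H_nonneg prof_B(1) hi_pos R by (intro mult_nonneg_nonneg) auto
    have kk: "\<bar>((A x - A y) *v G \<alpha> y) \<bullet> g\<psi> y\<bar> \<le> c * (indicator S y * (\<bar>1\<bar> * \<bar>norm (G \<alpha> y)\<bar>))" for y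
    proof (cases "y \<in> S")
      case True
      then have yb: "y \<in> ball 0 1" and d: "dist x y \<le> R / lo" using Sball unfolding S_def by auto
      have "\<bar>((A x - A y) *v G \<alpha> y) \<bullet> g\<psi> y\<bar> \<le> norm ((A x - A y) *v G \<alpha> y) * norm (g\<psi> y)" by (rule Cauchy_Schwarz_ineq2)
      also have "\<dots> \<le> (H * (R / lo) powr \<beta> * norm (G \<alpha> y)) * (2 * prof_B * hi / R)"
      proof (intro mult_mono gb(1))
        have "norm ((A x - A y) *v G \<alpha> y) \<le> H * dist x y powr \<beta> * norm (G \<alpha> y)" by (rule A_holder[OF xb yb])
        also have "\<dots> \<le> H * (R / lo) powr \<beta> * norm (G \<alpha> y)"
          using d H_nonneg \<beta>_pos by (intro mult_right_mono mult_left_mono powr_mono2) auto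
        finally show "norm ((A x - A y) *v G \<alpha> y) \<le> H * (R / lo) powr \<beta> * norm (G \<alpha> y)" .
      qed (use H_nonneg in auto)
      finally show ?thesis using True by (simp add: c_def mult_ac)
    qed (use g0 in simp)
    have fr: "\<bar>\<integral>y. ((A x - A y) *v G \<alpha> y) \<bullet> g\<psi> y \<partial>lborel\<bar> \<le> c * (sqrt (\<integral>y\<in>S. 1\<^sup>2 \<partial>lborel) * sqrt (\<integral>y\<in>S. (norm (G \<alpha> y))\<^sup>2 \<partial>lborel))"
    proof (rule L2_product_bound(3)[OF _ _ _ _ _ G_set[OF Sb(1)] kk c])
      show "(\<lambda>y. ((A x - A y) *v G \<alpha> y) \<bullet> g\<psi> y) \<in> borel_measurable lborel"
        using borel_measurable_matrix_vector_mult[of "\<lambda>y. A x - A y" borel "G \<alpha>"] A_meas G_meas[of \<alpha>] bm by simp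
      show "set_integrable lborel S (\<lambda>x. (1::real)\<^sup>2)" unfolding S_def by (rule set_integrable_compact) auto
    qed (use Sb G_meas in simp_all)
    have m: "(\<integral>y\<in>S. (1::real)\<^sup>2 \<partial>lborel) = pi * (R / lo)\<^sup>2"
      unfolding set_lebesgue_integral_def S_def using R lo_pos by (simp add: measure_cball_plane)
    have GE: "(\<integral>y\<in>S. (norm (G \<alpha> y))\<^sup>2 \<partial>lborel) \<le> En T" using G_mono[OF ST Sb, of \<alpha>] G_le_En[of T \<alpha>] by linarith
    have "c * (sqrt (\<integral>y\<in>S. 1\<^sup>2 \<partial>lborel) * sqrt (\<integral>y\<in>S. (norm (G \<alpha> y))\<^sup>2 \<partial>lborel)) \<le> c * ((sqrt pi * (R / lo)) * sqrt (En T))"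
      unfolding m using GE c R lo_pos by (intro mult_left_mono mult_mono) (auto simp: real_sqrt_mult intro!: set_int_nonneg)
    also have "\<dots> = c1 * (R powr \<beta> * sqrt (En T))"
      unfolding c_def c1_def using R lo_pos by (simp add: powr_divide field_simps)
    finally have t1: "\<bar>\<integral>y. ((A x - A y) *v G \<alpha> y) \<bullet> g\<psi> y \<partial>lborel\<bar> \<le> c1 * (R powr \<beta> * sqrt (En T))" using fr by linarith
    have split: "(\<integral>y. (A x *v G \<alpha> y) \<bullet> g\<psi> y \<partial>lborel) = (\<integral>y. ((A x - A y) *v G \<alpha> y) \<bullet> g\<psi> y \<partial>lborel) + (\<integral>y. (A y *v G \<alpha> y) \<bullet> g\<psi> y \<partial>lborel)"
      using iA iAy by (simp add: matrix_vector_mult_diff_rdistrib inner_diff_left)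
    have iX: "integrable lborel (\<lambda>y. X \<alpha> \<gamma> y \<bullet> (\<psi> y *\<^sub>R G \<gamma> y))" for \<gamma>
      using integrable_bounded_scaleR[OF XG_int bm(1) \<psi>B, of \<alpha> \<gamma> \<gamma>] by simp
    note FF = bounded_ball_integral[OF F_int \<psi>B _ bm(1) Sb(2), of \<alpha>]
    have \<psi>T: "\<psi> y = 0" if "y \<notin> T" for y using \<psi>0 that ST by blast
    have "(\<integral>y. (A y *v G \<alpha> y) \<bullet> g\<psi> y \<partial>lborel) = (\<integral>y. ((\<Sum>\<gamma>\<in>UNIV. X \<alpha> \<gamma> y \<bullet> G \<gamma> y) + F \<alpha> y) * \<psi> y \<partial>lborel)"
      by (rule weak_eq[OF C])
    also have "\<dots> = (\<integral>y. (\<Sum>\<gamma>\<in>UNIV. X \<alpha> \<gamma> y \<bullet> (\<psi> y *\<^sub>R G \<gamma> y)) + F \<alpha> y * \<psi> y \<partial>lborel)"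
      by (rule Bochner_Integration.integral_cong) (simp_all add: distrib_left sum_distrib_left mult.commute)
    also have "\<dots> = (\<Sum>\<gamma>\<in>UNIV. \<integral>y. X \<alpha> \<gamma> y \<bullet> (\<psi> y *\<^sub>R G \<gamma> y) \<partial>lborel) + (\<integral>y. F \<alpha> y * \<psi> y \<partial>lborel)"
      using iX FF(1)[OF \<psi>T] by (simp del: inner_scaleR_right)
    finally have eq: "(\<integral>y. (A y *v G \<alpha> y) \<bullet> g\<psi> y \<partial>lborel) = (\<Sum>\<gamma>\<in>UNIV. \<integral>y. X \<alpha> \<gamma> y \<bullet> (\<psi> y *\<^sub>R G \<gamma> y) \<partial>lborel) + (\<integral>y. F \<alpha> y * \<psi> y \<partial>lborel)" .
    define rg where "rg \<gamma> = sqrt (\<integral>y\<in>ring_set P x R. (norm (X \<alpha> \<gamma> y))\<^sup>2 \<partial>lborel) * sqrt (\<integral>y\<in>ring_set P x R. (norm (G \<gamma> y))\<^sup>2 \<partial>lborel)" for \<gamma>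
    have rg0: "rg \<gamma> \<ge> 0" for \<gamma> unfolding rg_def by (auto intro!: mult_nonneg_nonneg set_int_nonneg)
    define Kr where "Kr = K * (2 / lo) powr \<beta>"
    have Kr: "K * (2 * R / lo) powr \<beta> = Kr * R powr \<beta>" unfolding Kr_def using R lo_pos by (simp add: powr_mult powr_divide)
    have "\<bar>\<Sum>\<gamma>\<in>UNIV. \<integral>y. X \<alpha> \<gamma> y \<bullet> (\<psi> y *\<^sub>R G \<gamma> y) \<partial>lborel\<bar> \<le> (\<Sum>\<gamma>\<in>UNIV. Cr * (rg \<gamma> + Kr * R powr \<beta>))"
    proof (rule order_trans[OF sum_abs], rule sum_mono)
      fix \<gamma>
      have "\<bar>\<integral>y. X \<alpha> \<gamma> y \<bullet> (\<psi> y *\<^sub>R G \<gamma> y) \<partial>lborel\<bar> \<le> Cr * (rg \<gamma> + (\<integral>y\<in>T. \<bar>D \<alpha> \<gamma> y\<bar> \<partial>lborel))"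
        unfolding \<psi>_def rg_def T_def by (rule Cr(2)[OF R Pa Pb sub])
      also have "\<dots> \<le> Cr * (rg \<gamma> + Kr * R powr \<beta>)"
        using D_ball[OF r2 r1, of x \<alpha> \<gamma>] Cr(1) unfolding T_def Kr by (intro mult_left_mono add_left_mono) auto
      finally show "\<bar>\<integral>y. X \<alpha> \<gamma> y \<bullet> (\<psi> y *\<^sub>R G \<gamma> y) \<partial>lborel\<bar> \<le> Cr * (rg \<gamma> + Kr * R powr \<beta>)" .
    qed
    also have "\<dots> = Cr * (\<Sum>\<gamma>\<in>UNIV. rg \<gamma>) + Cr * (real CARD('m) * Kr) * R powr \<beta>"
      by (simp add: sum_distrib_left[symmetric] sum.distrib algebra_simps)
    finally have t2: "\<bar>\<Sum>\<gamma>\<in>UNIV. \<integral>y. X \<alpha> \<gamma> y \<bullet> (\<psi> y *\<^sub>R G \<gamma> y) \<partial>lborel\<bar> \<le> Cr * (\<Sum>\<gamma>\<in>UNIV. rg \<gamma>) + Cr * (real CARD('m) * Kr) * R powr \<beta>" .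
    have "\<bar>\<integral>y. F \<alpha> y * \<psi> y \<partial>lborel\<bar> \<le> prof_B * (\<integral>y\<in>T. \<bar>F \<alpha> y\<bar> \<partial>lborel)" by (rule FF(2)[OF \<psi>T])
    also have "\<dots> \<le> prof_B * (Kr * R powr \<beta>)"
      using F_ball[OF r2 r1, of x \<alpha>] prof_B(1) unfolding T_def Kr by (intro mult_left_mono) auto
    finally have t3: "\<bar>\<integral>y. F \<alpha> y * \<psi> y \<partial>lborel\<bar> \<le> prof_B * Kr * R powr \<beta>" by simp
    have "\<bar>ring_mean P x (R / 2) (U \<alpha>) - ring_mean P x R (U \<alpha>)\<bar> \<le> c1 * (R powr \<beta> * sqrt (En T)) + c2 * R powr \<beta> + Cr * (\<Sum>\<gamma>\<in>UNIV. rg \<gamma>)"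
      unfolding id[symmetric] split eq c2_def Kr_def[symmetric] using t1 t2 t3 by (simp add: algebra_simps)
    also have "\<dots> \<le> C * (R powr \<beta> * sqrt (En T)) + C * R powr \<beta> + C * (\<Sum>\<gamma>\<in>UNIV. rg \<gamma>)"
      unfolding C_def using c0 Cr(1) rg0 En_nonneg by (intro add_mono mult_right_mono) (auto intro: sum_nonneg)
    finally show "\<bar>ring_mean (Pm x) x (R / 2) (U \<alpha>) - ring_mean (Pm x) x R (U \<alpha>)\<bar>
          \<le> C * (R powr \<beta> * sqrt (En (cball x (2 * R / lo))) + R powr \<beta>
            + (\<Sum>\<gamma>\<in>UNIV. sqrt (\<integral>y\<in>ring_set (Pm x) x R. (norm (X \<alpha> \<gamma> y))\<^sup>2 \<partial>lborel) * sqrt (\<integral>y\<in>ring_set (Pm x) x R. (norm (G \<gamma> y))\<^sup>2 \<partial>lborel)))"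
      unfolding T_def rg_def P_def by (simp add: algebra_simps)
  qed
qed

lemma ring_sum_le:
  fixes h :: "real^2 \<Rightarrow> real"
  assumes h: "integrable lborel h" "\<And>y. 0 \<le> h y" and s: "s > 0"
    and S: "S \<in> sets borel" "\<And>k::nat. ring_set P x (s * (1/2) ^ k) \<subseteq> S"
  shows "(\<Sum>k<N. \<integral>y\<in>ring_set P x (s * (1/2) ^ k). h y \<partial>lborel) \<le> 4 * (\<integral>y\<in>S. h y \<partial>lborel)"
proof -
  have ri: "integrable lborel (\<lambda>y. indicator (ring_set P x (s * (1/2) ^ k)) y * h y)" for k
    using integrable_imp_set_integrable[OF h(1), of "ring_set P x (s * (1/2) ^ k)"] closed_ring_set unfolding set_integrable_def by (auto simp: borel_closed)
  have Si: "integrable lborel (\<lambda>y. indicator S y * h y)"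
    using integrable_imp_set_integrable[OF h(1), of S] S(1) unfolding set_integrable_def by simp
  have "(\<Sum>k<N. \<integral>y\<in>ring_set P x (s * (1/2) ^ k). h y \<partial>lborel) = (\<integral>y. (\<Sum>k<N. indicator (ring_set P x (s * (1/2) ^ k)) y * h y) \<partial>lborel)"
    unfolding set_lebesgue_integral_def real_scaleR_def by (rule Bochner_Integration.integral_sum[symmetric]) (rule ri)
  also have "\<dots> \<le> (\<integral>y. 4 * (indicator S y * h y) \<partial>lborel)"
  proof (rule integral_mono)
    fix y
    show "(\<Sum>k<N. indicator (ring_set P x (s * (1/2) ^ k)) y * h y) \<le> 4 * (indicator S y * h y)"
    proof (cases "y \<in> S")
      case True
      have "(\<Sum>k<N. indicator (ring_set P x (s * (1/2) ^ k)) y) * h y \<le> 4 * h y"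
        using ring_overlap[OF s] h(2) by (intro mult_right_mono) auto
      then show ?thesis using True by (simp only: sum_distrib_right indicator_simps mult_1)
    next
      case False
      then have "y \<notin> ring_set P x (s * (1/2) ^ k)" for k using S(2) by blast
      then show ?thesis using False by simp
    qed
    show "integrable lborel (\<lambda>y. \<Sum>k<N. indicator (ring_set P x (s * (1/2) ^ k)) y * h y)"
      by (intro Bochner_Integration.integrable_sum ri)
  qed (use Si in simp)
  finally show ?thesis unfolding set_lebesgue_integral_def by simp
qed

text \<open>The bound is uniform in N. The terms with R_k^\<beta> form a geometric series of ratio
  \<open>q\<close>, and the ring terms are summed by Cauchy-Schwarz in k, using that the rings
  overlap at most four times.\<close>

lemma telescoped_estimate:
  obtains C where "C > 0"
    "\<And>x R \<alpha> N. R > 0 \<Longrightarrow> R \<le> 1 \<Longrightarrow> cball x (2 * R / lo) \<subseteq> ball 0 1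
      \<Longrightarrow> \<bar>ring_mean (Pm x) x (R * (1/2) ^ N) (U \<alpha>) - ring_mean (Pm x) x R (U \<alpha>)\<bar>
          \<le> C * sqrt (En (cball x (2 * R / lo)) + R powr \<beta>)"
proof -
  obtain C0 where C0: "C0 > 0" and est: "\<And>x R \<alpha>. R > 0 \<Longrightarrow> cball x (2 * R / lo) \<subseteq> ball 0 1
      \<Longrightarrow> \<bar>ring_mean (Pm x) x (R / 2) (U \<alpha>) - ring_mean (Pm x) x R (U \<alpha>)\<bar>
          \<le> C0 * (R powr \<beta> * sqrt (En (cball x (2 * R / lo))) + R powr \<beta>
            + (\<Sum>\<gamma>\<in>UNIV. sqrt (\<integral>y\<in>ring_set (Pm x) x R. (norm (X \<alpha> \<gamma> y))\<^sup>2 \<partial>lborel) * sqrt (\<integral>y\<in>ring_set (Pm x) x R. (norm (G \<gamma> y))\<^sup>2 \<partial>lborel)))"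
    by (rule scale_estimate) blast
  define q where "q = (1/2::real) powr \<beta>"
  have q: "0 < q" "q < 1" unfolding q_def using powr_less_mono2[OF \<beta>_pos, of "1/2" 1] by auto
  \<comment> \<open>The 2 counts the two powers of R_k, each bounded by a times
    \<open>q ^ k\<close>. The 4 is the overlap number, which enters as a square root once for X and
    once for G.\<close>
  define C where "C = C0 * (2 / (1 - q)) + C0 * (real CARD('m) * (4 * sqrt (Xn UNIV)))"
  have C: "C > 0" unfolding C_def using C0 q Xn_nonneg by (intro add_pos_nonneg mult_pos_pos mult_nonneg_nonneg) auto
  show ?thesis
  proof (rule that[OF C])
    fix x :: "real^2" and R :: real and \<alpha> :: 'm and N :: nat
    assume R: "R > 0" "R \<le> 1" and sub: "cball x (2 * R / lo) \<subseteq> ball 0 1"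
    have xb: "x \<in> ball 0 1" by (rule center_in[OF sub]) (use R lo_pos in simp)
    define T where "T = cball x (2 * R / lo)"
    define P where "P = Pm x"
    define Rk where "Rk k = R * (1/2) ^ k" for k :: nat
    have Rk: "Rk k > 0" "Rk k \<le> R" for k unfolding Rk_def using R by (auto simp: power_le_one)
    have subk: "cball x (2 * Rk k / lo) \<subseteq> T" for k
      unfolding T_def using Rk[of k] lo_pos by (intro subset_cball divide_right_mono) auto
    have Tb: "T \<in> sets borel" unfolding T_def by simp
    define a where "a = sqrt (En T + R powr \<beta>)"
    have \<rho>: "0 < R powr \<beta>" "R powr \<beta> \<le> 1" using R \<beta>_pos by (auto simp: powr_le1)
    have a1: "sqrt (En T) \<le> a" unfolding a_def using \<rho> by simp
    \<comment> \<open>Since R is at most 1, the power does not exceed its own square root, so it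
      fits under the common root.\<close>
    have a2: "R powr \<beta> \<le> a"
    proof -
      have "R powr \<beta> * R powr \<beta> \<le> 1 * R powr \<beta>" using \<rho> by (intro mult_right_mono) auto
      then have "R powr \<beta> \<le> sqrt (R powr \<beta>)" using \<rho> by (intro real_le_rsqrt) (simp add: power2_eq_square)
      also have "\<dots> \<le> a" unfolding a_def using En_nonneg by simp
      finally show ?thesis .
    qed
    have a0: "a \<ge> 0" using a2 \<rho> by linarith
    define f where "f k = ring_mean P x (Rk k) (U \<alpha>)" for k
    define rg where "rg k \<gamma> = sqrt (\<integral>y\<in>ring_set P x (Rk k). (norm (X \<alpha> \<gamma> y))\<^sup>2 \<partial>lborel) * sqrt (\<integral>y\<in>ring_set P x (Rk k). (norm (G \<gamma> y))\<^sup>2 \<partial>lborel)" for k \<gamma>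
    have pk: "Rk k powr \<beta> = R powr \<beta> * q ^ k" for k
    proof -
      have "((1/2) ^ k :: real) powr \<beta> = q ^ k" unfolding q_def by (induction k) (simp_all add: powr_mult powr_divide)
      then show ?thesis unfolding Rk_def using R by (simp add: powr_mult)
    qed
    have step: "\<bar>f (Suc k) - f k\<bar> \<le> C0 * (2 * a * q ^ k) + C0 * (\<Sum>\<gamma>\<in>UNIV. rg k \<gamma>)" for k
    proof -
      have h: "Rk (Suc k) = Rk k / 2" unfolding Rk_def by simp
      have "\<bar>f (Suc k) - f k\<bar> \<le> C0 * (Rk k powr \<beta> * sqrt (En (cball x (2 * Rk k / lo))) + Rk k powr \<beta> + (\<Sum>\<gamma>\<in>UNIV. rg k \<gamma>))"
        unfolding f_def h rg_def P_def by (rule est[OF Rk(1) subset_trans[OF subk sub[folded T_def]]])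
      also have "\<dots> \<le> C0 * (a * q ^ k + a * q ^ k + (\<Sum>\<gamma>\<in>UNIV. rg k \<gamma>))"
      proof (intro mult_left_mono add_mono)
        have "sqrt (En (cball x (2 * Rk k / lo))) \<le> a"
          using real_sqrt_le_mono[OF En_mono[OF subk[of k] borel_closed[OF closed_cball] Tb]] a1 by linarith
        then have "R powr \<beta> * sqrt (En (cball x (2 * Rk k / lo))) \<le> 1 * a" using \<rho> En_nonneg by (intro mult_mono) auto
        then have "(R powr \<beta> * sqrt (En (cball x (2 * Rk k / lo)))) * q ^ k \<le> a * q ^ k" using q by (intro mult_right_mono) auto
        then show "Rk k powr \<beta> * sqrt (En (cball x (2 * Rk k / lo))) \<le> a * q ^ k" unfolding pk by (simp add: mult_ac)
        show "Rk k powr \<beta> \<le> a * q ^ k" unfolding pk using a2 q by (intro mult_right_mono) auto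
      qed (use C0 in auto)
      finally show ?thesis by (simp add: algebra_simps)
    qed
    have "\<bar>f N - f 0\<bar> \<le> (\<Sum>k<N. \<bar>f (Suc k) - f k\<bar>)"
      unfolding sum_lessThan_telescope[symmetric] by (rule sum_abs)
    also have "\<dots> \<le> (\<Sum>k<N. C0 * (2 * a * q ^ k) + C0 * (\<Sum>\<gamma>\<in>UNIV. rg k \<gamma>))" by (intro sum_mono step)
    also have "\<dots> = C0 * (2 * a) * (\<Sum>k<N. q ^ k) + C0 * (\<Sum>\<gamma>\<in>UNIV. \<Sum>k<N. rg k \<gamma>)"
      by (subst sum.swap) (simp add: sum.distrib sum_distrib_left mult_ac)
    also have "\<dots> \<le> C0 * (2 * a) * (1 / (1 - q)) + C0 * (\<Sum>\<gamma>\<in>(UNIV::'m set). 4 * sqrt (Xn UNIV) * a)"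
    proof (intro add_mono mult_left_mono sum_mono)
      have "(\<Sum>k<N. q ^ k) = (1 - q ^ N) / (1 - q)" using q by (simp add: sum_gp_strict)
      also have "\<dots> \<le> 1 / (1 - q)" using q by (intro divide_right_mono) auto
      finally show "(\<Sum>k<N. q ^ k) \<le> 1 / (1 - q)" .
      fix \<gamma> :: 'm
      have rs: "ring_set P x (R * (1/2) ^ k) \<subseteq> T" for k
        using ring_set_subset[OF lo_pos Pm(2)[OF xb], of x "Rk k"] subk[of k] unfolding P_def Rk_def by blast
      have "(\<Sum>k<N. rg k \<gamma>) \<le> sqrt (\<Sum>k<N. \<integral>y\<in>ring_set P x (Rk k). (norm (X \<alpha> \<gamma> y))\<^sup>2 \<partial>lborel) * sqrt (\<Sum>k<N. \<integral>y\<in>ring_set P x (Rk k). (norm (G \<gamma> y))\<^sup>2 \<partial>lborel)"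
        unfolding rg_def by (rule sum_sqrt_mult_le) (auto intro!: set_int_nonneg)
      also have "\<dots> \<le> sqrt (4 * Xn UNIV) * sqrt (4 * En T)"
      proof (intro mult_mono real_sqrt_le_mono)
        have "(\<Sum>k<N. \<integral>y\<in>ring_set P x (Rk k). (norm (X \<alpha> \<gamma> y))\<^sup>2 \<partial>lborel) \<le> 4 * (\<integral>y\<in>UNIV. (norm (X \<alpha> \<gamma> y))\<^sup>2 \<partial>lborel)"
          unfolding Rk_def by (rule ring_sum_le[OF X_L2 _ R(1)]) auto
        then show "(\<Sum>k<N. \<integral>y\<in>ring_set P x (Rk k). (norm (X \<alpha> \<gamma> y))\<^sup>2 \<partial>lborel) \<le> 4 * Xn UNIV"
          using X_le_Xn[of UNIV \<alpha> \<gamma>] by linarith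
        have "(\<Sum>k<N. \<integral>y\<in>ring_set P x (Rk k). (norm (G \<gamma> y))\<^sup>2 \<partial>lborel) \<le> 4 * (\<integral>y\<in>T. (norm (G \<gamma> y))\<^sup>2 \<partial>lborel)"
          unfolding Rk_def by (rule ring_sum_le[OF G_L2 _ R(1) Tb rs]) auto
        then show "(\<Sum>k<N. \<integral>y\<in>ring_set P x (Rk k). (norm (G \<gamma> y))\<^sup>2 \<partial>lborel) \<le> 4 * En T"
          using G_le_En[of T \<gamma>] by linarith
      qed (auto intro!: sum_nonneg set_int_nonneg simp: Xn_nonneg)
      also have "\<dots> = 4 * sqrt (Xn UNIV) * sqrt (En T)" by (simp add: real_sqrt_mult)
      also have "\<dots> \<le> 4 * sqrt (Xn UNIV) * a" using a1 Xn_nonneg by (intro mult_left_mono) auto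
      finally show "(\<Sum>k<N. rg k \<gamma>) \<le> 4 * sqrt (Xn UNIV) * a" .
    qed (use C0 a0 in auto)
    also have "\<dots> = C * a" unfolding C_def by (simp add: algebra_simps)
    finally show "\<bar>ring_mean (Pm x) x (R * (1/2) ^ N) (U \<alpha>) - ring_mean (Pm x) x R (U \<alpha>)\<bar>
          \<le> C * sqrt (En (cball x (2 * R / lo)) + R powr \<beta>)"
      unfolding f_def Rk_def P_def a_def T_def by simp
  qed
qed

end

text \<open>h vanishes up to 1/16, so the profile is flat near the centre. Together with its
  vanishing for t at least 1 this lets the same potential serve as the cutoff function of the energy
  inequality.\<close>

lemma prof_f_small: "-1/8 \<le> t \<Longrightarrow> t \<le> 1/16 \<Longrightarrow> prof_f t = prof_f 0"
proof -
  have z: "integral {-1/8..t} prof_h = 0" if "t \<le> 1/16" for t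
  proof -
    have "integral {-1/8..t} prof_h = integral {-1/8..t} (\<lambda>_. 0)"
      by (intro Henstock_Kurzweil_Integration.integral_cong) (use that in \<open>simp add: prof_h_outside\<close>)
    then show ?thesis by simp
  qed
  assume "-1/8 \<le> t" "t \<le> 1/16"
  then show ?thesis using z[of t] z[of 0] by (simp add: prof_f_def)
qed

lemma prof_f_0_pos: "0 < prof_f 0"
proof -
  have k: "1/64 \<le> prof_k (3/4)"
  proof -
    have "integral {1/2..3/4::real} (\<lambda>_. 1/16::real) \<le> integral {1/2..3/4} prof_w"
      by (intro integral_le integrable_continuous_real prof_w_simps) (auto intro: prof_w_simps)
    also have "\<dots> \<le> integral {-1..3/4} prof_w"
      by (intro integral_subset_le integrable_continuous_real prof_w_simps) (auto simp: prof_w_simps)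
    finally show ?thesis by (simp add: prof_k_def)
  qed
  \<comment> \<open>On this interval 4t is at least 3/4 while t is at most 1/4, so
    \<open>prof_k t = 0\<close> and only the lower bound for \<open>prof_k (3/4)\<close>
    counts.\<close>
  have h: "1/32 \<le> prof_h t" if t: "t \<in> {3/16..1/4}" for t
  proof -
    have "1/64 \<le> prof_k (4 * t) - prof_k t" using k prof_k_mono[of "3/4" "4 * t"] prof_k_small[of t] t by simp
    moreover have "(1/32) * (2 * t) \<le> 1/64" using t by simp
    ultimately have "(1/32) * (2 * t) \<le> prof_k (4 * t) - prof_k t" by linarith
    then show ?thesis unfolding prof_h_def using t by (subst pos_le_divide_eq) auto
  qed
  have "integral {3/16..1/4::real} (\<lambda>_. 1/32::real) \<le> integral {3/16..1/4} prof_h"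
    by (intro integral_le prof_h_integrable) (use h in auto)
  also have "\<dots> \<le> integral {-1/8..1} prof_h"
    by (intro integral_subset_le prof_h_integrable) (auto simp: prof_h_bounds)
  also have "\<dots> = prof_f 0"
  proof -
    have "integral {-1/8..0} prof_h = integral {-1/8..0::real} (\<lambda>_. 0)"
      by (intro Henstock_Kurzweil_Integration.integral_cong) (simp add: prof_h_outside)
    then show ?thesis by (simp add: prof_f_def)
  qed
  finally show ?thesis by simp
qed

context elliptic_system
begin

section \<open>From ring averages to pointwise values\<close>

lemma U_int: "integrable lborel (U \<alpha>)"
proof (rule Bochner_Integration.integrable_bound)
  show "integrable lborel (\<lambda>x::real^2. M * indicator (ball 0 1) x)"
    by (rule integrable_mult_right) (auto simp: integrable_indicator_iff emeasure_lborel_ball_finite[unfolded infinity_ennreal_def])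
  show "AE x in lborel. norm (U \<alpha> x) \<le> norm (M * indicator (ball 0 1) x)"
    using U_bound U_zero M_nonneg by (intro AE_I2) (auto simp: indicator_def)
qed (use U_meas in simp)

lemma Uc_square_set_integrable:
  assumes "compact S"
  shows "set_integrable lborel S (\<lambda>x. (U \<alpha> x - c)\<^sup>2)"
  unfolding set_integrable_def
proof (rule Bochner_Integration.integrable_bound)
  show "integrable lborel (\<lambda>x. indicator S x *\<^sub>R ((M + \<bar>c\<bar>)\<^sup>2))"
    using set_integrable_compact[OF assms, of "\<lambda>_. (M + \<bar>c\<bar>)\<^sup>2"] unfolding set_integrable_def by simp
  show "(\<lambda>x. indicator S x *\<^sub>R (U \<alpha> x - c)\<^sup>2) \<in> borel_measurable lborel"
    using assms U_meas[of \<alpha>] by (intro borel_measurable_scaleR borel_measurable_indicator) (auto simp: compact_imp_closed borel_closed)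
  show "AE x in lborel. norm (indicator S x *\<^sub>R (U \<alpha> x - c)\<^sup>2) \<le> norm (indicator S x *\<^sub>R ((M + \<bar>c\<bar>)\<^sup>2))"
  proof (rule AE_I2)
    fix x
    have "\<bar>U \<alpha> x - c\<bar> \<le> M + \<bar>c\<bar>" using U_bound[of \<alpha> x] by linarith
    then have "(U \<alpha> x - c)\<^sup>2 \<le> (M + \<bar>c\<bar>)\<^sup>2" using abs_le_square_iff[of "U \<alpha> x - c" "M + \<bar>c\<bar>"] M_nonneg by simp
    then show "norm (indicator S x *\<^sub>R (U \<alpha> x - c)\<^sup>2) \<le> norm (indicator S x *\<^sub>R ((M + \<bar>c\<bar>)\<^sup>2))"
      by (simp add: indicator_def)
  qed
qed

text \<open>The constants produced by the approximants need not converge, so no limit is taken: one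
  sufficiently late approximant is used, at the price of \<epsilon>. Its constant is a value of
  \<open>v n\<close>, hence bounded by M. The factor 256 is 2 * 64 * 2, from the ball inequality and
  two quadratic triangle inequalities.\<close>

lemma poincare_U:
  assumes s: "s > 0" and sub: "cball y0 s \<subseteq> ball 0 1" and \<epsilon>: "\<epsilon> > 0"
  obtains c where "\<bar>c\<bar> \<le> M" "(\<integral>x\<in>cball y0 s. (U \<alpha> x - c)\<^sup>2 \<partial>lborel) \<le> 256 * s\<^sup>2 * (\<integral>x\<in>cball y0 s. (norm (G \<alpha> x))\<^sup>2 \<partial>lborel) + \<epsilon>"
proof -
  obtain \<rho> where \<rho>: "\<rho> < 1" "cball y0 s \<subseteq> ball 0 \<rho>" using cball_subset_smaller_ball[OF sub] s by auto
  obtain v gv where v: "\<And>n::nat. has_grad (v n) (gv n)" "\<And>n x. \<bar>v n x\<bar> \<le> M"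
    and ae: "AE x in lborel. (\<lambda>n. v n x) \<longlonglongrightarrow> U \<alpha> x"
    and lim: "\<And>\<rho>. \<rho> < 1 \<Longrightarrow> (\<lambda>n. \<integral>x\<in>ball 0 \<rho>. (norm (gv n x - G \<alpha> x))\<^sup>2 \<partial>lborel) \<longlonglongrightarrow> 0"
    by (rule approximation[of \<alpha>]) blast
  define S where "S = cball y0 s"
  have S: "compact S" "S \<in> sets borel" "bounded S" unfolding S_def by auto
  have bs: "(a + b)\<^sup>2 \<le> 2 * a\<^sup>2 + 2 * b\<^sup>2" for a b :: real
    using sum_squares_bound[of a b] by (simp add: power2_eq_square algebra_simps)
  have im: "integrable lborel (\<lambda>x. indicator S x *\<^sub>R (4 * M\<^sup>2))"
    using set_integrable_compact[OF S(1), of "\<lambda>_. 4 * M\<^sup>2"] unfolding set_integrable_def by simp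
  have dv: "norm (indicator S x *\<^sub>R (U \<alpha> x - v n x)\<^sup>2) \<le> indicator S x *\<^sub>R (4 * M\<^sup>2)" for n x
  proof -
    have "\<bar>U \<alpha> x - v n x\<bar> \<le> 2 * M" using U_bound[of \<alpha> x] v(2)[of n x] by linarith
    then have "(U \<alpha> x - v n x)\<^sup>2 \<le> (2 * M)\<^sup>2" using abs_le_square_iff[of "U \<alpha> x - v n x" "2 * M"] M_nonneg by simp
    then show ?thesis by (simp add: indicator_def power_mult_distrib)
  qed
  have dm: "(\<lambda>x. indicator S x *\<^sub>R (U \<alpha> x - v n x)\<^sup>2) \<in> borel_measurable lborel" for n
    using S U_meas[of \<alpha>] has_grad_borel(1)[OF v(1)[of n]] by (intro borel_measurable_scaleR borel_measurable_indicator) auto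
  define d where "d n = (\<integral>x\<in>S. (U \<alpha> x - v n x)\<^sup>2 \<partial>lborel)" for n
  have "(\<lambda>n. \<integral>x. indicator S x *\<^sub>R (U \<alpha> x - v n x)\<^sup>2 \<partial>lborel) \<longlonglongrightarrow> (\<integral>x. 0 \<partial>(lborel :: (real^2) measure))"
  proof (rule integral_dominated_convergence[where w = "\<lambda>x. indicator S x *\<^sub>R (4 * M\<^sup>2)"])
    show "AE x in lborel. (\<lambda>n. indicator S x *\<^sub>R (U \<alpha> x - v n x)\<^sup>2) \<longlonglongrightarrow> 0"
      using ae
    proof eventually_elim
      fix x assume "(\<lambda>n. v n x) \<longlonglongrightarrow> U \<alpha> x"
      then have "(\<lambda>n. indicator S x *\<^sub>R (U \<alpha> x - v n x)\<^sup>2) \<longlonglongrightarrow> indicator S x *\<^sub>R (U \<alpha> x - U \<alpha> x)\<^sup>2"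
        by (intro tendsto_intros)
      then show "(\<lambda>n. indicator S x *\<^sub>R (U \<alpha> x - v n x)\<^sup>2) \<longlonglongrightarrow> 0" by simp
    qed
  qed (use im dm dv in auto)
  then have d: "d \<longlonglongrightarrow> 0" unfolding d_def set_lebesgue_integral_def by simp
  define e where "e n = (\<integral>x\<in>ball 0 \<rho>. (norm (gv n x - G \<alpha> x))\<^sup>2 \<partial>lborel)" for n
  have e: "e \<longlonglongrightarrow> 0" unfolding e_def using lim[OF \<rho>(1)] .
  have "(\<lambda>n. 2 * d n + 256 * s\<^sup>2 * e n) \<longlonglongrightarrow> 2 * 0 + 256 * s\<^sup>2 * 0" by (intro tendsto_intros d e)
  then have "(\<lambda>n. 2 * d n + 256 * s\<^sup>2 * e n) \<longlonglongrightarrow> 0" by simp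
  from order_tendstoD(2)[OF this \<epsilon>] obtain n where n: "2 * d n + 256 * s\<^sup>2 * e n < \<epsilon>"
    by (auto simp: eventually_sequentially)
  obtain z where z: "(\<integral>x\<in>S. (v n x - v n z)\<^sup>2 \<partial>lborel) \<le> 64 * s\<^sup>2 * (\<integral>x\<in>S. (norm (gv n x))\<^sup>2 \<partial>lborel)"
    using poincare_cball[OF s, of y0] v(1)[of n] unfolding poincare_def S_def by blast
  have i1: "set_integrable lborel S (\<lambda>x. (U \<alpha> x - v n x)\<^sup>2)"
    unfolding set_integrable_def by (rule Bochner_Integration.integrable_bound[OF im dm]) (use dv in \<open>auto intro: order_trans\<close>)
  have i2: "set_integrable lborel S (\<lambda>x. (v n x - v n z)\<^sup>2)"
    using has_grad_D(3)[OF v(1)] by (intro set_integrable_compact S continuous_intros)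
  have "(\<integral>x\<in>S. (U \<alpha> x - v n z)\<^sup>2 \<partial>lborel) \<le> (\<integral>x\<in>S. 2 * (U \<alpha> x - v n x)\<^sup>2 + 2 * (v n x - v n z)\<^sup>2 \<partial>lborel)"
  proof (rule set_integral_mono[OF Uc_square_set_integrable[OF S(1)]])
    show "set_integrable lborel S (\<lambda>x. 2 * (U \<alpha> x - v n x)\<^sup>2 + 2 * (v n x - v n z)\<^sup>2)"
      using i1 i2 by (intro set_integral_add set_integrable_mult_right)
    show "(U \<alpha> x - v n z)\<^sup>2 \<le> 2 * (U \<alpha> x - v n x)\<^sup>2 + 2 * (v n x - v n z)\<^sup>2" for x
      using bs[of "U \<alpha> x - v n x" "v n x - v n z"] by simp
  qed
  also have "\<dots> = 2 * d n + 2 * (\<integral>x\<in>S. (v n x - v n z)\<^sup>2 \<partial>lborel)"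
    unfolding d_def using i1 i2 by (subst set_integral_add) (auto intro!: set_integrable_mult_right)
  also have "\<dots> \<le> 2 * d n + 2 * (64 * s\<^sup>2 * (2 * (\<integral>x\<in>S. (norm (G \<alpha> x))\<^sup>2 \<partial>lborel) + 2 * e n))"
  proof -
    have "(\<integral>x\<in>S. (norm (gv n x))\<^sup>2 \<partial>lborel) \<le> 2 * (\<integral>x\<in>S. (norm (G \<alpha> x))\<^sup>2 \<partial>lborel) + 2 * e n"
      unfolding e_def by (rule grad_energy_le[OF v(1) _ S(2,3)]) (use \<rho> in \<open>simp add: S_def\<close>)
    then have "64 * s\<^sup>2 * (\<integral>x\<in>S. (norm (gv n x))\<^sup>2 \<partial>lborel) \<le> 64 * s\<^sup>2 * (2 * (\<integral>x\<in>S. (norm (G \<alpha> x))\<^sup>2 \<partial>lborel) + 2 * e n)"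
      by (intro mult_left_mono) auto
    then show ?thesis using z by linarith
  qed
  also have "\<dots> = 256 * s\<^sup>2 * (\<integral>x\<in>S. (norm (G \<alpha> x))\<^sup>2 \<partial>lborel) + (2 * d n + 256 * s\<^sup>2 * e n)"
    by (simp add: algebra_simps)
  finally have "(\<integral>x\<in>S. (U \<alpha> x - v n z)\<^sup>2 \<partial>lborel) \<le> 256 * s\<^sup>2 * (\<integral>x\<in>S. (norm (G \<alpha> x))\<^sup>2 \<partial>lborel) + \<epsilon>" using n by linarith
  with that[of "v n z"] v(2) show ?thesis unfolding S_def by blast
qed

text \<open>The ring weight is at most 1 and supported in a ball of comparable radius, so the ring
  average differs from \<open>ring_mass\<close> times the value by a multiple of the mean
  oscillation. The subsequence may depend on the point and on the component; only the set of points
  is common.\<close>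

lemma good_points:
  obtains good where "AE x in lborel. x \<in> good"
    "\<And>x \<alpha>. x \<in> good \<Longrightarrow> x \<in> ball 0 1 \<Longrightarrow> \<exists>r. strict_mono r \<and>
       (\<lambda>j. ring_mean (Pm x) x ((1/2) ^ (r j)) (U \<alpha>)) \<longlonglongrightarrow> ring_mass (Pm x) * U \<alpha> x"
proof -
  \<comment> \<open>Twice the radius R / \<open>lo\<close> of the closed ball supporting the weight
    at scale (1/2)^n, so that this support lies in the open ball.\<close>
  define s where "s n = 2 / lo * (1/2) ^ n" for n :: nat
  have s0: "s n > 0" for n unfolding s_def using lo_pos by simp
  have "(\<lambda>n. 2 / lo * (1/2) ^ n) \<longlonglongrightarrow> 2 / lo * 0" by (intro tendsto_intros) auto
  then have s1: "s \<longlonglongrightarrow> 0" unfolding s_def by simp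
  define av where "av \<alpha> r x n = (\<integral>y. indicator (ball 0 (s (r n))) y * \<bar>U \<alpha> (y + x) - U \<alpha> x\<bar> \<partial>lborel) / s (r n) ^ 2" for \<alpha> r x and n :: nat
  define good where "good = {x. \<forall>\<alpha>\<in>UNIV. \<exists>r. strict_mono r \<and> av \<alpha> r x \<longlonglongrightarrow> 0}"
  show ?thesis
  proof (rule that[of good])
    have "AE x in lborel. \<exists>r. strict_mono r \<and> av \<alpha> r x \<longlonglongrightarrow> 0" for \<alpha>
    proof -
      obtain r :: "nat \<Rightarrow> nat" where r: "strict_mono r"
        "AE x in lborel. (\<lambda>n. (\<integral>y. indicator (ball 0 (s (r n))) y * \<bar>U \<alpha> (y + x) - U \<alpha> x\<bar> \<partial>lborel) / s (r n) ^ DIM(real^2)) \<longlonglongrightarrow> 0"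
        by (rule lebesgue_points_subseq[OF U_int s0 s1, of \<alpha>]) blast
      show ?thesis using r(2) by eventually_elim (use r(1) in \<open>auto simp: av_def[abs_def]\<close>)
    qed
    then show "AE x in lborel. x \<in> good" unfolding good_def mem_Collect_eq by (subst AE_finite_all) auto
    fix x \<alpha> assume "x \<in> good" and x: "x \<in> ball 0 1"
    then obtain r where r: "strict_mono r" "av \<alpha> r x \<longlonglongrightarrow> 0" unfolding good_def by blast
    define P where "P = Pm x"
    note Pa = Pm(2)[OF x, folded P_def]
    have est: "\<bar>ring_mean P x ((1/2) ^ r j) (U \<alpha>) - ring_mass P * U \<alpha> x\<bar> \<le> 2 * (2 / lo)\<^sup>2 * av \<alpha> r x j" for j
    proof -
      define R where "R = (1/2::real) ^ r j"
      have R: "R > 0" unfolding R_def by simp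
      have sR: "s (r j) = 2 * R / lo" unfolding s_def R_def by simp
      define w where "w y = prof_w ((norm (P *v (y - x)))\<^sup>2 / R\<^sup>2)" for y
      have iU: "integrable lborel (\<lambda>y. U \<alpha> y * w y)" unfolding w_def by (rule prof_w_weight_integrable[OF lo_pos R Pa U_meas U_bound])
      have ic: "integrable lborel (\<lambda>y. U \<alpha> x * w y)" unfolding w_def by (rule prof_w_weight_integrable[OF lo_pos R Pa, where M = "\<bar>U \<alpha> x\<bar>"]) auto
      have i: "integrable lborel (\<lambda>y. (U \<alpha> y - U \<alpha> x) * w y)"
        using Bochner_Integration.integrable_diff[OF iU ic] by (simp add: left_diff_distrib)
      define f where "f y = indicator (ball x (s (r j))) y * \<bar>U \<alpha> y - U \<alpha> x\<bar>" for y
      have fi: "integrable lborel f"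
      proof -
        have "integrable lborel (\<lambda>y. indicator (ball x (s (r j))) y *\<^sub>R (U \<alpha> y))"
          by (rule integrable_mult_indicator[OF _ U_int]) simp
        moreover have "integrable lborel (\<lambda>y. indicator (ball x (s (r j))) y *\<^sub>R (U \<alpha> x))"
          unfolding real_scaleR_def by (rule integrable_mult_left) (auto simp: integrable_indicator_iff emeasure_lborel_ball_finite[unfolded infinity_ennreal_def])
        ultimately have "integrable lborel (\<lambda>y. \<bar>indicator (ball x (s (r j))) y *\<^sub>R (U \<alpha> y) - indicator (ball x (s (r j))) y *\<^sub>R (U \<alpha> x)\<bar>)"
          by (intro integrable_abs Bochner_Integration.integrable_diff)
        moreover have "\<bar>indicator (ball x (s (r j))) y *\<^sub>R (U \<alpha> y) - indicator (ball x (s (r j))) y *\<^sub>R (U \<alpha> x)\<bar> = f y" for y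
          unfolding f_def by (simp add: indicator_def)
        ultimately show ?thesis by simp
      qed
      have "ring_mean P x R (U \<alpha>) - ring_mass P * U \<alpha> x = ring_mean P x R (U \<alpha>) - ring_mean P x R (\<lambda>y. U \<alpha> x)"
        by (simp add: ring_mean_const[OF R])
      also have "\<dots> = 2 / R\<^sup>2 * (\<integral>y. (U \<alpha> y - U \<alpha> x) * w y \<partial>lborel)"
        unfolding ring_mean_def w_def[symmetric] left_diff_distrib Bochner_Integration.integral_diff[OF iU ic] by (simp add: right_diff_distrib)
      finally have eq: "ring_mean P x R (U \<alpha>) - ring_mass P * U \<alpha> x = 2 / R\<^sup>2 * (\<integral>y. (U \<alpha> y - U \<alpha> x) * w y \<partial>lborel)" .
      have "\<bar>\<integral>y. (U \<alpha> y - U \<alpha> x) * w y \<partial>lborel\<bar> \<le> (\<integral>y. f y \<partial>lborel)"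
      proof (rule order_trans[OF integral_abs_bound], rule integral_mono)
        fix y
        show "\<bar>(U \<alpha> y - U \<alpha> x) * w y\<bar> \<le> f y"
        proof (cases "y \<in> cball x (R / lo)")
          case True
          have "R / lo < s (r j)" unfolding sR using R lo_pos by (simp add: field_simps)
          then have "y \<in> ball x (s (r j))" using True by simp
          then show ?thesis unfolding f_def w_def using prof_w_simps(1,2)[of "(norm (P *v (y - x)))\<^sup>2 / R\<^sup>2"]
            by (simp add: abs_mult mult_left_le)
        next
          case False
          then have "w y = 0" unfolding w_def by (rule prof_w_weight(2)[OF lo_pos R Pa])
          then show ?thesis by (simp add: f_def)
        qed
      qed (use i fi in auto)
      also have "(\<integral>y. f y \<partial>lborel) = (\<integral>y. f (x + y) \<partial>lborel)" by (rule lborel_integral_translate[symmetric])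
      also have "\<dots> = s (r j) ^ 2 * av \<alpha> r x j"
      proof -
        have "f (x + y) = indicator (ball 0 (s (r j))) y * \<bar>U \<alpha> (y + x) - U \<alpha> x\<bar>" for y
          unfolding f_def by (simp add: indicator_def dist_norm add.commute)
        then show ?thesis unfolding av_def using s0[of "r j"] by simp
      qed
      finally have "2 / R\<^sup>2 * \<bar>\<integral>y. (U \<alpha> y - U \<alpha> x) * w y \<partial>lborel\<bar> \<le> 2 / R\<^sup>2 * (s (r j) ^ 2 * av \<alpha> r x j)"
        by (intro mult_left_mono) auto
      also have "\<dots> = 2 * (2 / lo)\<^sup>2 * av \<alpha> r x j" unfolding sR using R by (simp add: power_mult_distrib power_divide)
      finally show ?thesis unfolding R_def[symmetric] eq by (simp add: abs_mult)
    qed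
    have "(\<lambda>j. 2 * (2 / lo)\<^sup>2 * av \<alpha> r x j) \<longlonglongrightarrow> 2 * (2 / lo)\<^sup>2 * 0" by (intro tendsto_intros r)
    then have l0: "(\<lambda>j. 2 * (2 / lo)\<^sup>2 * av \<alpha> r x j) \<longlonglongrightarrow> 0" by simp
    have "(\<lambda>j. ring_mean P x ((1/2) ^ r j) (U \<alpha>) - ring_mass P * U \<alpha> x) \<longlonglongrightarrow> 0"
      by (rule Lim_null_comparison[OF _ l0]) (use est in \<open>auto intro!: always_eventually\<close>)
    then have "(\<lambda>j. ring_mean P x ((1/2) ^ r j) (U \<alpha>)) \<longlonglongrightarrow> ring_mass P * U \<alpha> x" by (rule LIM_zero_cancel)
    with r(1) show "\<exists>r. strict_mono r \<and> (\<lambda>j. ring_mean (Pm x) x ((1/2) ^ (r j)) (U \<alpha>)) \<longlonglongrightarrow> ring_mass (Pm x) * U \<alpha> x"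
      unfolding P_def by blast
  qed
qed

text \<open>For x within R of y0 the ball of radius 2R / \<open>lo\<close> around x, on which the
  ring estimates live, is contained in the ball of radius \<kappa> R around y0.\<close>

definition "\<kappa> = 1 + 2 / lo"

lemma \<kappa>_ge: "1 \<le> \<kappa>" unfolding \<kappa>_def using lo_pos by simp

text \<open>One constant c serves all good points of the ball of radius R: telescoping brings the
  value at x to the ring average at scale R, and the Poincare inequality on the ball of radius
  \<kappa> R compares that average with c. The integral bound for the same c is recorded because the
  energy inequality needs both.\<close>

lemma pointwise_bound:
  obtains good C where "C > 0" "AE x in lborel. x \<in> good"
    "\<And>i y0 \<alpha>. cball y0 (\<kappa> * (1/2) ^ i) \<subseteq> ball 0 1 \<Longrightarrow>
      \<exists>c. \<bar>c\<bar> \<le> M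
        \<and> (\<integral>x\<in>cball y0 (\<kappa> * (1/2) ^ i). (U \<alpha> x - c)\<^sup>2 \<partial>lborel) \<le> C * ((1/2) ^ i)\<^sup>2 * (En (cball y0 (\<kappa> * (1/2) ^ i)) + ((1/2) ^ i) powr \<beta>)
        \<and> (\<forall>x\<in>good. dist y0 x \<le> (1/2) ^ i \<longrightarrow> \<bar>U \<alpha> x - c\<bar> \<le> C * sqrt (En (cball y0 (\<kappa> * (1/2) ^ i)) + ((1/2) ^ i) powr \<beta>))"
proof -
  obtain good where good: "AE x in lborel. x \<in> good"
    "\<And>x \<alpha>. x \<in> good \<Longrightarrow> x \<in> ball 0 1 \<Longrightarrow> \<exists>r. strict_mono r \<and>
       (\<lambda>j. ring_mean (Pm x) x ((1/2) ^ (r j)) (U \<alpha>)) \<longlonglongrightarrow> ring_mass (Pm x) * U \<alpha> x"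
    by (rule good_points) blast
  obtain C1 where C1: "C1 > 0"
    "\<And>x R \<alpha> N. R > 0 \<Longrightarrow> R \<le> 1 \<Longrightarrow> cball x (2 * R / lo) \<subseteq> ball 0 1
      \<Longrightarrow> \<bar>ring_mean (Pm x) x (R * (1/2) ^ N) (U \<alpha>) - ring_mean (Pm x) x R (U \<alpha>)\<bar>
          \<le> C1 * sqrt (En (cball x (2 * R / lo)) + R powr \<beta>)"
    by (rule telescoped_estimate) blast
  define \<mu>0 where "\<mu>0 = (1/8) * (pi * (7 / (100 * hi))\<^sup>2)"
  have \<mu>0: "\<mu>0 > 0" unfolding \<mu>0_def using hi_pos by simp
  define C3 where "C3 = 256 * \<kappa>\<^sup>2 + 1"
  have C3: "C3 > 0" unfolding C3_def by (simp add: add_nonneg_pos)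
  \<comment> \<open>\<open>C1\<close> is the telescoping part. The rest is Cauchy-Schwarz for the
    ring average of U - c: the root of the area of the large ball times the root of the Poincare
    bound.\<close>
  define C4 where "C4 = C1 + 2 * sqrt pi * \<kappa> * sqrt C3"
  have C4: "C4 > 0" unfolding C4_def using C1(1) C3 \<kappa>_ge by (intro add_pos_nonneg) auto
  define C where "C = C3 + C4 / \<mu>0"
  have C: "C > 0" unfolding C_def using C3 C4 \<mu>0 by (simp add: add_pos_pos)
  show ?thesis
  proof (rule that[OF C good(1)])
    fix i :: nat and y0 :: "real^2" and \<alpha>
    define R where "R = (1/2::real) ^ i"
    have R: "R > 0" "R \<le> 1" unfolding R_def by (auto simp: power_le_one)
    assume "cball y0 (\<kappa> * (1/2) ^ i) \<subseteq> ball 0 1"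
    then have sub: "cball y0 (\<kappa> * R) \<subseteq> ball 0 1" by (simp add: R_def)
    define T where "T = cball y0 (\<kappa> * R)"
    have T: "compact T" "T \<in> sets borel" unfolding T_def by auto
    have kR: "\<kappa> * R > 0" using \<kappa>_ge R by (intro mult_pos_pos) auto
    define \<rho> where "\<rho> = R powr \<beta>"
    have \<rho>: "\<rho> > 0" unfolding \<rho>_def using R by simp
    define a where "a = sqrt (En T + \<rho>)"
    have a0: "a \<ge> 0" unfolding a_def using En_nonneg[of T] \<rho> by simp
    \<comment> \<open>The slack granted to the Poincare inequality is chosen of the size already
      present in the bound.\<close>
    have \<epsilon>: "R\<^sup>2 * \<rho> > 0" using R \<rho> by simp
    obtain c where c: "\<bar>c\<bar> \<le> M" "(\<integral>x\<in>T. (U \<alpha> x - c)\<^sup>2 \<partial>lborel) \<le> 256 * (\<kappa> * R)\<^sup>2 * (\<integral>x\<in>T. (norm (G \<alpha> x))\<^sup>2 \<partial>lborel) + R\<^sup>2 * \<rho>"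
      unfolding T_def by (rule poincare_U[OF kR sub \<epsilon>, of \<alpha>]) blast
    have "256 * (\<kappa> * R)\<^sup>2 * (\<integral>x\<in>T. (norm (G \<alpha> x))\<^sup>2 \<partial>lborel) \<le> 256 * (\<kappa> * R)\<^sup>2 * En T"
      using G_le_En by (intro mult_left_mono) auto
    then have "(\<integral>x\<in>T. (U \<alpha> x - c)\<^sup>2 \<partial>lborel) \<le> 256 * \<kappa>\<^sup>2 * R\<^sup>2 * En T + R\<^sup>2 * \<rho>"
      using c(2) by (simp add: power_mult_distrib)
    also have "\<dots> \<le> C3 * R\<^sup>2 * (En T + \<rho>)"
      unfolding C3_def using En_nonneg[of T] \<rho> by (simp add: algebra_simps)
    finally have cI: "(\<integral>x\<in>T. (U \<alpha> x - c)\<^sup>2 \<partial>lborel) \<le> C3 * R\<^sup>2 * (En T + \<rho>)" .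
    have pt: "\<bar>U \<alpha> x - c\<bar> \<le> C * a" if x: "x \<in> good" and d: "dist y0 x \<le> R" for x
    proof -
      have cb: "cball x (2 * R / lo) \<subseteq> T"
      proof
        fix y assume "y \<in> cball x (2 * R / lo)"
        then have "dist y0 y \<le> R + 2 * R / lo" using d dist_triangle[of y0 y x] by simp
        also have "\<dots> = \<kappa> * R" unfolding \<kappa>_def by (simp add: algebra_simps)
        finally show "y \<in> T" by (simp add: T_def)
      qed
      have cb2: "cball x (R / lo) \<subseteq> T"
        using subset_trans[OF _ cb, of "cball x (R / lo)"] R lo_pos by (simp add: subset_cball divide_right_mono)
      have csub: "cball x (2 * R / lo) \<subseteq> ball 0 1" using cb sub unfolding T_def by blast
      have xb: "x \<in> ball 0 1" by (rule center_in[OF csub]) (use R lo_pos in simp)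
      define P where "P = Pm x"
      note Pa = Pm(2)[OF xb, folded P_def] and Pb = Pm(3)[OF xb, folded P_def]
      obtain r where r: "strict_mono r" "(\<lambda>j. ring_mean P x ((1/2) ^ (r j)) (U \<alpha>)) \<longlonglongrightarrow> ring_mass P * U \<alpha> x"
        using good(2)[OF x xb, of \<alpha>] unfolding P_def by blast
      have "En (cball x (2 * R / lo)) + R powr \<beta> \<le> En T + \<rho>"
        unfolding \<rho>_def using En_mono[OF cb _ T(2)] by simp
      then have sa: "sqrt (En (cball x (2 * R / lo)) + R powr \<beta>) \<le> a" unfolding a_def by (rule real_sqrt_le_mono)
      have tl: "\<bar>ring_mean P x ((1/2) ^ n) (U \<alpha>) - ring_mean P x R (U \<alpha>)\<bar> \<le> C1 * a" if "n \<ge> i" for n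
      proof -
        have "(1/2::real) ^ n = R * (1/2) ^ (n - i)" unfolding R_def using that by (simp add: power_add[symmetric])
        then have "\<bar>ring_mean P x ((1/2) ^ n) (U \<alpha>) - ring_mean P x R (U \<alpha>)\<bar> \<le> C1 * sqrt (En (cball x (2 * R / lo)) + R powr \<beta>)"
          using C1(2)[OF R csub, of "n - i" \<alpha>] unfolding P_def by simp
        also have "\<dots> \<le> C1 * a" using sa C1(1) by (intro mult_left_mono) auto
        finally show ?thesis .
      qed
      have "\<bar>ring_mass P * U \<alpha> x - ring_mean P x R (U \<alpha>)\<bar> \<le> C1 * a"
      proof (rule tendsto_upperbound)
        show "(\<lambda>j. \<bar>ring_mean P x ((1/2) ^ (r j)) (U \<alpha>) - ring_mean P x R (U \<alpha>)\<bar>) \<longlonglongrightarrow> \<bar>ring_mass P * U \<alpha> x - ring_mean P x R (U \<alpha>)\<bar>"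
          by (intro tendsto_intros r)
        show "\<forall>\<^sub>F j in sequentially. \<bar>ring_mean P x ((1/2) ^ (r j)) (U \<alpha>) - ring_mean P x R (U \<alpha>)\<bar> \<le> C1 * a"
          unfolding eventually_sequentially
        proof (intro exI[of _ i] allI impI)
          fix j assume "i \<le> j"
          \<comment> \<open>A strictly increasing sequence of indices dominates the identity, so the
            scales (1/2)^(r j) eventually lie below R and are reached by telescoping from R.\<close>
          also have "j \<le> r j" by (rule seq_suble[OF r(1)])
          finally show "\<bar>ring_mean P x ((1/2) ^ (r j)) (U \<alpha>) - ring_mean P x R (U \<alpha>)\<bar> \<le> C1 * a" by (rule tl)
        qed
      qed simp
      moreover have "\<bar>ring_mean P x R (U \<alpha>) - ring_mass P * c\<bar> \<le> 2 * sqrt pi * \<kappa> * sqrt C3 * a"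
      proof -
        define w where "w y = prof_w ((norm (P *v (y - x)))\<^sup>2 / R\<^sup>2)" for y
        have iU: "integrable lborel (\<lambda>y. U \<alpha> y * w y)" unfolding w_def by (rule prof_w_weight_integrable[OF lo_pos R(1) Pa U_meas U_bound])
        have ic: "integrable lborel (\<lambda>y. c * w y)" unfolding w_def by (rule prof_w_weight_integrable[OF lo_pos R(1) Pa, where M = "\<bar>c\<bar>"]) auto
        have "ring_mean P x R (U \<alpha>) - ring_mass P * c = ring_mean P x R (U \<alpha>) - ring_mean P x R (\<lambda>y. c)"
          by (simp add: ring_mean_const[OF R(1)])
        also have "\<dots> = 2 / R\<^sup>2 * (\<integral>y. (U \<alpha> y - c) * w y \<partial>lborel)"
          unfolding ring_mean_def w_def[symmetric] left_diff_distrib Bochner_Integration.integral_diff[OF iU ic] by (simp add: right_diff_distrib)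
        finally have eq: "ring_mean P x R (U \<alpha>) - ring_mass P * c = 2 / R\<^sup>2 * (\<integral>y. (U \<alpha> y - c) * w y \<partial>lborel)" .
        have kk: "\<bar>(U \<alpha> y - c) * w y\<bar> \<le> 1 * (indicator T y * (\<bar>1\<bar> * \<bar>U \<alpha> y - c\<bar>))" for y
        proof (cases "y \<in> cball x (R / lo)")
          case True
          then have "y \<in> T" using cb2 by blast
          then show ?thesis unfolding w_def using prof_w_simps(1,2)[of "(norm (P *v (y - x)))\<^sup>2 / R\<^sup>2"] by (simp add: abs_mult mult_left_le)
        next
          case False
          then have "w y = 0" unfolding w_def by (rule prof_w_weight(2)[OF lo_pos R(1) Pa])
          then show ?thesis by simp
        qed
        have wm: "w \<in> borel_measurable borel" unfolding w_def by (rule continuous_on_imp_borel[OF prof_w_weight(1)[OF lo_pos R(1) Pa]])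
        have "\<bar>\<integral>y. (U \<alpha> y - c) * w y \<partial>lborel\<bar> \<le> 1 * (sqrt (\<integral>y\<in>T. 1\<^sup>2 \<partial>lborel) * sqrt (\<integral>y\<in>T. (U \<alpha> y - c)\<^sup>2 \<partial>lborel))"
        proof (rule L2_product_bound(3)[OF _ _ _ _ _ Uc_square_set_integrable[OF T(1)] kk])
          show "set_integrable lborel T (\<lambda>x. (1::real)\<^sup>2)" by (rule set_integrable_compact[OF T(1)]) auto
        qed (use T wm U_meas in auto)
        also have "\<dots> \<le> 1 * (sqrt pi * (\<kappa> * R) * (sqrt C3 * R * a))"
        proof (intro mult_left_mono mult_mono)
          have "(\<integral>y\<in>T. (1::real)\<^sup>2 \<partial>lborel) = pi * (\<kappa> * R)\<^sup>2"
            unfolding set_lebesgue_integral_def T_def using kR by (simp add: measure_cball_plane)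
          then show "sqrt (\<integral>y\<in>T. 1\<^sup>2 \<partial>lborel) \<le> sqrt pi * (\<kappa> * R)" using kR by (simp add: real_sqrt_mult)
          have "sqrt (\<integral>y\<in>T. (U \<alpha> y - c)\<^sup>2 \<partial>lborel) \<le> sqrt (C3 * R\<^sup>2 * (En T + \<rho>))" using cI by (rule real_sqrt_le_mono)
          also have "\<dots> = sqrt C3 * R * a" unfolding a_def using R by (simp add: real_sqrt_mult)
          finally show "sqrt (\<integral>y\<in>T. (U \<alpha> y - c)\<^sup>2 \<partial>lborel) \<le> sqrt C3 * R * a" .
        qed (use kR in \<open>auto intro!: set_int_nonneg\<close>)
        finally have "2 / R\<^sup>2 * \<bar>\<integral>y. (U \<alpha> y - c) * w y \<partial>lborel\<bar> \<le> 2 / R\<^sup>2 * (1 * (sqrt pi * (\<kappa> * R) * (sqrt C3 * R * a)))"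
          by (intro mult_left_mono) auto
        also have "\<dots> = 2 * sqrt pi * \<kappa> * sqrt C3 * a" using R by (simp add: power2_eq_square)
        finally show ?thesis unfolding eq by (simp add: abs_mult)
      qed
      ultimately have "\<bar>ring_mass P * U \<alpha> x - ring_mass P * c\<bar> \<le> C4 * a" unfolding C4_def by (simp add: algebra_simps)
      \<comment> \<open>The comparison so far is multiplied by the mass of the weight; a bound from
        below independent of x is needed to divide by it.\<close>
      moreover have mass: "ring_mass P \<ge> \<mu>0" unfolding \<mu>0_def by (rule ring_mass_lower[OF lo_pos hi_pos Pa Pb])
      ultimately have "ring_mass P * \<bar>U \<alpha> x - c\<bar> \<le> C4 * a"
        using \<mu>0 by (simp add: right_diff_distrib[symmetric] abs_mult)
      moreover have "\<mu>0 * \<bar>U \<alpha> x - c\<bar> \<le> ring_mass P * \<bar>U \<alpha> x - c\<bar>" using mass by (intro mult_right_mono) auto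
      ultimately have "\<mu>0 * \<bar>U \<alpha> x - c\<bar> \<le> C4 * a" by linarith
      then have "\<bar>U \<alpha> x - c\<bar> \<le> C4 / \<mu>0 * a" using \<mu>0 by (simp add: field_simps)
      also have "\<dots> \<le> C * a" unfolding C_def using C3 a0 by (intro mult_right_mono) auto
      finally show ?thesis .
    qed
    have "C3 * R\<^sup>2 * (En T + \<rho>) \<le> C * R\<^sup>2 * (En T + \<rho>)"
      unfolding C_def using C4 \<mu>0 En_nonneg[of T] \<rho> by (intro mult_right_mono) auto
    then have "(\<integral>x\<in>T. (U \<alpha> x - c)\<^sup>2 \<partial>lborel) \<le> C * R\<^sup>2 * (En T + \<rho>)" using cI by linarith
    with c(1) pt show "\<exists>c. \<bar>c\<bar> \<le> M
        \<and> (\<integral>x\<in>cball y0 (\<kappa> * (1/2) ^ i). (U \<alpha> x - c)\<^sup>2 \<partial>lborel) \<le> C * ((1/2) ^ i)\<^sup>2 * (En (cball y0 (\<kappa> * (1/2) ^ i)) + ((1/2) ^ i) powr \<beta>)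
        \<and> (\<forall>x\<in>good. dist y0 x \<le> (1/2) ^ i \<longrightarrow> \<bar>U \<alpha> x - c\<bar> \<le> C * sqrt (En (cball y0 (\<kappa> * (1/2) ^ i)) + ((1/2) ^ i) powr \<beta>))"
      unfolding R_def[symmetric] T_def[symmetric] \<rho>_def[symmetric] a_def[symmetric] by blast
  qed
qed

end

section \<open>Energy decay and Hoelder continuity\<close>

context elliptic_system
begin

lemma En_split:
  assumes "S \<subseteq> T" "S \<in> sets borel" "T \<in> sets borel"
  shows "En T = En S + En (T - S)"
proof -
  have "(\<integral>x\<in>T. (norm (G \<alpha> x))\<^sup>2 \<partial>lborel) = (\<integral>x\<in>S. (norm (G \<alpha> x))\<^sup>2 \<partial>lborel) + (\<integral>x\<in>T - S. (norm (G \<alpha> x))\<^sup>2 \<partial>lborel)" for \<alpha>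
  proof -
    have "(\<integral>x\<in>S \<union> (T - S). (norm (G \<alpha> x))\<^sup>2 \<partial>lborel) = (\<integral>x\<in>S. (norm (G \<alpha> x))\<^sup>2 \<partial>lborel) + (\<integral>x\<in>T - S. (norm (G \<alpha> x))\<^sup>2 \<partial>lborel)"
      by (rule set_integral_Un) (use assms in \<open>auto intro!: G_set\<close>)
    moreover have "S \<union> (T - S) = T" using assms(1) by blast
    ultimately show ?thesis by simp
  qed
  then show ?thesis unfolding En_def by (simp add: sum.distrib)
qed

text \<open>The equation is tested with \<open>\<psi>\<^sup>2 (u - c)\<close>, approximated by mollification.\<close>

lemma caccioppoli:
  obtains C where "C > 0"
    "\<And>y0 R \<alpha> c s. R > 0 \<Longrightarrow> cball y0 R \<subseteq> ball 0 1 \<Longrightarrow> \<bar>c\<bar> \<le> M \<Longrightarrow> 0 \<le> s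
      \<Longrightarrow> AE x in lborel. dist y0 x \<le> R \<longrightarrow> \<bar>U \<alpha> x - c\<bar> \<le> s
      \<Longrightarrow> (\<integral>x\<in>cball y0 (R / 4). (norm (G \<alpha> x))\<^sup>2 \<partial>lborel)
          \<le> C * (1 / R * sqrt (\<integral>x\<in>cball y0 R. (U \<alpha> x - c)\<^sup>2 \<partial>lborel) * sqrt (En (cball y0 R) - En (cball y0 (R / 4)))
              + s * sqrt (Xn (cball y0 R)) * sqrt (En (cball y0 R)) + (\<integral>x\<in>cball y0 R. \<bar>F \<alpha> x\<bar> \<partial>lborel))"
proof -
  define B where "B = prof_B"
  have B: "B > 0" unfolding B_def by (rule prof_B)
  define f0 where "f0 = prof_f 0"
  have f0: "f0 > 0" unfolding f0_def by (rule prof_f_0_pos)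
  \<comment> \<open>The three main summands belong to the flux against the gradient of the squared
    cutoff, the critical term summed over components, and the right-hand side F.\<close>
  define C0 where "C0 = 4 * B\<^sup>2 * L + real CARD('m) * B\<^sup>2 + 2 * M * B\<^sup>2 + 1"
  have C0: "C0 > 0" unfolding C0_def using L_pos M_nonneg by (intro add_nonneg_pos add_nonneg_nonneg) auto
  have l0: "l * f0\<^sup>2 > 0" using l_pos f0 by simp
  show ?thesis
  proof (rule that[of "C0 / (l * f0\<^sup>2)"])
    show "C0 / (l * f0\<^sup>2) > 0" using C0 l0 by simp
    fix y0 :: "real^2" and R c s :: real and \<alpha> :: 'm
    assume R: "R > 0" and sub: "cball y0 R \<subseteq> ball 0 1" and c: "\<bar>c\<bar> \<le> M" and s: "0 \<le> s"
      and ae: "AE x in lborel. dist y0 x \<le> R \<longrightarrow> \<bar>U \<alpha> x - c\<bar> \<le> s"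
    \<comment> \<open>With the identity matrix the potential is an ordinary radial cutoff: constant
      \<open>f0\<close> on the ball of radius R/4 and zero outside the ball of radius R.\<close>
    define I1 :: "real^2^2" where "I1 = mat 1"
    have Ia: "1 * norm z \<le> norm (I1 *v z)" and Ib: "norm (I1 *v z) \<le> 1 * norm z" for z by (simp_all add: I1_def)
    define \<psi> where "\<psi> = log_pot I1 y0 R"
    define g\<psi> where "g\<psi> = log_pot_grad I1 y0 R"
    define T where "T = cball y0 R"
    define S where "S = cball y0 (R / 4)"
    have ST: "S \<subseteq> T" "S \<in> sets borel" "T \<in> sets borel" "compact T" unfolding S_def T_def using R by (auto intro!: subset_cball)
    have C: "C1c (ball 0 1) \<psi> g\<psi>" unfolding \<psi>_def g\<psi>_def by (rule log_pot_C1c[OF zero_less_one R Ia]) (use sub in simp)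
    note bm = has_grad_borel[OF C1c_has_grad[OF C]]
    note gb = log_pot_grad_bound[OF R zero_le_one Ib, of y0, folded g\<psi>_def]
    have \<psi>B: "\<bar>\<psi> y\<bar> \<le> B" for y unfolding \<psi>_def B_def by (rule log_pot_bound)
    have \<psi>0: "\<psi> y = 0" if "y \<notin> T" for y
      unfolding \<psi>_def log_pot_def by (rule prof_f_large[OF outside_quad[OF zero_less_one R Ia]]) (use that in \<open>simp add: T_def\<close>)
    have \<psi>S: "\<psi> y = f0" if "y \<in> S" for y
    proof -
      have "norm (y - y0) \<le> R / 4" using that by (simp add: S_def dist_norm norm_minus_commute)
      then have "(norm (y - y0))\<^sup>2 \<le> (R / 4)\<^sup>2" by (intro power_mono) auto
      then have "(norm (y - y0))\<^sup>2 / R\<^sup>2 \<le> 1/16" using R by (simp add: power_divide)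
      moreover have "-1/8 \<le> (norm (y - y0))\<^sup>2 / R\<^sup>2" by (rule order_trans[of _ 0]) auto
      ultimately have "prof_f ((norm (y - y0))\<^sup>2 / R\<^sup>2) = prof_f 0" by (intro prof_f_small)
      then show ?thesis unfolding \<psi>_def log_pot_def f0_def I1_def by simp
    qed
    have gAnn: "g\<psi> y = 0" if "y \<notin> T - S" for y
    proof (rule ccontr)
      assume "g\<psi> y \<noteq> 0"
      with gb(2,3)[of y] that show False by (auto simp: T_def S_def I1_def dist_norm norm_minus_commute)
    qed
    define f2 where "f2 y = \<psi> y * \<psi> y" for y
    define g2 where "g2 y = \<psi> y *\<^sub>R g\<psi> y + \<psi> y *\<^sub>R g\<psi> y" for y
    have C2: "C1c (ball 0 1) f2 g2" unfolding f2_def g2_def by (rule C1c_mult[OF C1c_has_grad[OF C] C])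
    note bm2 = has_grad_borel[OF C1c_has_grad[OF C2]]
    have f2B: "\<bar>f2 y\<bar> \<le> B\<^sup>2" for y unfolding f2_def power2_eq_square abs_mult using \<psi>B B by (intro mult_mono) auto
    have f20: "f2 y \<ge> 0" for y unfolding f2_def by simp
    have f2T: "f2 y = 0" if "y \<notin> T" for y using \<psi>0[OF that] by (simp add: f2_def)
    have g2B: "norm (g2 y) \<le> 4 * B\<^sup>2 / R" for y
    proof -
      have "norm (g2 y) \<le> 2 * (\<bar>\<psi> y\<bar> * norm (g\<psi> y))" unfolding g2_def by (simp add: scaleR_2[symmetric])
      also have "\<dots> \<le> 2 * (B * (2 * B * 1 / R))" using gb(1)[of y] \<psi>B[of y] B by (intro mult_left_mono mult_mono) (auto simp: B_def)
      finally show ?thesis by (simp add: power2_eq_square)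
    qed
    have g2Ann: "g2 y = 0" if "y \<notin> T - S" for y using gAnn[OF that] by (simp add: g2_def)
    obtain \<rho> where \<rho>: "\<rho> < 1" "cball y0 R \<subseteq> ball 0 \<rho>" using cball_subset_smaller_ball[OF sub] R by auto
    obtain v gv where v: "\<And>n::nat. has_grad (v n) (gv n)" "\<And>n x. \<bar>v n x\<bar> \<le> M"
      and aev: "AE x in lborel. (\<lambda>n. v n x) \<longlonglongrightarrow> U \<alpha> x"
      and lim: "\<And>\<rho>. \<rho> < 1 \<Longrightarrow> (\<lambda>n. \<integral>x\<in>ball 0 \<rho>. (norm (gv n x - G \<alpha> x))\<^sup>2 \<partial>lborel) \<longlonglongrightarrow> 0"
      by (rule approximation[of \<alpha>]) blast
    define w where "w n y = v n y - c" for n y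
    have w: "has_grad (w n) (gv n)" for n unfolding w_def by (rule has_grad_diff_const[OF v(1)])
    have wM: "\<bar>w n y\<bar> \<le> 2 * M" for n y unfolding w_def using v(2)[of n y] c by linarith
    have wb: "w n \<in> borel_measurable borel" for n using has_grad_borel(1)[OF w] .
    have UM: "\<bar>U \<alpha> y - c\<bar> \<le> 2 * M" for y using U_bound[of \<alpha> y] c by linarith
    define AG where "AG y = A y *v G \<alpha> y" for y
    have AGi: "integrable lborel AG" and AGm: "AG \<in> borel_measurable borel" unfolding AG_def using AG_int AG_meas by auto
    have AG2: "integrable lborel (\<lambda>y. (norm (AG y))\<^sup>2)"
    proof (rule Bochner_Integration.integrable_bound)
      show "integrable lborel (\<lambda>y. L\<^sup>2 * (norm (G \<alpha> y))\<^sup>2)" using G_L2 by simp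
      show "AE y in lborel. norm ((norm (AG y))\<^sup>2) \<le> norm (L\<^sup>2 * (norm (G \<alpha> y))\<^sup>2)"
        unfolding AG_def using AG_bound by (intro AE_I2) (simp add: power_mult_distrib[symmetric] power_mono)
    qed (use AGm in simp)
    define h where "h y = ((\<Sum>\<gamma>\<in>UNIV. X \<alpha> \<gamma> y \<bullet> G \<gamma> y) + F \<alpha> y)" for y
    have hi: "integrable lborel h" unfolding h_def using XG_int F_int by auto
    have hm: "h \<in> borel_measurable borel" using hi by auto
    have ih: "integrable lborel (\<lambda>y. f2 y * h y)" using integrable_bounded_scaleR[OF hi bm2(1) f2B] by simp
    have iA2: "integrable lborel (\<lambda>y. AG y \<bullet> g2 y)" by (rule integrable_inner_bounded[OF AGi bm2(2) g2B])
    \<comment> \<open>Terms without gradients of the approximant pass to the limit by dominated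
      convergence, thanks to the common bound 2M; the term with the gradient is handled by L^2
      convergence.\<close>
    have dct: "(\<lambda>n. \<integral>y. w n y * k y \<partial>lborel) \<longlonglongrightarrow> (\<integral>y. (U \<alpha> y - c) * k y \<partial>lborel)" if k: "integrable lborel k" for k
    proof (rule integral_dominated_convergence[where w = "\<lambda>y. 2 * M * \<bar>k y\<bar>"])
      show "AE y in lborel. (\<lambda>n. w n y * k y) \<longlonglongrightarrow> (U \<alpha> y - c) * k y"
        using aev by eventually_elim (auto simp: w_def intro!: tendsto_intros)
      show "AE y in lborel. norm (w n y * k y) \<le> 2 * M * \<bar>k y\<bar>" for n
        using wM by (intro AE_I2) (simp add: abs_mult mult_right_mono)
    qed (use k wb U_meas in auto)
    have e1: "(\<integral>y. AG y \<bullet> (f2 y *\<^sub>R gv n y) \<partial>lborel) + (\<integral>y. w n y * (AG y \<bullet> g2 y) \<partial>lborel) = (\<integral>y. w n y * (f2 y * h y) \<partial>lborel)" for n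
    proof -
      have "(\<integral>y. AG y \<bullet> (f2 y *\<^sub>R gv n y + w n y *\<^sub>R g2 y) \<partial>lborel) = (\<integral>y. h y * (w n y * f2 y) \<partial>lborel)"
        unfolding AG_def h_def by (rule weak_eq[OF C1c_mult[OF w C2]])
      moreover have "integrable lborel (\<lambda>y. AG y \<bullet> (f2 y *\<^sub>R gv n y))"
      proof -
        obtain K where K: "compact K" "\<And>y. y \<notin> K \<Longrightarrow> f2 y = 0" using C2 unfolding C1c_def by blast
        have cc: "continuous_on UNIV (\<lambda>y. f2 y *\<^sub>R gv n y)"
          using has_grad_D[OF w] has_grad_D[OF C1c_has_grad[OF C2]] by (intro continuous_intros) auto
        have k0: "f2 y *\<^sub>R gv n y = 0" if "y \<notin> K" for y using K(2)[OF that] by simp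
        obtain b0 where b0: "\<And>y. norm (f2 y *\<^sub>R gv n y) \<le> b0" using compact_support_bounded[OF cc K(1) k0] by blast
        show ?thesis by (rule integrable_inner_bounded[OF AGi continuous_on_imp_borel[OF cc] b0])
      qed
      moreover have "integrable lborel (\<lambda>y. w n y * (AG y \<bullet> g2 y))"
        using integrable_bounded_scaleR[OF iA2 wb wM] by simp
      ultimately show ?thesis by (simp add: inner_add_right mult_ac)
    qed
    have p1: "(\<lambda>n. \<integral>y. AG y \<bullet> (f2 y *\<^sub>R gv n y) \<partial>lborel) \<longlonglongrightarrow> (\<integral>y. AG y \<bullet> (f2 y *\<^sub>R G \<alpha> y) \<partial>lborel)"
      and p2: "integrable lborel (\<lambda>y. AG y \<bullet> (f2 y *\<^sub>R G \<alpha> y))"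
    proof -
      have z: "f2 y = 0" if "y \<notin> ball 0 \<rho>" for y using f2T \<rho>(2) that unfolding T_def by blast
      note pp = pairing_tendsto_zero[OF AGm AG2 v(1) lim[OF \<rho>(1)] bm2(1) f2B z]
      show "(\<lambda>n. \<integral>y. AG y \<bullet> (f2 y *\<^sub>R gv n y) \<partial>lborel) \<longlonglongrightarrow> (\<integral>y. AG y \<bullet> (f2 y *\<^sub>R G \<alpha> y) \<partial>lborel)" by (rule pp(1))
      show "integrable lborel (\<lambda>y. AG y \<bullet> (f2 y *\<^sub>R G \<alpha> y))" by (rule pp(2))
    qed
    have eq: "(\<integral>y. AG y \<bullet> (f2 y *\<^sub>R G \<alpha> y) \<partial>lborel) + (\<integral>y. (U \<alpha> y - c) * (AG y \<bullet> g2 y) \<partial>lborel) = (\<integral>y. (U \<alpha> y - c) * (f2 y * h y) \<partial>lborel)"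
      by (rule LIMSEQ_unique[OF tendsto_add[OF p1 dct[OF iA2]]]) (unfold e1, rule dct[OF ih])
    have low: "l * f0\<^sup>2 * (\<integral>x\<in>S. (norm (G \<alpha> x))\<^sup>2 \<partial>lborel) \<le> (\<integral>y. AG y \<bullet> (f2 y *\<^sub>R G \<alpha> y) \<partial>lborel)"
    proof -
      have "l * f0\<^sup>2 * (\<integral>x\<in>S. (norm (G \<alpha> x))\<^sup>2 \<partial>lborel) = (\<integral>y. l * f0\<^sup>2 * (indicator S y *\<^sub>R (norm (G \<alpha> y))\<^sup>2) \<partial>lborel)"
        unfolding set_lebesgue_integral_def by simp
      also have "\<dots> \<le> (\<integral>y. AG y \<bullet> (f2 y *\<^sub>R G \<alpha> y) \<partial>lborel)"
      proof (rule integral_mono[OF _ p2])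
        show "integrable lborel (\<lambda>y. l * f0\<^sup>2 * (indicator S y *\<^sub>R (norm (G \<alpha> y))\<^sup>2))"
          using G_set[OF ST(2), of \<alpha>] unfolding set_integrable_def by (intro integrable_mult_right)
        fix y
        have Al: "l * (norm (G \<alpha> y))\<^sup>2 \<le> AG y \<bullet> G \<alpha> y"
          unfolding AG_def using A_lower[of y "G \<alpha> y"] G_zero[of y \<alpha>] by (cases "y \<in> ball 0 1") auto
        have A0: "0 \<le> AG y \<bullet> G \<alpha> y" using order_trans[OF _ Al] l_pos by simp
        show "l * f0\<^sup>2 * (indicator S y *\<^sub>R (norm (G \<alpha> y))\<^sup>2) \<le> AG y \<bullet> (f2 y *\<^sub>R G \<alpha> y)"
        proof (cases "y \<in> S")
          case True
          then have "f2 y = f0\<^sup>2" using \<psi>S by (simp add: f2_def power2_eq_square)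
          then show ?thesis using True mult_left_mono[OF Al, of "f0\<^sup>2"] by (simp add: mult_ac)
        qed (use A0 f20 in simp)
      qed
      finally show ?thesis .
    qed
    \<comment> \<open>The gradient of the cutoff vanishes on the inner ball, so only the energy of
      the annulus, En T - En S, enters. This difference is what later permits filling the
      hole.\<close>
    have t1: "\<bar>\<integral>y. (U \<alpha> y - c) * (AG y \<bullet> g2 y) \<partial>lborel\<bar> \<le> (4 * B\<^sup>2 / R * L) * (sqrt (\<integral>x\<in>T. (U \<alpha> x - c)\<^sup>2 \<partial>lborel) * sqrt (En T - En S))"
    proof -
      have TS: "T - S \<in> sets borel" using ST by blast
      have iU: "set_integrable lborel (T - S) (\<lambda>x. (U \<alpha> x - c)\<^sup>2)"
        by (rule set_integrable_subset[OF Uc_square_set_integrable[OF ST(4)]]) (use TS in auto)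
      have kk: "\<bar>(U \<alpha> y - c) * (AG y \<bullet> g2 y)\<bar> \<le> (4 * B\<^sup>2 / R * L) * (indicator (T - S) y * (\<bar>U \<alpha> y - c\<bar> * \<bar>norm (G \<alpha> y)\<bar>))" for y
      proof (cases "y \<in> T - S")
        case True
        have "\<bar>AG y \<bullet> g2 y\<bar> \<le> norm (AG y) * norm (g2 y)" by (rule Cauchy_Schwarz_ineq2)
        also have "\<dots> \<le> (L * norm (G \<alpha> y)) * (4 * B\<^sup>2 / R)"
          using AG_bound[of y \<alpha>] g2B[of y] L_pos unfolding AG_def by (intro mult_mono) auto
        finally have "\<bar>U \<alpha> y - c\<bar> * \<bar>AG y \<bullet> g2 y\<bar> \<le> \<bar>U \<alpha> y - c\<bar> * ((L * norm (G \<alpha> y)) * (4 * B\<^sup>2 / R))" by (rule mult_left_mono) simp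
        then show ?thesis using True by (simp add: abs_mult mult_ac)
      qed (use g2Ann in simp)
      have cc: "0 \<le> 4 * B\<^sup>2 / R * L" using R L_pos by simp
      have "\<bar>\<integral>y. (U \<alpha> y - c) * (AG y \<bullet> g2 y) \<partial>lborel\<bar> \<le> (4 * B\<^sup>2 / R * L) * (sqrt (\<integral>x\<in>T - S. (U \<alpha> x - c)\<^sup>2 \<partial>lborel) * sqrt (\<integral>x\<in>T - S. (norm (G \<alpha> x))\<^sup>2 \<partial>lborel))"
        by (rule L2_product_bound(3)[OF _ _ _ _ iU G_set[OF TS] kk cc]) (use U_meas G_meas AGm bm2 TS in auto)
      also have "\<dots> \<le> (4 * B\<^sup>2 / R * L) * (sqrt (\<integral>x\<in>T. (U \<alpha> x - c)\<^sup>2 \<partial>lborel) * sqrt (En T - En S))"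
      proof (intro mult_left_mono mult_mono real_sqrt_le_mono)
        show "(\<integral>x\<in>T - S. (U \<alpha> x - c)\<^sup>2 \<partial>lborel) \<le> (\<integral>x\<in>T. (U \<alpha> x - c)\<^sup>2 \<partial>lborel)"
          by (rule set_integral_mono_nonneg_set[OF Uc_square_set_integrable[OF ST(4)]]) (use TS in auto)
        show "(\<integral>x\<in>T - S. (norm (G \<alpha> x))\<^sup>2 \<partial>lborel) \<le> En T - En S"
          using G_le_En[of "T - S" \<alpha>] En_split[OF ST(1-3)] by linarith
      qed (use cc in \<open>auto intro!: set_int_nonneg\<close>)
      finally show ?thesis .
    qed
    \<comment> \<open>Here the oscillation bound s must replace the crude 2M: with s of the order of
      the root of the energy, the term becomes quadratic in that root and can be absorbed.\<close>
    have t2: "\<bar>\<integral>y. (U \<alpha> y - c) * (f2 y * (X \<alpha> \<gamma> y \<bullet> G \<gamma> y)) \<partial>lborel\<bar> \<le> B\<^sup>2 * (s * (sqrt (Xn T) * sqrt (En T)))"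
      and t2i: "integrable lborel (\<lambda>y. (U \<alpha> y - c) * (f2 y * (X \<alpha> \<gamma> y \<bullet> G \<gamma> y)))" for \<gamma>
    proof -
      define k where "k y = indicator T y * (norm (X \<alpha> \<gamma> y) * norm (G \<gamma> y))" for y
      have km: "k \<in> borel_measurable lborel" unfolding k_def using ST(3) X_meas[of \<alpha> \<gamma>] G_meas[of \<gamma>]
        by (intro borel_measurable_times borel_measurable_indicator borel_measurable_norm) auto
      have kk: "\<bar>k y\<bar> \<le> 1 * (indicator T y * (\<bar>norm (X \<alpha> \<gamma> y)\<bar> * \<bar>norm (G \<gamma> y)\<bar>))" for y unfolding k_def by simp
      have lm: "(\<lambda>y. norm (X \<alpha> \<gamma> y)) \<in> borel_measurable lborel" "(\<lambda>y. norm (G \<gamma> y)) \<in> borel_measurable lborel" "T \<in> sets lborel"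
        using X_meas G_meas ST(3) by auto
      note K = L2_product_bound[OF lm(1,2) km lm(3) X_set[OF ST(3)] G_set[OF ST(3)] kk zero_le_one]
      have k0: "0 \<le> k y" for y unfolding k_def by simp
      have "integrable lborel (\<lambda>y. f2 y * (X \<alpha> \<gamma> y \<bullet> G \<gamma> y))" using integrable_bounded_scaleR[OF XG_int bm2(1) f2B, of \<alpha> \<gamma> \<gamma>] by simp
      from integrable_bounded_scaleR[OF this _ UM] show i: "integrable lborel (\<lambda>y. (U \<alpha> y - c) * (f2 y * (X \<alpha> \<gamma> y \<bullet> G \<gamma> y)))"
        using U_meas[of \<alpha>] by simp
      have "\<bar>\<integral>y. (U \<alpha> y - c) * (f2 y * (X \<alpha> \<gamma> y \<bullet> G \<gamma> y)) \<partial>lborel\<bar> \<le> (\<integral>y. s * B\<^sup>2 * k y \<partial>lborel)"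
      proof (rule order_trans[OF integral_abs_bound], rule integral_mono_AE)
        show "AE y in lborel. \<bar>(U \<alpha> y - c) * (f2 y * (X \<alpha> \<gamma> y \<bullet> G \<gamma> y))\<bar> \<le> s * B\<^sup>2 * k y"
          using ae
        proof eventually_elim
          fix y assume y: "dist y0 y \<le> R \<longrightarrow> \<bar>U \<alpha> y - c\<bar> \<le> s"
          show "\<bar>(U \<alpha> y - c) * (f2 y * (X \<alpha> \<gamma> y \<bullet> G \<gamma> y))\<bar> \<le> s * B\<^sup>2 * k y"
          proof (cases "y \<in> T")
            case True
            then have "\<bar>U \<alpha> y - c\<bar> \<le> s" using y by (simp add: T_def)
            then have "\<bar>U \<alpha> y - c\<bar> * (\<bar>f2 y\<bar> * \<bar>X \<alpha> \<gamma> y \<bullet> G \<gamma> y\<bar>) \<le> s * (B\<^sup>2 * (norm (X \<alpha> \<gamma> y) * norm (G \<gamma> y)))"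
              using f2B[of y] s by (intro mult_mono Cauchy_Schwarz_ineq2) auto
            then show ?thesis using True by (simp add: abs_mult k_def mult_ac)
          qed (use f2T s k0 in simp)
        qed
      qed (use i K(1) in auto)
      also have "\<dots> = s * B\<^sup>2 * (\<integral>y. k y \<partial>lborel)" by simp
      also have "\<dots> \<le> s * B\<^sup>2 * (sqrt (Xn T) * sqrt (En T))"
      proof (rule mult_left_mono)
        have "(\<integral>y. k y \<partial>lborel) \<le> sqrt (\<integral>x\<in>T. (norm (X \<alpha> \<gamma> x))\<^sup>2 \<partial>lborel) * sqrt (\<integral>x\<in>T. (norm (G \<gamma> x))\<^sup>2 \<partial>lborel)" using K(3) by simp
        also have "\<dots> \<le> sqrt (Xn T) * sqrt (En T)"
          by (intro mult_mono real_sqrt_le_mono X_le_Xn G_le_En) (auto intro!: set_int_nonneg simp: Xn_nonneg)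
        finally show "(\<integral>y. k y \<partial>lborel) \<le> sqrt (Xn T) * sqrt (En T)" .
      qed (use s in simp)
      finally show "\<bar>\<integral>y. (U \<alpha> y - c) * (f2 y * (X \<alpha> \<gamma> y \<bullet> G \<gamma> y)) \<partial>lborel\<bar> \<le> B\<^sup>2 * (s * (sqrt (Xn T) * sqrt (En T)))" by (simp add: mult_ac)
    qed
    \<comment> \<open>For F the crude bound suffices, because its integral over balls already decays
      like a power of R.\<close>
    have kF: "\<bar>(U \<alpha> y - c) * f2 y\<bar> \<le> 2 * M * B\<^sup>2" for y unfolding abs_mult using UM[of y] f2B[of y] M_nonneg by (intro mult_mono) auto
    have kF0: "(U \<alpha> y - c) * f2 y = 0" if "y \<notin> T" for y using f2T[OF that] by simp
    have kFm: "(\<lambda>y. (U \<alpha> y - c) * f2 y) \<in> borel_measurable borel" using U_meas[of \<alpha>] bm2 by simp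
    note t3 = bounded_ball_integral[OF F_int kF kF0 kFm ST(3), of \<alpha>]
    have "(\<integral>y. (U \<alpha> y - c) * (f2 y * h y) \<partial>lborel) = (\<integral>y. (\<Sum>\<gamma>\<in>UNIV. (U \<alpha> y - c) * (f2 y * (X \<alpha> \<gamma> y \<bullet> G \<gamma> y))) + F \<alpha> y * ((U \<alpha> y - c) * f2 y) \<partial>lborel)"
      by (rule Bochner_Integration.integral_cong) (simp_all add: h_def distrib_left sum_distrib_left mult_ac)
    also have "\<dots> = (\<Sum>\<gamma>\<in>UNIV. \<integral>y. (U \<alpha> y - c) * (f2 y * (X \<alpha> \<gamma> y \<bullet> G \<gamma> y)) \<partial>lborel) + (\<integral>y. F \<alpha> y * ((U \<alpha> y - c) * f2 y) \<partial>lborel)"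
      using t2i t3(1) by simp
    finally have rhs: "(\<integral>y. (U \<alpha> y - c) * (f2 y * h y) \<partial>lborel) = (\<Sum>\<gamma>\<in>UNIV. \<integral>y. (U \<alpha> y - c) * (f2 y * (X \<alpha> \<gamma> y \<bullet> G \<gamma> y)) \<partial>lborel) + (\<integral>y. F \<alpha> y * ((U \<alpha> y - c) * f2 y) \<partial>lborel)" .
    have "\<bar>\<Sum>\<gamma>\<in>UNIV. \<integral>y. (U \<alpha> y - c) * (f2 y * (X \<alpha> \<gamma> y \<bullet> G \<gamma> y)) \<partial>lborel\<bar> \<le> (\<Sum>\<gamma>\<in>(UNIV::'m set). B\<^sup>2 * (s * (sqrt (Xn T) * sqrt (En T))))"
      by (rule order_trans[OF sum_abs], rule sum_mono, rule t2)
    then have t2s: "\<bar>\<Sum>\<gamma>\<in>UNIV. \<integral>y. (U \<alpha> y - c) * (f2 y * (X \<alpha> \<gamma> y \<bullet> G \<gamma> y)) \<partial>lborel\<bar> \<le> real CARD('m) * B\<^sup>2 * (s * sqrt (Xn T) * sqrt (En T))"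
      by (simp add: mult_ac)
    define q1 where "q1 = 1 / R * sqrt (\<integral>x\<in>T. (U \<alpha> x - c)\<^sup>2 \<partial>lborel) * sqrt (En T - En S)"
    define q2 where "q2 = s * sqrt (Xn T) * sqrt (En T)"
    define q3 where "q3 = (\<integral>x\<in>T. \<bar>F \<alpha> x\<bar> \<partial>lborel)"
    have "q1 \<ge> 0" unfolding q1_def
      by (intro mult_nonneg_nonneg real_sqrt_ge_zero set_int_nonneg) (use R En_mono[OF ST(1-3)] in auto)
    moreover have "q2 \<ge> 0" unfolding q2_def
      by (intro mult_nonneg_nonneg real_sqrt_ge_zero s Xn_nonneg En_nonneg)
    moreover have "q3 \<ge> 0" unfolding q3_def by (intro set_int_nonneg) simp
    ultimately have q0: "q1 \<ge> 0" "q2 \<ge> 0" "q3 \<ge> 0" by auto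
    have "l * f0\<^sup>2 * (\<integral>x\<in>S. (norm (G \<alpha> x))\<^sup>2 \<partial>lborel) \<le> (4 * B\<^sup>2 * L) * q1 + (real CARD('m) * B\<^sup>2) * q2 + (2 * M * B\<^sup>2) * q3"
    proof -
      have "(4 * B\<^sup>2 / R * L) * (sqrt (\<integral>x\<in>T. (U \<alpha> x - c)\<^sup>2 \<partial>lborel) * sqrt (En T - En S)) = (4 * B\<^sup>2 * L) * q1" unfolding q1_def by simp
      then show ?thesis using low eq t1 t2s t3(2) unfolding rhs q2_def q3_def by linarith
    qed
    also have "\<dots> \<le> C0 * q1 + C0 * q2 + C0 * q3"
      unfolding C0_def using q0 L_pos M_nonneg by (intro add_mono mult_right_mono) auto
    finally have "l * f0\<^sup>2 * (\<integral>x\<in>S. (norm (G \<alpha> x))\<^sup>2 \<partial>lborel) \<le> C0 * (q1 + q2 + q3)" by (simp add: algebra_simps)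
    then have "(\<integral>x\<in>S. (norm (G \<alpha> x))\<^sup>2 \<partial>lborel) \<le> C0 / (l * f0\<^sup>2) * (q1 + q2 + q3)" using l0 by (simp add: field_simps)
    then show "(\<integral>x\<in>cball y0 (R / 4). (norm (G \<alpha> x))\<^sup>2 \<partial>lborel)
          \<le> C0 / (l * f0\<^sup>2) * (1 / R * sqrt (\<integral>x\<in>cball y0 R. (U \<alpha> x - c)\<^sup>2 \<partial>lborel) * sqrt (En (cball y0 R) - En (cball y0 (R / 4)))
              + s * sqrt (Xn (cball y0 R)) * sqrt (En (cball y0 R)) + (\<integral>x\<in>cball y0 R. \<bar>F \<alpha> x\<bar> \<partial>lborel))"
      unfolding q1_def q2_def q3_def T_def S_def .
  qed
qed

text \<open>Inserting the pointwise bound into the energy inequality gives, for inner energy e0,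
  outer energy e and \<rho> = R^\<beta>, the estimate e0 \<le> N (a b + \<tau> a^2 + \<rho>) with
  a^2 = e + \<rho> and b^2 = e - e0. Young's inequality for a b produces -N^2 e0 on the right, and
  moving it to the left makes the factor of e smaller than 1.\<close>

lemma energy_decay:
  assumes good: "AE x in lborel. x \<in> good" and Cg: "Cg > 0"
    and pw: "\<And>i y0 \<alpha>. cball y0 (\<kappa> * (1/2) ^ i) \<subseteq> ball 0 1 \<Longrightarrow>
      \<exists>c. \<bar>c\<bar> \<le> M
        \<and> (\<integral>x\<in>cball y0 (\<kappa> * (1/2) ^ i). (U \<alpha> x - c)\<^sup>2 \<partial>lborel) \<le> Cg * ((1/2) ^ i)\<^sup>2 * (En (cball y0 (\<kappa> * (1/2) ^ i)) + ((1/2) ^ i) powr \<beta>)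
        \<and> (\<forall>x\<in>good. dist y0 x \<le> (1/2) ^ i \<longrightarrow> \<bar>U \<alpha> x - c\<bar> \<le> Cg * sqrt (En (cball y0 (\<kappa> * (1/2) ^ i)) + ((1/2) ^ i) powr \<beta>))"
  obtains \<theta> \<delta> C where "0 < \<theta>" "\<theta> < 1" "\<delta> > 0" "C > 0"
    "\<And>i y0. cball y0 (\<kappa> * (1/2) ^ i) \<subseteq> ball 0 1 \<Longrightarrow> Xn (cball y0 (\<kappa> * (1/2) ^ i)) \<le> \<delta> \<Longrightarrow>
      En (cball y0 ((1/2) ^ i / 4)) \<le> \<theta> * En (cball y0 (\<kappa> * (1/2) ^ i)) + C * ((1/2) ^ i) powr \<beta>"
proof -
  obtain Cc where Cc: "Cc > 0"
    "\<And>y0 R \<alpha> c s. R > 0 \<Longrightarrow> cball y0 R \<subseteq> ball 0 1 \<Longrightarrow> \<bar>c\<bar> \<le> M \<Longrightarrow> 0 \<le> s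
      \<Longrightarrow> AE x in lborel. dist y0 x \<le> R \<longrightarrow> \<bar>U \<alpha> x - c\<bar> \<le> s
      \<Longrightarrow> (\<integral>x\<in>cball y0 (R / 4). (norm (G \<alpha> x))\<^sup>2 \<partial>lborel)
          \<le> Cc * (1 / R * sqrt (\<integral>x\<in>cball y0 R. (U \<alpha> x - c)\<^sup>2 \<partial>lborel) * sqrt (En (cball y0 R) - En (cball y0 (R / 4)))
              + s * sqrt (Xn (cball y0 R)) * sqrt (En (cball y0 R)) + (\<integral>x\<in>cball y0 R. \<bar>F \<alpha> x\<bar> \<partial>lborel))"
    by (rule caccioppoli) blast
  define N where "N = real CARD('m) * Cc * (sqrt Cg + Cg + K + 1)"
  have cm: "real CARD('m) \<ge> 1" by (simp add: Suc_leI)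
  have N: "N > 0" unfolding N_def using cm Cc(1) Cg K_nonneg by (intro mult_pos_pos add_nonneg_pos add_nonneg_nonneg) auto
  \<comment> \<open>The 1/2 in the numerator is 1/4 from Young's inequality plus 1/4 from the
    critical term; \<delta> is chosen so that N times the L^2 norm of X is at most 1/4.\<close>
  define \<theta> where "\<theta> = (N\<^sup>2 + 1/2) / (N\<^sup>2 + 1)"
  define \<delta> where "\<delta> = (1 / (4 * N))\<^sup>2"
  show ?thesis
  proof (rule that[of \<theta> \<delta> "(N + 1) / (N\<^sup>2 + 1)"])
    have N2: "0 < N\<^sup>2 + 1" by (simp add: add_nonneg_pos)
    show "0 < \<theta>" "\<theta> < 1" unfolding \<theta>_def using N2 by (auto simp: add_nonneg_pos)
    show "\<delta> > 0" unfolding \<delta>_def using N by simp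
    show "(N + 1) / (N\<^sup>2 + 1) > 0" using N N2 by simp
    fix i :: nat and y0 :: "real^2"
    assume sub': "cball y0 (\<kappa> * (1/2) ^ i) \<subseteq> ball 0 1" and X': "Xn (cball y0 (\<kappa> * (1/2) ^ i)) \<le> \<delta>"
    define R where "R = (1/2::real) ^ i"
    have R: "R > 0" "R \<le> 1" unfolding R_def by (auto simp: power_le_one)
    define T0 where "T0 = cball y0 (\<kappa> * R)"
    define T where "T = cball y0 R"
    define S where "S = cball y0 (R / 4)"
    have sub: "T0 \<subseteq> ball 0 1" using sub' by (simp add: T0_def R_def)
    have X0: "Xn T0 \<le> \<delta>" using X' by (simp add: T0_def R_def)
    have "1 * R \<le> \<kappa> * R" using \<kappa>_ge R by (intro mult_right_mono) auto
    then have TT: "T \<subseteq> T0" unfolding T_def T0_def by (intro subset_cball) simp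
    have ST: "S \<subseteq> T" unfolding S_def T_def using R by (intro subset_cball) simp
    have bs: "S \<in> sets borel" "T \<in> sets borel" "T0 \<in> sets borel" unfolding S_def T_def T0_def by auto
    have subT: "cball y0 R \<subseteq> ball 0 1" using TT sub unfolding T_def by blast
    define \<rho> where "\<rho> = R powr \<beta>"
    have \<rho>: "\<rho> > 0" unfolding \<rho>_def using R by simp
    define e where "e = En T0"
    define e0 where "e0 = En S"
    have ee: "e0 \<le> e" "0 \<le> e0" "En T \<le> e" unfolding e_def e0_def using En_mono[OF subset_trans[OF ST TT] bs(1,3)] En_mono[OF TT bs(2,3)] by (auto simp: En_nonneg)
    define a where "a = sqrt (e + \<rho>)"
    have a: "a \<ge> 0" "a\<^sup>2 = e + \<rho>" unfolding a_def using ee \<rho> by auto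
    define b where "b = sqrt (e - e0)"
    have b: "b \<ge> 0" "b\<^sup>2 = e - e0" unfolding b_def using ee by auto
    define \<tau> where "\<tau> = sqrt (Xn T)"
    have "\<tau> \<le> sqrt \<delta>" unfolding \<tau>_def using Xn_mono[OF TT bs(2,3)] X0 by simp
    moreover have "sqrt \<delta> = 1 / (4 * N)" unfolding \<delta>_def using N by simp
    ultimately have "\<tau> \<le> 1 / (4 * N)" by simp
    then have \<tau>: "N * \<tau> \<le> 1/4" "\<tau> \<ge> 0" using N by (simp_all add: field_simps \<tau>_def Xn_nonneg)
    have comp: "(\<integral>x\<in>S. (norm (G \<alpha> x))\<^sup>2 \<partial>lborel) \<le> Cc * (sqrt Cg * a * b + Cg * a * \<tau> * a + K * \<rho>)" for \<alpha>
    proof -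
      obtain c where c: "\<bar>c\<bar> \<le> M" "(\<integral>x\<in>T0. (U \<alpha> x - c)\<^sup>2 \<partial>lborel) \<le> Cg * R\<^sup>2 * (e + \<rho>)"
        "\<forall>x\<in>good. dist y0 x \<le> R \<longrightarrow> \<bar>U \<alpha> x - c\<bar> \<le> Cg * a"
        using pw[OF sub', of \<alpha>] unfolding R_def[symmetric] T0_def[symmetric] e_def[symmetric] \<rho>_def[symmetric] a_def[symmetric] by blast
      have ae: "AE x in lborel. dist y0 x \<le> R \<longrightarrow> \<bar>U \<alpha> x - c\<bar> \<le> Cg * a"
        using good by eventually_elim (use c(3) in blast)
      have "(\<integral>x\<in>S. (norm (G \<alpha> x))\<^sup>2 \<partial>lborel)
          \<le> Cc * (1 / R * sqrt (\<integral>x\<in>T. (U \<alpha> x - c)\<^sup>2 \<partial>lborel) * sqrt (En T - En S) + Cg * a * \<tau> * sqrt (En T) + (\<integral>x\<in>T. \<bar>F \<alpha> x\<bar> \<partial>lborel))"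
        unfolding S_def T_def \<tau>_def by (rule Cc(2)[OF R(1) subT c(1) _ ae]) (use Cg a in auto)
      also have "\<dots> \<le> Cc * (sqrt Cg * a * b + Cg * a * \<tau> * a + K * \<rho>)"
      proof (rule mult_left_mono, intro add_mono)
        have cT0: "compact T0" unfolding T0_def by simp
        have "(\<integral>x\<in>T. (U \<alpha> x - c)\<^sup>2 \<partial>lborel) \<le> (\<integral>x\<in>T0. (U \<alpha> x - c)\<^sup>2 \<partial>lborel)"
          by (rule set_integral_mono_nonneg_set[OF Uc_square_set_integrable[OF cT0] TT]) (use bs in auto)
        then have "sqrt (\<integral>x\<in>T. (U \<alpha> x - c)\<^sup>2 \<partial>lborel) \<le> sqrt (Cg * R\<^sup>2 * (e + \<rho>))" using c(2) by (intro real_sqrt_le_mono) linarith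
        also have "\<dots> = R * (sqrt Cg * a)" unfolding a_def using R by (simp add: real_sqrt_mult)
        finally have "1 / R * sqrt (\<integral>x\<in>T. (U \<alpha> x - c)\<^sup>2 \<partial>lborel) \<le> 1 / R * (R * (sqrt Cg * a))" using R by (intro mult_left_mono) auto
        then have "1 / R * sqrt (\<integral>x\<in>T. (U \<alpha> x - c)\<^sup>2 \<partial>lborel) \<le> sqrt Cg * a" using R by simp
        moreover have "sqrt (En T - En S) \<le> b" unfolding b_def e0_def using ee by simp
        ultimately show "1 / R * sqrt (\<integral>x\<in>T. (U \<alpha> x - c)\<^sup>2 \<partial>lborel) * sqrt (En T - En S) \<le> sqrt Cg * a * b"
          by (rule mult_mono) (use Cg a En_mono[OF ST bs(1,2)] in auto)
        show "Cg * a * \<tau> * sqrt (En T) \<le> Cg * a * \<tau> * a"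
          using Cg a \<tau> ee \<rho> by (intro mult_left_mono) (auto simp: a_def)
        show "(\<integral>x\<in>T. \<bar>F \<alpha> x\<bar> \<partial>lborel) \<le> K * \<rho>" unfolding T_def \<rho>_def by (rule F_ball[OF R])
      qed (use Cc in auto)
      finally show ?thesis .
    qed
    have "e0 \<le> real CARD('m) * (Cc * (sqrt Cg * a * b + Cg * a * \<tau> * a + K * \<rho>))"
      unfolding e0_def En_def using sum_mono[of UNIV, OF comp] by simp
    also have "\<dots> = (real CARD('m) * Cc) * (sqrt Cg * (a * b) + Cg * (\<tau> * a\<^sup>2) + K * \<rho>)"
      by (simp add: power2_eq_square algebra_simps)
    also have "\<dots> \<le> (real CARD('m) * Cc) * ((sqrt Cg + Cg + K + 1) * (a * b) + (sqrt Cg + Cg + K + 1) * (\<tau> * a\<^sup>2) + (sqrt Cg + Cg + K + 1) * \<rho>)"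
      using Cc(1) Cg K_nonneg a(1) b(1) \<tau>(2) \<rho>
      by (intro mult_left_mono add_mono mult_right_mono mult_nonneg_nonneg[of \<tau>]) simp_all
    also have "\<dots> = N * (a * b) + (N * \<tau>) * a\<^sup>2 + N * \<rho>" unfolding N_def by (simp add: algebra_simps)
    also have "\<dots> \<le> (a\<^sup>2 / 4 + N\<^sup>2 * b\<^sup>2) + (1/4) * a\<^sup>2 + N * \<rho>"
    proof (intro add_mono mult_right_mono \<tau>)
      \<comment> \<open>Young's inequality, weighted so that a^2 receives only the factor 1/4 and
        the large N^2 falls on the annular energy.\<close>
      have "0 \<le> (a / 2 - N * b)\<^sup>2" by simp
      then show "N * (a * b) \<le> a\<^sup>2 / 4 + N\<^sup>2 * b\<^sup>2" by (simp add: power2_eq_square algebra_simps)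
    qed (use \<rho> in auto)
    also have "\<dots> = (N\<^sup>2 + 1/2) * e + (N + 1/2) * \<rho> - N\<^sup>2 * e0" unfolding a b by (simp add: algebra_simps)
    finally have "(N\<^sup>2 + 1) * e0 \<le> (N\<^sup>2 + 1/2) * e + (N + 1) * \<rho>" using \<rho> by (simp add: algebra_simps)
    then have "e0 \<le> ((N\<^sup>2 + 1/2) * e + (N + 1) * \<rho>) / (N\<^sup>2 + 1)" using N2 by (simp add: pos_le_divide_eq mult.commute)
    then have "e0 \<le> \<theta> * e + (N + 1) / (N\<^sup>2 + 1) * \<rho>" unfolding \<theta>_def by (simp only: add_divide_distrib[of "(N\<^sup>2 + 1/2) * e"] times_divide_eq_left)
    then show "En (cball y0 ((1/2) ^ i / 4)) \<le> \<theta> * En (cball y0 (\<kappa> * (1/2) ^ i)) + (N + 1) / (N\<^sup>2 + 1) * ((1/2) ^ i) powr \<beta>"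
      unfolding e0_def S_def e_def T0_def \<rho>_def R_def .
  qed
qed

end

section \<open>Uniform absolute continuity and iteration over dyadic scales\<close>

lemma integral_small_balls:
  fixes h :: "real^2 \<Rightarrow> real"
  assumes h: "integrable lborel h" "\<And>x. 0 \<le> h x" and \<epsilon>: "\<epsilon> > 0"
  obtains r0 where "r0 > 0" "\<And>y r. 0 < r \<Longrightarrow> r \<le> r0 \<Longrightarrow> (\<integral>x\<in>cball y r. h x \<partial>lborel) \<le> \<epsilon>"
proof -
  have hm: "h \<in> borel_measurable borel" using h by auto
  \<comment> \<open>The part of h above height n has small integral by dominated convergence, and
    the rest is at most n times the area of the ball. Neither bound depends on the centre, so one
    radius works everywhere.\<close>
  define t where "t n x = (if h x > real n then h x else 0)" for n x
  have tm: "t n \<in> borel_measurable borel" for n unfolding t_def using hm by measurable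
  have "(\<lambda>n. \<integral>x. t n x \<partial>lborel) \<longlonglongrightarrow> (\<integral>x. 0 \<partial>(lborel :: (real^2) measure))"
  proof (rule integral_dominated_convergence[where w = h])
    show "AE x in lborel. (\<lambda>n. t n x) \<longlonglongrightarrow> 0"
    proof (rule AE_I2)
      fix x
      obtain m where "h x \<le> real m" using real_arch_simple by blast
      then have "\<forall>\<^sub>F n in sequentially. t n x = 0"
        unfolding eventually_sequentially t_def by (intro exI[of _ m]) auto
      then show "(\<lambda>n. t n x) \<longlonglongrightarrow> 0" by (rule tendsto_eventually)
    qed
    show "AE x in lborel. norm (t n x) \<le> h x" for n using h(2) by (intro AE_I2) (simp add: t_def)
  qed (use h tm in auto)
  then have "(\<lambda>n. \<integral>x. t n x \<partial>lborel) \<longlonglongrightarrow> 0" by simp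
  from order_tendstoD(2)[OF this, of "\<epsilon> / 2"] \<epsilon> obtain n where n: "(\<integral>x. t n x \<partial>lborel) < \<epsilon> / 2"
    by (auto simp: eventually_sequentially)
  have ti: "integrable lborel (t n)"
    by (rule Bochner_Integration.integrable_bound[OF h(1)]) (use tm h(2) in \<open>auto simp: t_def\<close>)
  define r0 where "r0 = sqrt (\<epsilon> / (2 * pi * (real n + 1)))"
  have e1: "\<epsilon> / (2 * pi * (real n + 1)) > 0" using \<epsilon> by (intro divide_pos_pos mult_pos_pos) auto
  show ?thesis
  proof (rule that[of r0])
    show "r0 > 0" unfolding r0_def using e1 by simp
    fix y :: "real^2" and r :: real assume r: "0 < r" "r \<le> r0"
    have ci: "integrable lborel (\<lambda>x. indicator (cball y r) x *\<^sub>R real n)"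
      using set_integrable_compact[OF compact_cball, of "\<lambda>_. real n" y r] unfolding set_integrable_def by simp
    have hi: "integrable lborel (\<lambda>x. indicator (cball y r) x *\<^sub>R h x)"
      by (rule integrable_mult_indicator[OF _ h(1)]) simp
    have "(\<integral>x\<in>cball y r. h x \<partial>lborel) \<le> (\<integral>x. indicator (cball y r) x *\<^sub>R real n + t n x \<partial>lborel)"
      unfolding set_lebesgue_integral_def
    proof (rule integral_mono[OF hi Bochner_Integration.integrable_add[OF ci ti]])
      show "indicator (cball y r) x *\<^sub>R h x \<le> indicator (cball y r) x *\<^sub>R real n + t n x" for x
        using h(2)[of x] by (simp add: indicator_def t_def)
    qed
    also have "\<dots> = pi * r\<^sup>2 * real n + (\<integral>x. t n x \<partial>lborel)"
      using ci ti r by (simp add: measure_cball_plane)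
    also have "\<dots> \<le> pi * r0\<^sup>2 * (real n + 1) + \<epsilon> / 2"
      using n r by (intro add_mono mult_mono power_mono) auto
    also have "pi * r0\<^sup>2 * (real n + 1) = \<epsilon> / 2"
    proof -
      have "r0\<^sup>2 = \<epsilon> / (2 * pi * (real n + 1))" unfolding r0_def using e1 by simp
      moreover have "pi * (real n + 1) \<noteq> 0" by (simp add: add_eq_0_iff)
      ultimately show ?thesis by (simp add: divide_simps) (simp add: algebra_simps)
    qed
    finally show "(\<integral>x\<in>cball y r. h x \<partial>lborel) \<le> \<epsilon>" by simp
  qed
qed

text \<open>One step spans p indices. The condition on \<tau> leaves the margin (1 - \<theta>)/2
  above \<theta>, which absorbs the inhomogeneous term; this is the origin of 2 C / (1 - \<theta>).
  The first p indices are covered by the trivial bound E, divided by the smallest power of \<tau>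
  that occurs.\<close>

lemma geometric_iteration:
  fixes e :: "nat \<Rightarrow> real"
  assumes p: "p > 0" and step: "\<And>k. k \<ge> k0 \<Longrightarrow> e (k + p) \<le> \<theta> * e k + C * q ^ k"
    and E: "\<And>k. e k \<le> E" "0 \<le> E" and \<theta>: "0 \<le> \<theta>" "\<theta> < 1" and q: "0 \<le> q" "q \<le> \<tau>" and C: "0 \<le> C"
    and \<tau>: "0 < \<tau>" "\<tau> \<le> 1" "(1 + \<theta>) / 2 \<le> \<tau> ^ p" and k: "k \<ge> k0"
  shows "e k \<le> (E / \<tau> ^ (k0 + p) + 2 * C / (1 - \<theta>)) * \<tau> ^ k"
proof -
  define Q where "Q = E / \<tau> ^ (k0 + p) + 2 * C / (1 - \<theta>)"
  have Q: "0 \<le> Q" unfolding Q_def using E(2) C \<theta> \<tau> by (intro add_nonneg_nonneg divide_nonneg_nonneg) auto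
  have "k \<ge> k0 \<longrightarrow> e k \<le> Q * \<tau> ^ k"
  proof (induction k rule: less_induct)
    case (less k)
    show ?case
    proof
      assume k: "k \<ge> k0"
      show "e k \<le> Q * \<tau> ^ k"
      proof (cases "k < k0 + p")
        case True
        have "E = E / \<tau> ^ (k0 + p) * \<tau> ^ (k0 + p)" using \<tau>(1) by simp
        also have "\<dots> \<le> Q * \<tau> ^ (k0 + p)" unfolding Q_def using C \<theta> \<tau> by (intro mult_right_mono) auto
        also have "\<dots> \<le> Q * \<tau> ^ k" using Q \<tau> True by (intro mult_left_mono power_decreasing) auto
        finally show ?thesis using E(1)[of k] by linarith
      next
        case False
        define k' where "k' = k - p"
        have k': "k = k' + p" "k' \<ge> k0" "k' < k" using False p unfolding k'_def by auto
        have "e k \<le> \<theta> * e k' + C * q ^ k'" using step[OF k'(2)] k'(1) by simp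
        also have "\<dots> \<le> \<theta> * (Q * \<tau> ^ k') + C * \<tau> ^ k'"
          using less[OF k'(3)] k'(2) \<theta> C q by (intro add_mono mult_left_mono power_mono) auto
        also have "\<dots> = (\<theta> * Q + C) * \<tau> ^ k'" by (simp add: algebra_simps)
        also have "\<dots> \<le> (Q * \<tau> ^ p) * \<tau> ^ k'"
        proof (rule mult_right_mono)
          have "2 * C / (1 - \<theta>) \<le> Q" unfolding Q_def using E(2) \<tau> by simp
          then have "2 * C \<le> Q * (1 - \<theta>)" using \<theta> by (simp add: pos_divide_le_eq)
          then have "\<theta> * Q + C \<le> Q * ((1 + \<theta>) / 2)" by (simp add: algebra_simps)
          also have "\<dots> \<le> Q * \<tau> ^ p" using Q \<tau>(3) by (intro mult_left_mono) auto
          finally show "\<theta> * Q + C \<le> Q * \<tau> ^ p" .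
        qed (use \<tau> in simp)
        also have "\<dots> = Q * \<tau> ^ k" unfolding k'(1) by (simp add: power_add)
        finally show ?thesis .
      qed
    qed
  qed
  then show ?thesis using k unfolding Q_def by blast
qed

lemma dyadic_scale:
  assumes "0 < d" "d \<le> (1/2) ^ n"
  obtains i :: nat where "n \<le> i" "(1/2) ^ Suc i < d" "d \<le> (1/2::real) ^ i"
proof -
  define m where "m = (LEAST m. (1/2::real) ^ m < d)"
  have ex: "\<exists>m. (1/2::real) ^ m < d" using real_arch_pow_inv[OF assms(1), of "1/2"] by auto
  have m1: "(1/2::real) ^ m < d" unfolding m_def using LeastI_ex[OF ex] .
  have m2: "d \<le> (1/2) ^ j" if "j < m" for j using not_less_Least[OF that[unfolded m_def]] by simp
  have "m > n"
  proof (rule ccontr)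
    assume "\<not> m > n"
    then have "(1/2::real) ^ n \<le> (1/2) ^ m" by (intro power_decreasing) auto
    with m1 assms(2) show False by linarith
  qed
  with that[of "m - 1"] m1 m2[of "m - 1"] show ?thesis by auto
qed

context elliptic_system
begin

lemma Xn_small:
  assumes "\<delta> > 0"
  obtains r0 where "r0 > 0" "\<And>y r. 0 < r \<Longrightarrow> r \<le> r0 \<Longrightarrow> Xn (cball y r) \<le> \<delta>"
proof -
  define h where "h x = (\<Sum>\<alpha>\<in>UNIV. \<Sum>\<gamma>\<in>UNIV. (norm (X \<alpha> \<gamma> x))\<^sup>2)" for x
  have hi: "integrable lborel h" unfolding h_def using X_L2 by auto
  have h0: "0 \<le> h x" for x unfolding h_def by (intro sum_nonneg) auto
  have "Xn (cball y r) = (\<integral>x\<in>cball y r. h x \<partial>lborel)" for y r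
  proof -
    have i: "integrable lborel (\<lambda>x. indicator (cball y r) x *\<^sub>R (norm (X \<alpha> \<gamma> x))\<^sup>2)" for \<alpha> \<gamma>
      using X_set[of "cball y r" \<alpha> \<gamma>] unfolding set_integrable_def by simp
    have "(\<integral>x. (\<Sum>\<alpha>\<in>UNIV. \<Sum>\<gamma>\<in>UNIV. indicator (cball y r) x *\<^sub>R (norm (X \<alpha> \<gamma> x))\<^sup>2) \<partial>lborel)
        = (\<Sum>\<alpha>\<in>UNIV. \<integral>x. (\<Sum>\<gamma>\<in>UNIV. indicator (cball y r) x *\<^sub>R (norm (X \<alpha> \<gamma> x))\<^sup>2) \<partial>lborel)"
      by (rule Bochner_Integration.integral_sum) (intro Bochner_Integration.integrable_sum i)
    also have "\<dots> = (\<Sum>\<alpha>\<in>UNIV. \<Sum>\<gamma>\<in>UNIV. \<integral>x. indicator (cball y r) x *\<^sub>R (norm (X \<alpha> \<gamma> x))\<^sup>2 \<partial>lborel)"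
      by (intro sum.cong refl Bochner_Integration.integral_sum i)
    finally show ?thesis unfolding Xn_def h_def set_lebesgue_integral_def scaleR_sum_right by (rule sym)
  qed
  then show ?thesis using integral_small_balls[OF hi h0 assms] that by metis
qed

text \<open>Energy decay at every centre turns the pointwise bound into a Hoelder estimate: two
  nearby good points are compared with the same constant at a dyadic scale comparable to their
  distance, and distant points with 2M.\<close>

lemma holder_ae:
  obtains \<eta> good where "0 < \<eta>" "\<eta> < 1" "AE x in lborel. x \<in> good"
    "\<And>\<rho>. \<rho> < 1 \<Longrightarrow> \<exists>C\<ge>0. \<forall>\<alpha>. \<forall>x\<in>good \<inter> cball 0 \<rho>. \<forall>y\<in>good \<inter> cball 0 \<rho>. \<bar>U \<alpha> x - U \<alpha> y\<bar> \<le> C * dist x y powr \<eta>"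
proof -
  obtain good Cg where Cg: "Cg > 0" and good: "AE x in lborel. x \<in> good"
    and pw: "\<And>i y0 \<alpha>. cball y0 (\<kappa> * (1/2) ^ i) \<subseteq> ball 0 1 \<Longrightarrow>
      \<exists>c. \<bar>c\<bar> \<le> M
        \<and> (\<integral>x\<in>cball y0 (\<kappa> * (1/2) ^ i). (U \<alpha> x - c)\<^sup>2 \<partial>lborel) \<le> Cg * ((1/2) ^ i)\<^sup>2 * (En (cball y0 (\<kappa> * (1/2) ^ i)) + ((1/2) ^ i) powr \<beta>)
        \<and> (\<forall>x\<in>good. dist y0 x \<le> (1/2) ^ i \<longrightarrow> \<bar>U \<alpha> x - c\<bar> \<le> Cg * sqrt (En (cball y0 (\<kappa> * (1/2) ^ i)) + ((1/2) ^ i) powr \<beta>))"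
    by (rule pointwise_bound) blast
  obtain \<theta> \<delta> C where \<theta>: "0 < \<theta>" "\<theta> < 1" and \<delta>: "\<delta> > 0" and C: "C > 0"
    and dec: "\<And>i y0. cball y0 (\<kappa> * (1/2) ^ i) \<subseteq> ball 0 1 \<Longrightarrow> Xn (cball y0 (\<kappa> * (1/2) ^ i)) \<le> \<delta> \<Longrightarrow>
      En (cball y0 ((1/2) ^ i / 4)) \<le> \<theta> * En (cball y0 (\<kappa> * (1/2) ^ i)) + C * ((1/2) ^ i) powr \<beta>"
    by (rule energy_decay[OF good Cg pw]) blast+
  \<comment> \<open>Shrinking by j dyadic steps compensates the enlargement factor \<kappa>; the
    decay estimate then needs two more steps because its inner radius is R/4, hence p = j +
    2.\<close>
  obtain j where j: "\<kappa> < 2 ^ j" using real_arch_pow[of 2 \<kappa>] by auto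
  have \<kappa>0: "\<kappa> > 0" using \<kappa>_ge by linarith
  define p where "p = j + 2"
  define q where "q = (1/2::real) powr \<beta>"
  have q: "0 < q" "q < 1" unfolding q_def using powr_less_mono2[OF \<beta>_pos, of "1/2" 1] by auto
  \<comment> \<open>The decay per dyadic scale: the p-th root because one decay step spans p scales,
    and at least \<open>q\<close> because the inhomogeneous term itself decays no faster.\<close>
  define \<tau> where "\<tau> = max (root p ((1 + \<theta>) / 2)) q"
  have pp: "p > 0" by (simp add: p_def)
  have rt: "0 < root p ((1 + \<theta>) / 2)" "root p ((1 + \<theta>) / 2) < 1" "root p ((1 + \<theta>) / 2) ^ p = (1 + \<theta>) / 2"
    using \<theta> pp by (auto simp: real_root_lt_1_iff)
  have \<tau>: "0 < \<tau>" "\<tau> < 1" "q \<le> \<tau>" unfolding \<tau>_def using rt q by auto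
  have "root p ((1 + \<theta>) / 2) ^ p \<le> \<tau> ^ p" by (rule power_mono) (use rt(1) in \<open>auto simp: \<tau>_def\<close>)
  then have \<tau>p: "(1 + \<theta>) / 2 \<le> \<tau> ^ p" by (simp only: rt(3))
  \<comment> \<open>Chosen so that the root of \<tau>^k is the \<eta>-th power of (1/2)^k; the half
    reflects that oscillation is bounded by the square root of the energy. Since \<tau> is at least
    2^(-\<beta>), \<eta> is at most \<beta>/2 and thus below 1.\<close>
  define \<eta> where "\<eta> = - log 2 \<tau> / 2"
  have lt: "log 2 \<tau> < 0" using \<tau> by simp
  have "\<eta> > 0" unfolding \<eta>_def using lt by simp
  have "log 2 q \<le> log 2 \<tau>" using q \<tau> by simp
  moreover have "log 2 q = - \<beta>" unfolding q_def by (simp add: log_powr log_divide)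
  ultimately have "\<eta> < 1" unfolding \<eta>_def using \<beta>_le by simp
  have sq\<tau>: "sqrt \<tau> ^ k = ((1/2) ^ k) powr \<eta>" for k :: nat
  proof -
    have "(1/2) powr \<eta> = 2 powr (log 2 \<tau> / 2)" unfolding \<eta>_def by (simp add: powr_divide powr_minus_divide)
    also have "\<dots> = (2 powr (log 2 \<tau>)) powr (1/2)" by (simp add: powr_powr)
    also have "\<dots> = sqrt \<tau>" using \<tau> by (simp add: powr_half_sqrt)
    finally have b: "(1/2) powr \<eta> = sqrt \<tau>" .
    show ?thesis unfolding b[symmetric] by (induction k) (simp_all add: powr_mult powr_divide)
  qed
  have qk: "((1/2) ^ k :: real) powr \<beta> = q ^ k" for k :: nat
    unfolding q_def by (induction k) (simp_all add: powr_mult powr_divide)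
  have \<kappa>k: "\<kappa> * (1/2) ^ (k + j) \<le> (1/2) ^ k" for k :: nat
  proof -
    have "\<kappa> * (1/2) ^ j \<le> 1" using j by (simp add: field_simps power_divide)
    then have "\<kappa> * (1/2) ^ j * (1/2) ^ k \<le> 1 * (1/2::real) ^ k" by (intro mult_right_mono) auto
    then show ?thesis by (simp add: power_add mult_ac)
  qed
  show ?thesis
  proof (rule that[OF \<open>\<eta> > 0\<close> \<open>\<eta> < 1\<close> good])
    fix \<rho> :: real assume \<rho>: "\<rho> < 1"
    obtain r0 where r0: "r0 > 0" "\<And>y r. 0 < r \<Longrightarrow> r \<le> r0 \<Longrightarrow> Xn (cball y r) \<le> \<delta>"
      by (rule Xn_small[OF \<delta>]) blast
    have "min r0 ((1 - \<rho>) / 2) > 0" using r0 \<rho> by simp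
    \<comment> \<open>From this scale on, balls centred in the ball of radius \<rho> stay in the
      unit disk and X has small L^2 norm on them; \<open>k0\<close> depends on \<rho>, whereas
      \<eta> does not.\<close>
    from real_arch_pow_inv[OF this, of "1/2"] obtain k0 where k0: "(1/2::real) ^ k0 < min r0 ((1 - \<rho>) / 2)" by auto
    have small: "(1/2::real) ^ k \<le> r0" "(1/2::real) ^ k < 1 - \<rho>" if "k \<ge> k0" for k
    proof -
      have "(1/2::real) ^ k \<le> (1/2) ^ k0" using that by (intro power_decreasing) auto
      moreover have "(1/2::real) ^ k0 < r0" "(1/2::real) ^ k0 < (1 - \<rho>) / 2" using k0 by simp_all
      moreover have "a < 1 - \<rho>" if "a \<le> b" "b < (1 - \<rho>) / 2" for a b :: real using that \<rho> by (simp add: field_simps)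
      ultimately show "(1/2::real) ^ k \<le> r0" "(1/2::real) ^ k < 1 - \<rho>" by (meson order.trans less_imp_le)+
    qed
    have inb: "cball y0 ((1/2) ^ k) \<subseteq> ball 0 1" if "y0 \<in> cball 0 \<rho>" "k \<ge> k0" for y0 :: "real^2" and k
    proof
      fix z assume "z \<in> cball y0 ((1/2) ^ k)"
      then have "norm z \<le> norm y0 + (1/2) ^ k" using norm_triangle_ineq2[of z y0] by (simp add: dist_norm norm_minus_commute)
      then show "z \<in> ball 0 1" using small(2)[OF that(2)] that(1) by simp
    qed
    define Q where "Q = En UNIV / \<tau> ^ (k0 + p) + 2 * C / (1 - \<theta>)"
    have Q0: "Q \<ge> 0" unfolding Q_def using En_nonneg C \<theta> \<tau> by (intro add_nonneg_nonneg divide_nonneg_nonneg) auto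
    have dk: "En (cball y0 ((1/2) ^ k)) \<le> Q * \<tau> ^ k" if y0: "y0 \<in> cball 0 \<rho>" and k: "k \<ge> k0" for y0 :: "real^2" and k
      unfolding Q_def
    proof (rule geometric_iteration[OF pp _ _ En_nonneg less_imp_le[OF \<theta>(1)] \<theta>(2) less_imp_le[OF q(1)] \<tau>(3) less_imp_le[OF C] \<tau>(1) less_imp_le[OF \<tau>(2)] \<tau>p k])
      show "En (cball y0 ((1/2) ^ k)) \<le> En UNIV" for k by (rule En_mono) auto
      fix k :: nat assume k: "k \<ge> k0"
      have sub: "cball y0 (\<kappa> * (1/2) ^ (k + j)) \<subseteq> cball y0 ((1/2) ^ k)" using \<kappa>k by (rule subset_cball)
      have c1: "cball y0 (\<kappa> * (1/2) ^ (k + j)) \<subseteq> ball 0 1" using sub inb[OF y0 k] by blast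
      have kp: "\<kappa> * (1/2) ^ (k + j) > 0" using \<kappa>0 by simp
      have c2: "Xn (cball y0 (\<kappa> * (1/2) ^ (k + j))) \<le> \<delta>"
        by (rule r0(2)[OF kp]) (use \<kappa>k[of k] small(1)[OF k] in linarith)
      have "(1/2::real) ^ (k + p) = (1/2) ^ (k + j) / 4" unfolding p_def by (simp add: power_add)
      then have "En (cball y0 ((1/2) ^ (k + p))) \<le> \<theta> * En (cball y0 (\<kappa> * (1/2) ^ (k + j))) + C * ((1/2) ^ (k + j)) powr \<beta>"
        using dec[OF c1 c2] by (simp only:)
      also have "\<dots> \<le> \<theta> * En (cball y0 ((1/2) ^ k)) + C * q ^ k"
      proof (intro add_mono mult_left_mono)
        show "En (cball y0 (\<kappa> * (1/2) ^ (k + j))) \<le> En (cball y0 ((1/2) ^ k))" by (rule En_mono[OF sub]) auto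
        show "((1/2) ^ (k + j)) powr \<beta> \<le> q ^ k" unfolding qk using q by (intro power_decreasing) auto
      qed (use \<theta> C in auto)
      finally show "En (cball y0 ((1/2) ^ (k + p))) \<le> \<theta> * En (cball y0 ((1/2) ^ k)) + C * q ^ k" .
    qed
    \<comment> \<open>\<open>C1\<close> is for close points: a factor 2 for two comparisons with c,
      and 2^(j + 1) because the scale used is at most that multiple of the distance.
      \<open>C2\<close> is for points farther apart than the smallness scale.\<close>
    define C1 where "C1 = 2 * (Cg * sqrt (Q + 1)) * (2 ^ (j + 1)) powr \<eta>"
    define C2 where "C2 = 2 * M / ((1/2) ^ (k0 + j)) powr \<eta>"
    have C12: "C1 \<ge> 0" "C2 \<ge> 0" unfolding C1_def C2_def using Cg Q0 M_nonneg by auto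
    show "\<exists>C\<ge>0. \<forall>\<alpha>. \<forall>x\<in>good \<inter> cball 0 \<rho>. \<forall>y\<in>good \<inter> cball 0 \<rho>. \<bar>U \<alpha> x - U \<alpha> y\<bar> \<le> C * dist x y powr \<eta>"
    proof (intro exI[of _ "C1 + C2"] conjI allI ballI)
      show "C1 + C2 \<ge> 0" using C12 by simp
      fix \<alpha> x y assume x: "x \<in> good \<inter> cball 0 \<rho>" and y: "y \<in> good \<inter> cball 0 \<rho>"
      define d where "d = dist x y"
      show "\<bar>U \<alpha> x - U \<alpha> y\<bar> \<le> (C1 + C2) * dist x y powr \<eta>"
      proof (cases "x = y")
        case False
        then have d: "d > 0" by (simp add: d_def)
        show ?thesis
        proof (cases "d \<le> (1/2) ^ (k0 + j)")
          case True
          obtain i where i: "k0 + j \<le> i" "(1/2) ^ Suc i < d" "d \<le> (1/2::real) ^ i" by (rule dyadic_scale[OF d True])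
          define k where "k = i - j"
          have k: "i = k + j" "k \<ge> k0" using i(1) unfolding k_def by auto
          have sub: "cball x (\<kappa> * (1/2) ^ i) \<subseteq> cball x ((1/2) ^ k)" unfolding k(1) using \<kappa>k by (rule subset_cball)
          have xc: "x \<in> cball 0 \<rho>" using x by blast
          have c1: "cball x (\<kappa> * (1/2) ^ i) \<subseteq> ball 0 1" using sub inb[OF xc k(2)] by blast
          \<comment> \<open>The ball is centred at x itself and y lies within (1/2)^i of x, so one
            constant c serves both points.\<close>
          obtain c where c: "\<forall>z\<in>good. dist x z \<le> (1/2) ^ i \<longrightarrow> \<bar>U \<alpha> z - c\<bar> \<le> Cg * sqrt (En (cball x (\<kappa> * (1/2) ^ i)) + ((1/2) ^ i) powr \<beta>)"
            using pw[OF c1, of \<alpha>] by blast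
          have "En (cball x (\<kappa> * (1/2) ^ i)) + ((1/2) ^ i) powr \<beta> \<le> Q * \<tau> ^ k + 1 * \<tau> ^ k"
          proof (rule add_mono)
            show "En (cball x (\<kappa> * (1/2) ^ i)) \<le> Q * \<tau> ^ k" using En_mono[OF sub] dk[OF xc k(2)] by simp
            have "q ^ i \<le> q ^ k" using q k(1) by (intro power_decreasing) auto
            also have "\<dots> \<le> \<tau> ^ k" using q \<tau> by (intro power_mono) auto
            finally show "((1/2) ^ i) powr \<beta> \<le> 1 * \<tau> ^ k" unfolding qk by simp
          qed
          then have "sqrt (En (cball x (\<kappa> * (1/2) ^ i)) + ((1/2) ^ i) powr \<beta>) \<le> sqrt ((Q + 1) * \<tau> ^ k)"
            by (intro real_sqrt_le_mono) (simp add: algebra_simps)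
          also have "\<dots> = sqrt (Q + 1) * ((1/2) ^ k) powr \<eta>" by (simp add: real_sqrt_mult real_sqrt_power sq\<tau>)
          also have "\<dots> \<le> sqrt (Q + 1) * ((2 ^ (j + 1)) powr \<eta> * d powr \<eta>)"
          proof (rule mult_left_mono)
            have "(1/2::real) ^ k = 2 ^ (j + 1) * (1/2) ^ Suc i" unfolding k(1) by (simp add: power_add power_divide)
            also have "\<dots> \<le> 2 ^ (j + 1) * d" using i(2) by (intro mult_left_mono) auto
            finally have "((1/2::real) ^ k) powr \<eta> \<le> (2 ^ (j + 1) * d) powr \<eta>" using \<open>\<eta> > 0\<close> by (intro powr_mono2) auto
            then show "((1/2::real) ^ k) powr \<eta> \<le> (2 ^ (j + 1)) powr \<eta> * d powr \<eta>" using d by (simp add: powr_mult)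
          qed (use Q0 in simp)
          finally have sb: "Cg * sqrt (En (cball x (\<kappa> * (1/2) ^ i)) + ((1/2) ^ i) powr \<beta>) \<le> Cg * (sqrt (Q + 1) * ((2 ^ (j + 1)) powr \<eta> * d powr \<eta>))"
            using Cg by (intro mult_left_mono) auto
          have "\<bar>U \<alpha> x - c\<bar> \<le> Cg * (sqrt (Q + 1) * ((2 ^ (j + 1)) powr \<eta> * d powr \<eta>))"
            using c[rule_format, of x] x sb by simp
          moreover have "\<bar>U \<alpha> y - c\<bar> \<le> Cg * (sqrt (Q + 1) * ((2 ^ (j + 1)) powr \<eta> * d powr \<eta>))"
            using c[rule_format, of y] y i(3) sb unfolding d_def by simp
          ultimately have "\<bar>U \<alpha> x - U \<alpha> y\<bar> \<le> 2 * (Cg * (sqrt (Q + 1) * ((2 ^ (j + 1)) powr \<eta> * d powr \<eta>)))" by linarith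
          also have "\<dots> = C1 * d powr \<eta>" unfolding C1_def by simp
          also have "\<dots> \<le> (C1 + C2) * d powr \<eta>" using C12 by (intro mult_right_mono) auto
          finally show ?thesis unfolding d_def .
        next
          case False
          have "\<bar>U \<alpha> x - U \<alpha> y\<bar> \<le> 2 * M" using U_bound[of \<alpha> x] U_bound[of \<alpha> y] by linarith
          also have "\<dots> = C2 * ((1/2) ^ (k0 + j)) powr \<eta>" unfolding C2_def by simp
          also have "\<dots> \<le> C2 * d powr \<eta>" using C12 False \<open>\<eta> > 0\<close> by (intro mult_left_mono powr_mono2) auto
          also have "\<dots> \<le> (C1 + C2) * d powr \<eta>" using C12 by (intro mult_right_mono) auto
          finally show ?thesis unfolding d_def .
        qed
      qed simp
    qed
  qed
qed

end

section \<open>The Hoelder continuous representative\<close>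

lemma holder_extension:
  fixes u :: "real^2 \<Rightarrow> 'b::banach"
  assumes \<eta>: "\<eta> > 0" and good: "AE x in lborel. x \<in> good"
    and hol: "\<And>\<rho>. \<rho> < 1 \<Longrightarrow> \<exists>C\<ge>0. \<forall>x\<in>good \<inter> cball 0 \<rho>. \<forall>y\<in>good \<inter> cball 0 \<rho>. dist (u x) (u y) \<le> C * dist x y powr \<eta>"
  obtains v where "\<And>x. x \<in> good \<Longrightarrow> x \<in> ball 0 1 \<Longrightarrow> v x = u x" "locally_holder_on \<eta> (ball 0 1) v"
proof -
  \<comment> \<open>A set of full measure meets every ball, since balls have positive measure; so
    values at arbitrary points can be defined as limits along good points.\<close>
  have dense: "\<exists>y\<in>good. dist y x < r" if "r > 0" for x :: "real^2" and r
  proof (rule ccontr)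
    assume n: "\<not> ?thesis"
    have "AE y in lborel. y \<notin> ball x r"
      using good by eventually_elim (use n in \<open>auto simp: dist_commute\<close>)
    then have "ball x r \<in> null_sets lborel" by (subst (asm) AE_iff_null_sets[symmetric]) auto
    then show False using measure_ball_plane[of r x] that by (simp add: null_sets_def measure_def)
  qed
  \<comment> \<open>At a good point the approximating sequence is taken constant, which makes the
    extension agree with u there.\<close>
  have "\<exists>y\<in>good. dist y x < 1 / (real n + 1) \<and> (x \<in> good \<longrightarrow> y = x)" for x :: "real^2" and n
    using dense[of "1 / (real n + 1)" x] by (cases "x \<in> good") auto
  then obtain g where g: "\<And>x n. g x n \<in> good" "\<And>x n. dist (g x n) x < 1 / (real n + 1)" "\<And>x n. x \<in> good \<Longrightarrow> g x n = x"
    by metis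
  have lim0: "(\<lambda>n. 1 / (real n + 1)) \<longlonglongrightarrow> 0"
    using LIMSEQ_inverse_real_of_nat by (simp add: inverse_eq_divide add.commute)
  have gl: "(\<lambda>n. g x n) \<longlonglongrightarrow> x" for x
  proof (rule metric_LIMSEQ_I)
    fix r :: real assume "0 < r"
    from order_tendstoD(2)[OF lim0 this] obtain N where "\<And>n. n \<ge> N \<Longrightarrow> 1 / (real n + 1) < r"
      by (auto simp: eventually_sequentially)
    then show "\<exists>N. \<forall>n\<ge>N. dist (g x n) x < r" using less_trans[OF g(2)] by blast
  qed
  define v where "v x = lim (\<lambda>n. u (g x n))" for x
  have vg: "v x = u x" if "x \<in> good" for x unfolding v_def using g(3)[OF that] by simp
  \<comment> \<open>The approximating points may leave the ball of radius \<rho>; the Hoelder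
    estimate is therefore invoked on the ball of radius (1 + \<rho>)/2, which is still smaller than
    the disk.\<close>
  have ev: "\<forall>\<^sub>F n in sequentially. g x n \<in> good \<inter> cball 0 ((1 + \<rho>) / 2)" if "norm x \<le> \<rho>" "\<rho> < 1" for x \<rho>
  proof -
    have "(\<lambda>n. norm (g x n)) \<longlonglongrightarrow> norm x" by (intro tendsto_norm gl)
    then have "\<forall>\<^sub>F n in sequentially. norm (g x n) < (1 + \<rho>) / 2" by (rule order_tendstoD) (use that in simp)
    then show ?thesis by eventually_elim (use g(1) in simp)
  qed
  have dl: "(\<lambda>n. dist (g x n) (g y n) powr \<eta>) \<longlonglongrightarrow> dist x y powr \<eta>" if "x \<noteq> y" for x y
    by (intro tendsto_powr tendsto_dist gl tendsto_const) (use that in simp)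
  have conv: "(\<lambda>n. u (g x n)) \<longlonglongrightarrow> v x" if x: "norm x < 1" for x
  proof -
    obtain C where C: "C \<ge> 0" "\<And>a b. a \<in> good \<inter> cball 0 ((1 + norm x) / 2) \<Longrightarrow> b \<in> good \<inter> cball 0 ((1 + norm x) / 2) \<Longrightarrow> dist (u a) (u b) \<le> C * dist a b powr \<eta>"
      using hol[of "(1 + norm x) / 2"] x by auto
    obtain N where N: "\<And>n. n \<ge> N \<Longrightarrow> g x n \<in> good \<inter> cball 0 ((1 + norm x) / 2)"
      using ev[OF order_refl x] by (auto simp: eventually_sequentially)
    have "Cauchy (\<lambda>n. u (g x n))"
    proof (rule metric_CauchyI)
      fix e :: real assume e: "e > 0"
      \<comment> \<open>The distance at which the Hoelder modulus C t^\<eta> falls below e; C + 1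
        also covers C = 0.\<close>
      define t where "t = (e / (C + 1)) powr (1 / \<eta>)"
      have t: "t > 0" unfolding t_def using e C by simp
      have "Cauchy (g x)" using gl by (rule LIMSEQ_imp_Cauchy)
      from metric_CauchyD[OF this t] obtain N1 where N1: "\<And>m n. m \<ge> N1 \<Longrightarrow> n \<ge> N1 \<Longrightarrow> dist (g x m) (g x n) < t" by blast
      show "\<exists>M. \<forall>m\<ge>M. \<forall>n\<ge>M. dist (u (g x m)) (u (g x n)) < e"
      proof (intro exI[of _ "max N N1"] allI impI)
        fix m n assume mn: "max N N1 \<le> m" "max N N1 \<le> n"
        have "dist (u (g x m)) (u (g x n)) \<le> C * dist (g x m) (g x n) powr \<eta>" by (rule C(2)) (use N mn in auto)
        also have "\<dots> \<le> C * t powr \<eta>" using N1[of m n] mn \<eta> C(1) by (intro mult_left_mono powr_mono2) auto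
        also have "t powr \<eta> = e / (C + 1)" unfolding t_def using \<eta> e C by (simp add: powr_powr)
        also have "C * (e / (C + 1)) < e" using C(1) e by (simp add: field_simps)
        finally show "dist (u (g x m)) (u (g x n)) < e" .
      qed
    qed
    then show ?thesis unfolding v_def using Cauchy_convergent_iff convergent_LIMSEQ_iff by blast
  qed
  show ?thesis
  proof (rule that[of v])
    show "v x = u x" if "x \<in> good" for x by (rule vg[OF that])
    show "locally_holder_on \<eta> (ball 0 1) v"
      unfolding locally_holder_on_def
    proof (intro allI impI)
      fix Kc :: "(real^2) set" assume Kc: "compact Kc \<and> Kc \<subseteq> ball 0 1"
      have "\<exists>\<rho><1. Kc \<subseteq> cball 0 \<rho>"
      proof (cases "Kc = {}")
        case False
        obtain z where "z \<in> Kc" "\<forall>y\<in>Kc. norm y \<le> norm z"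
          using continuous_attains_sup[of Kc norm] Kc False continuous_on_norm_id by blast
        with Kc show ?thesis by (intro exI[of _ "norm z"]) auto
      qed (auto intro: exI[of _ 0])
      then obtain \<rho> where \<rho>: "\<rho> < 1" "Kc \<subseteq> cball 0 \<rho>" by blast
      obtain C where C: "C \<ge> 0" "\<And>a b. a \<in> good \<inter> cball 0 ((1 + \<rho>) / 2) \<Longrightarrow> b \<in> good \<inter> cball 0 ((1 + \<rho>) / 2) \<Longrightarrow> dist (u a) (u b) \<le> C * dist a b powr \<eta>"
        using hol[of "(1 + \<rho>) / 2"] \<rho>(1) by auto
      show "holder_on \<eta> Kc v"
        unfolding holder_on_def
      proof (intro exI[of _ C] ballI)
        fix x y assume xy: "x \<in> Kc" "y \<in> Kc"
        then have n: "norm x \<le> \<rho>" "norm y \<le> \<rho>" using \<rho>(2) by auto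
        show "dist (v x) (v y) \<le> C * dist x y powr \<eta>"
        proof (cases "x = y")
          case False
          show ?thesis
          proof (rule tendsto_le[OF sequentially_bot])
            show "(\<lambda>n. C * dist (g x n) (g y n) powr \<eta>) \<longlonglongrightarrow> C * dist x y powr \<eta>" by (intro tendsto_intros dl False)
            show "(\<lambda>n. dist (u (g x n)) (u (g y n))) \<longlonglongrightarrow> dist (v x) (v y)"
              using n \<rho>(1) by (intro tendsto_dist conv) auto
            show "\<forall>\<^sub>F n in sequentially. dist (u (g x n)) (u (g y n)) \<le> C * dist (g x n) (g y n) powr \<eta>"
              using ev[OF n(1) \<rho>(1)] ev[OF n(2) \<rho>(1)] by eventually_elim (rule C(2))
          qed
        qed simp
      qed
    qed
  qed
qed

section \<open>Borel representatives and weak identities\<close>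

text \<open>A Lebesgue measurable function agrees almost everywhere with a Borel one, here obtained
  coordinate by coordinate. Extending it by zero off S allows all later integrals to be taken over
  the whole plane with respect to \<open>lborel\<close>.\<close>

lemma borel_representative:
  fixes f :: "'a::euclidean_space \<Rightarrow> 'b::euclidean_space"
  assumes f: "f \<in> borel_measurable (lebesgue_on S)" and S: "S \<in> sets borel"
  obtains g where "g \<in> borel_measurable borel" "\<And>x. x \<notin> S \<Longrightarrow> g x = 0" "AE x in lebesgue_on S. g x = f x"
proof -
  define h where "h x = (if x \<in> S then f x else 0)" for x
  have hm: "h \<in> borel_measurable lebesgue" unfolding h_def using f S by (intro borel_measurable_if_I) auto
  have "\<exists>g'. g' \<in> borel_measurable lborel \<and> (AE x in lborel. h x \<bullet> b = g' x)" for b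
    using completion_ex_borel_measurable_real[of "\<lambda>x. h x \<bullet> b" lborel] hm by auto
  then obtain g' where g': "\<And>b. g' b \<in> borel_measurable lborel" "\<And>b. AE x in lborel. h x \<bullet> b = g' b x" by metis
  define g where "g x = indicator S x *\<^sub>R (\<Sum>b\<in>Basis. g' b x *\<^sub>R b)" for x
  have "AE x in lborel. \<forall>b\<in>Basis. h x \<bullet> b = g' b x" using g'(2) by (intro AE_finite_allI) auto
  then have "AE x in lborel. g x = h x"
  proof eventually_elim
    fix x assume "\<forall>b\<in>Basis. h x \<bullet> b = g' b x"
    then have "(\<Sum>b\<in>Basis. g' b x *\<^sub>R b) = (\<Sum>b\<in>Basis. (h x \<bullet> b) *\<^sub>R b)" by (intro sum.cong) auto
    also have "\<dots> = h x" by (rule euclidean_representation)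
    finally show "g x = h x" by (simp add: g_def h_def)
  qed
  then have "AE x in lebesgue. x \<in> S \<longrightarrow> g x = f x"
    unfolding AE_completion_iff by eventually_elim (auto simp: h_def)
  moreover have "S \<inter> space lebesgue \<in> sets lebesgue" using S by auto
  ultimately have "AE x in lebesgue_on S. g x = f x" by (simp add: AE_restrict_space_iff)
  moreover have "g \<in> borel_measurable borel"
    using g'(1) S unfolding g_def by (intro borel_measurable_scaleR borel_measurable_indicator borel_measurable_sum) auto
  moreover have "x \<notin> S \<Longrightarrow> g x = 0" for x by (simp add: g_def)
  ultimately show ?thesis using that by blast
qed

text \<open>Measurability of k is a consequence: Lebesgue measure is complete, so k restricted to S
  inherits it from the Borel function h.\<close>

lemma lebesgue_on_representative:
  fixes h k :: "'a::euclidean_space \<Rightarrow> real"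
  assumes S: "S \<in> sets borel" and h: "h \<in> borel_measurable borel" "\<And>x. x \<notin> S \<Longrightarrow> h x = 0"
    and ae: "AE x in lebesgue_on S. h x = k x"
  shows "integrable (lebesgue_on S) k \<longleftrightarrow> integrable lborel h" "(\<integral>x. k x \<partial>lebesgue_on S) = (\<integral>x. h x \<partial>lborel)"
proof -
  have Sl: "S \<inter> space lebesgue \<in> sets lebesgue" using S by auto
  have hl: "h \<in> borel_measurable lebesgue" using h(1) by (auto intro: measurable_completion)
  have "AE x in lebesgue. x \<in> S \<longrightarrow> h x = k x" using ae by (simp only: AE_restrict_space_iff[OF Sl])
  then have e: "AE x in lebesgue. h x = indicator S x *\<^sub>R k x"
    by eventually_elim (auto simp: h(2) indicator_def)
  have km: "(\<lambda>x. indicator S x *\<^sub>R k x) \<in> borel_measurable lebesgue" by (rule borel_measurable_AE[OF hl e])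
  show "integrable (lebesgue_on S) k \<longleftrightarrow> integrable lborel h"
    unfolding integrable_restrict_space[OF Sl] using integrable_cong_AE[OF hl km e] integrable_completion[of h lborel] h(1) by simp
  show "(\<integral>x. k x \<partial>lebesgue_on S) = (\<integral>x. h x \<partial>lborel)"
    unfolding integral_restrict_space[OF Sl] using integral_cong_AE[OF hl km e] integral_completion[of h lborel] h(1) by simp
qed

text \<open>Morrey decay by splitting \<open>\<bar>f\<bar>\<close> at the height \<open>r powr (- 2 / q)\<close>, which avoids Hoelder's inequality.\<close>

lemma Lp_integral_cball_le:
  fixes f :: "real^2 \<Rightarrow> 'b::euclidean_space"
  assumes f: "integrable lborel f" and i: "integrable lborel (\<lambda>x. norm (f x) powr q)" and q: "1 < q" and r: "0 < r"
  shows "(\<integral>x\<in>cball y r. norm (f x) \<partial>lborel) \<le> (pi + (\<integral>x. norm (f x) powr q \<partial>lborel)) * r powr (2 - 2 / q)"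
proof -
  define t where "t = r powr (- 2 / q)"
  have t: "t > 0" unfolding t_def using r by simp
  have pt: "s \<le> t + t powr (1 - q) * s powr q" if "0 \<le> s" for s
  proof (cases "s \<le> t")
    case False
    have "s = s powr (1 - q) * s powr q" using False t by (simp add: powr_add[symmetric])
    also have "\<dots> \<le> t powr (1 - q) * s powr q" using False t q by (intro mult_right_mono powr_mono2') auto
    finally show ?thesis using t by linarith
  qed (simp add: add_increasing2)
  have ci: "integrable lborel (\<lambda>x. indicator (cball y r) x *\<^sub>R t)"
    using set_integrable_compact[OF compact_cball, of "\<lambda>_. t" y r] unfolding set_integrable_def by simp
  have hi: "integrable lborel (\<lambda>x. indicator (cball y r) x *\<^sub>R norm (f x))"
    by (rule integrable_mult_indicator[OF _ integrable_norm[OF f]]) simp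
  have "(\<integral>x\<in>cball y r. norm (f x) \<partial>lborel) \<le> (\<integral>x. indicator (cball y r) x *\<^sub>R t + t powr (1 - q) * norm (f x) powr q \<partial>lborel)"
    unfolding set_lebesgue_integral_def
  proof (rule integral_mono[OF hi Bochner_Integration.integrable_add[OF ci integrable_mult_right[OF i]]])
    show "indicator (cball y r) x *\<^sub>R norm (f x) \<le> indicator (cball y r) x *\<^sub>R t + t powr (1 - q) * norm (f x) powr q" for x
      using pt[of "norm (f x)"] by (auto simp: indicator_def)
  qed
  also have "\<dots> = pi * (r\<^sup>2 * t) + t powr (1 - q) * (\<integral>x. norm (f x) powr q \<partial>lborel)"
    using ci i r by (simp add: measure_cball_plane)
  also have "r\<^sup>2 * t = r powr (2 - 2 / q)" unfolding t_def using r by (simp add: powr_diff powr_minus field_simps)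
  \<comment> \<open>The height was chosen to balance the two parts: area times height and the tail
    factor are the same power of r.\<close>
  also have "t powr (1 - q) = r powr (2 - 2 / q)"
  proof -
    have "(- 2 / q) * (1 - q) = 2 - 2 / q" using q by (simp add: field_simps)
    then show ?thesis unfolding t_def powr_powr by (simp only:)
  qed
  finally show ?thesis by (simp add: algebra_simps)
qed

section \<open>Transfer of the hypotheses to Borel data and C^1 test functions\<close>

lemma norm_matrix_vector_mult_le:
  fixes A :: "real^'n^'m"
  shows "norm (A *v x) \<le> norm A * norm x"
proof -
  have "norm (A *v x) = L2_set (\<lambda>i. \<bar>A $ i \<bullet> x\<bar>) UNIV"
    by (simp add: norm_vec_def matrix_vector_mul_component)
  also have "\<dots> \<le> L2_set (\<lambda>i. norm (A $ i) * norm x) UNIV"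
    by (rule L2_set_mono) (auto simp: Cauchy_Schwarz_ineq2)
  also have "\<dots> = norm A * norm x" by (simp add: norm_vec_def L2_set_left_distrib)
  finally show ?thesis .
qed

text \<open>The i-th component identity is a weak divergence identity for the field w e_i, so
  \<open>weak_identity_C1c\<close> applies to it; an arbitrary direction b is then recovered by
  linearity.\<close>

lemma weak_gradient_C1c:
  fixes w :: "real^'d \<Rightarrow> real" and G :: "real^'d \<Rightarrow> real^'d"
  assumes S: "open S" and w: "integrable lborel w" and G: "integrable lborel G"
    and weak: "\<And>\<phi> i. test_function S \<phi> \<Longrightarrow> (\<integral>x. w x * grad \<phi> x $ i \<partial>lborel) = - (\<integral>x. G x $ i * \<phi> x \<partial>lborel)"
    and \<phi>: "C1c S \<phi> g"
  shows "(\<integral>x. w x * (g x \<bullet> b) \<partial>lborel) = - (\<integral>x. (G x \<bullet> b) * \<phi> x \<partial>lborel)"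
proof -
  obtain B where B: "B > 0" "\<And>x. \<bar>\<phi> x\<bar> \<le> B" "\<And>x. norm (g x) \<le> B" using C1c_bounds[OF \<phi>] by metis
  note m = has_grad_borel[OF C1c_has_grad[OF \<phi>]]
  have Gi: "integrable lborel (\<lambda>x. G x $ i)" for i
    using integrable_inner_left[of "axis i 1" lborel G] G by (simp add: inner_axis)
  have e: "(\<integral>x. w x * g x $ i \<partial>lborel) = - (\<integral>x. G x $ i * \<phi> x \<partial>lborel)" for i
  proof -
    have "(\<integral>x. (w x *\<^sub>R axis i 1) \<bullet> g x \<partial>lborel) = (\<integral>x. (- G x $ i) * \<phi> x \<partial>lborel)"
    proof (rule weak_identity_C1c[OF S _ _ _ \<phi>])
      show "integrable lborel (\<lambda>x. w x *\<^sub>R axis i (1::real) :: real^'d)" using w by simp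
      show "integrable lborel (\<lambda>x. - G x $ i)" using Gi by simp
      show "(\<integral>x. (w x *\<^sub>R axis i 1) \<bullet> grad \<phi> x \<partial>lborel) = (\<integral>x. - G x $ i * \<phi> x \<partial>lborel)" if "test_function S \<phi>" for \<phi>
        using weak[OF that, of i] by (simp add: inner_axis' )
    qed
    then show ?thesis by (simp add: inner_axis')
  qed
  have gi: "norm (g x $ i) \<le> B" for x i using B(3)[of x] Finite_Cartesian_Product.norm_nth_le[of "g x" i] by linarith
  have gm: "(\<lambda>x. g x $ i) \<in> borel_measurable borel" for i
    using borel_measurable_inner[OF m(2), of "\<lambda>_. axis i 1"] by (simp add: inner_axis)
  have i1: "integrable lborel (\<lambda>x. w x * g x $ i)" for i
    using integrable_inner_bounded[OF w gm[of i] gi[of _ i]] by simp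
  have i2: "integrable lborel (\<lambda>x. G x $ i * \<phi> x)" for i
    using integrable_inner_bounded[OF Gi[of i] m(1), of B] B(2) by simp
  have "(\<integral>x. w x * (g x \<bullet> b) \<partial>lborel) = (\<integral>x. (\<Sum>i\<in>UNIV. (w x * g x $ i) * b $ i) \<partial>lborel)"
    by (simp add: inner_vec_def sum_distrib_left mult.assoc)
  also have "\<dots> = (\<Sum>i\<in>UNIV. \<integral>x. (w x * g x $ i) * b $ i \<partial>lborel)"
    by (rule Bochner_Integration.integral_sum) (intro integrable_mult_left i1)
  also have "\<dots> = - (\<Sum>i\<in>UNIV. \<integral>x. (G x $ i * \<phi> x) * b $ i \<partial>lborel)" by (simp add: e sum_negf)
  also have "(\<Sum>i\<in>UNIV. \<integral>x. (G x $ i * \<phi> x) * b $ i \<partial>lborel) = (\<integral>x. (\<Sum>i\<in>UNIV. (G x $ i * \<phi> x) * b $ i) \<partial>lborel)"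
    by (rule Bochner_Integration.integral_sum[symmetric]) (intro integrable_mult_left i2)
  also have "\<dots> = (\<integral>x. (G x \<bullet> b) * \<phi> x \<partial>lborel)"
    by (simp add: inner_vec_def sum_distrib_left sum_distrib_right mult_ac)
  finally show ?thesis .
qed

lemma Lp_on_representative:
  assumes f: "Lp_on q S f" and S: "S \<in> sets borel"
  obtains g where "g \<in> borel_measurable borel" "\<And>x. x \<notin> S \<Longrightarrow> g x = 0" "AE x in lebesgue_on S. g x = f x"
    "integrable lborel (\<lambda>x. norm (g x) powr q)"
proof -
  obtain g where g: "g \<in> borel_measurable borel" "\<And>x. x \<notin> S \<Longrightarrow> g x = 0" "AE x in lebesgue_on S. g x = f x"
    using borel_representative[of f S] f S unfolding Lp_on_def by metis
  have "integrable (lebesgue_on S) (\<lambda>x. norm (f x) powr q) \<longleftrightarrow> integrable lborel (\<lambda>x. norm (g x) powr q)"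
  proof (rule lebesgue_on_representative(1)[OF S])
    show "(\<lambda>x. norm (g x) powr q) \<in> borel_measurable borel" using g(1) by measurable
    show "AE x in lebesgue_on S. norm (g x) powr q = norm (f x) powr q" using g(3) by eventually_elim simp
  qed (simp add: g(2))
  then show ?thesis using that g f unfolding Lp_on_def by blast
qed

lemma borel_measurable_nth:
  fixes f :: "'a \<Rightarrow> 'b::euclidean_space^'n"
  shows "f \<in> borel_measurable M \<Longrightarrow> (\<lambda>x. f x $ i) \<in> borel_measurable M"
  by (rule borel_measurable_continuous_on[where f = "\<lambda>z. z $ i"]) (auto intro: continuous_intros)

lemma integrable_norm_nth_powr:
  fixes g :: "'a::euclidean_space \<Rightarrow> 'b::euclidean_space^'m"
  assumes g: "g \<in> borel_measurable borel" and i: "integrable lborel (\<lambda>x. norm (g x) powr q)" and q: "0 \<le> q"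
  shows "integrable lborel (\<lambda>x. norm (g x $ \<alpha>) powr q)"
proof (rule Bochner_Integration.integrable_bound[OF i])
  show "(\<lambda>x. norm (g x $ \<alpha>) powr q) \<in> borel_measurable lborel"
    using borel_measurable_nth[OF g, of \<alpha>] by measurable
  show "AE x in lborel. norm (norm (g x $ \<alpha>) powr q) \<le> norm (norm (g x) powr q)"
    using q by (intro AE_I2) (auto intro!: powr_mono2 Finite_Cartesian_Product.norm_nth_le)
qed

lemma test_function_grad:
  fixes \<phi> :: "real^'d \<Rightarrow> real"
  assumes "test_function S \<phi>" shows "has_grad \<phi> (grad \<phi>)"
proof -
  have "Ck (Suc 0) \<phi>" using assms unfolding test_function_def by blast
  then obtain g where "has_grad \<phi> g" using Ck_has_grad by blast
  then show ?thesis using has_grad_grad by metis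
qed

text \<open>Lowering a Hoelder exponent on a set of diameter at most 2 costs a factor 2. This puts
  the regularity of A on the common exponent \<beta>.\<close>

lemma powr_exponent_le:
  fixes d :: real
  assumes "0 \<le> d" "d \<le> 2" "0 < \<beta>" "\<beta> \<le> \<gamma>" "\<gamma> \<le> 1"
  shows "d powr \<gamma> \<le> 2 * d powr \<beta>"
proof (cases "d \<le> 1")
  case True
  then have "d powr \<gamma> \<le> d powr \<beta>" using assms by (cases "d = 0") (auto intro: powr_mono')
  then show ?thesis using powr_ge_zero[of d \<beta>] by linarith
next
  case False
  then have "d powr \<gamma> \<le> d powr 1" using assms by (intro powr_mono) auto
  moreover have "1 \<le> d powr \<beta>" using False assms by (intro ge_one_powr_ge_zero) auto
  ultimately show ?thesis using False assms by simp
qed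

lemma holder_imp_continuous_on:
  fixes f :: "'a::metric_space \<Rightarrow> 'b::real_normed_vector"
  assumes "\<And>x y. x \<in> S \<Longrightarrow> y \<in> S \<Longrightarrow> norm (f x - f y) \<le> C * dist x y powr \<gamma>" and "\<gamma> > 0"
  shows "continuous_on S f"
  unfolding continuous_on_def
proof
  fix x assume x: "x \<in> S"
  have "((\<lambda>y. f y - f x) \<longlongrightarrow> 0) (at x within S)"
  proof (rule Lim_null_comparison)
    show "\<forall>\<^sub>F y in at x within S. norm (f y - f x) \<le> C * dist y x powr \<gamma>"
      using assms(1) x by (auto simp: eventually_at_filter)
    have "((\<lambda>y. dist y x) \<longlongrightarrow> 0) (at x within S)"
      by (rule tendsto_eq_rhs[OF tendsto_dist[OF tendsto_ident_at tendsto_const]]) simp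
    then have "((\<lambda>y. dist y x powr \<gamma>) \<longlongrightarrow> 0) (at x within S)"
      using assms(2) by (intro tendsto_zero_powrI[where b = \<gamma>]) auto
    then show "((\<lambda>y. C * dist y x powr \<gamma>) \<longlongrightarrow> 0) (at x within S)" by (rule tendsto_mult_right_zero)
  qed
  then show "(f \<longlongrightarrow> f x) (at x within S)" by (rule Lim_null[THEN iffD2])
qed

theorem theorem1p3:
  fixes A :: "real ^ 2 \<Rightarrow> real ^ 2 ^ 2"
    and \<Omega> :: "real ^ 2 \<Rightarrow> real ^ 2 ^ 'm ^ 'm"
    and f u :: "real ^ 2 \<Rightarrow> real ^ 'm"
    and Du :: "real ^ 2 \<Rightarrow> real ^ 2 ^ 'm"
    and q \<gamma>\<^sub>0 :: real and n :: nat
  assumes dim: "CARD('m) = n + 1"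
    and q: "q > 1"
    and gamma: "0 < \<gamma>\<^sub>0" "\<gamma>\<^sub>0 \<le> 1"
    and u_H1: "H1_on (ball 0 1) u Du"
    and u_Linf: "Linf_on (ball 0 1) u"
    and u_sol: "weak_solution (ball 0 1) A \<Omega> f u Du"
    and A1_sym: "\<forall>x\<in>ball 0 1. transpose (A x) = A x"
    and A1_ell: "uniformly_elliptic_on (ball 0 1) A"
    and A1_holder: "holder_upto_closure \<gamma>\<^sub>0 (ball 0 1) A"
    and A2: "Lp_on 2 (ball 0 1) \<Omega>"
    and A3: "Lp_on q (ball 0 1) f"
    and A4: "div_in_Lp q (ball 0 1) \<Omega>"
  shows "\<exists>\<eta>. 0 < \<eta> \<and> \<eta> < 1 \<and>
           (\<exists>v. (AE x in lebesgue_on (ball 0 1). v x = u x) \<and>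
                locally_holder_on \<eta> (ball 0 1) v)"
proof -
  note B = open_ball[of "0 :: real^2" 1]
  have Bm: "ball 0 1 \<in> sets (borel :: (real^2) measure)" by simp
  obtain D where DL: "Lp_on q (ball 0 1) D"
    and Dw: "\<And>\<alpha> \<beta>. has_weak_divergence (\<lambda>x. \<Omega> x $ \<alpha> $ \<beta>) (\<lambda>x. D x $ \<alpha> $ \<beta>) (ball 0 1)"
    using A4 unfolding div_in_Lp_def by blast
  have uL: "Lp_on 2 (ball 0 1) u" and GL: "Lp_on 2 (ball 0 1) Du"
    and uw: "\<And>\<alpha>. has_weak_gradient (\<lambda>x. u x $ \<alpha>) (\<lambda>x. Du x $ \<alpha>) (ball 0 1)"
    using u_H1 unfolding H1_on_def by blast+
  obtain u0 where u0: "u0 \<in> borel_measurable borel" "\<And>x. x \<notin> ball 0 1 \<Longrightarrow> u0 x = 0" "AE x in lebesgue_on (ball 0 1). u0 x = u x"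
    "integrable lborel (\<lambda>x. norm (u0 x) powr 2)" by (rule Lp_on_representative[OF uL Bm]) blast
  obtain G where G: "G \<in> borel_measurable borel" "\<And>x. x \<notin> ball 0 1 \<Longrightarrow> G x = 0" "AE x in lebesgue_on (ball 0 1). G x = Du x"
    "integrable lborel (\<lambda>x. norm (G x) powr 2)" by (rule Lp_on_representative[OF GL Bm]) blast
  obtain X where X: "X \<in> borel_measurable borel" "\<And>x. x \<notin> ball 0 1 \<Longrightarrow> X x = 0" "AE x in lebesgue_on (ball 0 1). X x = \<Omega> x"
    "integrable lborel (\<lambda>x. norm (X x) powr 2)" by (rule Lp_on_representative[OF A2 Bm]) blast
  obtain F where F: "F \<in> borel_measurable borel" "\<And>x. x \<notin> ball 0 1 \<Longrightarrow> F x = 0" "AE x in lebesgue_on (ball 0 1). F x = f x"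
    "integrable lborel (\<lambda>x. norm (F x) powr q)" by (rule Lp_on_representative[OF A3 Bm]) blast
  obtain E where E: "E \<in> borel_measurable borel" "\<And>x. x \<notin> ball 0 1 \<Longrightarrow> E x = 0" "AE x in lebesgue_on (ball 0 1). E x = D x"
    "integrable lborel (\<lambda>x. norm (E x) powr q)" by (rule Lp_on_representative[OF DL Bm]) blast
  obtain M0 where M0: "AE x in lebesgue_on (ball 0 1). norm (u x) \<le> M0" using u_Linf unfolding Linf_on_def by blast
  \<comment> \<open>The absolute value makes M nonnegative, so that truncation at height M leaves
    the value 0 outside the disk unchanged.\<close>
  define M where "M = \<bar>M0\<bar>"
  \<comment> \<open>Truncation turns the almost everywhere bound into one valid at every point, and
    changes u only on a null set.\<close>
  define U where "U \<alpha> x = max (- M) (min M (u0 x $ \<alpha>))" for \<alpha> x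
  have Um: "U \<alpha> \<in> borel_measurable borel" for \<alpha>
    unfolding U_def using borel_measurable_nth[OF u0(1), of \<alpha>] by measurable
  have UM: "\<bar>U \<alpha> x\<bar> \<le> M" for \<alpha> x unfolding U_def M_def by auto
  have U0: "U \<alpha> x = 0" if "x \<notin> ball 0 1" for \<alpha> x using u0(2)[OF that] unfolding U_def M_def by simp
  have Uae: "AE x in lebesgue_on (ball 0 1). \<forall>\<alpha>. U \<alpha> x = u x $ \<alpha>"
    using u0(3) M0
  proof eventually_elim
    fix x assume x: "u0 x = u x" "norm (u x) \<le> M0"
    show "\<forall>\<alpha>. U \<alpha> x = u x $ \<alpha>"
    proof
      fix \<alpha>
      have "\<bar>u x $ \<alpha>\<bar> \<le> M" using component_le_norm_cart[of "u x" \<alpha>] x(2) unfolding M_def by linarith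
      then show "U \<alpha> x = u x $ \<alpha>" unfolding U_def x(1) by linarith
    qed
  qed
  have Ui: "integrable lborel (U \<alpha>)" for \<alpha>
  proof (rule Lp_imp_integrable[of _ 1])
    have "integrable lborel (\<lambda>x. indicator (ball 0 1) x * M)"
      by (simp add: integrable_indicator_iff emeasure_lborel_ball_finite[unfolded infinity_ennreal_def])
    then show "integrable lborel (\<lambda>x. norm (U \<alpha> x) powr 1)"
    proof (rule Bochner_Integration.integrable_bound)
      show "(\<lambda>x. norm (U \<alpha> x) powr 1) \<in> borel_measurable lborel" using Um[of \<alpha>] by measurable
      have "norm (U \<alpha> x) powr 1 \<le> indicator (ball 0 1) x * M" for x
        using UM[of \<alpha> x] U0[of x \<alpha>] by (cases "x \<in> ball 0 1") auto
      then show "AE x in lborel. norm (norm (U \<alpha> x) powr 1) \<le> norm (indicator (ball 0 1) x * M)"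
        by (intro AE_I2) (use M_def in auto)
    qed
  qed (use Um U0 in auto)
  obtain l L where l: "0 < l" and Al: "\<And>x \<xi>. x \<in> ball 0 1 \<Longrightarrow> l * (norm \<xi>)\<^sup>2 \<le> (A x *v \<xi>) \<bullet> \<xi>"
    and AL: "\<And>x \<xi>. x \<in> ball 0 1 \<Longrightarrow> (A x *v \<xi>) \<bullet> \<xi> \<le> L * (norm \<xi>)\<^sup>2"
    using A1_ell unfolding uniformly_elliptic_on_def by blast
  obtain C where C: "\<And>x y. x \<in> ball 0 1 \<Longrightarrow> y \<in> ball 0 1 \<Longrightarrow> dist (A x) (A y) \<le> C * dist x y powr \<gamma>\<^sub>0"
  proof -
    obtain g C where g: "\<forall>x\<in>ball 0 1. g x = A x" "\<forall>x\<in>closure (ball 0 1). \<forall>y\<in>closure (ball 0 1). dist (g x) (g y) \<le> C * dist x y powr \<gamma>\<^sub>0"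
      using A1_holder unfolding holder_upto_closure_def holder_on_def by blast
    show ?thesis
    proof (rule that[of C])
      fix x y :: "real^2" assume xy: "x \<in> ball 0 1" "y \<in> ball 0 1"
      then have "dist (g x) (g y) \<le> C * dist x y powr \<gamma>\<^sub>0"
        using g(2) closure_subset[of "ball (0::real^2) 1"] by blast
      then show "dist (A x) (A y) \<le> C * dist x y powr \<gamma>\<^sub>0" using g(1) xy by simp
    qed
  qed
  \<comment> \<open>Nothing is known about A off the disk. Extension by zero gives a Borel function
    on the plane, by continuity of A inside the disk.\<close>
  define A' where "A' x = (if x \<in> ball 0 1 then A x else 0)" for x
  have A': "A' x = A x" if "x \<in> ball 0 1" for x using that by (simp add: A'_def)
  have A'm: "A' \<in> borel_measurable borel"
    unfolding A'_def
  proof (rule borel_measurable_continuous_on_if[OF Bm])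
    show "continuous_on (ball 0 1) A"
      by (rule holder_imp_continuous_on[of _ _ C \<gamma>\<^sub>0]) (use C gamma in \<open>auto simp: dist_norm\<close>)
  qed simp
  have Ab: "norm (A' x *v \<xi>) \<le> \<bar>L\<bar> * norm \<xi>" for x \<xi>
  proof (cases "x \<in> ball 0 1")
    case True
    have "norm (A x *v \<xi>) \<le> L * norm \<xi>"
    proof (rule spd_matrix_bound)
      show "transpose (A x) = A x" using A1_sym True by blast
      show "0 \<le> (A x *v \<xi>) \<bullet> \<xi>" for \<xi> using order_trans[OF _ Al[OF True]] l by simp
    qed (rule AL[OF True])
    also have "\<dots> \<le> \<bar>L\<bar> * norm \<xi>" by (intro mult_right_mono) auto
    finally show ?thesis using A'[OF True] by simp
  qed (simp add: A'_def)
  \<comment> \<open>A single exponent for both sources of decay: the Hoelder regularity of A and the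
    integrals of f and div \<Omega> over small balls. It is positive because q > 1.\<close>
  define \<beta> where "\<beta> = min \<gamma>\<^sub>0 (2 - 2 / q)"
  have "2 / q < 2" using q by (simp add: field_simps)
  then have \<beta>: "0 < \<beta>" "\<beta> \<le> \<gamma>\<^sub>0" "\<beta> \<le> 2 - 2 / q" "\<beta> \<le> 1" using gamma unfolding \<beta>_def by auto
  define H where "H = \<bar>C\<bar> * 2"
  have AH: "norm ((A' x - A' y) *v \<xi>) \<le> H * dist x y powr \<beta> * norm \<xi>" if "x \<in> ball 0 1" "y \<in> ball 0 1" for x y \<xi>
  proof -
    have "dist x y \<le> 2" using that dist_triangle2[of x y 0] by (simp add: dist_commute)
    have "norm (A' x - A' y) \<le> C * dist x y powr \<gamma>\<^sub>0" using C[OF that] A' that by (simp add: dist_norm)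
    also have "\<dots> \<le> \<bar>C\<bar> * (2 * dist x y powr \<beta>)"
      using powr_exponent_le[of "dist x y" \<beta> \<gamma>\<^sub>0] \<open>dist x y \<le> 2\<close> \<beta> gamma by (intro mult_mono) auto
    finally have "norm (A' x - A' y) * norm \<xi> \<le> H * dist x y powr \<beta> * norm \<xi>"
      unfolding H_def by (intro mult_right_mono) (auto simp: mult.assoc)
    then show ?thesis using norm_matrix_vector_mult_le[of "A' x - A' y" \<xi>] by linarith
  qed
  have Fi: "integrable lborel F" and Ei: "integrable lborel E"
    using Lp_imp_integrable[OF F(1,2,4)] Lp_imp_integrable[OF E(1,2,4)] q by auto
  define K where "K = (pi + (\<integral>x. norm (E x) powr q \<partial>lborel)) + (pi + (\<integral>x. norm (F x) powr q \<partial>lborel))"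
  have N0: "0 \<le> pi + (\<integral>x. norm (E x) powr q \<partial>lborel)" "0 \<le> pi + (\<integral>x. norm (F x) powr q \<partial>lborel)"
    by (intro add_nonneg_nonneg integral_nonneg_AE; simp)+
  have K: "0 \<le> K" unfolding K_def using N0 by simp
  \<comment> \<open>Stated for a scalar h dominated by a vector-valued w, so that K depends only on
    the norms of the full arrays E and F and is common to all components.\<close>
  have morrey: "(\<integral>y\<in>cball x r. \<bar>h y\<bar> \<partial>lborel) \<le> K * r powr \<beta>"
    if r: "0 < r" "r \<le> 1" and h: "integrable lborel h" "\<And>y. \<bar>h y\<bar> \<le> norm (w y)"
      and w: "integrable lborel w" "integrable lborel (\<lambda>x. norm (w x) powr q)"
      and wK: "pi + (\<integral>x. norm (w x) powr q \<partial>lborel) \<le> K"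
    for h :: "real^2 \<Rightarrow> real" and w :: "real^2 \<Rightarrow> 'c::euclidean_space" and x r
  proof -
    have "(\<integral>y\<in>cball x r. \<bar>h y\<bar> \<partial>lborel) \<le> (\<integral>y\<in>cball x r. norm (w y) \<partial>lborel)"
      by (rule set_integral_mono) (use h w in \<open>auto intro: integrable_imp_set_integrable\<close>)
    also have "\<dots> \<le> (pi + (\<integral>x. norm (w x) powr q \<partial>lborel)) * r powr (2 - 2 / q)"
      by (rule Lp_integral_cball_le[OF w q r(1)])
    also have "\<dots> \<le> K * r powr \<beta>"
      using wK r \<beta> K by (intro mult_mono powr_mono') auto
    finally show ?thesis .
  qed
  have Gm: "(\<lambda>x. G x $ \<alpha>) \<in> borel_measurable borel" for \<alpha> by (rule borel_measurable_nth[OF G(1)])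
  have Xm: "(\<lambda>x. X x $ \<alpha> $ \<gamma>) \<in> borel_measurable borel" for \<alpha> \<gamma>
    by (rule borel_measurable_nth[OF borel_measurable_nth[OF X(1)]])
  have Fm: "(\<lambda>x. F x $ \<alpha>) \<in> borel_measurable borel" for \<alpha> by (rule borel_measurable_nth[OF F(1)])
  have Em: "(\<lambda>x. E x $ \<alpha> $ \<gamma>) \<in> borel_measurable borel" for \<alpha> \<gamma>
    by (rule borel_measurable_nth[OF borel_measurable_nth[OF E(1)]])
  have G2: "integrable lborel (\<lambda>x. norm (G x $ \<alpha>) powr 2)" for \<alpha> by (rule integrable_norm_nth_powr[OF G(1,4)]) simp
  have X2: "integrable lborel (\<lambda>x. norm (X x $ \<alpha> $ \<gamma>) powr 2)" for \<alpha> \<gamma>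
    by (rule integrable_norm_nth_powr[OF borel_measurable_nth[OF X(1)] integrable_norm_nth_powr[OF X(1,4)]]) simp_all
  have Gi: "integrable lborel (\<lambda>x. G x $ \<alpha>)" for \<alpha> by (rule Lp_imp_integrable[OF Gm _ G2]) (use G(2) in auto)
  have Xi: "integrable lborel (\<lambda>x. X x $ \<alpha> $ \<gamma>)" for \<alpha> \<gamma> by (rule Lp_imp_integrable[OF Xm _ X2]) (use X(2) in auto)
  have Fci: "integrable lborel (\<lambda>x. F x $ \<alpha>)" for \<alpha>
    by (rule Bochner_Integration.integrable_bound[OF Fi]) (use Fm component_le_norm_cart in auto)
  have Ele: "\<bar>E x $ \<alpha> $ \<gamma>\<bar> \<le> norm (E x)" for x \<alpha> \<gamma>
    using component_le_norm_cart[of "E x $ \<alpha>" \<gamma>] Finite_Cartesian_Product.norm_nth_le[of "E x" \<alpha>] by linarith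
  have Eci: "integrable lborel (\<lambda>x. E x $ \<alpha> $ \<gamma>)" for \<alpha> \<gamma>
    by (rule Bochner_Integration.integrable_bound[OF Ei]) (use Em Ele in auto)
  have XGi: "integrable lborel (\<lambda>x. X x $ \<alpha> $ \<gamma> \<bullet> G x $ \<gamma>)" for \<alpha> \<gamma>
  proof (rule Bochner_Integration.integrable_bound[OF Bochner_Integration.integrable_add[OF X2[of \<alpha> \<gamma>] G2[of \<gamma>]]])
    show "(\<lambda>x. X x $ \<alpha> $ \<gamma> \<bullet> G x $ \<gamma>) \<in> borel_measurable lborel"
      using borel_measurable_inner[OF Xm Gm] by simp
    have "\<bar>X x $ \<alpha> $ \<gamma> \<bullet> G x $ \<gamma>\<bar> \<le> (norm (X x $ \<alpha> $ \<gamma>))\<^sup>2 + (norm (G x $ \<gamma>))\<^sup>2" for x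
    proof -
      have "\<bar>X x $ \<alpha> $ \<gamma> \<bullet> G x $ \<gamma>\<bar> \<le> norm (X x $ \<alpha> $ \<gamma>) * norm (G x $ \<gamma>)" by (rule Cauchy_Schwarz_ineq2)
      also have "\<dots> \<le> (norm (X x $ \<alpha> $ \<gamma>))\<^sup>2 + (norm (G x $ \<gamma>))\<^sup>2"
        using sum_squares_bound[of "norm (X x $ \<alpha> $ \<gamma>)" "norm (G x $ \<gamma>)"]
          mult_nonneg_nonneg[OF norm_ge_zero norm_ge_zero, of "X x $ \<alpha> $ \<gamma>" "G x $ \<gamma>"] by linarith
      finally show ?thesis .
    qed
    then show "AE x in lborel. norm (X x $ \<alpha> $ \<gamma> \<bullet> G x $ \<gamma>) \<le> norm (norm (X x $ \<alpha> $ \<gamma>) powr 2 + norm (G x $ \<gamma>) powr 2)"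
      by (intro AE_I2) (simp add: powr_numeral)
  qed
  have AGm: "(\<lambda>x. A' x *v G x $ \<alpha>) \<in> borel_measurable borel" for \<alpha>
    by (rule borel_measurable_matrix_vector_mult[OF A'm Gm])
  have AGi: "integrable lborel (\<lambda>x. A' x *v G x $ \<alpha>)" for \<alpha>
  proof (rule Bochner_Integration.integrable_bound)
    show "integrable lborel (\<lambda>x. \<bar>L\<bar> * norm (G x $ \<alpha>))" using Gi[of \<alpha>] by simp
    show "AE x in lborel. norm (A' x *v G x $ \<alpha>) \<le> norm (\<bar>L\<bar> * norm (G x $ \<alpha>))" using Ab by (intro AE_I2) simp
  qed (use AGm in simp)
  have transfer: "(\<integral>x. k x \<partial>lebesgue_on (ball 0 1)) = (\<integral>x. h x \<partial>lborel)"
    if "h \<in> borel_measurable borel" "\<And>x. x \<notin> ball 0 1 \<Longrightarrow> h x = 0" "AE x in lebesgue_on (ball 0 1). h x = k x"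
    for h k :: "real^2 \<Rightarrow> real"
    by (rule lebesgue_on_representative(2)[OF Bm that])
  have ES: "elliptic_system A' (\<lambda>\<alpha> \<gamma> x. X x $ \<alpha> $ \<gamma>) (\<lambda>\<alpha> \<gamma> x. E x $ \<alpha> $ \<gamma>) (\<lambda>\<alpha> x. F x $ \<alpha>) U (\<lambda>\<alpha> x. G x $ \<alpha>) M l L H K \<beta>"
  proof (rule elliptic_system.intro)
    show "integrable lborel (\<lambda>x. (norm (G x $ \<alpha>))\<^sup>2)" for \<alpha> using G2[of \<alpha>] by (simp add: powr_numeral)
    show "integrable lborel (\<lambda>x. (norm (X x $ \<alpha> $ \<gamma>))\<^sup>2)" for \<alpha> \<gamma> using X2[of \<alpha> \<gamma>] by (simp add: powr_numeral)
    show "G x $ \<alpha> = 0" if "x \<notin> ball 0 1" for x \<alpha> using G(2)[OF that] by simp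
    show "X x $ \<alpha> $ \<gamma> = 0" if "x \<notin> ball 0 1" for x \<alpha> \<gamma> using X(2)[OF that] by simp
    show "(\<integral>y\<in>cball x r. \<bar>E y $ \<alpha> $ \<gamma>\<bar> \<partial>lborel) \<le> K * r powr \<beta>" if "0 < r" "r \<le> 1" for x r \<alpha> \<gamma>
      by (rule morrey[OF that Eci Ele Ei E(4)]) (use N0 in \<open>simp add: K_def\<close>)
    show "(\<integral>y\<in>cball x r. \<bar>F y $ \<alpha>\<bar> \<partial>lborel) \<le> K * r powr \<beta>" if "0 < r" "r \<le> 1" for x r \<alpha>
      by (rule morrey[OF that Fci component_le_norm_cart Fi F(4)]) (use N0 in \<open>simp add: K_def\<close>)
    show "transpose (A' x) = A' x" if "x \<in> ball 0 1" for x using A1_sym that A' by simp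
    show "l * (norm \<xi>)\<^sup>2 \<le> (A' x *v \<xi>) \<bullet> \<xi>" "(A' x *v \<xi>) \<bullet> \<xi> \<le> L * (norm \<xi>)\<^sup>2" if "x \<in> ball 0 1" for x \<xi>
      using Al AL A' that by auto
    show "(\<integral>x. U \<alpha> x * (g x \<bullet> b) \<partial>lborel) = - (\<integral>x. (G x $ \<alpha> \<bullet> b) * \<phi> x \<partial>lborel)" if "C1c (ball 0 1) \<phi> g" for \<alpha> \<phi> g b
    proof (rule weak_gradient_C1c[OF B Ui Gi _ that])
      fix \<psi> :: "real^2 \<Rightarrow> real" and i assume \<psi>: "test_function (ball 0 1) \<psi>"
      note m = has_grad_borel[OF test_function_grad[OF \<psi>]]
      have "(\<integral>x. u x $ \<alpha> * grad \<psi> x $ i \<partial>lebesgue_on (ball 0 1)) = - (\<integral>x. Du x $ \<alpha> $ i * \<psi> x \<partial>lebesgue_on (ball 0 1))"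
        using uw[of \<alpha>] \<psi> unfolding has_weak_gradient_def by blast
      also have "(\<integral>x. u x $ \<alpha> * grad \<psi> x $ i \<partial>lebesgue_on (ball 0 1)) = (\<integral>x. U \<alpha> x * grad \<psi> x $ i \<partial>lborel)"
      proof (rule transfer)
        show "(\<lambda>x. U \<alpha> x * grad \<psi> x $ i) \<in> borel_measurable borel"
          by (intro borel_measurable_times Um borel_measurable_nth m)
        show "AE x in lebesgue_on (ball 0 1). U \<alpha> x * grad \<psi> x $ i = u x $ \<alpha> * grad \<psi> x $ i"
          using Uae by eventually_elim simp
      qed (simp add: U0)
      also have "(\<integral>x. Du x $ \<alpha> $ i * \<psi> x \<partial>lebesgue_on (ball 0 1)) = (\<integral>x. G x $ \<alpha> $ i * \<psi> x \<partial>lborel)"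
      proof (rule transfer)
        show "(\<lambda>x. G x $ \<alpha> $ i * \<psi> x) \<in> borel_measurable borel"
          by (intro borel_measurable_times borel_measurable_nth G m)
        show "AE x in lebesgue_on (ball 0 1). G x $ \<alpha> $ i * \<psi> x = Du x $ \<alpha> $ i * \<psi> x"
          using G(3) by eventually_elim simp
      qed (simp add: G(2))
      finally show "(\<integral>x. U \<alpha> x * grad \<psi> x $ i \<partial>lborel) = - (\<integral>x. G x $ \<alpha> $ i * \<psi> x \<partial>lborel)" .
    qed
    show "(\<integral>x. X x $ \<alpha> $ \<gamma> \<bullet> g x \<partial>lborel) = - (\<integral>x. E x $ \<alpha> $ \<gamma> * \<phi> x \<partial>lborel)" if \<phi>: "C1c (ball 0 1) \<phi> g" for \<alpha> \<gamma> \<phi> g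
    proof -
      have "(\<integral>x. X x $ \<alpha> $ \<gamma> \<bullet> g x \<partial>lborel) = (\<integral>x. (- E x $ \<alpha> $ \<gamma>) * \<phi> x \<partial>lborel)"
      proof (rule weak_identity_C1c[OF B Xi _ _ \<phi>])
        show "integrable lborel (\<lambda>x. - E x $ \<alpha> $ \<gamma>)" using Eci[of \<alpha> \<gamma>] by simp
        fix \<psi> :: "real^2 \<Rightarrow> real" assume \<psi>: "test_function (ball 0 1) \<psi>"
        note m = has_grad_borel[OF test_function_grad[OF \<psi>]]
        have "(\<integral>x. \<Omega> x $ \<alpha> $ \<gamma> \<bullet> grad \<psi> x \<partial>lebesgue_on (ball 0 1)) = - (\<integral>x. D x $ \<alpha> $ \<gamma> * \<psi> x \<partial>lebesgue_on (ball 0 1))"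
          using Dw[of \<alpha> \<gamma>] \<psi> unfolding has_weak_divergence_def by blast
        also have "(\<integral>x. \<Omega> x $ \<alpha> $ \<gamma> \<bullet> grad \<psi> x \<partial>lebesgue_on (ball 0 1)) = (\<integral>x. X x $ \<alpha> $ \<gamma> \<bullet> grad \<psi> x \<partial>lborel)"
        proof (rule transfer)
          show "(\<lambda>x. X x $ \<alpha> $ \<gamma> \<bullet> grad \<psi> x) \<in> borel_measurable borel" by (intro borel_measurable_inner Xm m)
          show "AE x in lebesgue_on (ball 0 1). X x $ \<alpha> $ \<gamma> \<bullet> grad \<psi> x = \<Omega> x $ \<alpha> $ \<gamma> \<bullet> grad \<psi> x"
            using X(3) by eventually_elim simp
        qed (simp add: X(2))
        also have "(\<integral>x. D x $ \<alpha> $ \<gamma> * \<psi> x \<partial>lebesgue_on (ball 0 1)) = (\<integral>x. E x $ \<alpha> $ \<gamma> * \<psi> x \<partial>lborel)"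
        proof (rule transfer)
          show "(\<lambda>x. E x $ \<alpha> $ \<gamma> * \<psi> x) \<in> borel_measurable borel" by (intro borel_measurable_times Em m)
          show "AE x in lebesgue_on (ball 0 1). E x $ \<alpha> $ \<gamma> * \<psi> x = D x $ \<alpha> $ \<gamma> * \<psi> x"
            using E(3) by eventually_elim simp
        qed (simp add: E(2))
        finally show "(\<integral>x. X x $ \<alpha> $ \<gamma> \<bullet> grad \<psi> x \<partial>lborel) = (\<integral>x. - E x $ \<alpha> $ \<gamma> * \<psi> x \<partial>lborel)" by simp
      qed
      then show ?thesis by simp
    qed
    show "(\<integral>x. (A' x *v G x $ \<alpha>) \<bullet> g x \<partial>lborel) = (\<integral>x. ((\<Sum>\<gamma>\<in>UNIV. X x $ \<alpha> $ \<gamma> \<bullet> G x $ \<gamma>) + F x $ \<alpha>) * \<phi> x \<partial>lborel)"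
      if \<phi>: "C1c (ball 0 1) \<phi> g" for \<alpha> \<phi> g
    proof (rule weak_identity_C1c[OF B AGi _ _ \<phi>])
      show "integrable lborel (\<lambda>x. (\<Sum>\<gamma>\<in>UNIV. X x $ \<alpha> $ \<gamma> \<bullet> G x $ \<gamma>) + F x $ \<alpha>)"
        by (intro Bochner_Integration.integrable_add Bochner_Integration.integrable_sum XGi Fci)
      fix \<psi> :: "real^2 \<Rightarrow> real" assume \<psi>: "test_function (ball 0 1) \<psi>"
      note m = has_grad_borel[OF test_function_grad[OF \<psi>]]
      have "(\<integral>x. (A x *v Du x $ \<alpha>) \<bullet> grad \<psi> x \<partial>lebesgue_on (ball 0 1))
          = (\<integral>x. (Omega_dot (\<Omega> x) (Du x) + f x) $ \<alpha> * \<psi> x \<partial>lebesgue_on (ball 0 1))"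
        using u_sol \<psi> unfolding weak_solution_def by blast
      also have "(\<integral>x. (A x *v Du x $ \<alpha>) \<bullet> grad \<psi> x \<partial>lebesgue_on (ball 0 1)) = (\<integral>x. (A' x *v G x $ \<alpha>) \<bullet> grad \<psi> x \<partial>lborel)"
      proof (rule transfer)
        show "(\<lambda>x. (A' x *v G x $ \<alpha>) \<bullet> grad \<psi> x) \<in> borel_measurable borel" by (intro borel_measurable_inner AGm m)
        \<comment> \<open>The extended matrix agrees with A only inside the disk, so membership has
          to be made available almost everywhere.\<close>
        have "AE x in lebesgue_on (ball 0 1). x \<in> ball 0 1" by (rule AE_I2) simp
        with G(3) show "AE x in lebesgue_on (ball 0 1). (A' x *v G x $ \<alpha>) \<bullet> grad \<psi> x = (A x *v Du x $ \<alpha>) \<bullet> grad \<psi> x"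
          by eventually_elim (simp only: A')
      qed (simp add: A'_def)
      also have "(\<integral>x. (Omega_dot (\<Omega> x) (Du x) + f x) $ \<alpha> * \<psi> x \<partial>lebesgue_on (ball 0 1))
          = (\<integral>x. ((\<Sum>\<gamma>\<in>UNIV. X x $ \<alpha> $ \<gamma> \<bullet> G x $ \<gamma>) + F x $ \<alpha>) * \<psi> x \<partial>lborel)"
      proof (rule transfer)
        show "(\<lambda>x. ((\<Sum>\<gamma>\<in>UNIV. X x $ \<alpha> $ \<gamma> \<bullet> G x $ \<gamma>) + F x $ \<alpha>) * \<psi> x) \<in> borel_measurable borel"
          by (intro borel_measurable_times borel_measurable_add borel_measurable_sum borel_measurable_inner Xm Gm Fm m)
        show "AE x in lebesgue_on (ball 0 1). ((\<Sum>\<gamma>\<in>UNIV. X x $ \<alpha> $ \<gamma> \<bullet> G x $ \<gamma>) + F x $ \<alpha>) * \<psi> x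
            = (Omega_dot (\<Omega> x) (Du x) + f x) $ \<alpha> * \<psi> x"
          using X(3) G(3) F(3) by eventually_elim (simp add: Omega_dot_def)
      qed (simp add: X(2) F(2))
      finally show "(\<integral>x. (A' x *v G x $ \<alpha>) \<bullet> grad \<psi> x \<partial>lborel)
          = (\<integral>x. ((\<Sum>\<gamma>\<in>UNIV. X x $ \<alpha> $ \<gamma> \<bullet> G x $ \<gamma>) + F x $ \<alpha>) * \<psi> x \<partial>lborel)" .
    qed
  qed (use Um UM U0 Gm Xm Eci Fci A'm AH l \<beta> K H_def in auto)
  obtain \<eta> good where \<eta>: "0 < \<eta>" "\<eta> < 1" and good: "AE x in lborel. x \<in> good"
    and hol: "\<And>\<rho>. \<rho> < 1 \<Longrightarrow> \<exists>C\<ge>0. \<forall>\<alpha>. \<forall>x\<in>good \<inter> cball 0 \<rho>. \<forall>y\<in>good \<inter> cball 0 \<rho>. \<bar>U \<alpha> x - U \<alpha> y\<bar> \<le> C * dist x y powr \<eta>"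
    by (rule elliptic_system.holder_ae[OF ES]) blast
  \<comment> \<open>The components share the exponent, the constant and the set of good points, so
    they assemble into one vector-valued Hoelder function at the cost of a factor equal to their
    number.\<close>
  define u' where "u' x = (\<chi> \<alpha>. U \<alpha> x)" for x
  have "\<exists>C\<ge>0. \<forall>x\<in>good \<inter> cball 0 \<rho>. \<forall>y\<in>good \<inter> cball 0 \<rho>. dist (u' x) (u' y) \<le> C * dist x y powr \<eta>" if \<rho>: "\<rho> < 1" for \<rho>
  proof -
    obtain C where C: "C \<ge> 0" "\<And>\<alpha> x y. x \<in> good \<inter> cball 0 \<rho> \<Longrightarrow> y \<in> good \<inter> cball 0 \<rho> \<Longrightarrow> \<bar>U \<alpha> x - U \<alpha> y\<bar> \<le> C * dist x y powr \<eta>"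
      using hol[OF \<rho>] by blast
    show ?thesis
    proof (intro exI[of _ "real CARD('m) * C"] conjI ballI)
      fix x y assume xy: "x \<in> good \<inter> cball 0 \<rho>" "y \<in> good \<inter> cball 0 \<rho>"
      have "dist (u' x) (u' y) \<le> (\<Sum>\<alpha>\<in>UNIV. \<bar>(u' x - u' y) $ \<alpha>\<bar>)" unfolding dist_norm by (rule norm_le_l1_cart)
      also have "\<dots> \<le> (\<Sum>\<alpha>\<in>(UNIV :: 'm set). C * dist x y powr \<eta>)"
        using C(2)[OF xy] by (intro sum_mono) (simp add: u'_def)
      finally show "dist (u' x) (u' y) \<le> real CARD('m) * C * dist x y powr \<eta>" by simp
    qed (use C in simp)
  qed
  then obtain v where v: "\<And>x. x \<in> good \<Longrightarrow> x \<in> ball 0 1 \<Longrightarrow> v x = u' x" "locally_holder_on \<eta> (ball 0 1) v"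
    using holder_extension[OF \<eta>(1) good, of u'] by metis
  have "AE x in lebesgue. x \<in> ball 0 1 \<longrightarrow> x \<in> good"
    unfolding AE_completion_iff using good by eventually_elim simp
  then have "AE x in lebesgue_on (ball 0 1). x \<in> good"
    by (subst AE_restrict_space_iff) auto
  moreover have "AE x in lebesgue_on (ball 0 1). x \<in> ball 0 1" by (rule AE_I2) simp
  ultimately have "AE x in lebesgue_on (ball 0 1). v x = u x"
    using Uae by eventually_elim (simp add: v(1) u'_def vec_eq_iff)
  then show ?thesis using \<eta> v(2) by blast
qed

end
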